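(* Suppose the dense stationary local random countable set $M$ admits an honest indexation $\tau$. Then $M$ is minimal.
   Context: $\Omega_0:=\{\omega:\mathbb{R}\to\mathbb{R}\text{ continuous},\ \omega(0)=0\}$, with canonical process $B=(B_t)_{t\in\mathbb{R}}$. $\mathsf{W}$ is the completed two-sided Wiener measure: $(B_t)_{t\ge0}$ and $(B_{-t})_{t\ge 0}$ are independent standard Brownian motions under $\mathsf{W}$; its domain $\mathcal{G}$ is the $\mathsf{W}$-completion of the Borel $\sigma$-field of $\Omega_0$ (locally uniform topology). For extended-real $s<t$, $\mathcal{F}_{s,t}$ is the $\sigma$-field generated by the increments of $B$ between the times $s$ and $t$ and by all events of $\mathsf{W}$-probability $0$ or $1$. For $u\in\mathbb{R}$ the Lévy shift is $\Delta_u(\omega)(t):=\omega(u+t)-\omega(u)$. $\dagger\notin\mathbb{R}$ is a coffin state; $\mathbb{R}^\dagger:=\mathbb{R}\cup\{\dagger\}$ with the $\sigma$-field generated by the Borel sets of $\mathbb{R}$ and $\{\dagger\}$; $u+\dagger:=\dagger$. For a sequence $s=(s_i)_{i\in\mathbb{N}}$ in $\mathbb{R}^\dagger$, $[s]:=\{s_i:i\in\mathbb{N}\}\setminus\{\dagger\}$. For a sub-$\sigma$-field $\mathcal{A}$ of $\mathcal{G}$, an $\mathcal{A}$-measurable enumeration of a map (random set) $M:\Omega_0\to2^{\mathbb{R}}$ is a sequence $S$ of $\mathcal{A}$-measurable $\mathbb{R}^\dagger$-valued random variables with $M=[S]$ $\mathsf{W}$-a.s. $M$ is a random countable set if it has a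 $\mathcal{G}$-measurable enumeration; it is then dense if it is $\mathsf{W}$-a.s. dense in $\mathbb{R}$, local if for all extended-real $s<t$ the set $M\cap(s,t)$ has an $\mathcal{F}_{s,t}$-measurable enumeration, and stationary if for every $u\in\mathbb{R}$, $M=u+M(\Delta_u)$ $\mathsf{W}$-a.s. An honest indexation for a random set $M$ is a family $\tau=(\tau_{s,t})_{(s,t)\in\mathbb{R}^2,s<t}$ of $\mathcal{F}_{-\infty,\infty}$-measurable $\mathbb{R}^\dagger$-valued maps such that: (inclusion) $\tau_{s,t}\in M$ a.s. for all real $s<t$; (exhaustion) $M=\{\tau_{s,t}:(s,t)\in\mathbb{Q}^2,s<t\}$ a.s.; (locality) $\tau_{s,t}$ is a.s. valued in $(s,t)$ and is $\mathcal{F}_{s,t}$-measurable for all real $s<t$; (stationarity) $\tau_{s+h,t+h}=h+\tau_{s,t}(\Delta_h)$ a.s. for all real $h$ and $s<t$; (nestedness) $\tau_{s,t}=\tau_{u,v}$ a.s. on $\{\tau_{s,t}\in(u,v)\}$ for all real $s\le u<v\le t$. A stationary local dense random countable set $M$ is minimal if there is no dense stationary local random countable set $M'$ that is a proper subset of $M$ with positive $\mathsf{W}$-probability. *)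

theory Defs
  imports "HOL-Probability.Probability"
begin

section \<open>Path space and two-sided Wiener measure\<close>

type_synonym path = "real \<Rightarrow> real"

definition path_space :: "path set" where
  "path_space = {\<omega>. continuous_on UNIV \<omega> \<and> \<omega> 0 = 0}"

text \<open>Open sets of the topology of locally uniform convergence. On a compact \<open>K\<close> the pointwise
  strict bound is the same as a strict bound on the supremum, because paths are continuous.\<close>

definition locally_uniform_open :: "path set \<Rightarrow> bool" where
  "locally_uniform_open U \<longleftrightarrow> U \<subseteq> path_space \<and>
     (\<forall>\<omega>\<in>U. \<exists>K e. compact K \<and> e > 0 \<and>
        {\<omega>' \<in> path_space. \<forall>t\<in>K. \<bar>\<omega>' t - \<omega> t\<bar> < e} \<subseteq> U)"

definition path_borel :: "path measure" where
  "path_borel = sigma path_space {U. locally_uniform_open U}"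

definition standard_brownian_motion :: "'a measure \<Rightarrow> (real \<Rightarrow> 'a \<Rightarrow> real) \<Rightarrow> bool" where
  "standard_brownian_motion P X \<longleftrightarrow>
     prob_space P \<and>
     (\<forall>t\<ge>0. X t \<in> borel_measurable P) \<and>
     (AE \<omega> in P. X 0 \<omega> = 0) \<and>
     (AE \<omega> in P. continuous_on {0..} (\<lambda>t. X t \<omega>)) \<and>
     (\<forall>s t. 0 \<le> s \<and> s < t \<longrightarrow>
        distributed P lborel (\<lambda>\<omega>. X t \<omega> - X s \<omega>) (normal_density 0 (sqrt (t - s)))) \<and>
     (\<forall>(n::nat) t. 0 \<le> t 0 \<and> mono t \<longrightarrow>
        prob_space.indep_vars P (\<lambda>_. borel) (\<lambda>i \<omega>. X (t (Suc i)) \<omega> - X (t i) \<omega>) {..<n})"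

text \<open>The \<open>\<sigma>\<close>-field \<open>\<G>\<close> is \<open>sets W\<close>. The two halves of the canonical process are compared as
  random elements of \<open>\<real>\<^bsup>[0,\<infinity>)\<^esup>\<close> with the product \<open>\<sigma>\<close>-field.\<close>

definition two_sided_wiener_measure :: "path measure \<Rightarrow> bool" where
  "two_sided_wiener_measure W \<longleftrightarrow>
     (\<exists>P. sets P = sets path_borel \<and> W = completion P) \<and>
     standard_brownian_motion W (\<lambda>t \<omega>. \<omega> t) \<and>
     standard_brownian_motion W (\<lambda>t \<omega>. \<omega> (- t)) \<and>
     prob_space.indep_var W
       (\<Pi>\<^sub>M t\<in>{0..}. borel) (\<lambda>\<omega>. \<lambda>t\<in>{0..}. \<omega> t)
       (\<Pi>\<^sub>M t\<in>{0..}. borel) (\<lambda>\<omega>. \<lambda>t\<in>{0..}. \<omega> (- t))"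

definition increment_field :: "path measure \<Rightarrow> ereal \<Rightarrow> ereal \<Rightarrow> path measure" where
  "increment_field W s t = sigma path_space
     ({(\<lambda>\<omega>. \<omega> v - \<omega> u) -` A \<inter> path_space | u v A.
         s \<le> ereal u \<and> u \<le> v \<and> ereal v \<le> t \<and> A \<in> sets borel} \<union>
      {A \<in> sets W. measure W A = 0 \<or> measure W A = 1})"

definition levy_shift :: "real \<Rightarrow> path \<Rightarrow> path" where
  "levy_shift u \<omega> = (\<lambda>t. \<omega> (u + t) - \<omega> u)"

section \<open>Random sets\<close>

text \<open>The extended line with a coffin state is \<^typ>\<open>real option\<close>, the coffin state being
  \<^term>\<open>None\<close>; translation by \<open>u\<close>, fixing the coffin state, is \<open>map_option ((+) u)\<close>.\<close>

definition coffin_borel :: "real option measure" where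
  "coffin_borel = sigma UNIV ({Some ` A | A. A \<in> sets borel} \<union> {{None}})"

definition noncoffin_range :: "(nat \<Rightarrow> real option) \<Rightarrow> real set" where
  "noncoffin_range s = {x. \<exists>i. s i = Some x}"

text \<open>A sub-\<open>\<sigma>\<close>-field is passed as a measure \<open>\<A>\<close>, of which only \<open>space\<close> and \<open>sets\<close> matter.
  The values of a random set outside \<^const>\<open>path_space\<close> are irrelevant.\<close>

definition measurable_enumeration ::
    "path measure \<Rightarrow> path measure \<Rightarrow> (path \<Rightarrow> real set) \<Rightarrow> (nat \<Rightarrow> path \<Rightarrow> real option) \<Rightarrow> bool" where
  "measurable_enumeration W \<A> M S \<longleftrightarrow>
     (\<forall>i. S i \<in> measurable \<A> coffin_borel) \<and>
     (AE \<omega> in W. M \<omega> = noncoffin_range (\<lambda>i. S i \<omega>))"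

definition random_countable_set :: "path measure \<Rightarrow> (path \<Rightarrow> real set) \<Rightarrow> bool" where
  "random_countable_set W M \<longleftrightarrow> (\<exists>S. measurable_enumeration W W M S)"

definition dense_random_set :: "path measure \<Rightarrow> (path \<Rightarrow> real set) \<Rightarrow> bool" where
  "dense_random_set W M \<longleftrightarrow> (AE \<omega> in W. closure (M \<omega>) = UNIV)"

definition local_random_set :: "path measure \<Rightarrow> (path \<Rightarrow> real set) \<Rightarrow> bool" where
  "local_random_set W M \<longleftrightarrow>
     (\<forall>s t :: ereal. s < t \<longrightarrow>
        (\<exists>S. measurable_enumeration W (increment_field W s t)
               (\<lambda>\<omega>. M \<omega> \<inter> {x. s < ereal x \<and> ereal x < t}) S))"

definition stationary_random_set :: "path measure \<Rightarrow> (path \<Rightarrow> real set) \<Rightarrow> bool" where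
  "stationary_random_set W M \<longleftrightarrow>
     (\<forall>u. AE \<omega> in W. M \<omega> = (+) u ` M (levy_shift u \<omega>))"

definition dense_stationary_local_random_countable_set ::
    "path measure \<Rightarrow> (path \<Rightarrow> real set) \<Rightarrow> bool" where
  "dense_stationary_local_random_countable_set W M \<longleftrightarrow>
     random_countable_set W M \<and> dense_random_set W M \<and>
     stationary_random_set W M \<and> local_random_set W M"

section \<open>Honest indexations and minimality\<close>

text \<open>Only the values \<open>\<tau> s t\<close> with \<open>s < t\<close> are meaningful.\<close>

definition honest_indexation ::
    "path measure \<Rightarrow> (path \<Rightarrow> real set) \<Rightarrow> (real \<Rightarrow> real \<Rightarrow> path \<Rightarrow> real option) \<Rightarrow> bool" where
  "honest_indexation W M \<tau> \<longleftrightarrow>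
     (\<forall>s t. s < t \<longrightarrow> \<tau> s t \<in> measurable (increment_field W (-\<infinity>) \<infinity>) coffin_borel) \<and>
     \<comment> \<open>inclusion\<close>
     (\<forall>s t. s < t \<longrightarrow> (AE \<omega> in W. \<tau> s t \<omega> \<in> Some ` M \<omega>)) \<and>
     \<comment> \<open>exhaustion\<close>
     (AE \<omega> in W. Some ` M \<omega> = {\<tau> s t \<omega> | s t. s \<in> \<rat> \<and> t \<in> \<rat> \<and> s < t}) \<and>
     \<comment> \<open>locality\<close>
     (\<forall>s t. s < t \<longrightarrow> (AE \<omega> in W. \<tau> s t \<omega> \<in> Some ` {s<..<t}) \<and>
        \<tau> s t \<in> measurable (increment_field W (ereal s) (ereal t)) coffin_borel) \<and>
     \<comment> \<open>stationarity\<close>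
     (\<forall>h s t. s < t \<longrightarrow>
        (AE \<omega> in W. \<tau> (s + h) (t + h) \<omega> = map_option ((+) h) (\<tau> s t (levy_shift h \<omega>)))) \<and>
     \<comment> \<open>nestedness\<close>
     (\<forall>s t u v. s \<le> u \<and> u < v \<and> v \<le> t \<longrightarrow>
        (AE \<omega> in W. \<tau> s t \<omega> \<in> Some ` {u<..<v} \<longrightarrow> \<tau> s t \<omega> = \<tau> u v \<omega>))"

text \<open>The event below lies in \<open>sets W\<close>, since both sets have measurable enumerations and \<open>W\<close> is
  complete; so its \<^const>\<open>measure\<close> is its actual probability, not the default value \<open>0\<close>.\<close>

definition minimal_random_set :: "path measure \<Rightarrow> (path \<Rightarrow> real set) \<Rightarrow> bool" where
  "minimal_random_set W M \<longleftrightarrow>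
     dense_stationary_local_random_countable_set W M \<and>
     \<not> (\<exists>M'. dense_stationary_local_random_countable_set W M' \<and>
             measure W {\<omega> \<in> space W. M' \<omega> \<subset> M \<omega>} > 0)"

end

theory Submission
  imports Defs
begin

text \<open>A competitor \<open>M'\<close> colours the leaders \<open>\<tau> s t\<close>. A leader of a window that shows up late must
  already be the leader of a fresh window opened shortly before; since the Brownian filtration only
  has predictable stopping times, decomposing along such fresh windows yields a renewal equation for
  the coloured leaders and the same equation for all leaders. A maximum principle then shows that
  each leader is coloured with the same probability \<open>p\<close>, independently of the path before and after any
  small cell containing the leader. As the cells shrink, these pieces generate all events, so that
  the event \<open>\<tau> 0 1 \<in> M'\<close> is independent of itself and \<open>p\<close> is \<open>0\<close> or \<open>1\<close>. By exhaustion \<open>M\<close> and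
  \<open>M'\<close> are disjoint in the first case and \<open>M \<subseteq> M'\<close> in the second; either way \<open>M'\<close>, which
  is not empty, is not a proper subset of \<open>M\<close>.\<close>

section \<open>Honest indexations over a factorizing filtration\<close>

text \<open>The model case is the set of local minima of the path, with \<open>\<tau> s t\<close>
  the place of the minimum over the window. The obstacle is that a leader is not a stopping time,
  since later values of the path decide whether it leads; so no Markov property is available at the
  leader itself, and fresh windows have to be opened at deterministic grid times. The renewal
  equation alone does not determine the probability that \<open>\<tau> 0 d\<close> is coloured:
  every window has a leader, so the counterpart for all leaders is constantly 1 and nothing is known
  as \<open>d\<close> tends to 0. Hence the equation is first solved for points that stay leaders
  for a further time \<open>r\<close>. Such points may be absent, and the chance of finding one is
  exactly what the total renewal weight falls short of 1; this makes the maximum principle strict.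
  The resulting proportion could still depend on \<open>r\<close>. It is compared with the
  proportion found in reversed time, which depends on a margin to the left only; therefore the
  setting is kept symmetric under time reversal. End points of windows are rational so that
  countably many null sets suffice.\<close>

definition grid :: "real \<Rightarrow> real \<Rightarrow> nat \<Rightarrow> nat \<Rightarrow> real" where
  "grid a b n j = a + (b - a) * real j / 2 ^ n"

lemma grid_0 [simp]: "grid a b n 0 = a" and grid_end [simp]: "grid a b n (2 ^ n) = b"
  by (simp_all add: grid_def)

lemma grid_Suc: "grid a b n (Suc j) = grid a b n j + (b - a) / 2 ^ n"
  by (simp add: grid_def field_simps)

lemma grid_mono: "a < b \<Longrightarrow> i \<le> j \<Longrightarrow> grid a b n i \<le> grid a b n j"
  by (simp add: grid_def divide_right_mono mult_left_mono)

lemma grid_strict_mono: "a < b \<Longrightarrow> i < j \<Longrightarrow> grid a b n i < grid a b n j"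
  by (simp add: grid_def divide_strict_right_mono)

lemma grid_Rats: "a \<in> \<rat> \<Longrightarrow> b \<in> \<rat> \<Longrightarrow> grid a b n j \<in> \<rat>"
  by (simp add: grid_def)

lemma grid_bounds: "a < b \<Longrightarrow> j \<le> 2 ^ n \<Longrightarrow> a \<le> grid a b n j \<and> grid a b n j \<le> b"
  using grid_mono[of a b 0 j n] grid_mono[of a b j "2^n" n] by simp

text \<open>Rational end points make every grid point rational, so an irrational \<open>x\<close>
  falls on none of them and lies strictly inside one cell. Leaders are irrational almost surely for
  this purpose.\<close>

lemma grid_cell:
  assumes "a < b" "a < x" "x < b" "x \<notin> \<rat>" "a \<in> \<rat>" "b \<in> \<rat>"
  obtains j where "j < 2 ^ n" "grid a b n j < x" "x < grid a b n (Suc j)"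
proof -
  define j where "j = (LEAST j. x \<le> grid a b n j)"
  have ex: "x \<le> grid a b n (2 ^ n)" using assms by simp
  have 1: "x \<le> grid a b n j" unfolding j_def by (rule LeastI[where P="\<lambda>j. x \<le> grid a b n j", OF ex])
  have j_le: "j \<le> 2 ^ n" unfolding j_def by (rule Least_le[where P="\<lambda>j. x \<le> grid a b n j", OF ex])
  have "j \<noteq> 0" using 1 assms by (metis grid_0 not_le)
  then obtain i where i: "j = Suc i" by (cases j) auto
  have "\<not> x \<le> grid a b n i" using not_less_Least[of i "\<lambda>j. x \<le> grid a b n j"] i by (simp add: j_def)
  moreover have "x \<noteq> grid a b n j" using assms grid_Rats by metis
  ultimately show ?thesis using that[of i] i j_le 1 by simp
qed

text \<open>Approximability by closed martingales with small jumps; for the Brownian filtration this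
  expresses that all martingales are continuous.\<close>

definition (in prob_space) small_jumps :: "(real \<Rightarrow> 'a measure) \<Rightarrow> real \<Rightarrow> real \<Rightarrow> ('a \<Rightarrow> real) \<Rightarrow> bool" where
  "small_jumps F a b g \<longleftrightarrow> integrable M g \<and> (\<forall>c>0. (\<lambda>n. prob {\<omega>\<in>space M. \<exists>j<2^n.
      c < \<bar>real_cond_exp M (F (grid a b n (Suc j))) g \<omega> - real_cond_exp M (F (grid a b n j)) g \<omega>\<bar>}) \<longlonglongrightarrow> 0)"

definition (in prob_space) continuous_filtration :: "(real \<Rightarrow> 'a measure) \<Rightarrow> bool" where
  "continuous_filtration F \<longleftrightarrow> (\<forall>V a b e. integrable M V \<and> a < b \<and> 0 < e \<longrightarrow>
     (\<exists>g. small_jumps F a b g \<and> (\<integral>\<omega>. \<bar>V \<omega> - g \<omega>\<bar> \<partial>M) \<le> e))"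

text \<open>What the combinatorial part retains of Brownian motion: independence of past and future
  at each fixed time, continuity of the forward and of the backward filtration, and
  measure-preserving shifts. Leaders are plain reals because the coffin state has probability 0, and
  the competitor \<open>K\<close> is seen only through the events that a leader belongs to it. The
  conditions are symmetric under an exchange of \<open>past\<close> and \<open>fut\<close>, which
  makes \<open>reversed\<close> possible.\<close>

locale honest_index = prob_space P for P :: "'w measure" +
  fixes past fut :: "real \<Rightarrow> 'w measure" and shift :: "real \<Rightarrow> 'w \<Rightarrow> 'w"
    and \<tau> :: "real \<Rightarrow> real \<Rightarrow> 'w \<Rightarrow> real" and K :: "'w \<Rightarrow> real set"
  assumes sub_past: "\<And>t. subalgebra P (past t)" and sub_fut: "\<And>t. subalgebra P (fut t)"
    and past_mono: "\<And>s t. s \<le> t \<Longrightarrow> sets (past s) \<subseteq> sets (past t)"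
    and fut_mono: "\<And>s t. s \<le> t \<Longrightarrow> sets (fut t) \<subseteq> sets (fut s)"
    and indep_past_fut: "\<And>t A B. A \<in> sets (past t) \<Longrightarrow> B \<in> sets (fut t) \<Longrightarrow> prob (A \<inter> B) = prob A * prob B"
    and cont_past: "continuous_filtration past" and cont_fut: "continuous_filtration (\<lambda>t. fut (- t))"
    and shift_events: "\<And>A h. A \<in> events \<Longrightarrow> shift h -` A \<inter> space P \<in> events"
    and prob_shift: "\<And>A h. A \<in> events \<Longrightarrow> prob (shift h -` A \<inter> space P) = prob A"
    and shift_space: "\<And>\<omega> h. \<omega> \<in> space P \<Longrightarrow> shift h \<omega> \<in> space P"
    and \<tau>_past: "\<And>s t. s \<in> \<rat> \<Longrightarrow> t \<in> \<rat> \<Longrightarrow> s < t \<Longrightarrow> \<tau> s t \<in> borel_measurable (past t)"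
    and \<tau>_fut: "\<And>s t. s \<in> \<rat> \<Longrightarrow> t \<in> \<rat> \<Longrightarrow> s < t \<Longrightarrow> \<tau> s t \<in> borel_measurable (fut s)"
    and K_past: "\<And>s t. s \<in> \<rat> \<Longrightarrow> t \<in> \<rat> \<Longrightarrow> s < t \<Longrightarrow> {\<omega>\<in>space P. \<tau> s t \<omega> \<in> K \<omega>} \<in> sets (past t)"
    and K_fut: "\<And>s t. s \<in> \<rat> \<Longrightarrow> t \<in> \<rat> \<Longrightarrow> s < t \<Longrightarrow> {\<omega>\<in>space P. \<tau> s t \<omega> \<in> K \<omega>} \<in> sets (fut s)"
    and AE_inside: "AE \<omega> in P. \<forall>s\<in>\<rat>. \<forall>t\<in>\<rat>. s < t \<longrightarrow> s < \<tau> s t \<omega> \<and> \<tau> s t \<omega> < t \<and> \<tau> s t \<omega> \<notin> \<rat>"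
    and AE_nested: "AE \<omega> in P. \<forall>s\<in>\<rat>. \<forall>t\<in>\<rat>. \<forall>u\<in>\<rat>. \<forall>v\<in>\<rat>. s \<le> u \<longrightarrow> u < v \<longrightarrow> v \<le> t \<longrightarrow>
          u < \<tau> s t \<omega> \<longrightarrow> \<tau> s t \<omega> < v \<longrightarrow> \<tau> u v \<omega> = \<tau> s t \<omega>"
    and AE_stationary: "\<And>h. h \<in> \<rat> \<Longrightarrow> AE \<omega> in P. \<forall>s\<in>\<rat>. \<forall>t\<in>\<rat>. s < t \<longrightarrow>
          \<tau> (s + h) (t + h) \<omega> = h + \<tau> s t (shift h \<omega>) \<and>
          (\<tau> (s + h) (t + h) \<omega> \<in> K \<omega> \<longleftrightarrow> \<tau> s t (shift h \<omega>) \<in> K (shift h \<omega>))"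
begin

text \<open>Time reversal swaps \<open>past\<close> and \<open>fut\<close> and maps each window to
  its mirror image. Every one-sided result thereby yields its mirror image: estimates at the right
  end of a window, proportions for left margins, and independence from the future.\<close>

lemma reversed:
  "honest_index P (\<lambda>t. fut (- t)) (\<lambda>t. past (- t)) (\<lambda>h. shift (- h))
     (\<lambda>s t \<omega>. - \<tau> (- t) (- s) \<omega>) (\<lambda>\<omega>. uminus ` K \<omega>)"
proof unfold_locales
  have eq: "- x \<in> uminus ` A \<longleftrightarrow> x \<in> A" for x :: real and A by force
  show "AE \<omega> in P. \<forall>s\<in>\<rat>. \<forall>t\<in>\<rat>. s < t \<longrightarrow> s < - \<tau> (- t) (- s) \<omega> \<and> - \<tau> (- t) (- s) \<omega> < t \<and> - \<tau> (- t) (- s) \<omega> \<notin> \<rat>"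
    using AE_inside
  proof eventually_elim
    case (elim \<omega>)
    have "s < - \<tau> (- t) (- s) \<omega> \<and> - \<tau> (- t) (- s) \<omega> < t \<and> - \<tau> (- t) (- s) \<omega> \<notin> \<rat>" if "s \<in> \<rat>" "t \<in> \<rat>" "s < t" for s t
      using elim[rule_format, of "-t" "-s"] that by simp
    then show ?case by blast
  qed
  show "AE \<omega> in P. \<forall>s\<in>\<rat>. \<forall>t\<in>\<rat>. \<forall>u\<in>\<rat>. \<forall>v\<in>\<rat>. s \<le> u \<longrightarrow> u < v \<longrightarrow> v \<le> t \<longrightarrow>
          u < - \<tau> (- t) (- s) \<omega> \<longrightarrow> - \<tau> (- t) (- s) \<omega> < v \<longrightarrow> - \<tau> (- v) (- u) \<omega> = - \<tau> (- t) (- s) \<omega>"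
    using AE_nested
  proof eventually_elim
    case (elim \<omega>)
    have "- \<tau> (- v) (- u) \<omega> = - \<tau> (- t) (- s) \<omega>"
      if "s \<in> \<rat>" "t \<in> \<rat>" "u \<in> \<rat>" "v \<in> \<rat>" "s \<le> u" "u < v" "v \<le> t" "u < - \<tau> (- t) (- s) \<omega>" "- \<tau> (- t) (- s) \<omega> < v" for s t u v
      using elim[rule_format, of "-t" "-s" "-v" "-u"] that by simp
    then show ?case by blast
  qed
  show "AE \<omega> in P. \<forall>s\<in>\<rat>. \<forall>t\<in>\<rat>. s < t \<longrightarrow>
          - \<tau> (- (t + h)) (- (s + h)) \<omega> = h + - \<tau> (- t) (- s) (shift (- h) \<omega>) \<and>
          (- \<tau> (- (t + h)) (- (s + h)) \<omega> \<in> uminus ` K \<omega> \<longleftrightarrow> - \<tau> (- t) (- s) (shift (- h) \<omega>) \<in> uminus ` K (shift (- h) \<omega>))"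
    if "h \<in> \<rat>" for h
  proof -
    have "- h \<in> \<rat>" using that by simp
    from AE_stationary[OF this] show ?thesis
    proof eventually_elim
      case (elim \<omega>)
      have "- \<tau> (- (t + h)) (- (s + h)) \<omega> = h + - \<tau> (- t) (- s) (shift (- h) \<omega>) \<and>
          (- \<tau> (- (t + h)) (- (s + h)) \<omega> \<in> uminus ` K \<omega> \<longleftrightarrow> - \<tau> (- t) (- s) (shift (- h) \<omega>) \<in> uminus ` K (shift (- h) \<omega>))"
        if "s \<in> \<rat>" "t \<in> \<rat>" "s < t" for s t
        using elim[rule_format, of "-t" "-s"] that unfolding eq by (simp add: algebra_simps)
      then show ?case by blast
    qed
  qed
  have eq2: "{\<omega>\<in>space P. - \<tau> (- t) (- s) \<omega> \<in> uminus ` K \<omega>} = {\<omega>\<in>space P. \<tau> (- t) (- s) \<omega> \<in> K \<omega>}" for s t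
    unfolding eq ..
  show "{\<omega>\<in>space P. - \<tau> (- t) (- s) \<omega> \<in> uminus ` K \<omega>} \<in> sets (fut (- t))" if "s \<in> \<rat>" "t \<in> \<rat>" "s < t" for s t
    unfolding eq2 using that K_fut[of "-t" "-s"] by simp
  show "{\<omega>\<in>space P. - \<tau> (- t) (- s) \<omega> \<in> uminus ` K \<omega>} \<in> sets (past (- s))" if "s \<in> \<rat>" "t \<in> \<rat>" "s < t" for s t
    unfolding eq2 using that K_past[of "-t" "-s"] by simp
  show "prob (A \<inter> B) = prob A * prob B" if "A \<in> sets (fut (- t))" "B \<in> sets (past (- t))" for t A B
    using indep_past_fut[OF that(2,1)] by (simp add: Int_commute mult.commute)
  show "subalgebra P (fut (- t))" for t by (rule sub_fut)
  show "subalgebra P (past (- t))" for t by (rule sub_past)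
  show "sets (fut (- s)) \<subseteq> sets (fut (- t))" if "s \<le> t" for s t using that by (intro fut_mono) simp
  show "sets (past (- t)) \<subseteq> sets (past (- s))" if "s \<le> t" for s t using that by (intro past_mono) simp
  show "continuous_filtration (\<lambda>t. fut (- t))" by (rule cont_fut)
  show "continuous_filtration (\<lambda>t. past (- (- t)))" using cont_past by simp
  show "shift (- h) -` A \<inter> space P \<in> events" if "A \<in> events" for A h using that by (rule shift_events)
  show "prob (shift (- h) -` A \<inter> space P) = prob A" if "A \<in> events" for A h using that by (rule prob_shift)
  show "shift (- h) \<omega> \<in> space P" if "\<omega> \<in> space P" for \<omega> h using that by (rule shift_space)
  show "(\<lambda>\<omega>. - \<tau> (- t) (- s) \<omega>) \<in> borel_measurable (fut (- t))" if "s \<in> \<rat>" "t \<in> \<rat>" "s < t" for s t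
    using that by (intro borel_measurable_uminus \<tau>_fut) auto
  show "(\<lambda>\<omega>. - \<tau> (- t) (- s) \<omega>) \<in> borel_measurable (past (- s))" if "s \<in> \<rat>" "t \<in> \<rat>" "s < t" for s t
    using that by (intro borel_measurable_uminus \<tau>_past) auto
qed

text \<open>Gathers the almost sure rules for all rational windows into one predicate, so that
  statements about leaders can be proved pointwise.\<close>

definition reg :: "'w \<Rightarrow> bool" where
  "reg \<omega> \<longleftrightarrow> \<omega> \<in> space P \<and> (\<forall>s\<in>\<rat>. \<forall>t\<in>\<rat>. s < t \<longrightarrow> s < \<tau> s t \<omega> \<and> \<tau> s t \<omega> < t \<and> \<tau> s t \<omega> \<notin> \<rat>) \<and>
     (\<forall>s\<in>\<rat>. \<forall>t\<in>\<rat>. \<forall>u\<in>\<rat>. \<forall>v\<in>\<rat>. s \<le> u \<longrightarrow> u < v \<longrightarrow> v \<le> t \<longrightarrow>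
          u < \<tau> s t \<omega> \<longrightarrow> \<tau> s t \<omega> < v \<longrightarrow> \<tau> u v \<omega> = \<tau> s t \<omega>)"

lemma AE_reg: "AE \<omega> in P. reg \<omega>"
  using AE_inside AE_nested AE_space by eventually_elim (unfold reg_def, intro conjI)

lemma reg_space: "reg \<omega> \<Longrightarrow> \<omega> \<in> space P" by (simp add: reg_def)

lemma reg_inside:
  assumes "reg \<omega>" "s \<in> \<rat>" "t \<in> \<rat>" "s < t"
  shows "s < \<tau> s t \<omega>" "\<tau> s t \<omega> < t" "\<tau> s t \<omega> \<notin> \<rat>"
  using assms unfolding reg_def by blast+

lemma reg_nested:
  assumes "reg \<omega>" "s \<in> \<rat>" "t \<in> \<rat>" "u \<in> \<rat>" "v \<in> \<rat>" "s \<le> u" "v \<le> t" "u < \<tau> s t \<omega>" "\<tau> s t \<omega> < v"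
  shows "\<tau> u v \<omega> = \<tau> s t \<omega>"
  using assms unfolding reg_def by (meson order_less_trans)

lemma reg_neq: "reg \<omega> \<Longrightarrow> s \<in> \<rat> \<Longrightarrow> t \<in> \<rat> \<Longrightarrow> s < t \<Longrightarrow> q \<in> \<rat> \<Longrightarrow> \<tau> s t \<omega> \<noteq> q"
  using reg_inside(3) by metis

lemma space_past [simp]: "space (past t) = space P" and space_fut [simp]: "space (fut t) = space P"
  using sub_past[of t] sub_fut[of t] by (simp_all add: subalgebra_def)

lemma past_events: "A \<in> sets (past t) \<Longrightarrow> A \<in> events" and fut_events: "A \<in> sets (fut t) \<Longrightarrow> A \<in> events"
  using sub_past[of t] sub_fut[of t] by (auto simp: subalgebra_def)

lemma \<tau>_past_mono:
  assumes "s \<in> \<rat>" "t \<in> \<rat>" "s < t" "t \<le> v" shows "\<tau> s t \<in> borel_measurable (past v)"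
  using measurable_mono[of borel borel "past t" "past v"] \<tau>_past[OF assms(1-3)] past_mono[OF assms(4)] by auto

lemma \<tau>_fut_mono:
  assumes "s \<in> \<rat>" "t \<in> \<rat>" "s < t" "u \<le> s" shows "\<tau> s t \<in> borel_measurable (fut u)"
  using measurable_mono[of borel borel "fut s" "fut u"] \<tau>_fut[OF assms(1-3)] fut_mono[OF assms(4)] by auto

lemma \<tau>_meas:
  assumes "s \<in> \<rat>" "t \<in> \<rat>" "s < t" shows "\<tau> s t \<in> borel_measurable P"
  using measurable_from_subalg[OF sub_past \<tau>_past[OF assms]] .

lemma prob_less_shift:
  assumes "s \<in> \<rat>" "t \<in> \<rat>" "h \<in> \<rat>" "s < t"
  shows "prob {\<omega>\<in>space P. \<tau> (s + h) (t + h) \<omega> < c + h} = prob {\<omega>\<in>space P. \<tau> s t \<omega> < c}"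
proof -
  have m: "{\<omega>\<in>space P. \<tau> s t \<omega> < c} \<in> events" using \<tau>_meas[OF assms(1,2,4)] by measurable
  have m2: "\<tau> (s + h) (t + h) \<in> borel_measurable P" using assms by (intro \<tau>_meas) auto
  have "prob {\<omega>\<in>space P. \<tau> (s + h) (t + h) \<omega> < c + h} = prob (shift h -` {\<omega>\<in>space P. \<tau> s t \<omega> < c} \<inter> space P)"
  proof (rule finite_measure_eq_AE)
    show "AE \<omega> in P. (\<omega> \<in> {\<omega>\<in>space P. \<tau> (s + h) (t + h) \<omega> < c + h}) = (\<omega> \<in> shift h -` {\<omega>\<in>space P. \<tau> s t \<omega> < c} \<inter> space P)"
      using AE_stationary[OF assms(3)] AE_space
      by eventually_elim (use assms shift_space in auto)
  qed (use m2 shift_events[OF m] in measurable)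
  then show ?thesis using prob_shift[OF m] by simp
qed

text \<open>A leader lies strictly inside its window, so by continuity of the measure it is unlikely
  to be close to the left end. This smallness is what a leader appearing at a predictable time would
  violate.\<close>

lemma prob_near_left_tendsto_0:
  assumes "s \<in> \<rat>" "t \<in> \<rat>" "s < t"
  shows "(\<lambda>n. prob {\<omega>\<in>space P. \<tau> s t \<omega> < s + inverse (real (Suc n))}) \<longlonglongrightarrow> 0"
proof -
  have [measurable]: "\<tau> s t \<in> borel_measurable P" using assms by (rule \<tau>_meas)
  have "(\<lambda>n. prob {\<omega>\<in>space P. \<tau> s t \<omega> < s + inverse (real (Suc n))}) \<longlonglongrightarrow> prob (\<Inter>n. {\<omega>\<in>space P. \<tau> s t \<omega> < s + inverse (real (Suc n))})"
  proof (rule finite_Lim_measure_decseq)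
    show "decseq (\<lambda>n. {\<omega>\<in>space P. \<tau> s t \<omega> < s + inverse (real (Suc n))})"
    proof (rule decseq_SucI)
      fix n
      have "inverse (real (Suc (Suc n))) \<le> inverse (real (Suc n))" by (intro le_imp_inverse_le) auto
      then show "{\<omega>\<in>space P. \<tau> s t \<omega> < s + inverse (real (Suc (Suc n)))} \<subseteq> {\<omega>\<in>space P. \<tau> s t \<omega> < s + inverse (real (Suc n))}"
        by (smt (verit) Collect_mono_iff)
    qed
  qed auto
  moreover have "prob (\<Inter>n. {\<omega>\<in>space P. \<tau> s t \<omega> < s + inverse (real (Suc n))}) = 0"
  proof -
    have "AE \<omega> in P. \<omega> \<notin> (\<Inter>n. {\<omega>\<in>space P. \<tau> s t \<omega> < s + inverse (real (Suc n))})"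
      using AE_reg
    proof eventually_elim
      case (elim \<omega>)
      have "0 < \<tau> s t \<omega> - s" using reg_inside(1)[OF elim assms] by simp
      then obtain n where "inverse (real (Suc n)) < \<tau> s t \<omega> - s" using reals_Archimedean by blast
      then have "\<not> \<tau> s t \<omega> < s + inverse (real (Suc n))" by simp
      then show ?case by blast
    qed
    then show ?thesis by (subst prob_eq_0) auto
  qed
  ultimately show ?thesis by simp
qed

lemma prob_near_right_tendsto_0:
  assumes "s \<in> \<rat>" "t \<in> \<rat>" "s < t"
  shows "(\<lambda>n. prob {\<omega>\<in>space P. t - inverse (real (Suc n)) < \<tau> s t \<omega>}) \<longlonglongrightarrow> 0"
proof -
  interpret r: honest_index P "\<lambda>t. fut (- t)" "\<lambda>t. past (- t)" "\<lambda>h. shift (- h)"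
     "\<lambda>s t \<omega>. - \<tau> (- t) (- s) \<omega>" "\<lambda>\<omega>. uminus ` K \<omega>" by (rule reversed)
  have "{\<omega>\<in>space P. t - inverse (real (Suc n)) < \<tau> s t \<omega>} = {\<omega>\<in>space P. - \<tau> s t \<omega> < - t + inverse (real (Suc n))}" for n
    by auto
  then show ?thesis using r.prob_near_left_tendsto_0[of "-t" "-s"] assms by simp
qed

end

context prob_space begin

lemma sigma_finite_subalgebra_of_subalgebra: "subalgebra M F \<Longrightarrow> sigma_finite_subalgebra M F"
  by (intro finite_measure_subalgebra_is_sigma_finite finite_measure_subalgebra.intro
      finite_measure_subalgebra_axioms.intro finite_measure_axioms)

lemma sum_disjoint_integral_le:
  fixes f :: "'a \<Rightarrow> real"
  assumes "finite I" "disjoint_family_on B I" "\<And>i. i \<in> I \<Longrightarrow> B i \<in> events"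
    and f: "integrable M f" "\<And>\<omega>. 0 \<le> f \<omega>"
  shows "(\<Sum>i\<in>I. \<integral>\<omega>. indicator (B i) \<omega> * f \<omega> \<partial>M) \<le> (\<integral>\<omega>. f \<omega> \<partial>M)"
proof -
  have int: "integrable M (\<lambda>\<omega>. indicator (B i) \<omega> * f \<omega>)" if "i \<in> I" for i
    using integrable_mult_indicator[OF assms(3)[OF that], of f] f(1) by simp
  have "(\<Sum>i\<in>I. \<integral>\<omega>. indicator (B i) \<omega> * f \<omega> \<partial>M) = (\<integral>\<omega>. (\<Sum>i\<in>I. indicator (B i) \<omega> * f \<omega>) \<partial>M)"
    by (rule Bochner_Integration.integral_sum[symmetric]) (rule int)
  also have "\<dots> = (\<integral>\<omega>. indicator (\<Union>i\<in>I. B i) \<omega> * f \<omega> \<partial>M)"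
    by (simp add: indicator_UN_disjoint[OF assms(1,2)] sum_distrib_right)
  also have "\<dots> \<le> (\<integral>\<omega>. f \<omega> \<partial>M)"
  proof (rule integral_mono)
    have "(\<Union>i\<in>I. B i) \<in> events" using assms(1,3) by auto
    from integrable_mult_indicator[OF this, of f] f(1) show "integrable M (\<lambda>\<omega>. indicator (\<Union>i\<in>I. B i) \<omega> * f \<omega>)" by simp
  qed (use f in \<open>auto split: split_indicator\<close>)
  finally show ?thesis .
qed

lemma sum_disjoint_prob_le:
  assumes "finite I" "disjoint_family_on B I" "\<And>i. i \<in> I \<Longrightarrow> B i \<in> events"
  shows "(\<Sum>i\<in>I. prob (B i)) \<le> 1"
proof -
  have "(\<Sum>i\<in>I. prob (B i)) = prob (\<Union>i\<in>I. B i)"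
    using assms by (intro finite_measure_finite_Union[symmetric]) auto
  then show ?thesis by simp
qed

text \<open>Markov's inequality with a different function on each piece: \<open>f i\<close> is at
  least \<open>c\<close> on \<open>D i\<close>, so \<open>c\<close> times the sum of the
  probabilities is at most \<open>C\<close>. Overlaps are harmless by subadditivity.\<close>

lemma prob_UN_markov:
  fixes f :: "'i \<Rightarrow> 'a \<Rightarrow> real"
  assumes "finite I" "\<And>i. i \<in> I \<Longrightarrow> D i \<in> events" "\<And>i. i \<in> I \<Longrightarrow> integrable M (f i)" "0 < c"
    and AE: "\<And>i. i \<in> I \<Longrightarrow> AE \<omega> in M. \<omega> \<in> D i \<longrightarrow> c \<le> f i \<omega>"
    and C: "(\<Sum>i\<in>I. \<integral>\<omega>. indicator (D i) \<omega> * f i \<omega> \<partial>M) \<le> C"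
  shows "prob (\<Union>i\<in>I. D i) \<le> C / c"
proof -
  have "c * prob (D i) \<le> (\<integral>\<omega>. indicator (D i) \<omega> * f i \<omega> \<partial>M)" if "i \<in> I" for i
  proof -
    have [measurable]: "D i \<in> events" using assms that by simp
    have "c * prob (D i) = (\<integral>\<omega>. indicator (D i) \<omega> * c \<partial>M)" by simp
    also have "\<dots> \<le> (\<integral>\<omega>. indicator (D i) \<omega> * f i \<omega> \<partial>M)"
    proof (rule integral_mono_AE)
      show "integrable M (\<lambda>\<omega>. indicator (D i) \<omega> * f i \<omega>)"
        using integrable_mult_indicator[OF assms(2,3)[OF that]] by simp
      show "AE \<omega> in M. indicator (D i) \<omega> * c \<le> indicator (D i) \<omega> * f i \<omega>"
        using AE[OF that] by eventually_elim (auto split: split_indicator)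
    qed (auto intro!: integrable_mult_left integrable_real_indicator simp: less_top[symmetric])
    finally show ?thesis .
  qed
  then have "(\<Sum>i\<in>I. c * prob (D i)) \<le> (\<Sum>i\<in>I. \<integral>\<omega>. indicator (D i) \<omega> * f i \<omega> \<partial>M)" by (rule sum_mono)
  with C have "c * (\<Sum>i\<in>I. prob (D i)) \<le> C" unfolding sum_distrib_left by linarith
  moreover have "prob (\<Union>i\<in>I. D i) \<le> (\<Sum>i\<in>I. prob (D i))"
    using assms by (intro finite_measure_subadditive_finite) auto
  ultimately have "c * prob (\<Union>i\<in>I. D i) \<le> C" using order_trans[OF mult_left_mono[of "prob (\<Union>i\<in>I. D i)" "\<Sum>i\<in>I. prob (D i)" c]] assms(4) by simp
  then show ?thesis using assms(4) by (simp add: field_simps)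
qed

end

section \<open>Predictability of the time at which a new leader appears\<close>

context honest_index begin

text \<open>By nestedness a leader located before \<open>a\<close> already led every shorter window
  that reaches at least to \<open>a\<close>. So, as the right end of the window grows, a leader once
  beyond \<open>a\<close> never falls back before \<open>a\<close>.\<close>

lemma first_le_mono:
  assumes "reg \<omega>" "s \<in> \<rat>" "a \<in> \<rat>" "t \<in> \<rat>" "u \<in> \<rat>" "s < a" "a \<le> u" "u \<le> t" "\<tau> s t \<omega> < a"
  shows "\<tau> s u \<omega> = \<tau> s t \<omega>"
  using assms reg_inside(1)[of \<omega> s t] by (intro reg_nested) auto

text \<open>By \<open>first_le_mono\<close> the times in the infimum almost surely form a final
  segment of the rationals in \<open>[a, b]\<close>. The inserted \<open>b\<close> is the value if
  no new leader appears, and it keeps the time bounded, hence integrable.\<close>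

definition new_leader_time :: "real \<Rightarrow> real \<Rightarrow> real \<Rightarrow> 'w \<Rightarrow> real" where
  "new_leader_time s a b \<omega> = Inf (insert b {t\<in>\<rat>. a \<le> t \<and> t \<le> b \<and> a < \<tau> s t \<omega>})"

lemma new_leader_time_bounds:
  assumes "a < b" shows "a \<le> new_leader_time s a b \<omega>" "new_leader_time s a b \<omega> \<le> b"
proof -
  have bdd: "bdd_below (insert b {t\<in>\<rat>. a \<le> t \<and> t \<le> b \<and> a < \<tau> s t \<omega>})"
    using assms by (intro bdd_belowI[of _ a]) auto
  show "new_leader_time s a b \<omega> \<le> b" unfolding new_leader_time_def by (rule cInf_lower[OF _ bdd]) simp
  show "a \<le> new_leader_time s a b \<omega>" unfolding new_leader_time_def by (rule cInf_greatest) (use assms in auto)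
qed

lemma new_leader_time_le:
  assumes "a < b" "t \<in> \<rat>" "a \<le> t" "t \<le> b" "a < \<tau> s t \<omega>"
  shows "new_leader_time s a b \<omega> \<le> t"
  unfolding new_leader_time_def
  by (rule cInf_lower) (use assms in \<open>auto intro!: bdd_belowI[of _ a]\<close>)

lemma new_leader_time_ge:
  assumes "reg \<omega>" "s \<in> \<rat>" "a \<in> \<rat>" "s < a" "a < b" "t \<in> \<rat>" "a \<le> t" "t \<le> b" "\<tau> s t \<omega> < a"
  shows "t \<le> new_leader_time s a b \<omega>"
  unfolding new_leader_time_def
proof (rule cInf_greatest)
  fix u assume "u \<in> insert b {t\<in>\<rat>. a \<le> t \<and> t \<le> b \<and> a < \<tau> s t \<omega>}"
  then show "t \<le> u" using first_le_mono[of \<omega> s a t u] assms by (cases "t \<le> u") auto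
qed auto

lemma new_leader_time_measurable:
  assumes "s \<in> \<rat>" "s < a" "a < b"
  shows "new_leader_time s a b \<in> borel_measurable P"
proof (subst borel_measurable_iff_less, rule allI)
  fix c
  have *: "new_leader_time s a b \<omega> < c \<longleftrightarrow> b < c \<or> (\<exists>t\<in>\<rat>. a \<le> t \<and> t \<le> b \<and> t < c \<and> a < \<tau> s t \<omega>)" for \<omega>
    unfolding new_leader_time_def using assms
    by (subst cInf_less_iff) (auto intro!: bdd_belowI[of _ a])
  have "{\<omega>\<in>space P. new_leader_time s a b \<omega> < c} =
     (if b < c then space P else (\<Union>t\<in>{t\<in>\<rat>. a \<le> t \<and> t \<le> b \<and> t < c}. {\<omega>\<in>space P. a < \<tau> s t \<omega>}))"
    unfolding * by auto
  also have "\<dots> \<in> events"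
  proof -
    have "countable {t\<in>\<rat>. a \<le> t \<and> t \<le> b \<and> t < c}" by (rule countable_subset[OF _ countable_rat]) auto
    moreover have "{\<omega>\<in>space P. a < \<tau> s t \<omega>} \<in> events" if "t \<in> {t\<in>\<rat>. a \<le> t \<and> t \<le> b \<and> t < c}" for t
    proof -
      have "\<tau> s t \<in> borel_measurable P" using that assms by (intro \<tau>_meas) auto
      then show ?thesis by measurable
    qed
    ultimately show ?thesis by (auto intro!: sets.countable_UN')
  qed
  finally show "{\<omega>\<in>space P. new_leader_time s a b \<omega> < c} \<in> events" .
qed

lemma new_leader_time_integrable:
  assumes "s \<in> \<rat>" "s < a" "a < b"
  shows "integrable P (new_leader_time s a b)"
proof (rule integrable_const_bound[where B="max \<bar>a\<bar> \<bar>b\<bar>"])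
  show "AE \<omega> in P. norm (new_leader_time s a b \<omega>) \<le> max \<bar>a\<bar> \<bar>b\<bar>"
  proof (rule AE_I2)
    fix \<omega> show "norm (new_leader_time s a b \<omega>) \<le> max \<bar>a\<bar> \<bar>b\<bar>"
      using new_leader_time_bounds[OF assms(3), of s \<omega>] by (auto simp: abs_le_iff le_max_iff_disj)
  qed
qed (use assms new_leader_time_measurable in auto)

text \<open>The location of a new leader and its first appearance fall in the same cell: at the left
  end the leader is still an old one, and the leader after a look-ahead \<open>d\<close> lies in the
  cell. Thanks to the look-ahead this point also leads a fresh window of length \<open>d\<close>
  opened shortly before the cell.\<close>

definition jump_at_leader :: "real \<Rightarrow> real \<Rightarrow> real \<Rightarrow> real \<Rightarrow> nat \<Rightarrow> 'w set" where
  "jump_at_leader s a b d n = {\<omega>\<in>space P. \<exists>j<2^n. \<tau> s (grid a b n j) \<omega> < a \<and>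
     grid a b n j < \<tau> s (grid a b n j + d) \<omega> \<and> \<tau> s (grid a b n j + d) \<omega> < grid a b n (Suc j)}"

text \<open>The first new leader after \<^term>\<open>a\<close> appears at a predictable time. A leader that appears at
  that very time would be a leader of the fresh window opened at an announcing time, located
  arbitrarily close to the left end of this window.\<close>

lemma prob_jump_at_leader_le:
  fixes s a b d r e \<eta> :: real and n :: nat and g :: "'w \<Rightarrow> real"
  defines "V \<equiv> new_leader_time s a b" and "t \<equiv> grid a b n" and "h \<equiv> (b - a) / 2 ^ n"
  defines "c \<equiv> \<lambda>j. real_cond_exp P (past (t j)) g"
  assumes rat: "s \<in> \<rat>" "a \<in> \<rat>" "b \<in> \<rat>" "d \<in> \<rat>" and ord: "s < a" "a < b" "0 < r" "r \<le> d" "0 < \<eta>"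
    and h: "h \<le> r / 2" "h \<le> \<eta> / 3" "h < d"
    and g: "integrable P g" and e: "(\<integral>\<omega>. \<bar>V \<omega> - g \<omega>\<bar> \<partial>P) \<le> e"
  shows "prob (jump_at_leader s a b d n) \<le> prob {\<omega>\<in>space P. \<tau> 0 d \<omega> < r} + 2 * (e + \<eta>) / r
     + prob {\<omega>\<in>space P. \<exists>j<2^n. \<eta> / 3 < \<bar>c (Suc j) \<omega> - c j \<omega>\<bar>} + 3 * e / \<eta>"
proof -
  let ?N = "2 ^ n :: nat"
  have tR: "t j \<in> \<rat>" for j using rat by (simp add: t_def grid_Rats)
  have tSuc: "t (Suc j) = t j + h" for j by (simp add: t_def grid_Suc h_def)
  have tmono: "i \<le> j \<Longrightarrow> t i \<le> t j" for i j using ord by (simp add: t_def grid_mono)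
  have ta: "a \<le> t j" for j using tmono[of 0 j] by (simp add: t_def)
  have tb: "j \<le> ?N \<Longrightarrow> t j \<le> b" for j using grid_bounds[of a b j n] ord by (simp add: t_def)
  have st: "s < t j" for j using ta[of j] ord by simp
  have hpos: "0 < h" using ord by (simp add: h_def)
  have dpos: "0 < d" using ord by simp
  have V_int: "integrable P V" unfolding V_def using rat ord by (intro new_leader_time_integrable)
  have [measurable]: "V \<in> borel_measurable P" "g \<in> borel_measurable P" using V_int g by auto
  have ds: "integrable P (\<lambda>\<omega>. \<bar>V \<omega> - g \<omega>\<bar>)" using V_int g by auto
  have c_meas: "c j \<in> borel_measurable (past (t j))" for j by (simp add: c_def)
  have c_meas': "c j \<in> borel_measurable (past (t k))" if "j \<le> k" for j k
    using c_meas[of j] measurable_mono[of borel borel "past (t j)" "past (t k)"] past_mono[OF tmono[OF that]] by auto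
  have c_P: "c j \<in> borel_measurable P" for j by (simp add: c_def)
  have sub: "sigma_finite_subalgebra P (past u)" for u
    by (rule sigma_finite_subalgebra_of_subalgebra[OF sub_past])
  have c_int: "integrable P (c j)" for j unfolding c_def by (rule sigma_finite_subalgebra.real_cond_exp_int(1)[OF sub g])
  have c_eq: "(\<integral>\<omega>. indicator A \<omega> * c j \<omega> \<partial>P) = (\<integral>\<omega>. indicator A \<omega> * g \<omega> \<partial>P)" if "A \<in> sets (past (t j))" for A j
    using sigma_finite_subalgebra.real_cond_exp_intA[OF sub g that] by (simp add: set_lebesgue_integral_def c_def)
  have \<tau>P: "\<tau> s (t i) \<in> borel_measurable (past (t j))" if "i \<le> j" for i j
    using rat tR st tmono[OF that] by (intro \<tau>_past_mono)
  have integrable_indicator_times: "integrable P (\<lambda>\<omega>. indicator A \<omega> * f \<omega>)" if "A \<in> events" "integrable P f" for A and f :: "'w \<Rightarrow> real"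
    using integrable_mult_indicator[OF that] by simp

  have int_diff: "(\<integral>\<omega>. indicator A \<omega> * (f \<omega> - k) \<partial>P) = (\<integral>\<omega>. indicator A \<omega> * f \<omega> \<partial>P) - k * prob A"
    if "A \<in> events" "integrable P f" for A and f :: "'w \<Rightarrow> real" and k
  proof -
    have "(\<integral>\<omega>. indicator A \<omega> * (f \<omega> - k) \<partial>P) = (\<integral>\<omega>. indicator A \<omega> * f \<omega> - indicator A \<omega> * k \<partial>P)"
      by (simp add: right_diff_distrib)
    also have "\<dots> = (\<integral>\<omega>. indicator A \<omega> * f \<omega> \<partial>P) - (\<integral>\<omega>. indicator A \<omega> * k \<partial>P)"
      using that by (intro Bochner_Integration.integral_diff integrable_indicator_times) auto
    finally show ?thesis using that(1) by simp
  qed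

  \<comment> \<open>The closed martingale of \<open>g\<close> serves as a forecast of
    \<open>V\<close>. On \<open>B i\<close> it announces for the first time, at the grid time
    \<open>t i\<close>, that the new leader is due within \<open>\<eta>\<close>, while the leader
    from \<open>s\<close> is still an old one.\<close>
  define B where "B i = {\<omega>\<in>space P. \<tau> s (t i) \<omega> < a \<and> c i \<omega> \<le> t i + \<eta> \<and> (\<forall>k<i. t k + \<eta> < c k \<omega>)}" for i
  have B_past: "B i \<in> sets (past (t i))" for i
  proof -
    have 1: "{\<omega>\<in>space (past (t i)). \<tau> s (t i) \<omega> < a \<and> c i \<omega> \<le> t i + \<eta>} \<in> sets (past (t i))"
      using \<tau>P[OF order_refl, of i] c_meas[of i] by measurable
    have 2: "{\<omega>\<in>space (past (t i)). c k \<omega> \<le> t k + \<eta>} \<in> sets (past (t i))" if "k < i" for k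
      using c_meas'[OF less_imp_le[OF that]] by measurable
    have "B i = {\<omega>\<in>space (past (t i)). \<tau> s (t i) \<omega> < a \<and> c i \<omega> \<le> t i + \<eta>} - (\<Union>k<i. {\<omega>\<in>space (past (t i)). c k \<omega> \<le> t k + \<eta>})"
      unfolding B_def by (auto simp: not_le)
    also have "\<dots> \<in> sets (past (t i))" using 1 2 by auto
    finally show ?thesis .
  qed
  have B_ev [measurable]: "B i \<in> events" for i using past_events[OF B_past] .
  have Bc: "c i \<omega> \<le> t i + \<eta>" if "\<omega> \<in> B i" for i \<omega> using that by (simp add: B_def)
  have B_disj: "disjoint_family_on B I" for I
    unfolding disjoint_family_on_def
  proof (intro ballI impI)
    fix i j :: nat assume "i \<noteq> j"
    then have "i < j \<or> j < i" by auto
    then show "B i \<inter> B j = {}" unfolding B_def by force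
  qed
  have VB: "AE \<omega> in P. \<omega> \<in> B i \<longrightarrow> t i \<le> V \<omega>" if "i < ?N" for i
    using AE_reg
  proof eventually_elim
    case (elim \<omega>)
    then show ?case unfolding V_def B_def using rat ord tR ta tb[of i] that by (auto intro!: new_leader_time_ge)
  qed

  \<comment> \<open>The announcement belongs to the past of \<open>t i\<close> and the fresh window
    to its future, so the probabilities multiply. As the \<open>B i\<close> are disjoint, the sum is
    at most the probability that a single fresh leader lies within \<open>r\<close> of the left
    end.\<close>
  define E1 where "E1 = (\<Union>i<?N. B i \<inter> {\<omega>\<in>space P. \<tau> (t i) (t i + d) \<omega> < t i + r})"
  have fresh_meas: "\<tau> (t i) (t i + d) \<in> borel_measurable (fut (t i))" for i
    using rat tR dpos by (intro \<tau>_fut) auto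
  have fresh_fut: "{\<omega>\<in>space P. \<tau> (t i) (t i + d) \<omega> < t i + r} \<in> sets (fut (t i))" for i
  proof -
    have "{\<omega>\<in>space (fut (t i)). \<tau> (t i) (t i + d) \<omega> < t i + r} \<in> sets (fut (t i))"
      using fresh_meas[of i] by measurable
    then show ?thesis by simp
  qed
  have fresh_prob: "prob {\<omega>\<in>space P. \<tau> (t i) (t i + d) \<omega> < t i + r} = prob {\<omega>\<in>space P. \<tau> 0 d \<omega> < r}" for i
    using prob_less_shift[of 0 d "t i" r] rat tR dpos by (simp add: add.commute)
  have "prob E1 \<le> (\<Sum>i<?N. prob (B i \<inter> {\<omega>\<in>space P. \<tau> (t i) (t i + d) \<omega> < t i + r}))"
    unfolding E1_def using fut_events[OF fresh_fut] by (intro finite_measure_subadditive_finite) auto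
  also have "\<dots> = (\<Sum>i<?N. prob (B i)) * prob {\<omega>\<in>space P. \<tau> 0 d \<omega> < r}"
    unfolding sum_distrib_right indep_past_fut[OF B_past fresh_fut] fresh_prob ..
  also have "\<dots> \<le> 1 * prob {\<omega>\<in>space P. \<tau> 0 d \<omega> < r}"
    by (intro mult_right_mono sum_disjoint_prob_le B_disj) auto
  finally have E1: "prob E1 \<le> prob {\<omega>\<in>space P. \<tau> 0 d \<omega> < r}" by simp

  \<comment> \<open>False alarm: announced at \<open>t i\<close>, yet the new leader appears at
    least \<open>r / 2\<close> later. The expected delay after an announcement is controlled, so
    Markov's inequality applies.\<close>
  define E2 where "E2 = (\<Union>i<?N. B i \<inter> {\<omega>\<in>space P. t i + r / 2 \<le> V \<omega>})"
  have "prob E2 \<le> (e + \<eta>) / (r / 2)"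
    unfolding E2_def
  proof (rule prob_UN_markov[where f="\<lambda>i \<omega>. V \<omega> - t i"])
    have "(\<Sum>i<?N. \<integral>\<omega>. indicator (B i \<inter> {\<omega>\<in>space P. t i + r / 2 \<le> V \<omega>}) \<omega> * (V \<omega> - t i) \<partial>P)
       \<le> (\<Sum>i<?N. (\<integral>\<omega>. indicator (B i) \<omega> * \<bar>V \<omega> - g \<omega>\<bar> \<partial>P) + \<eta> * prob (B i))"
    proof (rule sum_mono)
      fix i assume i: "i \<in> {..<?N}"
      have "(\<integral>\<omega>. indicator (B i \<inter> {\<omega>\<in>space P. t i + r / 2 \<le> V \<omega>}) \<omega> * (V \<omega> - t i) \<partial>P)
         \<le> (\<integral>\<omega>. indicator (B i) \<omega> * (V \<omega> - t i) \<partial>P)"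
        using VB[of i] i V_int by (intro integral_mono_AE integrable_indicator_times) (auto elim!: eventually_mono split: split_indicator)
      also have "\<dots> \<le> (\<integral>\<omega>. indicator (B i) \<omega> * \<bar>V \<omega> - g \<omega>\<bar> + indicator (B i) \<omega> * (g \<omega> - t i) \<partial>P)"
        using V_int g by (intro integral_mono Bochner_Integration.integrable_add integrable_indicator_times) (auto split: split_indicator)
      also have "\<dots> = (\<integral>\<omega>. indicator (B i) \<omega> * \<bar>V \<omega> - g \<omega>\<bar> \<partial>P) + (\<integral>\<omega>. indicator (B i) \<omega> * (g \<omega> - t i) \<partial>P)"
        using V_int g by (intro Bochner_Integration.integral_add integrable_indicator_times) auto
      \<comment> \<open>\<open>B i\<close> belongs to the past of \<open>t i\<close>, so
        \<open>g\<close> may be replaced by its conditional expectation there, and on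
        \<open>B i\<close> this is at most \<open>t i + \<eta>\<close>.\<close>
      also have "(\<integral>\<omega>. indicator (B i) \<omega> * (g \<omega> - t i) \<partial>P) = (\<integral>\<omega>. indicator (B i) \<omega> * (c i \<omega> - t i) \<partial>P)"
        using c_eq[OF B_past[of i]] by (simp add: int_diff[OF B_ev g] int_diff[OF B_ev c_int])
      also have "\<dots> \<le> (\<integral>\<omega>. indicator (B i) \<omega> * \<eta> \<partial>P)"
        using c_int[of i] Bc[of _ i] by (intro integral_mono integrable_indicator_times B_ev) (auto split: split_indicator simp: algebra_simps)
      also have "\<dots> = \<eta> * prob (B i)" by simp
      finally show "(\<integral>\<omega>. indicator (B i \<inter> {\<omega>\<in>space P. t i + r / 2 \<le> V \<omega>}) \<omega> * (V \<omega> - t i) \<partial>P) \<le> (\<integral>\<omega>. indicator (B i) \<omega> * \<bar>V \<omega> - g \<omega>\<bar> \<partial>P) + \<eta> * prob (B i)"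
        by simp
    qed
    also have "\<dots> = (\<Sum>i<?N. \<integral>\<omega>. indicator (B i) \<omega> * \<bar>V \<omega> - g \<omega>\<bar> \<partial>P) + \<eta> * (\<Sum>i<?N. prob (B i))"
      by (simp add: sum.distrib sum_distrib_left)
    also have "\<dots> \<le> (\<integral>\<omega>. \<bar>V \<omega> - g \<omega>\<bar> \<partial>P) + \<eta> * 1"
      using ord ds by (intro add_mono sum_disjoint_integral_le mult_left_mono sum_disjoint_prob_le B_disj) auto
    finally show "(\<Sum>i<?N. \<integral>\<omega>. indicator (B i \<inter> {\<omega>\<in>space P. t i + r / 2 \<le> V \<omega>}) \<omega> * (V \<omega> - t i) \<partial>P) \<le> e + \<eta>"
      using e by simp
  qed (use V_int ord in auto)
  then have E2: "prob E2 \<le> 2 * (e + \<eta>) / r" by (simp add: field_simps)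

  define E3 where "E3 = {\<omega>\<in>space P. \<exists>j<2^n. \<eta> / 3 < \<bar>c (Suc j) \<omega> - c j \<omega>\<bar>}"

  \<comment> \<open>Missed alarm: at the right end of the cell the new leader is already present, so
    \<open>V\<close> is at most \<open>t (Suc j)\<close>, but the forecast is still more than
    \<open>\<eta> / 3\<close> ahead. Only the error of \<open>g\<close> can cause this.\<close>
  define D where "D j = {\<omega>\<in>space P. \<tau> s (t j) \<omega> < a \<and> a < \<tau> s (t (Suc j)) \<omega> \<and> t (Suc j) + \<eta> / 3 < c (Suc j) \<omega>}" for j
  have D_past: "D j \<in> sets (past (t (Suc j)))" for j
  proof -
    have [measurable]: "\<tau> s (t j) \<in> borel_measurable (past (t (Suc j)))" "\<tau> s (t (Suc j)) \<in> borel_measurable (past (t (Suc j)))"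
      using \<tau>P by auto
    have [measurable]: "c (Suc j) \<in> borel_measurable (past (t (Suc j)))" by (rule c_meas)
    have "D j = {\<omega>\<in>space (past (t (Suc j))). \<tau> s (t j) \<omega> < a \<and> a < \<tau> s (t (Suc j)) \<omega> \<and> t (Suc j) + \<eta> / 3 < c (Suc j) \<omega>}"
      by (simp add: D_def)
    also have "\<dots> \<in> sets (past (t (Suc j)))" by measurable
    finally show ?thesis .
  qed
  have D_ev [measurable]: "D j \<in> events" for j using past_events[OF D_past] .
  have D_disj: "\<omega> \<notin> D i" if "reg \<omega>" "i < j" "\<omega> \<in> D j" for \<omega> i j
    using first_le_mono[OF that(1), of s a "t j" "t (Suc i)"] that rat tR ord ta tmono[of "Suc i" j]
    by (auto simp: D_def)
  \<comment> \<open>The \<open>D j\<close> are disjoint only on \<open>reg\<close>;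
    \<open>D'\<close> removes the exceptional overlap so that the integrals over the pieces can be
    added.\<close>
  define D' where "D' j = D j - (\<Union>i<j. D i)" for j
  have D'_ev [measurable]: "D' j \<in> events" for j unfolding D'_def by measurable
  have D'_disj: "disjoint_family_on D' I" for I
    unfolding disjoint_family_on_def
  proof (intro ballI impI)
    fix i j :: nat assume "i \<noteq> j"
    then have "i < j \<or> j < i" by auto
    then show "D' i \<inter> D' j = {}" unfolding D'_def by blast
  qed
  have D_eq: "AE \<omega> in P. (\<omega> \<in> D j) = (\<omega> \<in> D' j)" for j
    using AE_reg by eventually_elim (auto simp: D'_def dest: D_disj)
  have V_D: "AE \<omega> in P. \<omega> \<in> D j \<longrightarrow> V \<omega> \<le> t (Suc j)" if "j < ?N" for j
    unfolding V_def D_def using that rat ord tR ta tb[of "Suc j"] by (auto intro!: AE_I2 new_leader_time_le)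
  have E4: "prob (\<Union>j<?N. D j) \<le> e / (\<eta> / 3)"
  proof (rule prob_UN_markov[where f="\<lambda>j \<omega>. c (Suc j) \<omega> - t (Suc j)"])
    have "(\<Sum>j<?N. \<integral>\<omega>. indicator (D j) \<omega> * (c (Suc j) \<omega> - t (Suc j)) \<partial>P) \<le> (\<Sum>j<?N. \<integral>\<omega>. indicator (D' j) \<omega> * \<bar>V \<omega> - g \<omega>\<bar> \<partial>P)"
    proof (rule sum_mono)
      fix j assume j: "j \<in> {..<?N}"
      have "(\<integral>\<omega>. indicator (D j) \<omega> * (c (Suc j) \<omega> - t (Suc j)) \<partial>P) = (\<integral>\<omega>. indicator (D j) \<omega> * (g \<omega> - t (Suc j)) \<partial>P)"
        using c_eq[OF D_past[of j]] by (simp add: int_diff[OF D_ev g] int_diff[OF D_ev c_int])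
      also have "\<dots> \<le> (\<integral>\<omega>. indicator (D' j) \<omega> * \<bar>V \<omega> - g \<omega>\<bar> \<partial>P)"
      proof (rule integral_mono_AE)
        show "AE \<omega> in P. indicator (D j) \<omega> * (g \<omega> - t (Suc j)) \<le> indicator (D' j) \<omega> * \<bar>V \<omega> - g \<omega>\<bar>"
          using V_D[of j] D_eq[of j] j by (auto elim!: eventually_elim2 split: split_indicator)
      qed (use g ds in \<open>auto intro!: integrable_indicator_times\<close>)
      finally show "(\<integral>\<omega>. indicator (D j) \<omega> * (c (Suc j) \<omega> - t (Suc j)) \<partial>P) \<le> (\<integral>\<omega>. indicator (D' j) \<omega> * \<bar>V \<omega> - g \<omega>\<bar> \<partial>P)" .
    qed
    also have "\<dots> \<le> (\<integral>\<omega>. \<bar>V \<omega> - g \<omega>\<bar> \<partial>P)"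
      using ds by (intro sum_disjoint_integral_le D'_disj) auto
    finally show "(\<Sum>j<?N. \<integral>\<omega>. indicator (D j) \<omega> * (c (Suc j) \<omega> - t (Suc j)) \<partial>P) \<le> e" using e by simp
    fix j :: nat
    have "\<eta> / 3 \<le> c (Suc j) \<omega> - t (Suc j)" if "\<omega> \<in> D j" for \<omega> using that by (simp add: D_def)
    then show "AE \<omega> in P. \<omega> \<in> D j \<longrightarrow> \<eta> / 3 \<le> c (Suc j) \<omega> - t (Suc j)" by (intro AE_I2) blast
  qed (use c_int ord D_ev in \<open>simp_all\<close>)

  have "AE \<omega> in P. \<omega> \<in> jump_at_leader s a b d n \<longrightarrow> \<omega> \<in> E1 \<union> E2 \<union> E3 \<union> (\<Union>j<?N. D j)"
    using AE_reg
  proof eventually_elim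
    case (elim \<omega>)
    show ?case
    proof
      assume "\<omega> \<in> jump_at_leader s a b d n"
      then obtain j where j: "j < ?N" "\<tau> s (t j) \<omega> < a" "t j < \<tau> s (t j + d) \<omega>" "\<tau> s (t j + d) \<omega> < t (Suc j)"
        by (auto simp: jump_at_leader_def t_def)
      have sp: "\<omega> \<in> space P" using reg_space[OF elim] .
      have td: "t (Suc j) < t j + d" using h by (simp add: tSuc)
      have lead: "\<tau> s (t (Suc j)) \<omega> = \<tau> s (t j + d) \<omega>"
        using elim rat tR st[of "Suc j"] j td ord st[of j] by (intro reg_nested) auto
      \<comment> \<open>If an announcement came at some \<open>i \<le> j\<close>, either the leader
        is within \<open>r\<close> of \<open>t i\<close> and therefore leads the fresh window opened
        there (\<open>E1\<close>), or the announcement was premature (\<open>E2\<close>). Without an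
        announcement the forecast at \<open>j\<close> exceeds \<open>t j + \<eta>\<close>; then
        either it jumps (\<open>E3\<close>) or it is still too late at \<open>Suc j\<close>
        (\<open>D j\<close>).\<close>
      show "\<omega> \<in> E1 \<union> E2 \<union> E3 \<union> (\<Union>j<?N. D j)"
      proof (cases "\<exists>i\<le>j. c i \<omega> \<le> t i + \<eta>")
        case True
        define i where "i = (LEAST i. c i \<omega> \<le> t i + \<eta>)"
        have i1: "c i \<omega> \<le> t i + \<eta>" unfolding i_def using True by (intro LeastI_ex[of "\<lambda>i. c i \<omega> \<le> t i + \<eta>"]) auto
        have i2: "i \<le> j" unfolding i_def using True by (metis (mono_tags, lifting) Least_le order_trans)
        have i3: "\<forall>k<i. t k + \<eta> < c k \<omega>" unfolding i_def using not_less_Least by (meson not_le)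
        have "\<tau> s (t i) \<omega> < a"
          using first_le_mono[OF elim, of s a "t j" "t i"] rat tR ord ta tmono[OF i2] j by simp
        then have iB: "\<omega> \<in> B i" using sp i1 i3 by (simp add: B_def)
        have iN: "i < ?N" using i2 j by simp
        show ?thesis
        proof (cases "t (Suc j) < t i + r")
          case True
          have "\<tau> (t i) (t i + d) \<omega> = \<tau> s (t j + d) \<omega>"
            using elim rat tR st[of i] j tmono[OF i2] ord True by (intro reg_nested) auto
          then have "\<tau> (t i) (t i + d) \<omega> < t i + r" using j True by simp
          then show ?thesis using iB iN sp by (auto simp: E1_def)
        next
          case False
          have "t j \<le> V \<omega>" unfolding V_def using elim rat ord tR ta tb[of j] j by (intro new_leader_time_ge) auto
          then have "t i + r / 2 \<le> V \<omega>" using False h tSuc[of j] by simp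
          then show ?thesis using iB iN sp by (auto simp: E2_def)
        qed
      next
        case False
        then have cj: "t j + \<eta> < c j \<omega>" by (auto simp: not_le)
        show ?thesis
        proof (cases "\<eta> / 3 < \<bar>c (Suc j) \<omega> - c j \<omega>\<bar>")
          case True then show ?thesis using j sp by (auto simp: E3_def)
        next
          case False
          \<comment> \<open>Of the lead \<open>\<eta>\<close> one third may be lost to the increment
            of the forecast and one third to the width of the cell; the last third is the one in
            \<open>D j\<close>.\<close>
          then have "c j \<omega> - \<eta> / 3 \<le> c (Suc j) \<omega>" by linarith
          then have "t (Suc j) + \<eta> / 3 < c (Suc j) \<omega>" using cj h tSuc[of j] by simp
          moreover have "a < \<tau> s (t (Suc j)) \<omega>" using lead j ta[of j] by simp
          ultimately have "\<omega> \<in> D j" using sp j by (simp add: D_def)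
          then show ?thesis using j by auto
        qed
      qed
    qed
  qed
  moreover have "E1 \<in> events" unfolding E1_def using fut_events[OF fresh_fut] by auto
  moreover have "E2 \<in> events" unfolding E2_def by measurable
  moreover have "E3 \<in> events" unfolding E3_def using c_P by measurable
  ultimately have "prob (jump_at_leader s a b d n) \<le> prob (E1 \<union> E2 \<union> E3 \<union> (\<Union>j<?N. D j))"
    by (intro finite_measure_mono_AE) auto
  also have "\<dots> \<le> prob E1 + prob E2 + prob E3 + prob (\<Union>j<?N. D j)"
    using \<open>E1 \<in> events\<close> \<open>E2 \<in> events\<close> \<open>E3 \<in> events\<close>
    by (intro order_trans[OF measure_Un_le] add_mono order_refl) auto
  finally show ?thesis using E1 E2 E4 unfolding E3_def[symmetric] by (simp add: mult.commute)
qed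

end

lemma grid_width_tendsto_0: "(\<lambda>n. (b - a) / 2 ^ n :: real) \<longlonglongrightarrow> 0"
  using tendsto_mult_right_zero[OF LIMSEQ_divide_realpow_zero[of 2 1], of "b - a"] by simp

context honest_index begin

lemma prob_jump_at_leader_tendsto_0:
  assumes rat: "s \<in> \<rat>" "a \<in> \<rat>" "b \<in> \<rat>" "d \<in> \<rat>" and ord: "s < a" "a < b" "0 < d"
  shows "(\<lambda>n. prob (jump_at_leader s a b d n)) \<longlonglongrightarrow> 0"
proof (rule LIMSEQ_I)
  fix \<epsilon> :: real assume \<epsilon>: "0 < \<epsilon>"
  have "eventually (\<lambda>n. prob {\<omega>\<in>space P. \<tau> 0 d \<omega> < 0 + inverse (real (Suc n))} < \<epsilon> / 5) sequentially"
    using rat ord \<epsilon> by (intro order_tendstoD(2)[OF prob_near_left_tendsto_0]) auto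
  moreover have "eventually (\<lambda>n. inverse (real (Suc n)) < d) sequentially"
    using LIMSEQ_inverse_real_of_nat ord by (intro order_tendstoD(2)) auto
  ultimately have "eventually (\<lambda>n. prob {\<omega>\<in>space P. \<tau> 0 d \<omega> < 0 + inverse (real (Suc n))} < \<epsilon> / 5 \<and> inverse (real (Suc n)) < d) sequentially"
    by (rule eventually_conj)
  then obtain m where m: "prob {\<omega>\<in>space P. \<tau> 0 d \<omega> < 0 + inverse (real (Suc m))} < \<epsilon> / 5" "inverse (real (Suc m)) < d"
    unfolding eventually_sequentially by blast
  define r where "r = inverse (real (Suc m))"
  have r: "0 < r" "r < d" "prob {\<omega>\<in>space P. \<tau> 0 d \<omega> < r} < \<epsilon> / 5" using m by (simp_all add: r_def)
  \<comment> \<open>Order of choice: \<open>r\<close> makes the term of the fresh window small,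
    \<open>\<eta>\<close> turns \<open>2 * \<eta> / r\<close> into \<open>\<epsilon> / 6\<close>,
    and only then \<open>e\<close> makes the terms that contain it add up to
    \<open>\<epsilon> / 8\<close>. With the two remaining terms below \<open>\<epsilon> / 5\<close>
    the total is below \<open>\<epsilon>\<close>.\<close>
  define \<eta> where "\<eta> = \<epsilon> * r / 12"
  have \<eta>: "0 < \<eta>" using \<epsilon> r by (simp add: \<eta>_def)
  define e where "e = (\<epsilon> / 8) / (2 / r + 3 / \<eta>)"
  have k: "0 < 2 / r + 3 / \<eta>" using r \<eta> by (simp add: add_pos_pos)
  have e: "0 < e" using \<epsilon> k by (simp add: e_def)
  have e2: "2 * (e + \<eta>) / r + 3 * e / \<eta> = \<epsilon> / 8 + \<epsilon> / 6"
  proof -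
    have "2 * (e + \<eta>) / r + 3 * e / \<eta> = e * (2 / r + 3 / \<eta>) + 2 * \<eta> / r" by (simp add: field_simps add_divide_distrib)
    also have "e * (2 / r + 3 / \<eta>) = \<epsilon> / 8" using k by (metis e_def less_irrefl nonzero_eq_divide_eq)
    also have "2 * \<eta> / r = \<epsilon> / 6" using r by (simp add: \<eta>_def)
    finally show ?thesis .
  qed
  obtain g where g: "small_jumps past a b g" and ge: "(\<integral>\<omega>. \<bar>new_leader_time s a b \<omega> - g \<omega>\<bar> \<partial>P) \<le> e"
    using cont_past ord(2) e new_leader_time_integrable[OF rat(1) ord(1,2)] unfolding continuous_filtration_def by blast
  have gi: "integrable P g" using g by (simp add: small_jumps_def)
  have "\<eta> / 3 > 0" using \<eta> by simp
  with g have "(\<lambda>n. prob {\<omega>\<in>space P. \<exists>j<2^n.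
      \<eta> / 3 < \<bar>real_cond_exp P (past (grid a b n (Suc j))) g \<omega> - real_cond_exp P (past (grid a b n j)) g \<omega>\<bar>}) \<longlonglongrightarrow> 0"
    unfolding small_jumps_def by blast
  then have "eventually (\<lambda>n. prob {\<omega>\<in>space P. \<exists>j<2^n.
      \<eta> / 3 < \<bar>real_cond_exp P (past (grid a b n (Suc j))) g \<omega> - real_cond_exp P (past (grid a b n j)) g \<omega>\<bar>} < \<epsilon> / 5) sequentially"
    using \<epsilon> by (intro order_tendstoD(2)) auto
  moreover have "eventually (\<lambda>n. (b - a) / 2 ^ n < min (r / 2) (min (\<eta> / 3) d)) sequentially"
    using grid_width_tendsto_0 r \<eta> ord by (intro order_tendstoD(2)) auto
  ultimately have "eventually (\<lambda>n. prob (jump_at_leader s a b d n) < \<epsilon>) sequentially"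
  proof eventually_elim
    case (elim n)
    have "prob (jump_at_leader s a b d n) \<le> prob {\<omega>\<in>space P. \<tau> 0 d \<omega> < r} + 2 * (e + \<eta>) / r
     + prob {\<omega>\<in>space P. \<exists>j<2^n. \<eta> / 3 < \<bar>real_cond_exp P (past (grid a b n (Suc j))) g \<omega> - real_cond_exp P (past (grid a b n j)) g \<omega>\<bar>}
     + 3 * e / \<eta>"
      by (rule prob_jump_at_leader_le) (use rat ord r \<eta> elim gi ge in auto)
    then show ?case using elim(1) r(3) e2 \<epsilon> by argo
  qed
  then show "\<exists>no. \<forall>n\<ge>no. norm (prob (jump_at_leader s a b d n) - 0) < \<epsilon>"
    unfolding eventually_sequentially by simp
qed

definition leader_jump :: "real \<Rightarrow> real \<Rightarrow> real \<Rightarrow> nat \<Rightarrow> 'w set" where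
  "leader_jump s a b n = {\<omega>\<in>space P. \<exists>j<2^n. \<tau> s (grid a b n j) \<omega> < a \<and>
     grid a b n j < \<tau> s b \<omega> \<and> \<tau> s b \<omega> < grid a b n (Suc j)}"

lemma leader_jump_events:
  assumes "s \<in> \<rat>" "a \<in> \<rat>" "b \<in> \<rat>" "s < a" "a < b"
  shows "leader_jump s a b n \<in> events"
proof -
  have m: "\<tau> s (grid a b n j) \<in> borel_measurable P" for j
    using assms grid_mono[of a b 0 j n] by (intro \<tau>_meas) (auto simp: grid_Rats)
  have "\<tau> s b \<in> borel_measurable P" using assms by (intro \<tau>_meas) auto
  with m have "{\<omega>\<in>space P. \<tau> s (grid a b n j) \<omega> < a \<and> grid a b n j < \<tau> s b \<omega> \<and> \<tau> s b \<omega> < grid a b n (Suc j)} \<in> events" for j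
    by measurable
  moreover have "leader_jump s a b n = (\<Union>j<2^n. {\<omega>\<in>space P. \<tau> s (grid a b n j) \<omega> < a \<and> grid a b n j < \<tau> s b \<omega> \<and> \<tau> s b \<omega> < grid a b n (Suc j)})"
    by (auto simp: leader_jump_def)
  ultimately show ?thesis by auto
qed

text \<open>Reduction to \<open>jump_at_leader\<close>: for small \<open>d\<close> the leader of the
  whole window is unlikely to lie within \<open>d\<close> of \<open>b\<close>. Otherwise the
  look-ahead window of its cell ends no later than \<open>b\<close>, and nestedness gives it the
  same leader.\<close>

lemma prob_leader_jump_tendsto_0:
  assumes rat: "s \<in> \<rat>" "a \<in> \<rat>" "b \<in> \<rat>" and ord: "s < a" "a < b"
  shows "(\<lambda>n. prob (leader_jump s a b n)) \<longlonglongrightarrow> 0"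
proof (rule LIMSEQ_I)
  fix \<epsilon> :: real assume \<epsilon>: "0 < \<epsilon>"
  have sb: "s < b" using ord by simp
  have "eventually (\<lambda>n. prob {\<omega>\<in>space P. b - inverse (real (Suc n)) < \<tau> s b \<omega>} < \<epsilon> / 2) sequentially"
    using rat sb \<epsilon> by (intro order_tendstoD(2)[OF prob_near_right_tendsto_0]) auto
  then obtain m where m: "prob {\<omega>\<in>space P. b - inverse (real (Suc m)) < \<tau> s b \<omega>} < \<epsilon> / 2"
    unfolding eventually_sequentially by blast
  define d where "d = inverse (real (Suc m))"
  have d: "0 < d" "d \<in> \<rat>" by (simp_all add: d_def)
  have \<tau>b: "\<tau> s b \<in> borel_measurable P" using rat sb by (intro \<tau>_meas)
  have "eventually (\<lambda>n. prob (jump_at_leader s a b d n) < \<epsilon> / 2) sequentially"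
    using prob_jump_at_leader_tendsto_0[OF rat d(2) ord d(1)] \<epsilon> by (intro order_tendstoD(2)) auto
  moreover have "eventually (\<lambda>n. (b - a) / 2 ^ n < d) sequentially"
    using grid_width_tendsto_0 d by (intro order_tendstoD(2)) auto
  ultimately have "eventually (\<lambda>n. prob (leader_jump s a b n) < \<epsilon>) sequentially"
  proof eventually_elim
    case (elim n)
    have jm: "jump_at_leader s a b d n \<in> events"
    proof -
      have m: "\<tau> s (grid a b n j) \<in> borel_measurable P" "\<tau> s (grid a b n j + d) \<in> borel_measurable P" for j
        using rat ord d grid_mono[of a b 0 j n] by (auto intro!: \<tau>_meas simp: grid_Rats)
      then have "{\<omega>\<in>space P. \<tau> s (grid a b n j) \<omega> < a \<and> grid a b n j < \<tau> s (grid a b n j + d) \<omega> \<and> \<tau> s (grid a b n j + d) \<omega> < grid a b n (Suc j)} \<in> events" for j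
        by measurable
      moreover have "jump_at_leader s a b d n = (\<Union>j<2^n. {\<omega>\<in>space P. \<tau> s (grid a b n j) \<omega> < a \<and> grid a b n j < \<tau> s (grid a b n j + d) \<omega> \<and> \<tau> s (grid a b n j + d) \<omega> < grid a b n (Suc j)})"
        by (auto simp: jump_at_leader_def)
      ultimately show ?thesis by auto
    qed
    have tm: "{\<omega>\<in>space P. b - d < \<tau> s b \<omega>} \<in> events" using \<tau>b by measurable
    have "AE \<omega> in P. \<omega> \<in> leader_jump s a b n \<longrightarrow> \<omega> \<in> jump_at_leader s a b d n \<union> {\<omega>\<in>space P. b - d < \<tau> s b \<omega>}"
      using AE_reg
    proof eventually_elim
      case (elim \<omega>)
      show ?case
      proof
        assume "\<omega> \<in> leader_jump s a b n"
        then obtain j where j: "j < 2^n" "\<tau> s (grid a b n j) \<omega> < a" "grid a b n j < \<tau> s b \<omega>" "\<tau> s b \<omega> < grid a b n (Suc j)"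
          and sp: "\<omega> \<in> space P" by (auto simp: leader_jump_def)
        show "\<omega> \<in> jump_at_leader s a b d n \<union> {\<omega>\<in>space P. b - d < \<tau> s b \<omega>}"
        proof (cases "grid a b n j + d \<le> b")
          case True
          have "a \<le> grid a b n j" using grid_mono[of a b 0 j n] ord by simp
          then have "\<tau> s (grid a b n j + d) \<omega> = \<tau> s b \<omega>"
            using True elim rat ord d j \<open>(b - a) / 2 ^ n < d\<close> grid_Rats[OF rat(2,3)] grid_Suc[of a b n j] reg_inside(1)[OF elim rat(1,3)]
            by (intro reg_nested) auto
          then show ?thesis using j sp unfolding jump_at_leader_def by auto
        next
          case False then show ?thesis using j sp by auto
        qed
      qed
    qed
    then have "prob (leader_jump s a b n) \<le> prob (jump_at_leader s a b d n \<union> {\<omega>\<in>space P. b - d < \<tau> s b \<omega>})"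
      using jm tm by (intro finite_measure_mono_AE) auto
    also have "\<dots> \<le> prob (jump_at_leader s a b d n) + prob {\<omega>\<in>space P. b - d < \<tau> s b \<omega>}"
      using jm tm by (rule measure_Un_le)
    finally show ?case using elim m by (simp add: d_def)
  qed
  then show "\<exists>no. \<forall>n\<ge>no. norm (prob (leader_jump s a b n) - 0) < \<epsilon>"
    unfolding eventually_sequentially by simp
qed

section \<open>The renewal equation for hereditary families\<close>

definition hit :: "(real \<Rightarrow> 'w \<Rightarrow> real set) \<Rightarrow> real \<Rightarrow> real \<Rightarrow> real \<Rightarrow> 'w set" where
  "hit Z t a b = {\<omega>\<in>space P. \<exists>x\<in>Z t \<omega>. a < x \<and> x < b}"

text \<open>Points selected by \<^term>\<open>Z t\<close> are leaders from time \<^term>\<open>t\<close>; a selected point stays selected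
  when the window is shortened from the left, and it is only lost, when the window is extended to
  the left, because an earlier leader prevails.\<close>

definition hereditary :: "real \<Rightarrow> real \<Rightarrow> real \<Rightarrow> (real \<Rightarrow> 'w \<Rightarrow> real set) \<Rightarrow> bool" where
  "hereditary s a b Z \<longleftrightarrow> hit Z s a b \<in> events \<and> (\<forall>t\<in>\<rat>. a < t \<and> t < b \<longrightarrow> hit Z t t b \<in> sets (fut t)) \<and>
     (\<forall>\<omega>. reg \<omega> \<longrightarrow>
       (\<forall>x\<in>Z s \<omega>. a < x \<and> x < b \<longrightarrow> \<tau> s b \<omega> = x \<and> (\<forall>t\<in>\<rat>. a < t \<and> t < x \<longrightarrow> x \<in> Z t \<omega>)) \<and>
       (\<forall>t\<in>\<rat>. \<forall>x\<in>Z t \<omega>. a < t \<and> t < x \<and> x < b \<longrightarrow> x \<in> Z s \<omega> \<or> \<tau> s b \<omega> < t))"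

text \<open>The cell that contains the first new leader as seen from the right end of the cell; at
  this right end a fresh window is opened. Asking for an old leader at all \<open>i \<le> j\<close>
  makes these events disjoint at every point.\<close>

definition renewal_at :: "real \<Rightarrow> real \<Rightarrow> real \<Rightarrow> nat \<Rightarrow> nat \<Rightarrow> 'w set" where
  "renewal_at s a b n j = {\<omega>\<in>space P. (\<forall>i\<le>j. \<tau> s (grid a b n i) \<omega> < a) \<and> grid a b n j < \<tau> s (grid a b n (Suc j)) \<omega>}"

lemma renewal_at_past:
  assumes rat: "s \<in> \<rat>" "a \<in> \<rat>" "b \<in> \<rat>" and ord: "s < a" "a < b"
  shows "renewal_at s a b n j \<in> sets (past (grid a b n (Suc j)))"
proof -
  let ?F = "past (grid a b n (Suc j))"
  have m: "\<tau> s (grid a b n i) \<in> borel_measurable ?F" if "i \<le> Suc j" for i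
    using rat ord grid_mono[of a b 0 i n] grid_mono[of a b i "Suc j" n] that by (intro \<tau>_past_mono) (auto simp: grid_Rats)
  have 1: "{\<omega>\<in>space ?F. grid a b n j < \<tau> s (grid a b n (Suc j)) \<omega>} \<in> sets ?F"
    using m[of "Suc j"] by measurable
  have 2: "{\<omega>\<in>space ?F. a \<le> \<tau> s (grid a b n i) \<omega>} \<in> sets ?F" if "i \<le> j" for i
    using m[OF le_SucI[OF that]] by measurable
  have "renewal_at s a b n j = {\<omega>\<in>space ?F. grid a b n j < \<tau> s (grid a b n (Suc j)) \<omega>} - (\<Union>i\<le>j. {\<omega>\<in>space ?F. a \<le> \<tau> s (grid a b n i) \<omega>})"
    unfolding renewal_at_def by (auto simp: not_le)
  also have "\<dots> \<in> sets ?F" using 1 2 by auto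
  finally show ?thesis .
qed

lemma renewal_at_disjoint:
  assumes "a < b" shows "disjoint_family_on (renewal_at s a b n) I"
  unfolding disjoint_family_on_def
proof (intro ballI impI)
  have *: "renewal_at s a b n i \<inter> renewal_at s a b n j = {}" if "i < j" for i j
    using that grid_mono[OF assms, of 0 i n] unfolding renewal_at_def by (force dest: spec[of _ "Suc i"])
  fix i j :: nat assume "i \<noteq> j"
  then show "renewal_at s a b n i \<inter> renewal_at s a b n j = {}" using *[of i j] *[of j i] by (cases "i < j") auto
qed

lemma prob_sym_diff_le:
  assumes [measurable]: "X \<in> events" "Y \<in> events" "B \<in> events"
    and "AE \<omega> in P. (\<omega> \<in> X \<longrightarrow> \<omega> \<in> Y \<or> \<omega> \<in> B) \<and> (\<omega> \<in> Y \<longrightarrow> \<omega> \<in> X \<or> \<omega> \<in> B)"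
  shows "\<bar>prob X - prob Y\<bar> \<le> prob B"
proof -
  have "prob X \<le> prob (Y \<union> B)" using assms by (intro finite_measure_mono_AE) (auto elim!: eventually_mono)
  also have "\<dots> \<le> prob Y + prob B" by (rule measure_Un_le) auto
  finally have 1: "prob X \<le> prob Y + prob B" .
  have "prob Y \<le> prob (X \<union> B)" using assms by (intro finite_measure_mono_AE) (auto elim!: eventually_mono)
  also have "\<dots> \<le> prob X + prob B" by (rule measure_Un_le) auto
  finally show ?thesis using 1 by simp
qed

text \<open>A point selected from \<open>s\<close> either lies in the renewal cell, which is a
  \<open>leader_jump\<close>, or beyond it, and then heredity makes it selected from the fresh
  window too. Conversely, a point selected from the fresh window but not from \<open>s\<close> has
  lost to an earlier leader in the renewal cell, again a \<open>leader_jump\<close>. The products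
  arise because past and future of the right end of the cell are independent.\<close>

lemma renewal_approx:
  assumes rat: "s \<in> \<rat>" "a \<in> \<rat>" "b \<in> \<rat>" and ord: "s < a" "a < b"
    and Z: "hereditary s a b Z" and A: "A \<in> sets (past a)"
  shows "\<bar>prob (A \<inter> hit Z s a b) - (\<Sum>j<2^n. prob (A \<inter> renewal_at s a b n j) *
            prob (hit Z (grid a b n (Suc j)) (grid a b n (Suc j)) b))\<bar> \<le> prob (leader_jump s a b n)"
proof -
  let ?t = "grid a b n" and ?N = "2 ^ n :: nat"
  let ?G = "renewal_at s a b n"
  let ?H = "\<lambda>j. hit Z (?t (Suc j)) (?t (Suc j)) b"
  have tR: "?t j \<in> \<rat>" for j using rat by (simp add: grid_Rats)
  have ta: "a \<le> ?t j" for j using grid_mono[of a b 0 j n] ord by simp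
  have tb: "j \<le> ?N \<Longrightarrow> ?t j \<le> b" for j using grid_bounds[of a b j n] ord by simp
  have tmono: "i \<le> j \<Longrightarrow> ?t i \<le> ?t j" for i j using ord by (simp add: grid_mono)
  have tpos: "a < ?t (Suc j)" for j using grid_strict_mono[of a b 0 "Suc j" n] ord by simp
  have H_fut: "?H j \<in> sets (fut (?t (Suc j)))" for j
  proof (cases "?t (Suc j) < b")
    case True
    then show ?thesis using Z tR tpos unfolding hereditary_def by blast
  next
    case False
    then have "?H j = {}" by (auto simp: hit_def)
    then show ?thesis by simp
  qed
  have G_past: "A \<inter> ?G j \<in> sets (past (?t (Suc j)))" for j
    using A past_mono[OF less_imp_le[OF tpos[of j]]] renewal_at_past[OF rat ord, of n j] by blast
  have ev: "A \<inter> ?G j \<inter> ?H j \<in> events" for j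
    using past_events[OF G_past[of j]] fut_events[OF H_fut[of j]] by auto
  have Aev: "A \<in> events" using A past_events by blast
  have hev: "hit Z s a b \<in> events" using Z by (simp add: hereditary_def)
  have "(\<Sum>j<?N. prob (A \<inter> ?G j) * prob (?H j)) = (\<Sum>j<?N. prob (A \<inter> ?G j \<inter> ?H j))"
    by (simp add: indep_past_fut[OF G_past H_fut])
  also have "\<dots> = prob (\<Union>j<?N. A \<inter> ?G j \<inter> ?H j)"
  proof (rule finite_measure_finite_Union[symmetric])
    show "disjoint_family_on (\<lambda>j. A \<inter> ?G j \<inter> ?H j) {..<?N}"
      using renewal_at_disjoint[OF ord(2), of s n "{..<?N}"] unfolding disjoint_family_on_def by blast
  qed (use ev in auto)
  finally have eq: "(\<Sum>j<?N. prob (A \<inter> ?G j) * prob (?H j)) = prob (\<Union>j<?N. A \<inter> ?G j \<inter> ?H j)" .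
  have "AE \<omega> in P. (\<omega> \<in> A \<inter> hit Z s a b \<longrightarrow> \<omega> \<in> (\<Union>j<?N. A \<inter> ?G j \<inter> ?H j) \<or> \<omega> \<in> leader_jump s a b n) \<and>
      (\<omega> \<in> (\<Union>j<?N. A \<inter> ?G j \<inter> ?H j) \<longrightarrow> \<omega> \<in> A \<inter> hit Z s a b \<or> \<omega> \<in> leader_jump s a b n)"
    using AE_reg
  proof eventually_elim
    case (elim \<omega>)
    note sp = reg_space[OF elim]
    have Z1: "\<tau> s b \<omega> = x" "\<And>t. t \<in> \<rat> \<Longrightarrow> a < t \<Longrightarrow> t < x \<Longrightarrow> x \<in> Z t \<omega>" if "x \<in> Z s \<omega>" "a < x" "x < b" for x
      using Z elim that unfolding hereditary_def by blast+
    have Z2: "x \<in> Z s \<omega> \<or> \<tau> s b \<omega> < t" if "t \<in> \<rat>" "x \<in> Z t \<omega>" "a < t" "t < x" "x < b" for x t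
      using Z elim that unfolding hereditary_def by blast
    show ?case
    proof (intro conjI impI)
      assume *: "\<omega> \<in> A \<inter> hit Z s a b"
      then obtain x where x: "x \<in> Z s \<omega>" "a < x" "x < b" by (auto simp: hit_def)
      have lx: "\<tau> s b \<omega> = x" using Z1(1)[OF x] .
      have "x \<notin> \<rat>" using reg_inside(3)[OF elim rat(1,3)] ord lx by simp
      then obtain i where i: "i < ?N" "?t i < x" "x < ?t (Suc i)"
        using grid_cell[of a b x n] x rat ord by metis
      have "\<tau> s (?t (Suc i)) \<omega> = \<tau> s b \<omega>"
        using elim rat tR lx tb[of "Suc i"] i ord x by (intro reg_nested) auto
      then have lead: "\<tau> s (?t (Suc i)) \<omega> = x" using lx by simp
      \<comment> \<open>The renewal cell: the first one at whose right end the leader from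
        \<open>s\<close> lies beyond \<open>a\<close>. It comes no later than \<open>i\<close>,
        because the cell of \<open>x\<close> has this property.\<close>
      define j where "j = (LEAST j. \<not> \<tau> s (?t (Suc j)) \<omega> < a)"
      have j1: "\<not> \<tau> s (?t (Suc j)) \<omega> < a" unfolding j_def
        by (rule LeastI[of "\<lambda>j. \<not> \<tau> s (?t (Suc j)) \<omega> < a" i]) (use lead x in simp)
      have ji: "j \<le> i" unfolding j_def by (rule Least_le) (use lead x in simp)
      have j2: "\<tau> s (?t (Suc k)) \<omega> < a" if "k < j" for k using not_less_Least[of k "\<lambda>j. \<not> \<tau> s (?t (Suc j)) \<omega> < a"] that by (auto simp: j_def)
      have j3: "\<tau> s (?t k) \<omega> < a" if "k \<le> j" for k
      proof (cases k)
        case 0 then show ?thesis using reg_inside(2)[OF elim rat(1,2) ord(1)] by simp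
      next
        case (Suc l) then show ?thesis using j2[of l] that by simp
      qed
      have "a < \<tau> s (?t (Suc j)) \<omega>"
        using j1 reg_neq[OF elim rat(1) tR[of "Suc j"] _ rat(2)] ord tpos[of j] by fastforce
      \<comment> \<open>Were the new leader to the left of \<open>?t j\<close>, then by nestedness
        it would already have led the window up to \<open>?t j\<close>, against the choice of
        \<open>j\<close>.\<close>
      have "?t j < \<tau> s (?t (Suc j)) \<omega>"
      proof (rule ccontr)
        assume "\<not> ?t j < \<tau> s (?t (Suc j)) \<omega>"
        then have l: "\<tau> s (?t (Suc j)) \<omega> < ?t j"
          using reg_neq[OF elim rat(1) tR[of "Suc j"] _ tR[of j]] ord tpos[of j] by fastforce
        have "\<tau> s (?t j) \<omega> = \<tau> s (?t (Suc j)) \<omega>"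
          using elim rat tR l ord tmono[of j "Suc j"] \<open>a < \<tau> s (?t (Suc j)) \<omega>\<close> by (intro reg_nested) auto
        then show False using j3[of j] \<open>a < \<tau> s (?t (Suc j)) \<omega>\<close> by simp
      qed
      then have G: "\<omega> \<in> ?G j" using sp j3 by (simp add: renewal_at_def)
      show "\<omega> \<in> (\<Union>j<?N. A \<inter> ?G j \<inter> ?H j) \<or> \<omega> \<in> leader_jump s a b n"
      proof (cases "j = i")
        case True
        then have "\<omega> \<in> leader_jump s a b n" using sp i j3[of i] lx by (auto simp: leader_jump_def)
        then show ?thesis ..
      next
        case False
        then have "?t (Suc j) < x" using tmono[of "Suc j" i] ji i by simp
        then have "\<omega> \<in> ?H j" using Z1(2)[OF x tR tpos] x sp unfolding hit_def by blast
        then show ?thesis using G * i ji by auto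
      qed
    next
      assume "\<omega> \<in> (\<Union>j<?N. A \<inter> ?G j \<inter> ?H j)"
      then obtain j where j: "j < ?N" "\<omega> \<in> A" "\<omega> \<in> ?G j" "\<omega> \<in> ?H j" by auto
      then obtain x where x: "x \<in> Z (?t (Suc j)) \<omega>" "?t (Suc j) < x" "x < b" by (auto simp: hit_def)
      from Z2[OF tR x(1) tpos x(2,3)] show "\<omega> \<in> A \<inter> hit Z s a b \<or> \<omega> \<in> leader_jump s a b n"
      proof
        assume "x \<in> Z s \<omega>"
        moreover have "a < x" using x tpos[of j] by simp
        ultimately have "\<omega> \<in> hit Z s a b" using sp x by (auto simp: hit_def)
        then show ?thesis using j by blast
      next
        assume l: "\<tau> s b \<omega> < ?t (Suc j)"
        \<comment> \<open>The earlier leader that prevails over \<open>x\<close> already leads at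
          the right end of the renewal cell, and the definition of \<open>renewal_at\<close> places
          it inside that cell.\<close>
        have "\<tau> s (?t (Suc j)) \<omega> = \<tau> s b \<omega>"
          using elim rat tR l ord tb[of "Suc j"] j reg_inside(1)[OF elim rat(1,3)] by (intro reg_nested) auto
        then show ?thesis using j l sp by (auto simp: leader_jump_def renewal_at_def)
      qed
    qed
  qed
  then have "\<bar>prob (A \<inter> hit Z s a b) - prob (\<Union>j<?N. A \<inter> ?G j \<inter> ?H j)\<bar> \<le> prob (leader_jump s a b n)"
    using Aev hev ev leader_jump_events[OF rat ord] by (intro prob_sym_diff_le) auto
  then show ?thesis unfolding eq .
qed

text \<open>Both families obey the renewal equation with the same weights, so a bound
  \<open>S\<close> on the defect for fresh windows passes to the window of \<open>s\<close>,
  multiplied by the total weight. This weight is at most the probability that the final leader is a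
  new one, and its distance from 1 drives the maximum principle. With \<open>S = 0\<close> a
  proportion that is exact for all fresh windows is carried over to the window of \<open>s\<close>,
  jointly with any event \<open>A\<close> of the past.\<close>

theorem renewal_comparison:
  assumes rat: "s \<in> \<rat>" "a \<in> \<rat>" "b \<in> \<rat>" and ord: "s < a" "a < b"
    and Z: "hereditary s a b Z1" "hereditary s a b Z2" and A: "A \<in> sets (past a)"
    and S: "0 \<le> S" "\<And>t. t \<in> \<rat> \<Longrightarrow> a < t \<Longrightarrow> t < b \<Longrightarrow> \<bar>\<alpha> * prob (hit Z1 t t b) - \<beta> * prob (hit Z2 t t b)\<bar> \<le> S"
  shows "\<bar>\<alpha> * prob (A \<inter> hit Z1 s a b) - \<beta> * prob (A \<inter> hit Z2 s a b)\<bar> \<le> S * prob {\<omega>\<in>space P. a < \<tau> s b \<omega>}"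
proof -
  let ?J = "\<lambda>n. prob (leader_jump s a b n)"
  have bound: "\<bar>\<alpha> * prob (A \<inter> hit Z1 s a b) - \<beta> * prob (A \<inter> hit Z2 s a b)\<bar> \<le>
      S * prob {\<omega>\<in>space P. a < \<tau> s b \<omega>} + (\<bar>\<alpha>\<bar> + \<bar>\<beta>\<bar>) * ?J n" for n
  proof -
    let ?t = "grid a b n" and ?N = "2 ^ n :: nat"
    let ?G = "renewal_at s a b n"
    let ?p = "\<lambda>Z j. prob (hit Z (?t (Suc j)) (?t (Suc j)) b)"
    let ?S = "\<lambda>Z. \<Sum>j<?N. prob (A \<inter> ?G j) * ?p Z j"
    have Aev: "A \<in> events" using A past_events by blast
    have Gev: "?G j \<in> events" for j using renewal_at_past[OF rat ord] past_events by blast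
    have 1: "\<bar>\<alpha> * ?p Z1 j - \<beta> * ?p Z2 j\<bar> \<le> S" if "j < ?N" for j
    proof (cases "?t (Suc j) < b")
      case True
      then show ?thesis using S(2)[of "?t (Suc j)"] grid_strict_mono[of a b 0 "Suc j" n] rat ord by (simp add: grid_Rats)
    next
      case False
      then have "hit Z (?t (Suc j)) (?t (Suc j)) b = {}" for Z by (auto simp: hit_def)
      then show ?thesis using S by simp
    qed
    have "\<bar>\<alpha> * ?S Z1 - \<beta> * ?S Z2\<bar> = \<bar>\<Sum>j<?N. prob (A \<inter> ?G j) * (\<alpha> * ?p Z1 j - \<beta> * ?p Z2 j)\<bar>"
      by (simp add: sum_distrib_left sum_subtractf right_diff_distrib mult.left_commute)
    also have "\<dots> \<le> (\<Sum>j<?N. prob (A \<inter> ?G j) * \<bar>\<alpha> * ?p Z1 j - \<beta> * ?p Z2 j\<bar>)"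
      by (rule order_trans[OF sum_abs]) (simp add: abs_mult)
    also have "\<dots> \<le> (\<Sum>j<?N. prob (?G j) * S)"
      using 1 Gev Aev by (intro sum_mono mult_mono finite_measure_mono) auto
    also have "\<dots> = S * prob (\<Union>j<?N. ?G j)"
      using Gev renewal_at_disjoint[OF ord(2)] by (subst finite_measure_finite_Union) (auto simp: sum_distrib_left mult.commute[of S])
    \<comment> \<open>The renewal events are disjoint, and each of them keeps the final leader from
      \<open>s\<close> beyond \<open>a\<close>, because leaders do not fall back before
      \<open>a\<close>.\<close>
    also have "\<dots> \<le> S * prob {\<omega>\<in>space P. a < \<tau> s b \<omega>}"
    proof (intro mult_left_mono S finite_measure_mono_AE)
      show "AE \<omega> in P. \<omega> \<in> (\<Union>j<?N. ?G j) \<longrightarrow> \<omega> \<in> {\<omega>\<in>space P. a < \<tau> s b \<omega>}"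
        using AE_reg
      proof eventually_elim
        case (elim \<omega>)
        show ?case
        proof
          assume "\<omega> \<in> (\<Union>j<?N. ?G j)"
          then obtain j where j: "j < ?N" "?t j < \<tau> s (?t (Suc j)) \<omega>" by (auto simp: renewal_at_def)
          have tj: "a \<le> ?t j" "a \<le> ?t (Suc j)" "?t (Suc j) \<le> b" using grid_bounds[of a b _ n] j ord by auto
          have "\<not> \<tau> s b \<omega> < a"
          proof
            assume "\<tau> s b \<omega> < a"
            then have "\<tau> s (?t (Suc j)) \<omega> < a" using first_le_mono[OF elim, of s a b "?t (Suc j)"] rat ord tj by (simp add: grid_Rats)
            then show False using j tj by simp
          qed
          then show "\<omega> \<in> {\<omega>\<in>space P. a < \<tau> s b \<omega>}" using reg_neq[OF elim rat(1,3) _ rat(2)] ord reg_space[OF elim] by fastforce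
        qed
      qed
      show "{\<omega>\<in>space P. a < \<tau> s b \<omega>} \<in> events" using \<tau>_meas[OF rat(1,3) order_less_trans[OF ord]] by measurable
    qed
    finally have main: "\<bar>\<alpha> * ?S Z1 - \<beta> * ?S Z2\<bar> \<le> S * prob {\<omega>\<in>space P. a < \<tau> s b \<omega>}" .
    have "\<bar>\<alpha> * (prob (A \<inter> hit Z1 s a b) - ?S Z1)\<bar> \<le> \<bar>\<alpha>\<bar> * ?J n" "\<bar>\<beta> * (prob (A \<inter> hit Z2 s a b) - ?S Z2)\<bar> \<le> \<bar>\<beta>\<bar> * ?J n"
      using renewal_approx[OF rat ord Z(1) A, of n] renewal_approx[OF rat ord Z(2) A, of n]
      by (auto simp: abs_mult intro!: mult_left_mono)
    then show ?thesis using main unfolding right_diff_distrib distrib_right by linarith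
  qed
  have "(\<lambda>n. S * prob {\<omega>\<in>space P. a < \<tau> s b \<omega>} + (\<bar>\<alpha>\<bar> + \<bar>\<beta>\<bar>) * ?J n) \<longlonglongrightarrow> S * prob {\<omega>\<in>space P. a < \<tau> s b \<omega>} + (\<bar>\<alpha>\<bar> + \<bar>\<beta>\<bar>) * 0"
    by (intro tendsto_intros prob_leader_jump_tendsto_0 rat ord)
  then show ?thesis using bound by (intro LIMSEQ_le_const) auto
qed

end

lemma (in prob_space) prob_UN_AE_disjoint:
  assumes "finite I" and ev: "\<And>i. i \<in> I \<Longrightarrow> B i \<in> events"
    and dis: "AE \<omega> in M. \<forall>i\<in>I. \<forall>j\<in>I. \<omega> \<in> B i \<longrightarrow> \<omega> \<in> B j \<longrightarrow> i = j"
  shows "prob (\<Union>i\<in>I. B i) = (\<Sum>i\<in>I. prob (B i))"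
proof -
  obtain N where N: "{\<omega>\<in>space M. \<not> (\<forall>i\<in>I. \<forall>j\<in>I. \<omega> \<in> B i \<longrightarrow> \<omega> \<in> B j \<longrightarrow> i = j)} \<subseteq> N" "N \<in> null_sets M"
    using dis by (auto simp: eventually_ae_filter)
  have Nev: "N \<in> events" using N(2) by auto
  have UN: "(\<Union>i\<in>I. B i) \<in> events" using assms(1) ev by auto
  have AEN: "AE \<omega> in M. \<omega> \<notin> N" using AE_not_in[OF N(2)] .
  have "prob (\<Union>i\<in>I. B i) = prob (\<Union>i\<in>I. B i - N)"
    using UN Nev AEN by (intro finite_measure_eq_AE) (auto elim!: eventually_mono)
  also have "\<dots> = (\<Sum>i\<in>I. prob (B i - N))"
  proof (rule finite_measure_finite_Union[OF assms(1)])
    show "disjoint_family_on (\<lambda>i. B i - N) I"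
      using N(1) ev sets.sets_into_space unfolding disjoint_family_on_def by blast
  qed (use ev Nev in auto)
  also have "\<dots> = (\<Sum>i\<in>I. prob (B i))"
    using ev Nev AEN by (intro sum.cong refl finite_measure_eq_AE) (auto elim!: eventually_mono)
  finally show ?thesis .
qed

lemma (in prob_space) prob_tendsto_AE:
  assumes [measurable]: "\<And>n. E n \<in> events" "T \<in> events"
    and AE: "AE \<omega> in M. eventually (\<lambda>n. \<omega> \<in> E n \<longleftrightarrow> \<omega> \<in> T) sequentially"
  shows "(\<lambda>n. prob (E n)) \<longlonglongrightarrow> prob T"
proof -
  have "(\<lambda>n. \<integral>\<omega>. indicator (E n) \<omega> \<partial>M) \<longlonglongrightarrow> (\<integral>\<omega>. indicator T \<omega> \<partial>M :: real)"
  proof (rule integral_dominated_convergence[where w="\<lambda>_. 1"])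
    show "AE \<omega> in M. (\<lambda>n. indicator (E n) \<omega> :: real) \<longlonglongrightarrow> indicator T \<omega>"
      using AE
    proof eventually_elim
      case (elim \<omega>)
      then have "eventually (\<lambda>n. (indicator (E n) \<omega> :: real) = indicator T \<omega>) sequentially"
        by eventually_elim (auto split: split_indicator)
      then show ?case by (rule tendsto_eventually)
    qed
  qed (auto split: split_indicator)
  then show ?thesis by simp
qed

section \<open>Survivors and the maximum principle\<close>

context honest_index begin

text \<open>A common frame for the competitor and for the trivial colour that every point has, so
  that coloured leaders and all leaders are treated by the same lemmas.\<close>

definition colouring :: "('w \<Rightarrow> real set) \<Rightarrow> bool" where
  "colouring \<kappa> \<longleftrightarrow> (\<forall>s\<in>\<rat>. \<forall>t\<in>\<rat>. s < t \<longrightarrow> {\<omega>\<in>space P. \<tau> s t \<omega> \<in> \<kappa> \<omega>} \<in> sets (fut s)) \<and>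
     (\<forall>h\<in>\<rat>. AE \<omega> in P. \<forall>s\<in>\<rat>. \<forall>t\<in>\<rat>. s < t \<longrightarrow>
        (\<tau> (s + h) (t + h) \<omega> \<in> \<kappa> \<omega> \<longleftrightarrow> \<tau> s t (shift h \<omega>) \<in> \<kappa> (shift h \<omega>)))"

lemma colouring_K: "colouring K"
  unfolding colouring_def
proof (intro conjI ballI impI)
  fix h :: real assume "h \<in> \<rat>"
  from AE_stationary[OF this] show "AE \<omega> in P. \<forall>s\<in>\<rat>. \<forall>t\<in>\<rat>. s < t \<longrightarrow>
        (\<tau> (s + h) (t + h) \<omega> \<in> K \<omega> \<longleftrightarrow> \<tau> s t (shift h \<omega>) \<in> K (shift h \<omega>))"
    by eventually_elim blast
qed (rule K_fut)

lemma space_fut_sets [simp]: "space P \<in> sets (fut s)" and space_past_sets [simp]: "space P \<in> sets (past s)"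
  using sets.top[of "fut s"] sets.top[of "past s"] by simp_all

lemma colouring_UNIV: "colouring (\<lambda>_. UNIV)"
  unfolding colouring_def by auto

text \<open>Points that lead from \<open>s\<close> and stay leaders for more than \<open>r\<close>
  beyond their own location. The end \<open>t\<close> of the witnessing window is left free;
  nevertheless an interval of length at most \<open>r\<close> to the right of \<open>s\<close>
  contains at most one survivor, since it can only be the leader of the window that ends with the
  interval. Survivors may be absent, unlike leaders.\<close>

definition survivors :: "('w \<Rightarrow> real set) \<Rightarrow> real \<Rightarrow> real \<Rightarrow> 'w \<Rightarrow> real set" where
  "survivors \<kappa> r s \<omega> = {x \<in> \<kappa> \<omega>. \<exists>t\<in>\<rat>. s < t \<and> x + r < t \<and> \<tau> s t \<omega> = x}"

lemma hit_survivors_fut: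
  assumes \<kappa>: "colouring \<kappa>" and s: "s \<in> \<rat>"
  shows "hit (survivors \<kappa> r) s a b \<in> sets (fut s)"
proof -
  have "hit (survivors \<kappa> r) s a b = (\<Union>t\<in>{t\<in>\<rat>. s < t}. {\<omega>\<in>space P. \<tau> s t \<omega> \<in> \<kappa> \<omega>} \<inter>
      {\<omega>\<in>space (fut s). \<tau> s t \<omega> + r < t \<and> a < \<tau> s t \<omega> \<and> \<tau> s t \<omega> < b})"
    by (auto simp: hit_def survivors_def)
  also have "\<dots> \<in> sets (fut s)"
  proof -
    have "{\<omega>\<in>space P. \<tau> s t \<omega> \<in> \<kappa> \<omega>} \<inter> {\<omega>\<in>space (fut s). \<tau> s t \<omega> + r < t \<and> a < \<tau> s t \<omega> \<and> \<tau> s t \<omega> < b} \<in> sets (fut s)"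
      if t: "t \<in> \<rat>" "s < t" for t
    proof -
      have "{\<omega>\<in>space P. \<tau> s t \<omega> \<in> \<kappa> \<omega>} \<in> sets (fut s)" using \<kappa> s t unfolding colouring_def by blast
      moreover have "{\<omega>\<in>space (fut s). \<tau> s t \<omega> + r < t \<and> a < \<tau> s t \<omega> \<and> \<tau> s t \<omega> < b} \<in> sets (fut s)"
        using \<tau>_fut[OF s t] by measurable
      ultimately show ?thesis by blast
    qed
    moreover have "countable {t\<in>\<rat>. s < t}" by (rule countable_subset[OF _ countable_rat]) auto
    ultimately show ?thesis by (intro sets.countable_UN') auto
  qed
  finally show ?thesis .
qed

lemma hit_survivors_events:
  "colouring \<kappa> \<Longrightarrow> s \<in> \<rat> \<Longrightarrow> hit (survivors \<kappa> r) s a b \<in> events"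
  using hit_survivors_fut fut_events by blast

lemma survivors_leader:
  assumes "reg \<omega>" "x \<in> survivors \<kappa> r s \<omega>" "s \<in> \<rat>" "b \<in> \<rat>" "x < b" "b \<le> x + r"
  shows "\<tau> s b \<omega> = x"
proof -
  obtain t where t: "t \<in> \<rat>" "s < t" "x + r < t" "\<tau> s t \<omega> = x" using assms(2) by (auto simp: survivors_def)
  then have "s < x" using reg_inside(1)[OF assms(1,3) t(1,2)] by simp
  then have "\<tau> s b \<omega> = \<tau> s t \<omega>" using assms t by (intro reg_nested) auto
  then show ?thesis using t by simp
qed

lemma survivors_restrict:
  assumes "reg \<omega>" "x \<in> survivors \<kappa> r s \<omega>" "s \<in> \<rat>" "t \<in> \<rat>" "s \<le> t" "t < x" "0 \<le> r"
  shows "x \<in> survivors \<kappa> r t \<omega>"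
proof -
  obtain u where u: "u \<in> \<rat>" "s < u" "x + r < u" "\<tau> s u \<omega> = x" "x \<in> \<kappa> \<omega>" using assms(2) by (auto simp: survivors_def)
  then have "\<tau> t u \<omega> = \<tau> s u \<omega>" using assms by (intro reg_nested) auto
  then show ?thesis using u assms by (auto simp: survivors_def intro!: bexI[of _ u])
qed

text \<open>Since \<open>b \<le> a + r\<close>, a survivor beyond \<open>a\<close> keeps the lead
  past \<open>b\<close> and is thus the leader from \<open>s\<close> to \<open>b\<close>. A survivor
  from a later start \<open>t\<close> is lost from \<open>s\<close> only if the leader of the longer
  window lies before \<open>t\<close>, and then nestedness makes that point the leader up to
  \<open>b\<close> as well.\<close>

lemma hereditary_survivors:
  assumes \<kappa>: "colouring \<kappa>" and rat: "s \<in> \<rat>" "a \<in> \<rat>" "b \<in> \<rat>" and ord: "s < a" "a < b" "b \<le> a + r"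
  shows "hereditary s a b (survivors \<kappa> r)"
  unfolding hereditary_def
proof (intro conjI allI impI ballI)
  have r: "0 \<le> r" using ord by simp
  show "hit (survivors \<kappa> r) s a b \<in> events" using \<kappa> rat by (intro hit_survivors_events)
  show "hit (survivors \<kappa> r) t t b \<in> sets (fut t)" if "t \<in> \<rat>" for t using \<kappa> that by (intro hit_survivors_fut)
  fix \<omega> assume reg: "reg \<omega>"
  { fix x assume x: "x \<in> survivors \<kappa> r s \<omega>" "a < x \<and> x < b"
    show "\<tau> s b \<omega> = x" using survivors_leader[OF reg x(1)] rat x ord by simp
    fix t assume "t \<in> \<rat>" "a < t \<and> t < x"
    then show "x \<in> survivors \<kappa> r t \<omega>" using survivors_restrict[OF reg x(1), of t] rat ord r by simp }
  fix t x assume t: "t \<in> \<rat>" "x \<in> survivors \<kappa> r t \<omega>" "a < t \<and> t < x \<and> x < b"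
  then obtain u where u: "u \<in> \<rat>" "t < u" "x + r < u" "\<tau> t u \<omega> = x" "x \<in> \<kappa> \<omega>" by (auto simp: survivors_def)
  have su: "s < u" using t u ord by simp
  show "x \<in> survivors \<kappa> r s \<omega> \<or> \<tau> s b \<omega> < t"
  proof (cases "t < \<tau> s u \<omega>")
    case True
    then have "\<tau> t u \<omega> = \<tau> s u \<omega>" using reg rat t u ord reg_inside(2)[OF reg rat(1) u(1) su] by (intro reg_nested) auto
    then show ?thesis using u su by (auto simp: survivors_def)
  next
    case False
    then have l: "\<tau> s u \<omega> < t" using reg_neq[OF reg rat(1) u(1) su t(1)] by simp
    have "\<tau> s b \<omega> = \<tau> s u \<omega>" using reg rat t u ord l reg_inside(1)[OF reg rat(1) u(1) su] by (intro reg_nested) auto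
    then show ?thesis using l by simp
  qed
qed

lemma prob_hit_survivors_shift:
  assumes \<kappa>: "colouring \<kappa>" and t: "t \<in> \<rat>"
  shows "prob (hit (survivors \<kappa> r) t t b) = prob (hit (survivors \<kappa> r) 0 0 (b - t))"
proof -
  let ?H = "hit (survivors \<kappa> r) 0 0 (b - t)"
  have ev: "?H \<in> events" "hit (survivors \<kappa> r) t t b \<in> events" using \<kappa> t by (auto intro!: hit_survivors_events)
  have "prob (hit (survivors \<kappa> r) t t b) = prob (shift t -` ?H \<inter> space P)"
  proof (rule finite_measure_eq_AE)
    have 1: "AE \<omega> in P. \<forall>s\<in>\<rat>. \<forall>u\<in>\<rat>. s < u \<longrightarrow>
        (\<tau> (s + t) (u + t) \<omega> \<in> \<kappa> \<omega> \<longleftrightarrow> \<tau> s u (shift t \<omega>) \<in> \<kappa> (shift t \<omega>))"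
      using \<kappa> t unfolding colouring_def by blast
    show "AE \<omega> in P. (\<omega> \<in> hit (survivors \<kappa> r) t t b) = (\<omega> \<in> shift t -` ?H \<inter> space P)"
      using 1 AE_stationary[OF t] AE_space
    proof eventually_elim
      case (elim \<omega>)
      have k: "\<tau> t u \<omega> \<in> \<kappa> \<omega> \<longleftrightarrow> \<tau> 0 (u - t) (shift t \<omega>) \<in> \<kappa> (shift t \<omega>)" if "u \<in> \<rat>" "t < u" for u
        using elim(1)[rule_format, of 0 "u - t"] that t by simp
      have e: "\<tau> t u \<omega> = t + \<tau> 0 (u - t) (shift t \<omega>)" if "u \<in> \<rat>" "t < u" for u
        using elim(2)[rule_format, of 0 "u - t"] that t by simp
      show ?case
      proof
        assume "\<omega> \<in> hit (survivors \<kappa> r) t t b"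
        then obtain x u where x: "t < x" "x < b" "x \<in> \<kappa> \<omega>" "u \<in> \<rat>" "t < u" "x + r < u" "\<tau> t u \<omega> = x"
          by (auto simp: hit_def survivors_def)
        have "x - t \<in> survivors \<kappa> r 0 (shift t \<omega>)"
          unfolding survivors_def using x k[of u] e[of u] t by (auto intro!: bexI[of _ "u - t"])
        then show "\<omega> \<in> shift t -` ?H \<inter> space P"
          using x elim(3) shift_space[OF elim(3)] by (auto simp: hit_def intro!: bexI[of _ "x - t"])
      next
        assume "\<omega> \<in> shift t -` ?H \<inter> space P"
        then obtain y v where y: "0 < y" "y < b - t" "y \<in> \<kappa> (shift t \<omega>)" "v \<in> \<rat>" "0 < v" "y + r < v" "\<tau> 0 v (shift t \<omega>) = y"
          by (auto simp: hit_def survivors_def)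
        have "t + y \<in> survivors \<kappa> r t \<omega>"
          unfolding survivors_def using y k[of "v + t"] e[of "v + t"] t by (auto intro!: bexI[of _ "v + t"])
        then show "\<omega> \<in> hit (survivors \<kappa> r) t t b"
          using y elim(3) by (auto simp: hit_def intro!: bexI[of _ "t + y"])
      qed
    qed
  qed (use ev shift_events in auto)
  then show ?thesis using prob_shift[OF ev(1)] by simp
qed

abbreviation "all_points \<equiv> (\<lambda>_ :: 'w. UNIV :: real set)"

lemma survivors_mono: "survivors \<kappa> r s \<omega> \<subseteq> survivors all_points r s \<omega>"
  by (auto simp: survivors_def)

lemma prob_hit_survivors_mono:
  assumes "colouring \<kappa>" "s \<in> \<rat>" "b \<le> b'"
  shows "prob (hit (survivors \<kappa> r) s a b) \<le> prob (hit (survivors all_points r) s a b')"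
  using assms colouring_UNIV survivors_mono
  by (intro finite_measure_mono hit_survivors_events) (fastforce simp: hit_def)+

text \<open>Any survivor before \<open>r\<close> equals \<open>\<tau> 0 r\<close>, so there cannot
  be one on each side of \<open>a\<close>; and \<open>a\<close> itself, being rational, is not
  hit.\<close>

lemma prob_hit_survivors_split:
  assumes \<kappa>: "colouring \<kappa>" and rat: "r \<in> \<rat>" "a \<in> \<rat>" and ord: "0 < a" "a < r"
  shows "prob (hit (survivors \<kappa> r) 0 0 r) = prob (hit (survivors \<kappa> r) 0 0 a) + prob (hit (survivors \<kappa> r) 0 a r)"
proof -
  let ?B = "\<lambda>i::bool. if i then hit (survivors \<kappa> r) 0 0 a else hit (survivors \<kappa> r) 0 a r"
  have "prob (hit (survivors \<kappa> r) 0 0 r) = prob (\<Union>i\<in>UNIV. ?B i)"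
  proof (rule finite_measure_eq_AE)
    show "AE \<omega> in P. (\<omega> \<in> hit (survivors \<kappa> r) 0 0 r) = (\<omega> \<in> (\<Union>i\<in>UNIV. ?B i))"
      using AE_reg
    proof eventually_elim
      case (elim \<omega>)
      have "x \<noteq> a" if x: "x \<in> survivors \<kappa> r 0 \<omega>" for x
      proof -
        obtain t where t: "t \<in> \<rat>" "0 < t" "\<tau> 0 t \<omega> = x" using x by (auto simp: survivors_def)
        have "\<tau> 0 t \<omega> \<noteq> a" by (rule reg_neq[OF elim _ t(1,2) rat(2)]) simp
        then show ?thesis using t by simp
      qed
      then show ?case using ord unfolding UNIV_bool hit_def by (auto, (metis linorder_neqE_linordered_idom order_less_trans)+)
    qed
  qed (use \<kappa> in \<open>auto intro!: hit_survivors_events\<close>)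
  also have "\<dots> = (\<Sum>i\<in>UNIV. prob (?B i))"
  proof (rule prob_UN_AE_disjoint)
    show "AE \<omega> in P. \<forall>i\<in>UNIV. \<forall>j\<in>UNIV. \<omega> \<in> ?B i \<longrightarrow> \<omega> \<in> ?B j \<longrightarrow> i = j"
      using AE_reg
    proof eventually_elim
      case (elim \<omega>)
      have "\<not> (\<omega> \<in> hit (survivors \<kappa> r) 0 0 a \<and> \<omega> \<in> hit (survivors \<kappa> r) 0 a r)"
      proof
        assume *: "\<omega> \<in> hit (survivors \<kappa> r) 0 0 a \<and> \<omega> \<in> hit (survivors \<kappa> r) 0 a r"
        then obtain x y where x: "x \<in> survivors \<kappa> r 0 \<omega>" "0 < x" "x < a" and y: "y \<in> survivors \<kappa> r 0 \<omega>" "a < y" "y < r"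
          by (auto simp: hit_def)
        have "\<tau> 0 r \<omega> = x" by (rule survivors_leader[OF elim x(1) _ rat(1)]) (use x ord in auto)
        moreover have "\<tau> 0 r \<omega> = y" by (rule survivors_leader[OF elim y(1) _ rat(1)]) (use y ord in auto)
        ultimately show False using x y by simp
      qed
      then show ?case by auto
    qed
  qed (use \<kappa> in \<open>auto intro!: hit_survivors_events\<close>)
  finally show ?thesis by (simp add: UNIV_bool add.commute)
qed

text \<open>A discrete maximum principle: the defect of proportionality satisfies the same renewal equation
  as the two functions and vanishes at both ends of the interval.\<close>

lemma survivors_proportional:
  assumes r: "r \<in> \<rat>" "0 < r"
  shows "\<exists>m. \<forall>d\<in>\<rat>. 0 < d \<longrightarrow> d \<le> r \<longrightarrow>
     prob (hit (survivors K r) 0 0 d) = m * prob (hit (survivors all_points r) 0 0 d)"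
proof -
  let ?U = "\<lambda>\<kappa> d. prob (hit (survivors \<kappa> r) 0 0 d)"
  \<comment> \<open>The proportion is cross-multiplied, so that the argument needs no division by a
    probability that might be 0.\<close>
  let ?D = "\<lambda>a. ?U all_points r * ?U K a - ?U K r * ?U all_points a"
  let ?X = "{a\<in>\<rat>. 0 < a \<and> a < r}"
  define S where "S = (SUP a\<in>?X. \<bar>?D a\<bar>)"
  have UK_le: "?U K d \<le> ?U all_points d" for d using colouring_K by (intro prob_hit_survivors_mono) auto
  have D_le: "\<bar>?D a\<bar> \<le> ?U all_points a" for a
  proof -
    have "?U all_points r * ?U K a \<le> ?U K a" "?U K r * ?U all_points a \<le> ?U all_points a"
      by (intro mult_left_le_one_le measure_nonneg prob_le_1)+
    moreover have "0 \<le> ?U all_points r * ?U K a" "0 \<le> ?U K r * ?U all_points a" by auto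
    ultimately show ?thesis using UK_le[of a] by linarith
  qed
  have bdd: "bdd_above ((\<lambda>a. \<bar>?D a\<bar>) ` ?X)"
  proof (rule bdd_aboveI2)
    fix a show "\<bar>?D a\<bar> \<le> 1" using D_le[of a] prob_le_1[of "hit (survivors all_points r) 0 0 a"] by linarith
  qed
  have ne: "?X \<noteq> {}" using r by (auto intro!: exI[of _ "r / 2"])
  have le_S: "\<bar>?D a\<bar> \<le> S" if "a \<in> ?X" for a unfolding S_def by (rule cSUP_upper[OF that bdd])
  obtain a0 where "a0 \<in> ?X" using ne by blast
  from le_S[OF this] have S0: "0 \<le> S" by linarith
  have key: "\<bar>?D a\<bar> \<le> S / (1 + S)" if a: "a \<in> ?X" for a
  proof -
    have ar: "a \<in> \<rat>" "0 < a" "a < r" using a by auto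
    have "\<bar>?U all_points r * prob (space P \<inter> hit (survivors K r) 0 a r) - ?U K r * prob (space P \<inter> hit (survivors all_points r) 0 a r)\<bar>
        \<le> S * prob {\<omega>\<in>space P. a < \<tau> 0 r \<omega>}"
    proof (rule renewal_comparison)
      show "hereditary 0 a r (survivors K r)" "hereditary 0 a r (survivors all_points r)"
        using ar r colouring_K colouring_UNIV by (auto intro!: hereditary_survivors)
      fix t assume t: "t \<in> \<rat>" "a < t" "t < r"
      then have "r - t \<in> ?X" using ar r by auto
      from le_S[OF this] show "\<bar>?U all_points r * prob (hit (survivors K r) t t r) - ?U K r * prob (hit (survivors all_points r) t t r)\<bar> \<le> S"
        unfolding prob_hit_survivors_shift[OF colouring_K t(1)] prob_hit_survivors_shift[OF colouring_UNIV t(1)] .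
    qed (use ar r S0 in auto)
    moreover have "space P \<inter> hit Z s x y = hit Z s x y" for Z s x y by (auto simp: hit_def)
    moreover have "prob (hit (survivors K r) 0 a r) = ?U K r - ?U K a" "prob (hit (survivors all_points r) 0 a r) = ?U all_points r - ?U all_points a"
      using prob_hit_survivors_split[OF colouring_K r(1) ar] prob_hit_survivors_split[OF colouring_UNIV r(1) ar] by auto
    \<comment> \<open>After both hit probabilities are split at \<open>a\<close>, the contributions
      of the whole interval cancel and the defect at \<open>a\<close> remains.\<close>
    ultimately have 1: "\<bar>?D a\<bar> \<le> S * prob {\<omega>\<in>space P. a < \<tau> 0 r \<omega>}"
      by (simp add: algebra_simps abs_minus_commute)
    have \<tau>r: "\<tau> 0 r \<in> borel_measurable P" using r by (intro \<tau>_meas) auto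
    \<comment> \<open>A survivor before \<open>a\<close> is the leader up to \<open>r\<close> and
      excludes a leader beyond \<open>a\<close>. Hence the weight is at most
      \<open>1 - \<bar>?D a\<bar>\<close>: a large defect at \<open>a\<close> strictly sharpens the
      bound on itself.\<close>
    have "prob {\<omega>\<in>space P. a < \<tau> 0 r \<omega>} \<le> prob (space P - hit (survivors all_points r) 0 0 a)"
    proof (rule finite_measure_mono_AE)
      show "AE \<omega> in P. \<omega> \<in> {\<omega>\<in>space P. a < \<tau> 0 r \<omega>} \<longrightarrow> \<omega> \<in> space P - hit (survivors all_points r) 0 0 a"
        using AE_reg
      proof eventually_elim
        case (elim \<omega>)
        have "\<tau> 0 r \<omega> < a" if x: "x \<in> survivors all_points r 0 \<omega>" "0 < x" "x < a" for x
          using survivors_leader[OF elim x(1)] x ar r by auto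
        then show ?case by (fastforce simp: hit_def)
      qed
    qed (use colouring_UNIV in \<open>auto intro!: hit_survivors_events\<close>)
    also have "\<dots> = 1 - ?U all_points a" using colouring_UNIV by (intro prob_compl hit_survivors_events) auto
    also have "\<dots> \<le> 1 - \<bar>?D a\<bar>" using D_le[of a] by simp
    finally have "\<bar>?D a\<bar> \<le> S * (1 - \<bar>?D a\<bar>)" using 1 mult_left_mono[OF _ S0] by (rule_tac order_trans[OF 1]) blast
    then have "\<bar>?D a\<bar> * (1 + S) \<le> S" by (simp add: algebra_simps)
    then show ?thesis using S0 by (simp add: field_simps)
  qed
  \<comment> \<open>The bound is uniform in \<open>a\<close>, so it passes to the supremum, and the
    resulting inequality leaves only \<open>S = 0\<close>.\<close>
  have "S \<le> S / (1 + S)" unfolding S_def[symmetric] by (subst S_def, rule cSUP_least[OF ne key])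
  then have "S * (1 + S) \<le> S" using S0 by (simp add: field_simps)
  then have "S * S \<le> 0" by (simp add: algebra_simps)
  then have "S = 0" using S0 by (simp add: mult_le_0_iff)
  then have D0: "?D a = 0" if "a \<in> ?X" for a using le_S[OF that] by simp
  show ?thesis
  proof (intro exI ballI impI)
    fix d :: real assume d: "d \<in> \<rat>" "0 < d" "d \<le> r"
    \<comment> \<open>If survivors up to \<open>r\<close> have probability 0, the quotient is 0 by
      the convention for division, and both sides vanish.\<close>
    show "?U K d = ?U K r / ?U all_points r * ?U all_points d"
    proof (cases "?U all_points r = 0")
      case True
      then have "?U all_points d \<le> 0" using prob_hit_survivors_mono[OF colouring_UNIV _ d(3), of 0 r 0] by simp
      then have "?U K d \<le> 0" using UK_le[of d] by linarith
      then have "?U K d = 0" using measure_nonneg[of P] by (meson order_antisym)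
      then show ?thesis using True by simp
    next
      case False
      show ?thesis
      proof (cases "d = r")
        case True then show ?thesis using False by simp
      next
        case False': False
        then have "?D d = 0" using d by (intro D0) auto
        then show ?thesis using False by (simp add: field_simps)
      qed
    qed
  qed
qed

text \<open>Stationarity yields the ratio when hits are counted from the start of the window;
  \<open>renewal_comparison\<close> with \<open>S = 0\<close> then allows a start \<open>s\<close>
  further to the left.\<close>

lemma survivors_ratio:
  assumes r: "r \<in> \<rat>" "0 < r"
  shows "\<exists>m. \<forall>s\<in>\<rat>. \<forall>a\<in>\<rat>. \<forall>b\<in>\<rat>. s \<le> a \<longrightarrow> a < b \<longrightarrow> b \<le> a + r \<longrightarrow>
     prob (hit (survivors K r) s a b) = m * prob (hit (survivors all_points r) s a b)"
proof -
  obtain m where m: "\<And>d. d \<in> \<rat> \<Longrightarrow> 0 < d \<Longrightarrow> d \<le> r \<Longrightarrow>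
     prob (hit (survivors K r) 0 0 d) = m * prob (hit (survivors all_points r) 0 0 d)"
    using survivors_proportional[OF r] by blast
  have eq: "prob (hit (survivors K r) t t b) = m * prob (hit (survivors all_points r) t t b)"
    if "t \<in> \<rat>" "b \<in> \<rat>" "t < b" "b \<le> t + r" for t b
    unfolding prob_hit_survivors_shift[OF colouring_K that(1)] prob_hit_survivors_shift[OF colouring_UNIV that(1)]
    using that by (intro m) auto
  have "prob (hit (survivors K r) s a b) = m * prob (hit (survivors all_points r) s a b)"
    if rat: "s \<in> \<rat>" "a \<in> \<rat>" "b \<in> \<rat>" and ord: "s \<le> a" "a < b" "b \<le> a + r" for s a b
  proof (cases "s = a")
    case True then show ?thesis using eq rat ord by simp
  next
    case False
    then have sa: "s < a" using ord by simp
    have "\<bar>1 * prob (space P \<inter> hit (survivors K r) s a b) - m * prob (space P \<inter> hit (survivors all_points r) s a b)\<bar>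
        \<le> 0 * prob {\<omega>\<in>space P. a < \<tau> s b \<omega>}"
    proof (rule renewal_comparison)
      show "hereditary s a b (survivors K r)" "hereditary s a b (survivors all_points r)"
        using rat ord sa colouring_K colouring_UNIV by (auto intro!: hereditary_survivors)
    qed (use rat ord sa eq in auto)
    moreover have "space P \<inter> hit Z s x y = hit Z s x y" for Z s x y by (auto simp: hit_def)
    ultimately show ?thesis by simp
  qed
  then show ?thesis by blast
qed

section \<open>Points isolated on both sides and the universal ratio\<close>

lemma prob_hit_grid:
  assumes \<kappa>: "colouring \<kappa>" and rat: "a \<in> \<rat>" "b \<in> \<rat>" "a < b" and s: "\<And>j. s j \<in> \<rat>"
    and uniq: "\<And>\<omega> i j x y. reg \<omega> \<Longrightarrow> i < j \<Longrightarrow> j < 2 ^ n \<Longrightarrow> x \<in> survivors all_points (r i) (s i) \<omega> \<Longrightarrow>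
       y \<in> survivors all_points (r j) (s j) \<omega> \<Longrightarrow> grid a b n i < x \<Longrightarrow> x < grid a b n (Suc i) \<Longrightarrow>
       grid a b n j < y \<Longrightarrow> y < grid a b n (Suc j) \<Longrightarrow> False"
  shows "prob (\<Union>j<2^n. hit (survivors \<kappa> (r j)) (s j) (grid a b n j) (grid a b n (Suc j))) =
     (\<Sum>j<2^n. prob (hit (survivors \<kappa> (r j)) (s j) (grid a b n j) (grid a b n (Suc j))))"
proof (rule prob_UN_AE_disjoint)
  show "AE \<omega> in P. \<forall>i\<in>{..<2^n}. \<forall>j\<in>{..<2^n}. \<omega> \<in> hit (survivors \<kappa> (r i)) (s i) (grid a b n i) (grid a b n (Suc i)) \<longrightarrow>
      \<omega> \<in> hit (survivors \<kappa> (r j)) (s j) (grid a b n j) (grid a b n (Suc j)) \<longrightarrow> i = j"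
    using AE_reg
  proof eventually_elim
    case (elim \<omega>)
    have *: False if ij: "i < j" "j < 2 ^ n" and h: "\<omega> \<in> hit (survivors \<kappa> (r i)) (s i) (grid a b n i) (grid a b n (Suc i))"
       "\<omega> \<in> hit (survivors \<kappa> (r j)) (s j) (grid a b n j) (grid a b n (Suc j))" for i j
    proof -
      obtain x y where "x \<in> survivors \<kappa> (r i) (s i) \<omega>" "grid a b n i < x" "x < grid a b n (Suc i)"
        "y \<in> survivors \<kappa> (r j) (s j) \<omega>" "grid a b n j < y" "y < grid a b n (Suc j)"
        using h by (auto simp: hit_def)
      then show False using uniq[OF elim ij] survivors_mono by blast
    qed
    show ?case
    proof (intro ballI impI)
      fix i j assume "i \<in> {..<(2::nat)^n}" "j \<in> {..<(2::nat)^n}"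
        "\<omega> \<in> hit (survivors \<kappa> (r i)) (s i) (grid a b n i) (grid a b n (Suc i))"
        "\<omega> \<in> hit (survivors \<kappa> (r j)) (s j) (grid a b n j) (grid a b n (Suc j))"
      then show "i = j" using *[of i j] *[of j i] by (cases i j rule: linorder_cases) auto
    qed
  qed
qed (use \<kappa> s hit_survivors_events in auto)

text \<open>Survivors refer to a prescribed start \<open>s\<close> of the window. Here both margins
  are attached to the point itself, so that time reversal merely exchanges \<open>l\<close> and
  \<open>r\<close>; this symmetry makes forward and backward ratios comparable.\<close>

definition isolated_hit :: "('w \<Rightarrow> real set) \<Rightarrow> real \<Rightarrow> real \<Rightarrow> real \<Rightarrow> real \<Rightarrow> 'w set" where
  "isolated_hit \<kappa> l r a b = {\<omega>\<in>space P. \<exists>x\<in>\<kappa> \<omega>. a < x \<and> x < b \<and>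
     (\<exists>s\<in>\<rat>. \<exists>t\<in>\<rat>. s < x - l \<and> x + r < t \<and> \<tau> s t \<omega> = x)}"

lemma isolated_hitI:
  "\<omega> \<in> space P \<Longrightarrow> x \<in> \<kappa> \<omega> \<Longrightarrow> a < x \<Longrightarrow> x < b \<Longrightarrow> s \<in> \<rat> \<Longrightarrow> t \<in> \<rat> \<Longrightarrow> s < x - l \<Longrightarrow> x + r < t \<Longrightarrow> \<tau> s t \<omega> = x \<Longrightarrow>
    \<omega> \<in> isolated_hit \<kappa> l r a b"
  by (simp add: isolated_hit_def) blast

lemma isolated_hit_events:
  assumes \<kappa>: "colouring \<kappa>" and r: "0 < l" "0 < r" shows "isolated_hit \<kappa> l r a b \<in> events"
proof -
  have "isolated_hit \<kappa> l r a b = (\<Union>(s,t)\<in>{(s,t). s \<in> \<rat> \<and> t \<in> \<rat> \<and> s < t}. {\<omega>\<in>space P. \<tau> s t \<omega> \<in> \<kappa> \<omega>} \<inter>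
     {\<omega>\<in>space P. a < \<tau> s t \<omega> \<and> \<tau> s t \<omega> < b \<and> s < \<tau> s t \<omega> - l \<and> \<tau> s t \<omega> + r < t})"
    using r by (auto simp: isolated_hit_def)
  also have "\<dots> \<in> events"
  proof -
    have "{\<omega>\<in>space P. \<tau> s t \<omega> \<in> \<kappa> \<omega>} \<inter> {\<omega>\<in>space P. a < \<tau> s t \<omega> \<and> \<tau> s t \<omega> < b \<and> s < \<tau> s t \<omega> - l \<and> \<tau> s t \<omega> + r < t} \<in> events"
      if t: "s \<in> \<rat>" "t \<in> \<rat>" "s < t" for s t
    proof -
      have "{\<omega>\<in>space P. \<tau> s t \<omega> \<in> \<kappa> \<omega>} \<in> events" using \<kappa> t fut_events unfolding colouring_def by blast
      moreover have "{\<omega>\<in>space P. a < \<tau> s t \<omega> \<and> \<tau> s t \<omega> < b \<and> s < \<tau> s t \<omega> - l \<and> \<tau> s t \<omega> + r < t} \<in> events"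
        using \<tau>_meas[OF t] by measurable
      ultimately show ?thesis by blast
    qed
    moreover have "countable {(s,t). s \<in> \<rat> \<and> t \<in> \<rat> \<and> s < (t::real)}"
      by (rule countable_subset[of _ "\<rat> \<times> \<rat>"]) (auto intro: countable_rat)
    ultimately show ?thesis by (intro sets.countable_UN') auto
  qed
  finally show ?thesis .
qed

text \<open>Isolated hits are limits of hits by survivors whose window starts at distance
  \<open>l\<close> to the left of their cell. The ratio \<open>m\<close> is the same for every
  start, so it does not depend on \<open>l\<close>.\<close>

lemma isolated_hit_ratio:
  assumes m: "\<And>s a b. s \<in> \<rat> \<Longrightarrow> a \<in> \<rat> \<Longrightarrow> b \<in> \<rat> \<Longrightarrow> s \<le> a \<Longrightarrow> a < b \<Longrightarrow> b \<le> a + r \<Longrightarrow>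
     prob (hit (survivors K r) s a b) = m * prob (hit (survivors all_points r) s a b)"
    and rat: "l \<in> \<rat>" "r \<in> \<rat>" "a \<in> \<rat>" "b \<in> \<rat>" and ord: "0 < l" "0 < r" "a < b" "b \<le> a + l" "b \<le> a + r"
  shows "prob (isolated_hit K l r a b) = m * prob (isolated_hit all_points l r a b)"
proof -
  define E where "E \<kappa> n = (\<Union>j<2^n. hit (survivors \<kappa> r) (grid a b n j - l) (grid a b n j) (grid a b n (Suc j)))" for \<kappa> n
  have tR: "grid a b n j \<in> \<rat>" for n j using rat by (simp add: grid_Rats)
  have ev: "E \<kappa> n \<in> events" if "colouring \<kappa>" for \<kappa> n
    unfolding E_def using that tR rat by (intro sets.finite_UN hit_survivors_events) auto
  have lim: "(\<lambda>n. prob (E \<kappa> n)) \<longlonglongrightarrow> prob (isolated_hit \<kappa> l r a b)" if \<kappa>: "colouring \<kappa>" for \<kappa>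
  proof (rule prob_tendsto_AE)
    show "AE \<omega> in P. \<forall>\<^sub>F n in sequentially. (\<omega> \<in> E \<kappa> n) = (\<omega> \<in> isolated_hit \<kappa> l r a b)"
      using AE_reg
    proof eventually_elim
      case (elim \<omega>)
      note sp = reg_space[OF elim]
      have sub: "\<omega> \<in> isolated_hit \<kappa> l r a b" if "\<omega> \<in> E \<kappa> n" for n
      proof -
        obtain j x t where j: "j < 2 ^ n" "x \<in> \<kappa> \<omega>" "t \<in> \<rat>" "x + r < t" "\<tau> (grid a b n j - l) t \<omega> = x"
          "grid a b n j < x" "x < grid a b n (Suc j)"
          using \<open>\<omega> \<in> E \<kappa> n\<close> by (auto simp: E_def hit_def survivors_def)
        moreover have "a \<le> grid a b n j" "grid a b n (Suc j) \<le> b"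
          using grid_bounds[of a b j n] grid_bounds[of a b "Suc j" n] j(1) ord by auto
        ultimately show ?thesis using sp tR[of n j] rat
          by (intro isolated_hitI[of \<omega> x \<kappa> a b "grid a b n j - l" t]) auto
      qed
      show ?case
      proof (cases "\<omega> \<in> isolated_hit \<kappa> l r a b")
        case False
        then have "\<omega> \<notin> E \<kappa> n" for n using sub by blast
        then show ?thesis using False by (intro always_eventually) auto
      next
        case True
        then obtain x s t where x: "x \<in> \<kappa> \<omega>" "a < x" "x < b" "s \<in> \<rat>" "t \<in> \<rat>" "s < x - l" "x + r < t" "\<tau> s t \<omega> = x"
          by (auto simp: isolated_hit_def)
        have "s < t" using x ord by simp
        then have xR: "x \<notin> \<rat>" using reg_inside(3)[OF elim x(4,5)] x by simp
        have "eventually (\<lambda>n. (b - a) / 2 ^ n < x - l - s) sequentially"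
          using grid_width_tendsto_0 x by (intro order_tendstoD(2)) auto
        then show ?thesis
        proof eventually_elim
          case n: (elim n)
          obtain j where j: "j < 2 ^ n" "grid a b n j < x" "x < grid a b n (Suc j)"
            using grid_cell[of a b x n] x xR rat ord by metis
          \<comment> \<open>On fine grids the start attached to the cell of \<open>x\<close> lies to
            the right of \<open>s\<close>, so by nestedness \<open>x\<close> leads from there as
            well.\<close>
          have "s < grid a b n j - l" using n j(3) grid_Suc[of a b n j] by simp
          then have "\<tau> (grid a b n j - l) t \<omega> = \<tau> s t \<omega>"
            using elim x j ord tR[of n j] rat by (intro reg_nested) auto
          then have "x \<in> survivors \<kappa> r (grid a b n j - l) \<omega>"
            using x j ord by (auto simp: survivors_def intro!: bexI[of _ t])
          then have "\<omega> \<in> E \<kappa> n" using j sp unfolding E_def hit_def by auto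
          then show ?case using True by simp
        qed
      qed
    qed
  qed (use \<kappa> ord ev isolated_hit_events in auto)
  have sum: "prob (E \<kappa> n) = (\<Sum>j<2^n. prob (hit (survivors \<kappa> r) (grid a b n j - l) (grid a b n j) (grid a b n (Suc j))))"
    if "colouring \<kappa>" for \<kappa> n
    unfolding E_def
  proof (rule prob_hit_grid[OF that rat(3,4) ord(3)])
    fix \<omega> i j x y
    let ?t = "grid a b n"
    assume reg: "reg \<omega>" and ij: "i < j" "j < 2 ^ n" and x: "x \<in> survivors all_points r (?t i - l) \<omega>" "?t i < x" "x < ?t (Suc i)"
      and y: "y \<in> survivors all_points r (?t j - l) \<omega>" "?t j < y" "y < ?t (Suc j)"
    have b: "a \<le> ?t i" "?t (Suc i) \<le> ?t j" "?t (Suc j) \<le> b"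
      using grid_bounds[of a b i n] grid_bounds[of a b "Suc j" n] grid_mono[of a b "Suc i" j n] ij ord by auto
    \<comment> \<open>As \<open>b \<le> a + l\<close>, the later start \<open>?t j - l\<close> is
      still to the left of \<open>x\<close>. Both points survive from this common start, so both are
      the leader up to \<open>?t (Suc j)\<close> and coincide.\<close>
    have "x \<in> survivors all_points r (?t j - l) \<omega>"
      using survivors_restrict[OF reg x(1), of "?t j - l"] x y b tR rat ord grid_mono[of a b i j n] ij by auto
    then have "\<tau> (?t j - l) (?t (Suc j)) \<omega> = x"
      by (rule survivors_leader[OF reg]) (use x y b tR rat ord in auto)
    moreover have "\<tau> (?t j - l) (?t (Suc j)) \<omega> = y"
      by (rule survivors_leader[OF reg y(1)]) (use x y b tR rat ord in auto)
    ultimately show False using x y b by simp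
  qed (use tR rat in auto)
  have "prob (E K n) = m * prob (E all_points n)" for n
  proof -
    have "prob (hit (survivors K r) (grid a b n j - l) (grid a b n j) (grid a b n (Suc j)))
       = m * prob (hit (survivors all_points r) (grid a b n j - l) (grid a b n j) (grid a b n (Suc j)))"
      if "j < 2 ^ n" for j
    proof (rule m)
      show "grid a b n (Suc j) \<le> grid a b n j + r"
        using grid_bounds[of a b "Suc j" n] grid_bounds[of a b j n] that ord by auto
    qed (use tR rat ord grid_strict_mono[of a b j "Suc j" n] in auto)
    then show ?thesis by (simp add: sum colouring_K colouring_UNIV sum_distrib_left)
  qed
  then have "(\<lambda>n. prob (E K n)) \<longlonglongrightarrow> m * prob (isolated_hit all_points l r a b)"
    using tendsto_mult_left[OF lim[OF colouring_UNIV], of m] by simp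
  then show ?thesis using lim[OF colouring_K] LIMSEQ_unique by blast
qed

text \<open>Provides a positive probability to cancel when two ratios are compared. With positive
  probability a survivor from 0 keeps some distance \<open>inverse (real (Suc k))\<close> from 0,
  which serves as left margin for all smaller \<open>l\<close>; then one cell of a fine grid must be
  hit with positive probability.\<close>

lemma isolated_hit_pos:
  assumes r: "r \<in> \<rat>" "0 < r" and pos: "0 < prob (hit (survivors all_points r) 0 0 r)"
  shows "\<exists>l0>0. \<forall>l\<in>\<rat>. 0 < l \<longrightarrow> l \<le> l0 \<longrightarrow> (\<exists>a\<in>\<rat>. \<exists>b\<in>\<rat>. a < b \<and> b \<le> a + l \<and> b \<le> a + r \<and> 0 < prob (isolated_hit all_points l r a b))"
proof -
  let ?Y = "\<lambda>k. hit (survivors all_points r) 0 (inverse (real (Suc k))) r"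
  have Yev: "?Y k \<in> events" for k using colouring_UNIV by (intro hit_survivors_events) auto
  have "\<exists>k. prob (?Y k) \<noteq> 0"
  proof (rule ccontr)
    assume "\<not> (\<exists>k. prob (?Y k) \<noteq> 0)"
    then have "AE \<omega> in P. \<forall>k. \<omega> \<notin> ?Y k" using Yev by (intro AE_all_countable[THEN iffD2] allI) (simp add: prob_eq_0)
    moreover have "\<omega> \<in> hit (survivors all_points r) 0 0 r \<Longrightarrow> \<exists>k. \<omega> \<in> ?Y k" for \<omega>
      using reals_Archimedean by (fastforce simp: hit_def)
    ultimately have "AE \<omega> in P. \<omega> \<notin> hit (survivors all_points r) 0 0 r" by (auto elim!: eventually_mono)
    then have "prob (hit (survivors all_points r) 0 0 r) = 0"
      using colouring_UNIV by (subst prob_eq_0) (auto intro!: hit_survivors_events)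
    then show False using pos by simp
  qed
  then obtain k where k: "prob (?Y k) \<noteq> 0" by blast
  show ?thesis
  proof (intro exI[of _ "inverse (real (Suc k))"] conjI ballI impI)
    fix l :: real assume l: "l \<in> \<rat>" "0 < l" "l \<le> inverse (real (Suc k))"
    have "eventually (\<lambda>n. (r - 0) / 2 ^ n < min l r) sequentially"
      using l r by (intro order_tendstoD(2)[OF grid_width_tendsto_0]) auto
    then obtain n where n: "r / 2 ^ n < min l r" unfolding eventually_sequentially by auto
    let ?t = "grid 0 r n"
    have tR: "?t j \<in> \<rat>" for j using r by (simp add: grid_Rats)
    have iev: "isolated_hit all_points l r (?t j) (?t (Suc j)) \<in> events" for j
      using colouring_UNIV l r by (intro isolated_hit_events)
    have "\<exists>j<2^n. prob (isolated_hit all_points l r (?t j) (?t (Suc j))) \<noteq> 0"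
    proof (rule ccontr)
      assume "\<not> (\<exists>j<2^n. prob (isolated_hit all_points l r (?t j) (?t (Suc j))) \<noteq> 0)"
      then have "AE \<omega> in P. \<omega> \<notin> isolated_hit all_points l r (?t j) (?t (Suc j))" if "j < 2^n" for j
        using that iev by (auto simp: prob_eq_0)
      then have "AE \<omega> in P. \<forall>j\<in>{..<2^n}. \<omega> \<notin> isolated_hit all_points l r (?t j) (?t (Suc j))"
        by (intro AE_finite_allI) auto
      then have "AE \<omega> in P. \<omega> \<notin> ?Y k"
        using AE_reg
      proof eventually_elim
        case (elim \<omega>)
        show ?case
        proof
          assume "\<omega> \<in> ?Y k"
          then obtain x t where x: "inverse (real (Suc k)) < x" "x < r" "t \<in> \<rat>" "0 < t" "x + r < t" "\<tau> 0 t \<omega> = x"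
            by (auto simp: hit_def survivors_def)
          have x0: "0 < x" using x(1) l by simp
          have "x \<notin> \<rat>" using reg_inside(3)[OF elim(2) _ x(3,4)] x by simp
          then obtain j where "j < 2 ^ n" "?t j < x" "x < ?t (Suc j)" using grid_cell[of 0 r x n] x x0 r by auto
          moreover have "0 < x - l" using x l by simp
          ultimately have "\<omega> \<in> isolated_hit all_points l r (?t j) (?t (Suc j))"
            using x reg_space[OF elim(2)] by (intro isolated_hitI[of \<omega> x _ _ _ 0 t]) auto
          then show False using elim(1) \<open>j < 2 ^ n\<close> by auto
        qed
      qed
      then have "prob (?Y k) = 0" using Yev by (subst prob_eq_0) auto
      then show False using k by simp
    qed
    then obtain j where j: "j < 2 ^ n" "prob (isolated_hit all_points l r (?t j) (?t (Suc j))) \<noteq> 0" by blast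
    show "\<exists>a\<in>\<rat>. \<exists>b\<in>\<rat>. a < b \<and> b \<le> a + l \<and> b \<le> a + r \<and> 0 < prob (isolated_hit all_points l r a b)"
    proof (intro bexI conjI)
      show "?t j < ?t (Suc j)" using r by (simp add: grid_strict_mono)
      show "?t (Suc j) \<le> ?t j + l" "?t (Suc j) \<le> ?t j + r" using n by (simp_all add: grid_Suc)
      show "0 < prob (isolated_hit all_points l r (?t j) (?t (Suc j)))"
        using j(2) measure_nonneg[of P] by (metis order_le_less)
    qed (rule tR)+
  qed simp
qed

lemma isolated_hit_reversed:
  "honest_index.isolated_hit P (\<lambda>s t \<omega>. - \<tau> (- t) (- s) \<omega>) (\<lambda>\<omega>. uminus ` \<kappa> \<omega>) r l (- b) (- a) = isolated_hit \<kappa> l r a b"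
proof -
  interpret r: honest_index P "\<lambda>t. fut (- t)" "\<lambda>t. past (- t)" "\<lambda>h. shift (- h)"
     "\<lambda>s t \<omega>. - \<tau> (- t) (- s) \<omega>" "\<lambda>\<omega>. uminus ` K \<omega>" by (rule reversed)
  show ?thesis
  proof (intro set_eqI iffI)
    fix \<omega> assume "\<omega> \<in> r.isolated_hit (\<lambda>\<omega>. uminus ` \<kappa> \<omega>) r l (- b) (- a)"
    then obtain x s t where "\<omega> \<in> space P" "x \<in> \<kappa> \<omega>" "- b < - x" "- x < - a" "s \<in> \<rat>" "t \<in> \<rat>" "s < - x - r" "- x + l < t" "- \<tau> (- t) (- s) \<omega> = - x"
      unfolding r.isolated_hit_def by auto
    then show "\<omega> \<in> isolated_hit \<kappa> l r a b"
      by (intro isolated_hitI[of \<omega> x \<kappa> a b "- t" "- s"]) auto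
  next
    fix \<omega> assume "\<omega> \<in> isolated_hit \<kappa> l r a b"
    then obtain x s t where "\<omega> \<in> space P" "x \<in> \<kappa> \<omega>" "a < x" "x < b" "s \<in> \<rat>" "t \<in> \<rat>" "s < x - l" "x + r < t" "\<tau> s t \<omega> = x"
      unfolding isolated_hit_def by auto
    then show "\<omega> \<in> r.isolated_hit (\<lambda>\<omega>. uminus ` \<kappa> \<omega>) r l (- b) (- a)"
      by (intro r.isolated_hitI[of \<omega> "- x" _ _ _ "- t" "- s"]) auto
  qed
qed

text \<open>The proportionality factor for points isolated to the right does not depend on the left
  isolation, and vice versa; hence it is universal.\<close>

lemma survivors_universal_ratio:
  "\<exists>p. \<forall>r\<in>\<rat>. \<forall>s\<in>\<rat>. \<forall>a\<in>\<rat>. \<forall>b\<in>\<rat>. 0 < r \<longrightarrow> s \<le> a \<longrightarrow> a < b \<longrightarrow> b \<le> a + r \<longrightarrow>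
     prob (hit (survivors K r) s a b) = p * prob (hit (survivors all_points r) s a b)"
proof -
  interpret r: honest_index P "\<lambda>t. fut (- t)" "\<lambda>t. past (- t)" "\<lambda>h. shift (- h)"
     "\<lambda>s t \<omega>. - \<tau> (- t) (- s) \<omega>" "\<lambda>\<omega>. uminus ` K \<omega>" by (rule reversed)
  have "\<forall>r\<in>{r\<in>\<rat>. 0 < r}. \<exists>m. \<forall>s\<in>\<rat>. \<forall>a\<in>\<rat>. \<forall>b\<in>\<rat>. s \<le> a \<longrightarrow> a < b \<longrightarrow> b \<le> a + r \<longrightarrow>
     prob (hit (survivors K r) s a b) = m * prob (hit (survivors all_points r) s a b)"
    using survivors_ratio by blast
  then obtain f where f: "\<And>r s a b. r \<in> \<rat> \<Longrightarrow> 0 < r \<Longrightarrow> s \<in> \<rat> \<Longrightarrow> a \<in> \<rat> \<Longrightarrow> b \<in> \<rat> \<Longrightarrow> s \<le> a \<Longrightarrow> a < b \<Longrightarrow> b \<le> a + r \<Longrightarrow>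
     prob (hit (survivors K r) s a b) = f r * prob (hit (survivors all_points r) s a b)"
    unfolding bchoice_iff by blast
  have "\<forall>r\<in>{r\<in>\<rat>. 0 < r}. \<exists>m. \<forall>s\<in>\<rat>. \<forall>a\<in>\<rat>. \<forall>b\<in>\<rat>. s \<le> a \<longrightarrow> a < b \<longrightarrow> b \<le> a + r \<longrightarrow>
     prob (r.hit (r.survivors (\<lambda>\<omega>. uminus ` K \<omega>) r) s a b) = m * prob (r.hit (r.survivors (\<lambda>_. UNIV) r) s a b)"
    using r.survivors_ratio by blast
  then obtain g where g: "\<And>r s a b. r \<in> \<rat> \<Longrightarrow> 0 < r \<Longrightarrow> s \<in> \<rat> \<Longrightarrow> a \<in> \<rat> \<Longrightarrow> b \<in> \<rat> \<Longrightarrow> s \<le> a \<Longrightarrow> a < b \<Longrightarrow> b \<le> a + r \<Longrightarrow>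
     prob (r.hit (r.survivors (\<lambda>\<omega>. uminus ` K \<omega>) r) s a b) = g r * prob (r.hit (r.survivors (\<lambda>_. UNIV) r) s a b)"
    unfolding bchoice_iff by blast
  \<comment> \<open>The same probability is computed twice: forward, with a factor that depends only
    on the right margin \<open>r\<close>, and in reversed time, with a factor that depends only on
    the left margin \<open>l\<close>.\<close>
  have fl: "prob (isolated_hit K l r a b) = f r * prob (isolated_hit all_points l r a b)"
    if "l \<in> \<rat>" "r \<in> \<rat>" "a \<in> \<rat>" "b \<in> \<rat>" "0 < l" "0 < r" "a < b" "b \<le> a + l" "b \<le> a + r" for l r a b
    using that f by (intro isolated_hit_ratio) auto
  have gl: "prob (isolated_hit K l r a b) = g l * prob (isolated_hit all_points l r a b)"
    if "l \<in> \<rat>" "r \<in> \<rat>" "a \<in> \<rat>" "b \<in> \<rat>" "0 < l" "0 < r" "a < b" "b \<le> a + l" "b \<le> a + r" for l r a b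
  proof -
    have "prob (r.isolated_hit (\<lambda>\<omega>. uminus ` K \<omega>) r l (- b) (- a)) = g l * prob (r.isolated_hit (\<lambda>_. UNIV) r l (- b) (- a))"
      using that g by (intro r.isolated_hit_ratio) auto
    moreover have "r.isolated_hit (\<lambda>_. UNIV) r l (- b) (- a) = isolated_hit all_points l r a b"
      using isolated_hit_reversed[of all_points r l b a] by (simp add: surj_uminus)
    ultimately show ?thesis by (simp add: isolated_hit_reversed)
  qed
  let ?good = "\<lambda>r. r \<in> \<rat> \<and> 0 < r \<and> 0 < prob (hit (survivors all_points r) 0 0 r)"
  have same: "f r1 = f r2" if good: "?good r1" "?good r2" for r1 r2
  proof -
    have g1: "r1 \<in> \<rat>" "0 < r1" "0 < prob (hit (survivors all_points r1) 0 0 r1)" using good by auto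
    have g2: "r2 \<in> \<rat>" "0 < r2" "0 < prob (hit (survivors all_points r2) 0 0 r2)" using good by auto
    obtain l1 where l1: "0 < l1" "\<forall>l\<in>\<rat>. 0 < l \<longrightarrow> l \<le> l1 \<longrightarrow> (\<exists>a\<in>\<rat>. \<exists>b\<in>\<rat>. a < b \<and> b \<le> a + l \<and> b \<le> a + r1 \<and> 0 < prob (isolated_hit all_points l r1 a b))"
      using isolated_hit_pos[OF g1] by blast
    obtain l2 where l2: "0 < l2" "\<forall>l\<in>\<rat>. 0 < l \<longrightarrow> l \<le> l2 \<longrightarrow> (\<exists>a\<in>\<rat>. \<exists>b\<in>\<rat>. a < b \<and> b \<le> a + l \<and> b \<le> a + r2 \<and> 0 < prob (isolated_hit all_points l r2 a b))"
      using isolated_hit_pos[OF g2] by blast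
    \<comment> \<open>A left margin that suits both radii links \<open>f r1\<close> and
      \<open>f r2\<close> through the common value \<open>g l\<close>.\<close>
    have "0 < min l1 l2" using l1 l2 by simp
    then obtain l where l: "l \<in> \<rat>" "0 < l" "l < min l1 l2" using Rats_dense_in_real by blast
    obtain a b where ab: "a \<in> \<rat>" "b \<in> \<rat>" "a < b" "b \<le> a + l" "b \<le> a + r1" "0 < prob (isolated_hit all_points l r1 a b)"
      using bspec[OF l1(2) l(1)] l by auto
    obtain c d where cd: "c \<in> \<rat>" "d \<in> \<rat>" "c < d" "d \<le> c + l" "d \<le> c + r2" "0 < prob (isolated_hit all_points l r2 c d)"
      using bspec[OF l2(2) l(1)] l by auto
    have "f r1 = g l" using fl[of l r1 a b] gl[of l r1 a b] ab l g1 by simp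
    moreover have "f r2 = g l" using fl[of l r2 c d] gl[of l r2 c d] cd l g2 by simp
    ultimately show ?thesis by simp
  qed
  \<comment> \<open>Any good radius gives the same value. If there is none, the second case below
    shows that all probabilities in question are 0.\<close>
  define p where "p = f (SOME r. ?good r)"
  have "prob (hit (survivors K r) s a b) = p * prob (hit (survivors all_points r) s a b)"
    if *: "r \<in> \<rat>" "s \<in> \<rat>" "a \<in> \<rat>" "b \<in> \<rat>" "0 < r" "s \<le> a" "a < b" "b \<le> a + r" for r s a b
  proof (cases "?good r")
    case True
    then have "?good (SOME r. ?good r)" by (rule someI)
    then have "f r = p" unfolding p_def using same True by blast
    then show ?thesis using f[of r s a b] * by simp
  next
    case False
    \<comment> \<open>Without survivors of this radius near 0 there are none anywhere, by
      stationarity and because moving the start to the right only adds survivors. Both sides are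
      then 0.\<close>
    then have 0: "prob (hit (survivors all_points r) 0 0 r) = 0" using * measure_nonneg[of P] by (metis order_le_less)
    have "prob (hit (survivors all_points r) s a b) \<le> prob (hit (survivors all_points r) a a b)"
    proof (rule finite_measure_mono_AE)
      show "AE \<omega> in P. \<omega> \<in> hit (survivors all_points r) s a b \<longrightarrow> \<omega> \<in> hit (survivors all_points r) a a b"
        using AE_reg
      proof eventually_elim
        case (elim \<omega>)
        then show ?case using survivors_restrict[OF elim _ *(2,3,6)] *(5) by (force simp: hit_def)
      qed
    qed (use * colouring_UNIV hit_survivors_events in auto)
    also have "\<dots> = prob (hit (survivors all_points r) 0 0 (b - a))"
      by (rule prob_hit_survivors_shift[OF colouring_UNIV *(3)])
    also have "\<dots> \<le> prob (hit (survivors all_points r) 0 0 r)"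
      using colouring_UNIV * by (intro prob_hit_survivors_mono) auto
    finally have z: "prob (hit (survivors all_points r) s a b) = 0" using 0 measure_nonneg[of P] by (metis order_antisym)
    have "prob (hit (survivors K r) s a b) \<le> prob (hit (survivors all_points r) s a b)"
      using colouring_K * by (intro prob_hit_survivors_mono) auto
    then have "prob (hit (survivors K r) s a b) = 0" using z measure_nonneg[of P] by (metis order_antisym)
    then show ?thesis using z by simp
  qed
  then show ?thesis by blast
qed

text \<open>If every extension of the window replaced the leader, then for each small step
  \<open>h\<close> the leader up to \<open>l + h\<close> would lie in the last piece of length
  \<open>h\<close>. By stationarity this is no more likely than \<open>\<tau> 0 l\<close> lying
  within \<open>h\<close> of \<open>l\<close>, whose probability tends to 0.\<close>

lemma AE_leader_persists:
  assumes l: "l \<in> \<rat>" "0 < l"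
  shows "AE \<omega> in P. \<exists>t\<in>\<rat>. l < t \<and> \<tau> 0 t \<omega> = \<tau> 0 l \<omega>"
proof -
  let ?h = "\<lambda>k. inverse (real (Suc k))"
  let ?N = "{\<omega>\<in>space P. \<forall>k. \<not> \<tau> 0 (l + ?h k) \<omega> < l}"
  have h: "?h k \<in> \<rat>" "0 < ?h k" for k by simp_all
  have m: "{\<omega>\<in>space P. \<not> \<tau> s t \<omega> < c} \<in> events" "{\<omega>\<in>space P. c < \<tau> s t \<omega>} \<in> events" if "s \<in> \<rat>" "t \<in> \<rat>" "s < t" for s t c
    using \<tau>_meas[OF that] by measurable
  have lh: "0 < l + ?h k" for k using l h(2)[of k] by (rule_tac add_pos_pos)
  have Nev: "?N \<in> events"
  proof -
    have "?N = (\<Inter>k. {\<omega>\<in>space P. \<not> \<tau> 0 (l + ?h k) \<omega> < l})" by auto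
    also have "\<dots> \<in> events" using l h lh by (intro sets.countable_INT' m) (auto intro!: m)
    finally show ?thesis .
  qed
  have "eventually (\<lambda>k. ?h k < l) sequentially"
    using LIMSEQ_inverse_real_of_nat l by (intro order_tendstoD(2)) auto
  then have "eventually (\<lambda>k. prob ?N \<le> prob {\<omega>\<in>space P. l - ?h k < \<tau> 0 l \<omega>}) sequentially"
  proof eventually_elim
    case (elim k)
    have "prob ?N \<le> prob {\<omega>\<in>space P. \<not> \<tau> 0 (l + ?h k) \<omega> < l}"
      using l h lh by (intro finite_measure_mono m) auto
    \<comment> \<open>Cutting off the first \<open>?h k\<close> restores the length \<open>l\<close>
      of the window and keeps the leader, which lies beyond \<open>?h k\<close> because
      \<open>?h k < l\<close>.\<close>
    also have "\<dots> \<le> prob {\<omega>\<in>space P. \<not> \<tau> (0 + ?h k) (l + ?h k) \<omega> < (l - ?h k) + ?h k}"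
    proof (rule finite_measure_mono_AE)
      show "AE \<omega> in P. \<omega> \<in> {\<omega>\<in>space P. \<not> \<tau> 0 (l + ?h k) \<omega> < l} \<longrightarrow>
          \<omega> \<in> {\<omega>\<in>space P. \<not> \<tau> (0 + ?h k) (l + ?h k) \<omega> < (l - ?h k) + ?h k}"
        using AE_reg
      proof eventually_elim
        case r: (elim \<omega>)
        have "\<tau> (?h k) (l + ?h k) \<omega> = \<tau> 0 (l + ?h k) \<omega>" if "\<not> \<tau> 0 (l + ?h k) \<omega> < l"
          using that r l h[of k] elim reg_inside(2)[OF r _ _ lh, of k] by (intro reg_nested) auto
        then show ?case by auto
      qed
    qed (use l h in \<open>auto intro!: m\<close>)
    also have "\<dots> = 1 - prob {\<omega>\<in>space P. \<tau> (0 + ?h k) (l + ?h k) \<omega> < (l - ?h k) + ?h k}"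
      using l h \<tau>_meas[of "0 + ?h k" "l + ?h k"] by (intro prob_neg) auto
    also have "\<dots> = 1 - prob {\<omega>\<in>space P. \<tau> 0 l \<omega> < l - ?h k}"
      using l h by (subst prob_less_shift) auto
    also have "\<dots> = prob {\<omega>\<in>space P. \<not> \<tau> 0 l \<omega> < l - ?h k}"
      using l \<tau>_meas[of 0 l] by (intro prob_neg[symmetric]) auto
    also have "\<dots> \<le> prob {\<omega>\<in>space P. l - ?h k < \<tau> 0 l \<omega>}"
    proof (rule finite_measure_mono_AE)
      show "AE \<omega> in P. \<omega> \<in> {\<omega>\<in>space P. \<not> \<tau> 0 l \<omega> < l - ?h k} \<longrightarrow> \<omega> \<in> {\<omega>\<in>space P. l - ?h k < \<tau> 0 l \<omega>}"
        using AE_reg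
      proof eventually_elim
        case r: (elim \<omega>)
        have "\<tau> 0 l \<omega> \<noteq> l - ?h k" by (rule reg_neq[OF r]) (use l h in auto)
        then show ?case by auto
      qed
    qed (use l in \<open>auto intro!: m\<close>)
    finally show ?case .
  qed
  then have "prob ?N \<le> 0"
    using l by (intro tendsto_lowerbound[OF prob_near_right_tendsto_0]) auto
  then have "prob ?N = 0" using measure_nonneg[of P ?N] by linarith
  then have "AE \<omega> in P. \<omega> \<notin> ?N" using Nev by (simp add: prob_eq_0)
  then show ?thesis using AE_reg
  proof eventually_elim
    case (elim \<omega>)
    then obtain k where k: "\<tau> 0 (l + ?h k) \<omega> < l" using reg_space by blast
    then have "\<tau> 0 l \<omega> = \<tau> 0 (l + ?h k) \<omega>"
      using elim l h[of k] reg_inside(1)[OF elim(2) _ _ lh, of k] by (intro reg_nested) auto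
    then show ?case using l h by (intro bexI[of _ "l + ?h k"]) auto
  qed
qed

lemma colouring_events: "colouring \<kappa> \<Longrightarrow> s \<in> \<rat> \<Longrightarrow> t \<in> \<rat> \<Longrightarrow> s < t \<Longrightarrow> {\<omega>\<in>space P. \<tau> s t \<omega> \<in> \<kappa> \<omega>} \<in> events"
  using fut_events unfolding colouring_def by blast

text \<open>The leader up to \<open>l\<close> is sorted by the cell that contains it. In cell
  \<open>j\<close> it is treated as a survivor of radius \<open>l - ?t n j\<close>; the error
  vanishes in the limit by \<open>AE_leader_persists\<close>. The radius varies with the cell, which
  is why the ratio has to be universal.\<close>

lemma prob_colour_initial:
  "\<exists>p. \<forall>l\<in>\<rat>. 0 < l \<longrightarrow> prob {\<omega>\<in>space P. \<tau> 0 l \<omega> \<in> K \<omega>} = p"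
proof -
  obtain p where p: "\<And>r s a b. r \<in> \<rat> \<Longrightarrow> s \<in> \<rat> \<Longrightarrow> a \<in> \<rat> \<Longrightarrow> b \<in> \<rat> \<Longrightarrow> 0 < r \<Longrightarrow> s \<le> a \<Longrightarrow> a < b \<Longrightarrow> b \<le> a + r \<Longrightarrow>
     prob (hit (survivors K r) s a b) = p * prob (hit (survivors all_points r) s a b)"
    using survivors_universal_ratio by blast
  have "prob {\<omega>\<in>space P. \<tau> 0 l \<omega> \<in> K \<omega>} = p" if l: "l \<in> \<rat>" "0 < l" for l
  proof -
    let ?t = "\<lambda>n. grid 0 l n"
    define E where "E \<kappa> n = (\<Union>j<2^n. hit (survivors \<kappa> (l - ?t n j)) 0 (?t n j) (?t n (Suc j)))" for \<kappa> n
    have tR: "?t n j \<in> \<rat>" for n j using l by (simp add: grid_Rats)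
    have ev: "E \<kappa> n \<in> events" if "colouring \<kappa>" for \<kappa> n
      unfolding E_def using that by (intro sets.finite_UN hit_survivors_events) auto
    have lead: "\<tau> 0 l \<omega> = x" if "reg \<omega>" "x \<in> survivors \<kappa> (l - ?t n j) 0 \<omega>" "?t n j < x" "x < ?t n (Suc j)" "j < 2 ^ n" for \<omega> x \<kappa> n j
      using that l grid_bounds[of 0 l "Suc j" n] by (intro survivors_leader[OF that(1,2)]) auto
    have lim: "(\<lambda>n. prob (E \<kappa> n)) \<longlonglongrightarrow> prob {\<omega>\<in>space P. \<tau> 0 l \<omega> \<in> \<kappa> \<omega>}" if \<kappa>: "colouring \<kappa>" for \<kappa>
    proof (rule prob_tendsto_AE)
      show "AE \<omega> in P. \<forall>\<^sub>F n in sequentially. (\<omega> \<in> E \<kappa> n) = (\<omega> \<in> {\<omega>\<in>space P. \<tau> 0 l \<omega> \<in> \<kappa> \<omega>})"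
        using AE_reg AE_leader_persists[OF l]
      proof eventually_elim
        case (elim \<omega>)
        note sp = reg_space[OF elim(1)]
        let ?x = "\<tau> 0 l \<omega>"
        have x: "0 < ?x" "?x < l" "?x \<notin> \<rat>" using reg_inside[OF elim(1) _ l(1), of 0] l by auto
        have sub: "?x \<in> \<kappa> \<omega>" if E: "\<omega> \<in> E \<kappa> n" for n
        proof -
          obtain j y where j: "j < 2 ^ n" and y: "y \<in> survivors \<kappa> (l - ?t n j) 0 \<omega>" "?t n j < y" "y < ?t n (Suc j)"
            using E by (auto simp: E_def hit_def)
          from lead[OF elim(1) y j] show ?thesis using y by (simp add: survivors_def)
        qed
        obtain t where t: "t \<in> \<rat>" "l < t" "\<tau> 0 t \<omega> = ?x" using elim(2) by blast
        have "eventually (\<lambda>n. (l - 0) / 2 ^ n < t - l) sequentially"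
          using t by (intro order_tendstoD(2)[OF grid_width_tendsto_0]) auto
        then show ?case
        proof eventually_elim
          case n: (elim n)
          obtain j where j: "j < 2 ^ n" "?t n j < ?x" "?x < ?t n (Suc j)"
            using grid_cell[of 0 l ?x n] x l by auto
          \<comment> \<open>To survive by the radius of its cell, the leader must outlast
            \<open>l\<close> by less than one cell width, and on fine grids it does because it leads
            up to \<open>t\<close>.\<close>
          have "?x + (l - ?t n j) < t" using n j grid_Suc[of 0 l n j] by simp
          then have "?x \<in> survivors \<kappa> (l - ?t n j) 0 \<omega>" if "?x \<in> \<kappa> \<omega>"
            using that t l unfolding survivors_def by (auto intro!: bexI[of _ t])
          then have "\<omega> \<in> E \<kappa> n" if "?x \<in> \<kappa> \<omega>" using that j sp unfolding E_def hit_def by blast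
          then show ?case using sub[of n] sp by blast
        qed
      qed
    qed (use \<kappa> l ev colouring_events in auto)
    have sum: "prob (E \<kappa> n) = (\<Sum>j<2^n. prob (hit (survivors \<kappa> (l - ?t n j)) 0 (?t n j) (?t n (Suc j))))"
      if "colouring \<kappa>" for \<kappa> n
      unfolding E_def
    proof (rule prob_hit_grid[OF that _ l])
      fix \<omega> i j x y
      assume reg: "reg \<omega>" and ij: "i < j" "j < 2 ^ n"
        and x: "x \<in> survivors all_points (l - ?t n i) 0 \<omega>" "?t n i < x" "x < ?t n (Suc i)"
        and y: "y \<in> survivors all_points (l - ?t n j) 0 \<omega>" "?t n j < y" "y < ?t n (Suc j)"
      have "x = y" using lead[OF reg x] lead[OF reg y] ij by simp
      moreover have "?t n (Suc i) \<le> ?t n j" using ij l by (simp add: grid_mono)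
      ultimately show False using x y by simp
    qed auto
    have "prob (E K n) = p * prob (E all_points n)" for n
    proof -
      have "prob (hit (survivors K (l - ?t n j)) 0 (?t n j) (?t n (Suc j)))
         = p * prob (hit (survivors all_points (l - ?t n j)) 0 (?t n j) (?t n (Suc j)))"
        if j: "j < 2 ^ n" for j
      proof (rule p)
        have "?t n j < ?t n (Suc j)" "?t n (Suc j) \<le> l"
          using grid_bounds[of 0 l "Suc j" n] grid_strict_mono[of 0 l j "Suc j" n] j l by auto
        then show "0 < l - ?t n j" "?t n j < ?t n (Suc j)" "?t n (Suc j) \<le> ?t n j + (l - ?t n j)" by auto
        show "0 \<le> ?t n j" using grid_bounds[of 0 l j n] j l by simp
      qed (use tR l in auto)
      then show ?thesis by (simp add: sum colouring_K colouring_UNIV sum_distrib_left)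
    qed
    then have "(\<lambda>n. prob (E K n)) \<longlonglongrightarrow> p * prob {\<omega>\<in>space P. \<tau> 0 l \<omega> \<in> UNIV}"
      using tendsto_mult_left[OF lim[OF colouring_UNIV], of p] by simp
    then have "prob {\<omega>\<in>space P. \<tau> 0 l \<omega> \<in> K \<omega>} = p * prob {\<omega>\<in>space P. \<tau> 0 l \<omega> \<in> UNIV}"
      using lim[OF colouring_K] LIMSEQ_unique by blast
    then show ?thesis by (simp add: prob_space)
  qed
  then show ?thesis by blast
qed

section \<open>Independence of the colour from past and future\<close>

definition colour_prob :: real where
  "colour_prob = prob {\<omega>\<in>space P. \<tau> 0 1 \<omega> \<in> K \<omega>}"

lemma prob_colour:
  assumes "s \<in> \<rat>" "t \<in> \<rat>" "s < t"
  shows "prob {\<omega>\<in>space P. \<tau> s t \<omega> \<in> K \<omega>} = colour_prob"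
proof -
  let ?H = "{\<omega>\<in>space P. \<tau> 0 (t - s) \<omega> \<in> K \<omega>}"
  have ev: "?H \<in> events" using assms colouring_K by (intro colouring_events) auto
  have "prob {\<omega>\<in>space P. \<tau> s t \<omega> \<in> K \<omega>} = prob (shift s -` ?H \<inter> space P)"
  proof (rule finite_measure_eq_AE)
    show "AE \<omega> in P. (\<omega> \<in> {\<omega>\<in>space P. \<tau> s t \<omega> \<in> K \<omega>}) = (\<omega> \<in> shift s -` ?H \<inter> space P)"
      using colouring_K[unfolded colouring_def, THEN conjunct2, rule_format, OF assms(1)] AE_space
    proof eventually_elim
      case (elim \<omega>)
      then show ?case using elim(1)[rule_format, of 0 "t - s"] assms shift_space[OF elim(2)] by simp
    qed
  qed (use assms colouring_K colouring_events shift_events[OF ev] in auto)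
  also have "\<dots> = prob ?H" by (rule prob_shift[OF ev])
  also have "\<dots> = colour_prob"
  proof -
    obtain p where p: "\<And>l. l \<in> \<rat> \<Longrightarrow> 0 < l \<Longrightarrow> prob {\<omega>\<in>space P. \<tau> 0 l \<omega> \<in> K \<omega>} = p"
      using prob_colour_initial by blast
    show ?thesis unfolding colour_prob_def using p[of "t - s"] p[of 1] assms by simp
  qed
  finally show ?thesis .
qed

text \<open>The right end \<open>c\<close> of the windows is fixed and may lie beyond the interval
  in which hits are counted. The event \<open>B\<close> is carried along inside the family, so that
  the renewal argument yields statements jointly with an event of the future.\<close>

definition leader_from :: "'w set \<Rightarrow> ('w \<Rightarrow> real set) \<Rightarrow> real \<Rightarrow> real \<Rightarrow> 'w \<Rightarrow> real set" where
  "leader_from B \<kappa> c t \<omega> = {x \<in> \<kappa> \<omega>. \<omega> \<in> B \<and> x = \<tau> t c \<omega>}"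

lemma hit_leader_from:
  "hit (leader_from B \<kappa> c) t a b = {\<omega>\<in>space P. \<omega> \<in> B \<and> \<tau> t c \<omega> \<in> \<kappa> \<omega> \<and> a < \<tau> t c \<omega> \<and> \<tau> t c \<omega> < b}"
  by (auto simp: hit_def leader_from_def)

lemma hereditary_leader_from:
  assumes \<kappa>: "colouring \<kappa>" and rat: "s \<in> \<rat>" "a \<in> \<rat>" "b \<in> \<rat>" "c \<in> \<rat>" and ord: "s < a" "a < b" "b \<le> c"
    and B: "B \<in> sets (fut b)"
  shows "hereditary s a b (leader_from B \<kappa> c)"
  unfolding hereditary_def
proof (intro conjI allI impI ballI)
  have fut: "hit (leader_from B \<kappa> c) t d b \<in> sets (fut t)" if t: "t \<in> \<rat>" "t < b" for t d
  proof -
    have tc: "t < c" using t ord by simp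
    have "{\<omega>\<in>space P. \<tau> t c \<omega> \<in> \<kappa> \<omega>} \<in> sets (fut t)" using \<kappa> t rat tc unfolding colouring_def by blast
    moreover have "{\<omega>\<in>space (fut t). d < \<tau> t c \<omega> \<and> \<tau> t c \<omega> < b} \<in> sets (fut t)"
      using \<tau>_fut[OF t(1) rat(4) tc] by measurable
    moreover have "B \<in> sets (fut t)" using B fut_mono[of t b] t by auto
    moreover have "hit (leader_from B \<kappa> c) t d b = {\<omega>\<in>space P. \<tau> t c \<omega> \<in> \<kappa> \<omega>} \<inter> {\<omega>\<in>space (fut t). d < \<tau> t c \<omega> \<and> \<tau> t c \<omega> < b} \<inter> B"
      unfolding hit_leader_from by auto
    ultimately show ?thesis by auto
  qed
  show "hit (leader_from B \<kappa> c) s a b \<in> events" using fut[of s a] fut_events rat ord by auto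
  show "hit (leader_from B \<kappa> c) t t b \<in> sets (fut t)" if "t \<in> \<rat>" "a < t \<and> t < b" for t using that by (intro fut) auto
  fix \<omega> assume reg: "reg \<omega>"
  { fix x assume x: "x \<in> leader_from B \<kappa> c s \<omega>" "a < x \<and> x < b"
    then have xs: "x = \<tau> s c \<omega>" "x \<in> \<kappa> \<omega>" "\<omega> \<in> B" by (auto simp: leader_from_def)
    show "\<tau> s b \<omega> = x" unfolding xs(1) using reg rat ord x xs(1) by (intro reg_nested) auto
    fix t assume t: "t \<in> \<rat>" "a < t \<and> t < x"
    have "\<tau> t c \<omega> = \<tau> s c \<omega>" using reg rat ord x t xs(1) by (intro reg_nested) auto
    then show "x \<in> leader_from B \<kappa> c t \<omega>" using xs by (simp add: leader_from_def) }
  fix t x assume t: "t \<in> \<rat>" "x \<in> leader_from B \<kappa> c t \<omega>" "a < t \<and> t < x \<and> x < b"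
  then have xs: "x = \<tau> t c \<omega>" "x \<in> \<kappa> \<omega>" "\<omega> \<in> B" by (auto simp: leader_from_def)
  have sc: "s < c" using ord by simp
  show "x \<in> leader_from B \<kappa> c s \<omega> \<or> \<tau> s b \<omega> < t"
  proof (cases "t < \<tau> s c \<omega>")
    case True
    then have "\<tau> t c \<omega> = \<tau> s c \<omega>" using reg rat t ord reg_inside(2)[OF reg rat(1,4) sc] by (intro reg_nested) auto
    then show ?thesis using xs by (simp add: leader_from_def)
  next
    case False
    then have l: "\<tau> s c \<omega> < t" using reg_neq[OF reg rat(1,4) sc t(1)] by simp
    have "\<tau> s b \<omega> = \<tau> s c \<omega>" using reg rat t ord l reg_inside(1)[OF reg rat(1,4) sc] by (intro reg_nested) auto
    then show ?thesis using l by simp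
  qed
qed

text \<open>The leaders of all fresh windows up to \<open>b\<close> are coloured with the same
  probability. So the defect bound in \<open>renewal_comparison\<close> is 0, and an arbitrary event
  of the past can be inserted.\<close>

lemma colour_indep_past:
  assumes rat: "s \<in> \<rat>" "a \<in> \<rat>" "b \<in> \<rat>" and ord: "s < a" "a < b" and A: "A \<in> sets (past a)"
  shows "prob (A \<inter> {\<omega>\<in>space P. \<tau> s b \<omega> \<in> K \<omega> \<and> a < \<tau> s b \<omega>}) = colour_prob * prob (A \<inter> {\<omega>\<in>space P. a < \<tau> s b \<omega>})"
proof -
  have B: "space P \<in> sets (fut b)" by simp
  have h: "prob (C \<inter> hit (leader_from (space P) \<kappa> b) t d b) = prob (C \<inter> {\<omega>\<in>space P. \<tau> t b \<omega> \<in> \<kappa> \<omega> \<and> d < \<tau> t b \<omega>})"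
    if "t \<in> \<rat>" "t < b" "colouring \<kappa>" "C \<in> events" for t d \<kappa> C
  proof (rule finite_measure_eq_AE)
    show "AE \<omega> in P. (\<omega> \<in> C \<inter> hit (leader_from (space P) \<kappa> b) t d b) = (\<omega> \<in> C \<inter> {\<omega>\<in>space P. \<tau> t b \<omega> \<in> \<kappa> \<omega> \<and> d < \<tau> t b \<omega>})"
      using AE_reg
    proof eventually_elim
      case (elim \<omega>)
      then show ?case using reg_inside(2)[OF elim that(1) rat(3) that(2)] by (auto simp: hit_leader_from)
    qed
    have "{\<omega>\<in>space P. d < \<tau> t b \<omega> \<and> \<tau> t b \<omega> < b} \<in> events" "{\<omega>\<in>space P. d < \<tau> t b \<omega>} \<in> events"
      using \<tau>_meas[OF that(1) rat(3) that(2)] by measurable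
    moreover note colouring_events[OF that(3,1) rat(3) that(2)] that(4)
    moreover have "C \<inter> hit (leader_from (space P) \<kappa> b) t d b = C \<inter> {\<omega>\<in>space P. \<tau> t b \<omega> \<in> \<kappa> \<omega>} \<inter> {\<omega>\<in>space P. d < \<tau> t b \<omega> \<and> \<tau> t b \<omega> < b}"
      by (auto simp: hit_leader_from)
    moreover have "C \<inter> {\<omega>\<in>space P. \<tau> t b \<omega> \<in> \<kappa> \<omega> \<and> d < \<tau> t b \<omega>} = C \<inter> {\<omega>\<in>space P. \<tau> t b \<omega> \<in> \<kappa> \<omega>} \<inter> {\<omega>\<in>space P. d < \<tau> t b \<omega>}"
      by auto
    ultimately show "C \<inter> hit (leader_from (space P) \<kappa> b) t d b \<in> events"
      "C \<inter> {\<omega>\<in>space P. \<tau> t b \<omega> \<in> \<kappa> \<omega> \<and> d < \<tau> t b \<omega>} \<in> events" by auto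
  qed
  have full: "prob (space P \<inter> {\<omega>\<in>space P. \<tau> t b \<omega> \<in> \<kappa> \<omega> \<and> t < \<tau> t b \<omega>}) = prob {\<omega>\<in>space P. \<tau> t b \<omega> \<in> \<kappa> \<omega>}"
    if "t \<in> \<rat>" "t < b" "colouring \<kappa>" for t \<kappa>
  proof (rule finite_measure_eq_AE)
    show "AE \<omega> in P. (\<omega> \<in> space P \<inter> {\<omega>\<in>space P. \<tau> t b \<omega> \<in> \<kappa> \<omega> \<and> t < \<tau> t b \<omega>}) = (\<omega> \<in> {\<omega>\<in>space P. \<tau> t b \<omega> \<in> \<kappa> \<omega>})"
      using AE_reg
    proof eventually_elim
      case (elim \<omega>)
      then show ?case using reg_inside(1)[OF elim that(1) rat(3) that(2)] by auto
    qed
    show ev: "{\<omega>\<in>space P. \<tau> t b \<omega> \<in> \<kappa> \<omega>} \<in> events" using that rat by (intro colouring_events) auto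
    have "{\<omega>\<in>space P. t < \<tau> t b \<omega>} \<in> events" using \<tau>_meas[OF that(1) rat(3) that(2)] by measurable
    moreover have "space P \<inter> {\<omega>\<in>space P. \<tau> t b \<omega> \<in> \<kappa> \<omega> \<and> t < \<tau> t b \<omega>} = {\<omega>\<in>space P. \<tau> t b \<omega> \<in> \<kappa> \<omega>} \<inter> {\<omega>\<in>space P. t < \<tau> t b \<omega>}" by auto
    ultimately show "space P \<inter> {\<omega>\<in>space P. \<tau> t b \<omega> \<in> \<kappa> \<omega> \<and> t < \<tau> t b \<omega>} \<in> events" using ev by auto
  qed
  have hh: "prob (hit (leader_from (space P) \<kappa> b) t t b) = prob {\<omega>\<in>space P. \<tau> t b \<omega> \<in> \<kappa> \<omega>}"
    if "t \<in> \<rat>" "t < b" "colouring \<kappa>" for t \<kappa>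
  proof -
    have "space P \<inter> hit (leader_from (space P) \<kappa> b) t t b = hit (leader_from (space P) \<kappa> b) t t b" by (auto simp: hit_def)
    then show ?thesis using h[OF that, of "space P" t] full[OF that] by simp
  qed
  have "\<bar>1 * prob (A \<inter> hit (leader_from (space P) K b) s a b) - colour_prob * prob (A \<inter> hit (leader_from (space P) all_points b) s a b)\<bar>
      \<le> 0 * prob {\<omega>\<in>space P. a < \<tau> s b \<omega>}"
  proof (rule renewal_comparison)
    show "hereditary s a b (leader_from (space P) K b)" "hereditary s a b (leader_from (space P) all_points b)"
      using rat ord B colouring_K colouring_UNIV by (auto intro!: hereditary_leader_from)
    fix t assume t: "t \<in> \<rat>" "a < t" "t < b"
    show "\<bar>1 * prob (hit (leader_from (space P) K b) t t b) - colour_prob * prob (hit (leader_from (space P) all_points b) t t b)\<bar> \<le> 0"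
      unfolding hh[OF t(1,3) colouring_K] hh[OF t(1,3) colouring_UNIV] prob_colour[OF t(1) rat(3) t(3)]
      by (simp add: prob_space)
  qed (use rat ord A in auto)
  then show ?thesis
    using h[OF rat(1) order_less_trans[OF ord] colouring_K past_events[OF A], of a]
      h[OF rat(1) order_less_trans[OF ord] colouring_UNIV past_events[OF A], of a] by simp
qed

lemma colour_indep_fut:
  assumes rat: "a \<in> \<rat>" "b \<in> \<rat>" "c \<in> \<rat>" and ord: "a < b" "b < c" and B: "B \<in> sets (fut b)"
  shows "prob (B \<inter> {\<omega>\<in>space P. \<tau> a c \<omega> \<in> K \<omega> \<and> \<tau> a c \<omega> < b}) = colour_prob * prob (B \<inter> {\<omega>\<in>space P. \<tau> a c \<omega> < b})"
proof -
  interpret r: honest_index P "\<lambda>t. fut (- t)" "\<lambda>t. past (- t)" "\<lambda>h. shift (- h)"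
     "\<lambda>s t \<omega>. - \<tau> (- t) (- s) \<omega>" "\<lambda>\<omega>. uminus ` K \<omega>" by (rule reversed)
  have eq: "- x \<in> uminus ` A \<longleftrightarrow> x \<in> A" for x :: real and A by force
  \<comment> \<open>The constant of the reversed setting belongs to the window from -1 to 0, which
    by \<open>prob_colour\<close> has the same value.\<close>
  have "r.colour_prob = colour_prob"
    unfolding r.colour_prob_def eq using prob_colour[of "-1" 0] by simp
  moreover have "prob (B \<inter> {\<omega>\<in>space P. - \<tau> (- (- a)) (- (- c)) \<omega> \<in> uminus ` K \<omega> \<and> - b < - \<tau> (- (- a)) (- (- c)) \<omega>}) =
     r.colour_prob * prob (B \<inter> {\<omega>\<in>space P. - b < - \<tau> (- (- a)) (- (- c)) \<omega>})"
    using rat ord B by (intro r.colour_indep_past) auto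
  ultimately show ?thesis unfolding eq by simp
qed

text \<open>Future and past are inserted one after the other: for each fresh window independence
  from \<open>B\<close> is \<open>colour_indep_fut\<close>, and the renewal argument carries it to
  the window from \<open>s\<close>, where \<open>A\<close> enters.\<close>

theorem colour_indep_past_fut:
  assumes rat: "s \<in> \<rat>" "a \<in> \<rat>" "b \<in> \<rat>" "c \<in> \<rat>" and ord: "s < a" "a < b" "b < c"
    and A: "A \<in> sets (past a)" and B: "B \<in> sets (fut b)"
  shows "prob (A \<inter> B \<inter> {\<omega>\<in>space P. \<tau> s c \<omega> \<in> K \<omega> \<and> a < \<tau> s c \<omega> \<and> \<tau> s c \<omega> < b}) =
     colour_prob * prob (A \<inter> B \<inter> {\<omega>\<in>space P. a < \<tau> s c \<omega> \<and> \<tau> s c \<omega> < b})"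
proof -
  have Bev: "B \<in> events" using B fut_events by blast
  have full: "prob (hit (leader_from B \<kappa> c) t t b) = prob (B \<inter> {\<omega>\<in>space P. \<tau> t c \<omega> \<in> \<kappa> \<omega> \<and> \<tau> t c \<omega> < b})"
    if t: "t \<in> \<rat>" "t < b" "colouring \<kappa>" for t \<kappa>
  proof (rule finite_measure_eq_AE)
    have tc: "t < c" using t ord by simp
    show "AE \<omega> in P. (\<omega> \<in> hit (leader_from B \<kappa> c) t t b) = (\<omega> \<in> B \<inter> {\<omega>\<in>space P. \<tau> t c \<omega> \<in> \<kappa> \<omega> \<and> \<tau> t c \<omega> < b})"
      using AE_reg
    proof eventually_elim
      case (elim \<omega>)
      then show ?case using reg_inside(1)[OF elim t(1) rat(4) tc] by (auto simp: hit_leader_from)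
    qed
    have "{\<omega>\<in>space P. t < \<tau> t c \<omega> \<and> \<tau> t c \<omega> < b} \<in> events" "{\<omega>\<in>space P. \<tau> t c \<omega> < b} \<in> events"
      using \<tau>_meas[OF t(1) rat(4) tc] by measurable
    moreover note colouring_events[OF t(3,1) rat(4) tc] Bev
    moreover have "hit (leader_from B \<kappa> c) t t b = B \<inter> {\<omega>\<in>space P. \<tau> t c \<omega> \<in> \<kappa> \<omega>} \<inter> {\<omega>\<in>space P. t < \<tau> t c \<omega> \<and> \<tau> t c \<omega> < b}"
      by (auto simp: hit_leader_from)
    moreover have "B \<inter> {\<omega>\<in>space P. \<tau> t c \<omega> \<in> \<kappa> \<omega> \<and> \<tau> t c \<omega> < b} = B \<inter> {\<omega>\<in>space P. \<tau> t c \<omega> \<in> \<kappa> \<omega>} \<inter> {\<omega>\<in>space P. \<tau> t c \<omega> < b}"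
      by auto
    ultimately show "hit (leader_from B \<kappa> c) t t b \<in> events" "B \<inter> {\<omega>\<in>space P. \<tau> t c \<omega> \<in> \<kappa> \<omega> \<and> \<tau> t c \<omega> < b} \<in> events" by auto
  qed
  have "\<bar>1 * prob (A \<inter> hit (leader_from B K c) s a b) - colour_prob * prob (A \<inter> hit (leader_from B all_points c) s a b)\<bar>
      \<le> 0 * prob {\<omega>\<in>space P. a < \<tau> s b \<omega>}"
  proof (rule renewal_comparison)
    show "hereditary s a b (leader_from B K c)" "hereditary s a b (leader_from B all_points c)"
      using rat ord B colouring_K colouring_UNIV by (auto intro!: hereditary_leader_from)
    fix t assume t: "t \<in> \<rat>" "a < t" "t < b"
    show "\<bar>1 * prob (hit (leader_from B K c) t t b) - colour_prob * prob (hit (leader_from B all_points c) t t b)\<bar> \<le> 0"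
      unfolding full[OF t(1,3) colouring_K] full[OF t(1,3) colouring_UNIV]
      using colour_indep_fut[OF t(1) rat(3,4) t(3) ord(3) B] by simp
  qed (use rat ord A in auto)
  moreover have "A \<inter> hit (leader_from B K c) s a b = A \<inter> B \<inter> {\<omega>\<in>space P. \<tau> s c \<omega> \<in> K \<omega> \<and> a < \<tau> s c \<omega> \<and> \<tau> s c \<omega> < b}"
    "A \<inter> hit (leader_from B all_points c) s a b = A \<inter> B \<inter> {\<omega>\<in>space P. a < \<tau> s c \<omega> \<and> \<tau> s c \<omega> < b}"
    by (auto simp: hit_leader_from)
  ultimately show ?thesis by simp
qed

end

section \<open>Path space\<close>

lemma space_path_borel [simp]: "space path_borel = path_space"
  by (simp add: path_borel_def space_measure_of_conv)

lemma locally_uniform_open_sets: "{U. locally_uniform_open U} \<subseteq> Pow path_space"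
  by (auto simp: locally_uniform_open_def)

lemma sets_path_borel: "sets path_borel = sigma_sets path_space {U. locally_uniform_open U}"
  unfolding path_borel_def by (rule sets_measure_of[OF locally_uniform_open_sets])

lemma coordinate_measurable [measurable]: "(\<lambda>\<omega>. \<omega> t) \<in> borel_measurable path_borel"
proof (rule borel_measurableI)
  fix S :: "real set" assume S: "open S"
  have "locally_uniform_open ((\<lambda>\<omega>. \<omega> t) -` S \<inter> path_space)"
    unfolding locally_uniform_open_def
  proof (intro conjI ballI)
    fix \<omega> assume "\<omega> \<in> (\<lambda>\<omega>. \<omega> t) -` S \<inter> path_space"
    then obtain e where e: "e > 0" "ball (\<omega> t) e \<subseteq> S" using open_contains_ball[THEN iffD1, OF S] by blast
    have "{\<omega>' \<in> path_space. \<forall>s\<in>{t}. \<bar>\<omega>' s - \<omega> s\<bar> < e} \<subseteq> (\<lambda>\<omega>. \<omega> t) -` S \<inter> path_space"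
      using e(2) by (auto simp: dist_real_def abs_minus_commute subset_iff)
    then show "\<exists>K e. compact K \<and> e > 0 \<and> {\<omega>' \<in> path_space. \<forall>s\<in>K. \<bar>\<omega>' s - \<omega> s\<bar> < e} \<subseteq> (\<lambda>\<omega>. \<omega> t) -` S \<inter> path_space"
      using e(1) by (intro exI[of _ "{t}"] exI[of _ e]) auto
  qed auto
  then show "(\<lambda>\<omega>. \<omega> t) -` S \<inter> space path_borel \<in> sets path_borel"
    by (simp add: sets_path_borel sigma_sets.Basic)
qed

lemma continuous_bound_from_rationals:
  fixes f :: "real \<Rightarrow> real"
  assumes f: "continuous_on UNIV f" and "x < y" and "\<And>t. t \<in> \<rat> \<Longrightarrow> x \<le> t \<Longrightarrow> t \<le> y \<Longrightarrow> \<bar>f t - c\<bar> \<le> r"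
    and t: "x \<le> t" "t \<le> y"
  shows "\<bar>f t - c\<bar> \<le> r"
proof (rule ccontr)
  assume n: "\<not> \<bar>f t - c\<bar> \<le> r"
  have "open {s. r < \<bar>f s - c\<bar>}"
    using f by (intro open_Collect_less continuous_intros)
  then obtain d where d: "d > 0" "ball t d \<subseteq> {s. r < \<bar>f s - c\<bar>}"
    using n open_contains_ball[of "{s. r < \<bar>f s - c\<bar>}"] by (auto simp: not_le)
  have "max x (t - d) < min y (t + d)" using assms(2) t d by auto
  then obtain s where s: "s \<in> \<rat>" "max x (t - d) < s" "s < min y (t + d)" using Rats_dense_in_real by blast
  then have "s \<in> ball t d" by (auto simp: dist_real_def)
  then show False using d(2) assms(3)[of s] s by auto
qed

text \<open>A countable family of neighbourhoods: \<open>N\<close> is the half-length of the time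
  interval, \<open>Suc m\<close> the number of cells per unit of time,
  \<open>inverse (real (Suc j))\<close> the tolerance, and \<open>q\<close> lists one rational level
  per cell. Only rational times are tested, so a tube is a countable intersection of coordinate
  events.\<close>

definition tube :: "nat \<Rightarrow> nat \<Rightarrow> nat \<Rightarrow> rat list \<Rightarrow> path set" where
  "tube N m j q = {\<omega>\<in>path_space. \<forall>k<length q. \<forall>t\<in>\<rat>.
     - real N + real k / real (Suc m) \<le> t \<longrightarrow> t \<le> - real N + real (Suc k) / real (Suc m) \<longrightarrow>
     \<bar>\<omega> t - of_rat (q ! k)\<bar> \<le> inverse (real (Suc j))}"

text \<open>Separability of the path space: by uniform continuity on a compact interval, a step
  function with rational levels follows the path up to any tolerance.\<close>

lemma tube_between:
  assumes U: "locally_uniform_open U" and \<omega>: "\<omega> \<in> U"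
  shows "\<exists>N m j q. \<omega> \<in> tube N m j q \<and> tube N m j q \<subseteq> U"
proof -
  obtain C e where C: "compact C" "e > 0" "{\<omega>' \<in> path_space. \<forall>t\<in>C. \<bar>\<omega>' t - \<omega> t\<bar> < e} \<subseteq> U"
    using U \<omega> unfolding locally_uniform_open_def by blast
  have \<omega>p: "\<omega> \<in> path_space" using U \<omega> unfolding locally_uniform_open_def by blast
  then have cont: "continuous_on UNIV \<omega>" by (simp add: path_space_def)
  obtain B where B: "\<And>t. t \<in> C \<Longrightarrow> \<bar>t\<bar> \<le> B" using C(1) compact_imp_bounded bounded_iff by (metis real_norm_def)
  obtain N :: nat where N: "B \<le> real N" using real_arch_simple by blast
  \<comment> \<open>Two paths in the same tube are compared through a common level, hence the half
    of \<open>e\<close>.\<close>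
  obtain j :: nat where j: "inverse (real (Suc j)) < e / 2" using reals_Archimedean[of "e / 2"] C(2) by auto
  define r where "r = inverse (real (Suc j))"
  have r: "0 < r" by (simp add: r_def)
  have "uniformly_continuous_on {- real N - 1..real N + 1} \<omega>"
    by (rule compact_uniformly_continuous[OF continuous_on_subset[OF cont]]) auto
  then obtain d where d: "d > 0" "\<And>s t. s \<in> {- real N - 1..real N + 1} \<Longrightarrow> t \<in> {- real N - 1..real N + 1} \<Longrightarrow> \<bar>s - t\<bar> < d \<Longrightarrow> \<bar>\<omega> s - \<omega> t\<bar> < r / 2"
    unfolding uniformly_continuous_on_def dist_real_def using r by (metis half_gt_zero)
  obtain m :: nat where m: "inverse (real (Suc m)) < d" using reals_Archimedean[OF d(1)] by blast
  let ?h = "inverse (real (Suc m))"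
  have h1: "0 < ?h" "?h \<le> 1" by (simp_all add: inverse_le_1_iff)
  let ?x = "\<lambda>k. - real N + real k / real (Suc m)"
  have xS: "?x (Suc k) = ?x k + ?h" for k by (simp add: add_divide_distrib inverse_eq_divide)
  have "\<exists>q::rat. \<bar>\<omega> (?x k) - of_rat q\<bar> < r / 2" for k
  proof -
    obtain y where "y \<in> \<rat>" "\<omega> (?x k) < y" "y < \<omega> (?x k) + r / 2"
      using Rats_dense_in_real[of "\<omega> (?x k)" "\<omega> (?x k) + r / 2"] r by auto
    moreover from this obtain p where "y = of_rat p" by (auto elim: Rats_cases)
    ultimately show ?thesis by (intro exI[of _ p]) auto
  qed
  then obtain Q :: "nat \<Rightarrow> rat" where Q: "\<And>k. \<bar>\<omega> (?x k) - of_rat (Q k)\<bar> < r / 2" by metis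
  \<comment> \<open>The additional cell starts at \<open>N\<close>: rounding down selects it for the
    time \<open>N\<close> itself. It is also the reason for uniform continuity up to
    \<open>N + 1\<close>.\<close>
  define q where "q = map Q [0..<2 * N * Suc m + 1]"
  have lq: "length q = 2 * N * Suc m + 1" by (simp add: q_def)
  have qk: "q ! k = Q k" if "k < length q" for k using that unfolding q_def by (simp del: upt_Suc)
  have xk: "?x k \<in> {- real N - 1..real N + 1}" "?x k + ?h \<le> real N + 1" if "k < length q" for k
  proof -
    have "real k \<le> 2 * real N * real (Suc m)" using that lq by (metis Suc_eq_plus1 less_Suc_eq_le of_nat_le_iff of_nat_mult of_nat_numeral)
    then have "real k / real (Suc m) \<le> 2 * real N" by (simp add: divide_le_eq)
    then have "?x k \<le> real N" by linarith
    moreover have "- real N \<le> ?x k" using divide_nonneg_nonneg[of "real k" "real (Suc m)"] by linarith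
    ultimately show "?x k \<in> {- real N - 1..real N + 1}" "?x k + ?h \<le> real N + 1" using h1 unfolding atLeastAtMost_iff by linarith+
  qed
  have close: "\<bar>\<omega> t - of_rat (q ! k)\<bar> \<le> r" if k: "k < length q" and t: "?x k \<le> t" "t \<le> ?x (Suc k)" for k t
  proof -
    have "t \<in> {- real N - 1..real N + 1}" using xk[OF k] t xS[of k] by auto
    moreover have "\<bar>t - ?x k\<bar> < d" using t xS[of k] m by simp
    ultimately have "\<bar>\<omega> t - \<omega> (?x k)\<bar> < r / 2" using d(2) xk(1)[OF k] by blast
    then show ?thesis using Q[of k] unfolding qk[OF k] by linarith
  qed
  have "\<omega> \<in> tube N m j q" using \<omega>p close unfolding tube_def r_def by blast
  moreover have "tube N m j q \<subseteq> U"
  proof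
    fix \<omega>' assume w: "\<omega>' \<in> tube N m j q"
    then have wp: "\<omega>' \<in> path_space" by (simp add: tube_def)
    then have cont': "continuous_on UNIV \<omega>'" by (simp add: path_space_def)
    have "\<bar>\<omega>' t - \<omega> t\<bar> < e" if "t \<in> C" for t
    proof -
      have tN: "- real N \<le> t" "t \<le> real N" using B[OF that] N by auto
      define k where "k = nat \<lfloor>(t + real N) * real (Suc m)\<rfloor>"
      have nn: "0 \<le> (t + real N) * real (Suc m)" using tN by simp
      have k: "real k \<le> (t + real N) * real (Suc m)" "(t + real N) * real (Suc m) < real k + 1"
        using nn unfolding k_def by (simp_all add: of_nat_nat)
      have "real k \<le> 2 * real N * real (Suc m)" using k(1) tN by (smt (verit) mult_right_mono of_nat_0_le_iff)
      then have "real k \<le> real (2 * N * Suc m)" by (simp add: algebra_simps)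
      then have kq: "k < length q" unfolding lq of_nat_le_iff by simp
      have t1: "?x k \<le> t" using k(1) by (simp add: field_simps)
      have t2: "t \<le> ?x (Suc k)" using k(2) by (simp add: field_simps)
      have "\<bar>\<omega>' t - of_rat (q ! k)\<bar> \<le> r"
      proof (rule continuous_bound_from_rationals[OF cont', of "?x k" "?x (Suc k)"])
        show "?x k < ?x (Suc k)" using xS[of k] h1 by simp
        show "\<bar>\<omega>' s - of_rat (q ! k)\<bar> \<le> r" if "s \<in> \<rat>" "?x k \<le> s" "s \<le> ?x (Suc k)" for s
          using w kq that unfolding tube_def r_def by blast
      qed (use t1 t2 in auto)
      then show ?thesis using close[OF kq t1 t2] j unfolding r_def by linarith
    qed
    then show "\<omega>' \<in> U" using C(3) wp by blast
  qed
  ultimately show ?thesis by blast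
qed

text \<open>Every open set is the union of the tubes inside it, and there are only countably many
  tubes; so the coordinates generate the Borel field of the path space.\<close>

lemma path_measurableI:
  assumes sp: "space N = path_space" and N: "\<And>t. (\<lambda>\<omega>. \<omega> t) \<in> borel_measurable N"
  shows "sets path_borel \<subseteq> sets N"
  unfolding sets_path_borel
proof (rule sets.sigma_sets_subset[of _ N, unfolded sp])
  have tube: "tube a m j q \<in> sets N" for a m j q
  proof -
    let ?P = "\<lambda>k t. - real a + real k / real (Suc m) \<le> t \<and> t \<le> - real a + real (Suc k) / real (Suc m)"
    let ?b = "inverse (real (Suc j))"
    have "tube a m j q = space N - (\<Union>k<length q. \<Union>t\<in>{t\<in>\<rat>. ?P k t}. {\<omega>\<in>space N. ?b < \<bar>\<omega> t - of_rat (q ! k)\<bar>})"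
      unfolding tube_def sp not_less[symmetric] by blast
    also have "\<dots> \<in> sets N"
    proof -
      have "{\<omega>\<in>space N. ?b < \<bar>\<omega> t - of_rat (q ! k)\<bar>} \<in> sets N" for k t using N[of t] by measurable
      moreover have "countable {t\<in>\<rat>. ?P k t}" for k by (rule countable_subset[OF _ countable_rat]) auto
      ultimately have *: "(\<Union>t\<in>{t\<in>\<rat>. ?P k t}. {\<omega>\<in>space N. ?b < \<bar>\<omega> t - of_rat (q ! k)\<bar>}) \<in> sets N" for k
        by (intro sets.countable_UN') auto
      show ?thesis by (rule sets.Diff[OF sets.top sets.finite_UN]) (use * in blast)+
    qed
    finally show ?thesis .
  qed
  show "{U. locally_uniform_open U} \<subseteq> sets N"
  proof
    fix U assume "U \<in> {U. locally_uniform_open U}"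
    then have U: "locally_uniform_open U" by simp
    let ?I = "{(a, m, j, q). tube a m j q \<subseteq> U}"
    have "U = (\<Union>(a, m, j, q)\<in>?I. tube a m j q)"
    proof
      show "U \<subseteq> (\<Union>(a, m, j, q)\<in>?I. tube a m j q)" using tube_between[OF U] by fast
    qed auto
    also have "\<dots> \<in> sets N"
      using tube by (intro sets.countable_UN' countableI_type) (auto split: prod.splits)
    finally show "U \<in> sets N" .
  qed
qed

section \<open>Increments of the two-sided Brownian motion\<close>

locale wiener =
  fixes W :: "path measure"
  assumes two_sided: "two_sided_wiener_measure W"

sublocale wiener \<subseteq> prob_space W
  using two_sided unfolding two_sided_wiener_measure_def standard_brownian_motion_def by blast

text \<open>The enumeration is continued beyond \<open>n\<close> to a strictly increasing sequence
  on all naturals, which is how times enter \<open>standard_brownian_motion\<close>.\<close>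

lemma finite_grid:
  fixes T :: "real set"
  assumes "finite T"
  shows "T \<noteq> {} \<Longrightarrow> \<exists>f n. strict_mono f \<and> f ` {..n::nat} = T"
  using assms
proof (induction T rule: finite_linorder_max_induct)
  case empty then show ?case by simp
next
  case (insert b A)
  show ?case
  proof (cases "A = {}")
    case True
    have "strict_mono (\<lambda>i. b + real i)" by (simp add: strict_mono_def)
    then show ?thesis using True by (intro exI[of _ "\<lambda>i. b + real i"] exI[of _ 0]) auto
  next
    case False
    then obtain f and n :: nat where f: "strict_mono f" "f ` {..n} = A" using insert.IH by blast
    define g where "g i = (if i \<le> n then f i else b + real (i - Suc n))" for i
    have fb: "f n < b" using f insert.hyps by auto
    have "g i < g (Suc i)" for i
    proof (cases "i < n")
      case True then show ?thesis using f(1) by (simp add: g_def strict_mono_Suc_iff)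
    next
      case False
      then show ?thesis using fb by (cases "i = n") (auto simp: g_def)
    qed
    then have "strict_mono g" by (simp add: strict_mono_Suc_iff)
    moreover have "g ` {..Suc n} = insert b A"
    proof -
      have "g ` {..n} = A" using f(2) by (auto simp: g_def)
      then show ?thesis by (simp add: atMost_Suc) (simp add: g_def)
    qed
    ultimately show ?thesis by blast
  qed
qed

context wiener begin

lemma space_W [simp]: "space W = path_space"
  and sets_path_borel_W: "sets path_borel \<subseteq> sets W"
proof -
  obtain P where P: "sets P = sets path_borel" "W = completion P"
    using two_sided unfolding two_sided_wiener_measure_def by blast
  have "space P = path_space" using sets_eq_imp_space_eq[OF P(1)] by simp
  then show "space W = path_space" using P by simp
  show "sets path_borel \<subseteq> sets W" using P by auto
qed

lemma coordinate_W [measurable]: "(\<lambda>\<omega>. \<omega> t) \<in> borel_measurable W"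
  using coordinate_measurable[of t] sets_path_borel_W by (auto simp: measurable_def)

lemma path_0: "\<omega> \<in> path_space \<Longrightarrow> \<omega> 0 = 0" and path_cont: "\<omega> \<in> path_space \<Longrightarrow> continuous_on UNIV \<omega>"
  by (simp_all add: path_space_def)

abbreviation normal_law :: "real \<Rightarrow> real measure" where
  "normal_law d \<equiv> density lborel (normal_density 0 (sqrt d))"

text \<open>On the negative half the increment is one of the reversed motion with opposite sign, and
  the centred normal law is symmetric. Intervals across 0 are covered later by shift
  invariance.\<close>

lemma distr_increment_half:
  assumes "u < v" "0 \<le> u \<or> v \<le> 0"
  shows "distr W borel (\<lambda>\<omega>. \<omega> v - \<omega> u) = normal_law (v - u)"
proof -
  have bm: "standard_brownian_motion W (\<lambda>t \<omega>. \<omega> t)" "standard_brownian_motion W (\<lambda>t \<omega>. \<omega> (- t))"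
    using two_sided unfolding two_sided_wiener_measure_def by blast+
  have "distributed W lborel (\<lambda>\<omega>. \<omega> v - \<omega> u) (normal_density 0 (sqrt (v - u)))"
  proof (cases "0 \<le> u")
    case True
    then show ?thesis using bm(1) assms unfolding standard_brownian_motion_def by blast
  next
    case False
    then have "0 \<le> - v \<and> - v < - u" using assms by auto
    then have "distributed W lborel (\<lambda>\<omega>. \<omega> (- (- u)) - \<omega> (- (- v))) (normal_density 0 (sqrt (- u - (- v))))"
      using bm(2) unfolding standard_brownian_motion_def by blast
    then have "distributed W lborel (\<lambda>\<omega>. \<omega> u - \<omega> v) (normal_density 0 (sqrt (v - u)))" by simp
    from normal_density_affine[OF this, of "-1" 0] show ?thesis using assms by simp
  qed
  then have "distr W lborel (\<lambda>\<omega>. \<omega> v - \<omega> u) = normal_law (v - u)" by (rule distributed_distr_eq_density)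
  moreover have "distr W borel (\<lambda>\<omega>. \<omega> v - \<omega> u) = distr W lborel (\<lambda>\<omega>. \<omega> v - \<omega> u)" by (rule distr_cong) auto
  ultimately show ?thesis by simp
qed

lemma grid_increments_indep_half:
  assumes f: "strict_mono f" "f k = 0" and S: "\<And>j. S j \<in> sets borel"
  shows "prob {\<omega>\<in>path_space. \<forall>j\<in>{k..<n}. \<omega> (f (Suc j)) - \<omega> (f j) \<in> S j} =
      (\<Prod>j\<in>{k..<n}. prob {\<omega>\<in>path_space. \<omega> (f (Suc j)) - \<omega> (f j) \<in> S j})"
    and "prob {\<omega>\<in>path_space. \<forall>j<k. \<omega> (f (Suc j)) - \<omega> (f j) \<in> S j} =
      (\<Prod>j<k. prob {\<omega>\<in>path_space. \<omega> (f (Suc j)) - \<omega> (f j) \<in> S j})"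
proof -
  have bm: "standard_brownian_motion W (\<lambda>t \<omega>. \<omega> t)" "standard_brownian_motion W (\<lambda>t \<omega>. \<omega> (- t))"
    using two_sided unfolding two_sided_wiener_measure_def by blast+
  show "prob {\<omega>\<in>path_space. \<forall>j\<in>{k..<n}. \<omega> (f (Suc j)) - \<omega> (f j) \<in> S j} =
      (\<Prod>j\<in>{k..<n}. prob {\<omega>\<in>path_space. \<omega> (f (Suc j)) - \<omega> (f j) \<in> S j})"
  proof (cases "k < n")
    case False
    then show ?thesis using prob_space by simp
  next
    case True
    have ne: "{..<n - k} \<noteq> {}" using True by (simp add: lessThan_empty_iff)
    have ax: "\<And>t n. 0 \<le> t 0 \<Longrightarrow> mono t \<Longrightarrow> indep_vars (\<lambda>_. borel) (\<lambda>i \<omega>. \<omega> (t (Suc i)) - \<omega> (t i)) {..<n}"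
      using bm(1) unfolding standard_brownian_motion_def by blast
    have "mono (\<lambda>i. f (k + i))" using f(1) by (auto simp: mono_def strict_mono_less_eq)
    then have "indep_vars (\<lambda>_. borel) (\<lambda>i \<omega>. \<omega> (f (k + Suc i)) - \<omega> (f (k + i))) {..<n - k}"
      using ax[of "\<lambda>i. f (k + i)" "n - k"] f(2) by simp
    from indep_varsD_finite[OF this, of "\<lambda>i. S (k + i)"] ne S
    have "prob (\<Inter>i<n - k. (\<lambda>\<omega>. \<omega> (f (k + Suc i)) - \<omega> (f (k + i))) -` S (k + i) \<inter> space W) =
       (\<Prod>i<n - k. prob ((\<lambda>\<omega>. \<omega> (f (k + Suc i)) - \<omega> (f (k + i))) -` S (k + i) \<inter> space W))" by auto
    moreover have "(\<Inter>i<n - k. (\<lambda>\<omega>. \<omega> (f (k + Suc i)) - \<omega> (f (k + i))) -` S (k + i) \<inter> space W) =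
       {\<omega>\<in>path_space. \<forall>j\<in>{k..<n}. \<omega> (f (Suc j)) - \<omega> (f j) \<in> S j}"
    proof (intro set_eqI iffI)
      fix \<omega> assume a: "\<omega> \<in> (\<Inter>i<n - k. (\<lambda>\<omega>. \<omega> (f (k + Suc i)) - \<omega> (f (k + i))) -` S (k + i) \<inter> space W)"
      have "\<omega> (f (Suc j)) - \<omega> (f j) \<in> S j" if "j \<in> {k..<n}" for j
        using a that INT_D[OF a, of "j - k"] by auto
      moreover have "\<omega> \<in> path_space" using INT_D[OF a, of 0] True by simp
      ultimately show "\<omega> \<in> {\<omega>\<in>path_space. \<forall>j\<in>{k..<n}. \<omega> (f (Suc j)) - \<omega> (f j) \<in> S j}" by blast
    qed auto
    moreover have "(\<Prod>i<n - k. prob ((\<lambda>\<omega>. \<omega> (f (k + Suc i)) - \<omega> (f (k + i))) -` S (k + i) \<inter> space W)) =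
       (\<Prod>j\<in>{k..<n}. prob {\<omega>\<in>path_space. \<omega> (f (Suc j)) - \<omega> (f j) \<in> S j})"
    proof (rule prod.reindex_bij_witness[of _ "\<lambda>j. j - k" "\<lambda>i. k + i"])
      fix i assume "i \<in> {..<n - k}"
      show "prob {\<omega>\<in>path_space. \<omega> (f (Suc (k + i))) - \<omega> (f (k + i)) \<in> S (k + i)} =
        prob ((\<lambda>\<omega>. \<omega> (f (k + Suc i)) - \<omega> (f (k + i))) -` S (k + i) \<inter> space W)"
        by (intro arg_cong[of _ _ prob]) auto
    qed auto
    ultimately show ?thesis by simp
  qed
  show "prob {\<omega>\<in>path_space. \<forall>j<k. \<omega> (f (Suc j)) - \<omega> (f j) \<in> S j} =
      (\<Prod>j<k. prob {\<omega>\<in>path_space. \<omega> (f (Suc j)) - \<omega> (f j) \<in> S j})"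
  proof (cases "k = 0")
    case True
    then show ?thesis using prob_space by simp
  next
    case False
    have ne: "{..<k} \<noteq> {}" using False by (simp add: lessThan_empty_iff)
    \<comment> \<open>The grid points up to 0, read backwards as times of the reversed motion;
      beyond \<open>k\<close> the values only keep the sequence increasing.\<close>
    define t where "t i = (if i \<le> k then - f (k - i) else - f 0 + real (i - k))" for i
    have "t i \<le> t (Suc i)" for i
    proof (cases "i < k")
      case True
      then have "f (k - Suc i) \<le> f (k - i)" using f(1) by (simp add: strict_mono_less_eq)
      then show ?thesis using True by (simp add: t_def)
    qed (auto simp: t_def)
    then have "mono t" by (simp add: mono_iff_le_Suc)
    moreover have "0 \<le> t 0" using f(2) by (simp add: t_def)
    ultimately have iv: "indep_vars (\<lambda>_. borel) (\<lambda>i \<omega>. \<omega> (- t (Suc i)) - \<omega> (- t i)) {..<k}"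
      using bm(2) unfolding standard_brownian_motion_def by blast
    \<comment> \<open>Increments of the reversed motion have the opposite sign, hence the reflected
      sets in reversed order.\<close>
    let ?S = "\<lambda>i. uminus ` S (k - Suc i)"
    have S': "?S i \<in> sets borel" for i
    proof -
      have "?S i = uminus -` S (k - Suc i) \<inter> space borel" by (auto simp: image_iff) (metis minus_minus)
      moreover have "(uminus :: real \<Rightarrow> real) \<in> borel_measurable borel" by measurable
      ultimately show ?thesis using S measurable_sets by metis
    qed
    have mem: "\<omega> (- t (Suc i)) - \<omega> (- t i) \<in> ?S i \<longleftrightarrow> \<omega> (f (Suc (k - Suc i))) - \<omega> (f (k - Suc i)) \<in> S (k - Suc i)"
      if "i < k" for i and \<omega> :: path
    proof -
      have "x \<in> uminus ` A \<longleftrightarrow> - x \<in> A" for x :: real and A by force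
      then show ?thesis using that by (simp add: t_def Suc_diff_Suc)
    qed
    from indep_varsD_finite[OF iv, of ?S] ne S'
    have "prob (\<Inter>i<k. (\<lambda>\<omega>. \<omega> (- t (Suc i)) - \<omega> (- t i)) -` ?S i \<inter> space W) =
       (\<Prod>i<k. prob ((\<lambda>\<omega>. \<omega> (- t (Suc i)) - \<omega> (- t i)) -` ?S i \<inter> space W))" by auto
    moreover have "(\<Inter>i<k. (\<lambda>\<omega>. \<omega> (- t (Suc i)) - \<omega> (- t i)) -` ?S i \<inter> space W) =
       {\<omega>\<in>path_space. \<forall>j<k. \<omega> (f (Suc j)) - \<omega> (f j) \<in> S j}"
    proof (intro set_eqI iffI)
      fix \<omega> assume a: "\<omega> \<in> (\<Inter>i<k. (\<lambda>\<omega>. \<omega> (- t (Suc i)) - \<omega> (- t i)) -` ?S i \<inter> space W)"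
      have "\<omega> (f (Suc j)) - \<omega> (f j) \<in> S j" if "j < k" for j
      proof -
        have "\<omega> (- t (Suc (k - Suc j))) - \<omega> (- t (k - Suc j)) \<in> ?S (k - Suc j)"
          using INT_D[OF a, of "k - Suc j"] that by auto
        then show ?thesis using mem[of "k - Suc j" \<omega>] that by (simp add: Suc_diff_Suc)
      qed
      moreover have "\<omega> \<in> path_space" using INT_D[OF a, of 0] False by simp
      ultimately show "\<omega> \<in> {\<omega>\<in>path_space. \<forall>j<k. \<omega> (f (Suc j)) - \<omega> (f j) \<in> S j}" by blast
    next
      fix \<omega> assume a: "\<omega> \<in> {\<omega>\<in>path_space. \<forall>j<k. \<omega> (f (Suc j)) - \<omega> (f j) \<in> S j}"
      then have "\<omega> (- t (Suc i)) - \<omega> (- t i) \<in> ?S i" if "i < k" for i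
        using mem[OF that, of \<omega>] that by simp
      then show "\<omega> \<in> (\<Inter>i<k. (\<lambda>\<omega>. \<omega> (- t (Suc i)) - \<omega> (- t i)) -` ?S i \<inter> space W)" using a by auto
    qed
    moreover have "(\<Prod>i<k. prob ((\<lambda>\<omega>. \<omega> (- t (Suc i)) - \<omega> (- t i)) -` ?S i \<inter> space W)) =
       (\<Prod>j<k. prob {\<omega>\<in>path_space. \<omega> (f (Suc j)) - \<omega> (f j) \<in> S j})"
    proof (rule prod.reindex_bij_witness[of _ "\<lambda>j. k - Suc j" "\<lambda>i. k - Suc i"])
      fix i assume "i \<in> {..<k}"
      then show "prob {\<omega>\<in>path_space. \<omega> (f (Suc (k - Suc i))) - \<omega> (f (k - Suc i)) \<in> S (k - Suc i)} =
        prob ((\<lambda>\<omega>. \<omega> (- t (Suc i)) - \<omega> (- t i)) -` ?S i \<inter> space W)"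
        using mem[of i] by (intro arg_cong[of _ _ prob]) auto
    qed auto
    ultimately show ?thesis by simp
  qed
qed

text \<open>Because the grid passes through 0, no increment crosses it. The increments are
  independent within each half, and the two halves of the motion are independent of each
  other.\<close>

lemma grid_increments_indep:
  assumes f: "strict_mono f" "f k = 0" and k: "k \<le> n"
  shows "indep_vars (\<lambda>_. borel) (\<lambda>i \<omega>. \<omega> (f (Suc i)) - \<omega> (f i)) {..<n}"
proof (cases "n = 0")
  case True
  then show ?thesis by (simp add: indep_vars_def indep_sets_def)
next
  case False
  let ?X = "\<lambda>i \<omega>. \<omega> (f (Suc i)) - \<omega> (f i)"
  have "indep_sets (\<lambda>i. {?X i -` A \<inter> space W |A. A \<in> sets borel}) {..<n}"
  proof (subst indep_sets_finite)
    show "{?X i -` A \<inter> space W |A. A \<in> sets borel} \<subseteq> events" for i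
    proof -
      have "?X i \<in> borel_measurable W" by measurable
      from measurable_sets[OF this] show ?thesis by blast
    qed
    show "space W \<in> {?X i -` A \<inter> space W |A. A \<in> sets borel}" for i by (auto intro!: exI[of _ UNIV])
    show "\<forall>A\<in>Pi {..<n} (\<lambda>i. {?X i -` A \<inter> space W |A. A \<in> sets borel}). prob (\<Inter>j\<in>{..<n}. A j) = (\<Prod>j\<in>{..<n}. prob (A j))"
    proof
      fix A assume A: "A \<in> Pi {..<n} (\<lambda>i. {?X i -` A \<inter> space W |A. A \<in> sets borel})"
      then have "\<forall>i\<in>{..<n}. \<exists>S. A i = ?X i -` S \<inter> space W \<and> S \<in> sets borel" by blast
      then obtain S0 where S0: "\<And>i. i < n \<Longrightarrow> A i = ?X i -` S0 i \<inter> space W \<and> S0 i \<in> sets borel"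
        unfolding bchoice_iff by auto
      define S where "S i = (if i < n then S0 i else UNIV)" for i
      have S: "S i \<in> sets borel" for i using S0 by (simp add: S_def)
      have A_eq: "A i = {\<omega>\<in>path_space. ?X i \<omega> \<in> S i}" if "i < n" for i
        using S0[OF that] that by (auto simp: S_def)
      let ?EP = "{\<omega>\<in>path_space. \<forall>j\<in>{k..<n}. ?X j \<omega> \<in> S j}"
      let ?EN = "{\<omega>\<in>path_space. \<forall>j<k. ?X j \<omega> \<in> S j}"
      let ?M = "\<Pi>\<^sub>M t\<in>{0::real..}. (borel :: real measure)"
      have comp: "(\<lambda>g. g x) \<in> borel_measurable ?M" if "0 \<le> x" for x using that by simp
      have fk: "0 \<le> f j" if "k \<le> j" for j using f that by (metis strict_mono_less_eq)
      have fk': "f j \<le> 0" if "j \<le> k" for j using f that by (metis strict_mono_less_eq)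
      let ?XP = "{g\<in>space ?M. \<forall>j\<in>{k..<n}. g (f (Suc j)) - g (f j) \<in> S j}"
      let ?XN = "{g\<in>space ?M. \<forall>j\<in>{..<k}. g (- f (Suc j)) - g (- f j) \<in> S j}"
      have XP: "?XP \<in> sets ?M"
      proof (rule sets.sets_Collect_finite_All)
        fix j assume "j \<in> {k..<n}"
        then have "(\<lambda>g. g (f (Suc j)) - g (f j)) \<in> borel_measurable ?M" using fk by (intro borel_measurable_diff comp) auto
        from measurable_sets[OF this S[of j]] show "{g\<in>space ?M. g (f (Suc j)) - g (f j) \<in> S j} \<in> sets ?M"
          by (simp add: vimage_def Int_def conj_commute)
      qed simp
      have XN: "?XN \<in> sets ?M"
      proof (rule sets.sets_Collect_finite_All)
        fix j assume "j \<in> {..<k}"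
        then have "(\<lambda>g. g (- f (Suc j)) - g (- f j)) \<in> borel_measurable ?M" using fk' by (intro borel_measurable_diff comp) auto
        from measurable_sets[OF this S[of j]] show "{g\<in>space ?M. g (- f (Suc j)) - g (- f j) \<in> S j} \<in> sets ?M"
          by (simp add: vimage_def Int_def conj_commute)
      qed simp
      have iv: "indep_var ?M (\<lambda>\<omega>. \<lambda>t\<in>{0..}. \<omega> t) ?M (\<lambda>\<omega>. \<lambda>t\<in>{0..}. \<omega> (- t))"
        using two_sided unfolding two_sided_wiener_measure_def by blast
      have eP: "(\<lambda>\<omega>. \<lambda>t\<in>{0..}. \<omega> t) -` ?XP \<inter> space W = ?EP"
        using fk by (auto simp: space_PiM PiE_def)
      have eN: "(\<lambda>\<omega>. \<lambda>t\<in>{0..}. \<omega> (- t)) -` ?XN \<inter> space W = ?EN"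
        using fk' by (auto simp: space_PiM PiE_def)
      have "prob (?EP \<inter> ?EN) = prob ?EP * prob ?EN"
      proof -
        have "(\<lambda>\<omega>. (\<lambda>t\<in>{0..}. \<omega> t, \<lambda>t\<in>{0..}. \<omega> (- t))) -` (?XP \<times> ?XN) \<inter> space W = ?EP \<inter> ?EN"
          unfolding eP[symmetric] eN[symmetric] by blast
        then show ?thesis using indep_varD[OF iv XP XN] unfolding eP eN by simp
      qed
      moreover have "(\<Inter>j\<in>{..<n}. A j) = ?EP \<inter> ?EN"
      proof -
        have "(\<Inter>j\<in>{..<n}. A j) = {\<omega>\<in>path_space. \<forall>j<n. ?X j \<omega> \<in> S j}"
          using A_eq False by (auto simp: set_eq_iff)
        also have "\<dots> = ?EP \<inter> ?EN" using k by (auto simp: not_less)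
        finally show ?thesis .
      qed
      moreover have "(\<Prod>j\<in>{..<n}. prob (A j)) = (\<Prod>j\<in>{k..<n}. prob {\<omega>\<in>path_space. ?X j \<omega> \<in> S j}) * (\<Prod>j<k. prob {\<omega>\<in>path_space. ?X j \<omega> \<in> S j})"
      proof -
        have "{..<n} = {k..<n} \<union> {..<k}" "{k..<n} \<inter> {..<k} = {}" using k by auto
        then have "(\<Prod>j\<in>{..<n}. prob (A j)) = (\<Prod>j\<in>{k..<n}. prob (A j)) * (\<Prod>j<k. prob (A j))"
          by (simp add: prod.union_disjoint)
        then show ?thesis using A_eq k by simp
      qed
      ultimately show "prob (\<Inter>j\<in>{..<n}. A j) = (\<Prod>j\<in>{..<n}. prob (A j))"
        using grid_increments_indep_half[OF f, of S] S by simp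
    qed
  qed (use False in auto)
  then show ?thesis unfolding indep_vars_def2 by simp
qed

end

section \<open>Invariance of Wiener measure under Levy shifts\<close>

lemma measurable_path_borelI:
  assumes f: "\<And>x. x \<in> space N \<Longrightarrow> f x \<in> path_space" and c: "\<And>t. (\<lambda>x. f x t) \<in> borel_measurable N"
  shows "f \<in> measurable N path_borel"
proof -
  define C where "C = {A. A \<subseteq> path_space \<and> f -` A \<inter> space N \<in> sets N}"
  have C: "sigma_algebra path_space C"
    unfolding sigma_algebra_iff2 C_def
  proof (intro conjI ballI allI impI)
    fix A assume "A \<in> {A. A \<subseteq> path_space \<and> f -` A \<inter> space N \<in> sets N}"
    moreover have "f -` (path_space - A) \<inter> space N = space N - (f -` A \<inter> space N)" using f by auto
    ultimately show "path_space - A \<in> {A. A \<subseteq> path_space \<and> f -` A \<inter> space N \<in> sets N}" by auto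
  next
    fix A :: "nat \<Rightarrow> path set" assume "range A \<subseteq> {A. A \<subseteq> path_space \<and> f -` A \<inter> space N \<in> sets N}"
    then have A: "A i \<subseteq> path_space" "f -` A i \<inter> space N \<in> sets N" for i by auto
    have "(\<Union>i. f -` A i \<inter> space N) \<in> sets N" by (rule sets.countable_nat_UN) (use A(2) in blast)
    moreover have "f -` (\<Union>i. A i) \<inter> space N = (\<Union>i. f -` A i \<inter> space N)" by auto
    ultimately have "f -` (\<Union>i. A i) \<inter> space N \<in> sets N" by simp
    then show "(\<Union>i. A i) \<in> {A. A \<subseteq> path_space \<and> f -` A \<inter> space N \<in> sets N}" using A(1) by blast
  qed auto
  have s: "sets (sigma path_space C) = C" using C sigma_algebra.sigma_sets_eq[OF C] by (simp add: sigma_algebra.sets_measure_of_eq)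
  have "sets path_borel \<subseteq> sets (sigma path_space C)"
  proof (rule path_measurableI)
    fix t
    show "(\<lambda>\<omega>. \<omega> t) \<in> borel_measurable (sigma path_space C)"
    proof (rule measurableI)
      fix B :: "real set" assume B: "B \<in> sets borel"
      have "f -` ((\<lambda>\<omega>. \<omega> t) -` B \<inter> path_space) \<inter> space N = (\<lambda>x. f x t) -` B \<inter> space N" using f by auto
      then show "(\<lambda>\<omega>. \<omega> t) -` B \<inter> space (sigma path_space C) \<in> sets (sigma path_space C)"
        unfolding s using measurable_sets[OF c B, of t] by (simp add: C_def space_measure_of_conv)
    qed simp
  qed (simp add: space_measure_of_conv)
  then show ?thesis using f s by (intro measurableI) (auto simp: C_def)
qed

lemma levy_shift_path_space: "\<omega> \<in> path_space \<Longrightarrow> levy_shift h \<omega> \<in> path_space"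
  by (auto simp: path_space_def levy_shift_def intro!: continuous_intros continuous_on_compose2[of UNIV \<omega>])

lemma levy_shift_measurable: "levy_shift h \<in> measurable path_borel path_borel"
proof (rule measurable_path_borelI)
  show "levy_shift h \<omega> \<in> path_space" if "\<omega> \<in> space path_borel" for \<omega> using that levy_shift_path_space by simp
  show "(\<lambda>\<omega>. levy_shift h \<omega> t) \<in> borel_measurable path_borel" for t unfolding levy_shift_def by measurable
qed

definition cylinder :: "real set \<Rightarrow> (real \<Rightarrow> real set) \<Rightarrow> path set" where
  "cylinder T A = {\<omega>\<in>path_space. \<forall>x\<in>T. \<omega> x \<in> A x}"

definition cylinders :: "path set set" where
  "cylinders = {cylinder T A | T A. finite T \<and> (\<forall>x. A x \<in> sets borel)}"

lemma Int_stable_cylinders: "Int_stable cylinders"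
proof (rule Int_stableI)
  fix a b assume "a \<in> cylinders" "b \<in> cylinders"
  then obtain S A T B where a: "a = cylinder S A" "finite S" "\<forall>x. A x \<in> sets borel"
    and b: "b = cylinder T B" "finite T" "\<forall>x. B x \<in> sets borel" unfolding cylinders_def by blast
  have "a \<inter> b = cylinder (S \<union> T) (\<lambda>x. (if x \<in> S then A x else UNIV) \<inter> (if x \<in> T then B x else UNIV))"
    unfolding a b cylinder_def by auto
  moreover have "finite (S \<union> T)" "\<forall>x. (if x \<in> S then A x else UNIV) \<inter> (if x \<in> T then B x else UNIV) \<in> sets borel"
    using a b by auto
  ultimately show "a \<inter> b \<in> cylinders" unfolding cylinders_def mem_Collect_eq by (intro exI conjI)
qed

lemma sigma_sets_cylinders: "sets path_borel = sigma_sets path_space cylinders"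
proof
  have sub: "cylinders \<subseteq> Pow path_space" by (auto simp: cylinders_def cylinder_def)
  show "sets path_borel \<subseteq> sigma_sets path_space cylinders"
  proof -
    have "sets path_borel \<subseteq> sets (sigma path_space cylinders)"
    proof (rule path_measurableI)
      fix t
      show "(\<lambda>\<omega>. \<omega> t) \<in> borel_measurable (sigma path_space cylinders)"
      proof (rule measurableI)
        fix B :: "real set" assume "B \<in> sets borel"
        then have "cylinder {t} (\<lambda>_. B) \<in> cylinders" unfolding cylinders_def by blast
        moreover have "(\<lambda>\<omega>. \<omega> t) -` B \<inter> path_space = cylinder {t} (\<lambda>_. B)" by (auto simp: cylinder_def)
        ultimately show "(\<lambda>\<omega>. \<omega> t) -` B \<inter> space (sigma path_space cylinders) \<in> sets (sigma path_space cylinders)"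
          using sub by (simp add: space_measure_of_conv)
      qed simp
    qed (simp add: space_measure_of_conv)
    then show ?thesis using sub by simp
  qed
  have "cylinders \<subseteq> sets path_borel"
  proof
    fix a assume "a \<in> cylinders"
    then obtain T A where a: "a = cylinder T A" "finite T" "\<forall>x. A x \<in> sets borel" unfolding cylinders_def by blast
    have "a = path_space \<inter> (space path_borel - (\<Union>x\<in>T. (\<lambda>\<omega>. \<omega> x) -` (UNIV - A x) \<inter> space path_borel))"
      unfolding a cylinder_def by auto
    also have "\<dots> \<in> sets path_borel"
    proof -
      have "(\<lambda>\<omega>. \<omega> x) -` (UNIV - A x) \<inter> space path_borel \<in> sets path_borel" for x
        using a(3) by (intro measurable_sets[OF coordinate_measurable]) auto
      then have "(\<Union>x\<in>T. (\<lambda>\<omega>. \<omega> x) -` (UNIV - A x) \<inter> space path_borel) \<in> sets path_borel"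
        using a(2) by blast
      moreover have "path_space \<in> sets path_borel" using sets.top[of path_borel] by simp
      ultimately show ?thesis by blast
    qed
    finally show "a \<in> sets path_borel" .
  qed
  then show "sigma_sets path_space cylinders \<subseteq> sets path_borel"
    using sets.sigma_sets_subset[of cylinders path_borel] by simp
qed

context wiener begin

text \<open>The joint law depends on the spacings only, so it does not change when the grid is
  translated to another grid through 0.\<close>

lemma grid_increments_law:
  assumes f: "strict_mono f" "f k = 0" and k: "k \<le> n" and n: "0 < n"
  shows "distr W (\<Pi>\<^sub>M i\<in>{..<n}. borel) (\<lambda>\<omega>. \<lambda>i\<in>{..<n}. \<omega> (f (Suc i)) - \<omega> (f i)) =
    (\<Pi>\<^sub>M i\<in>{..<n}. normal_law (f (Suc i) - f i))"
proof -
  have "distr W (\<Pi>\<^sub>M i\<in>{..<n}. borel) (\<lambda>\<omega>. \<lambda>i\<in>{..<n}. \<omega> (f (Suc i)) - \<omega> (f i)) =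
    (\<Pi>\<^sub>M i\<in>{..<n}. distr W borel (\<lambda>\<omega>. \<omega> (f (Suc i)) - \<omega> (f i)))"
    using grid_increments_indep[OF f k] n
    by (subst (asm) indep_vars_iff_distr_eq_PiM') (auto simp: lessThan_empty_iff)
  also have "\<dots> = (\<Pi>\<^sub>M i\<in>{..<n}. normal_law (f (Suc i) - f i))"
  proof (rule PiM_cong[OF refl])
    fix i
    have "0 \<le> f i \<or> f (Suc i) \<le> 0"
    proof (cases "k \<le> i")
      case True then show ?thesis using f by (metis strict_mono_less_eq)
    next
      case False then show ?thesis using f by (metis Suc_leI not_le strict_mono_less_eq)
    qed
    then show "distr W borel (\<lambda>\<omega>. \<omega> (f (Suc i)) - \<omega> (f i)) = normal_law (f (Suc i) - f i)"
      using f(1) by (intro distr_increment_half) (simp add: strict_mono_Suc_iff)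
  qed
  finally show ?thesis .
qed

text \<open>The increments of the shifted path over the grid \<open>f\<close> are those of the
  original path over \<open>h + f\<close>. Including both 0 and \<open>- h\<close> among the points
  of \<open>f\<close> lets both grids pass through 0, so that their increments have the same
  law.\<close>

lemma prob_levy_shift_cylinder:
  assumes T: "finite T" and A: "\<And>x. A x \<in> sets borel"
  shows "prob (levy_shift h -` cylinder T A \<inter> path_space) = prob (cylinder T A)"
proof -
  obtain f and n :: nat where f: "strict_mono f" "f ` {..n} = T \<union> {0, - h}"
    using finite_grid[of "T \<union> {0, - h}"] T by auto
  have "0 \<in> f ` {..n}" "- h \<in> f ` {..n}" unfolding f(2) by auto
  then obtain k l where k: "k \<le> n" "f k = 0" and l: "l \<le> n" "f l = - h"
    by (auto simp: image_iff)
  let ?N = "Suc n" and ?M = "\<Pi>\<^sub>M i\<in>{..<Suc n}. (borel :: real measure)"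
  let ?V = "\<lambda>f \<omega>. \<lambda>i\<in>{..<?N}. \<omega> (f (Suc i)) - \<omega> (f i) :: real"
  define g where "g i = h + f i" for i
  have g: "strict_mono g" "g l = 0" using f(1) l by (auto simp: g_def strict_mono_def)
  \<comment> \<open>Recovers \<open>\<omega> (f j)\<close> from the increments by summing away from
    the grid point \<open>f k = 0\<close>; one of the two sums is always empty.\<close>
  let ?val = "\<lambda>y j. (\<Sum>i\<in>{k..<j}. y i) - (\<Sum>i\<in>{j..<k}. y i)"
  define S where "S = {y\<in>space ?M. \<forall>j\<in>{j. j \<le> n \<and> f j \<in> T}. ?val y j \<in> A (f j)}"
  have S: "S \<in> sets ?M"
    unfolding S_def
  proof (rule sets.sets_Collect_finite_All)
    fix j assume "j \<in> {j. j \<le> n \<and> f j \<in> T}"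
    then have "(\<lambda>y. ?val y j) \<in> borel_measurable ?M" using k
      by (intro borel_measurable_diff borel_measurable_sum measurable_component_singleton) auto
    from measurable_sets[OF this A[of "f j"]] show "{y\<in>space ?M. ?val y j \<in> A (f j)} \<in> sets ?M"
      by (simp add: vimage_def Int_def conj_commute)
  qed simp
  have val: "?val (?V f \<omega>) j = \<omega> (f j)" if "\<omega> \<in> path_space" "j \<le> n" for \<omega> j
  proof -
    have "(\<Sum>i\<in>{a..<b}. ?V f \<omega> i) = \<omega> (f b) - \<omega> (f a)" if "a \<le> b" "b \<le> n" for a b
    proof -
      have "(\<Sum>i\<in>{a..<b}. ?V f \<omega> i) = (\<Sum>i\<in>{a..<b}. \<omega> (f (Suc i)) - \<omega> (f i))" using that by (intro sum.cong) auto
      also have "\<dots> = \<omega> (f b) - \<omega> (f a)" using sum_Suc_diff'[OF that(1), of "\<lambda>i. \<omega> (f i)"] by simp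
      finally show ?thesis .
    qed
    then show ?thesis using that k path_0[OF that(1)] by (cases "k \<le> j") auto
  qed
  have cyl: "cylinder T A = ?V f -` S \<inter> space W"
  proof (intro set_eqI iffI)
    fix \<omega> assume w: "\<omega> \<in> cylinder T A"
    then have "\<omega> \<in> path_space" by (simp add: cylinder_def)
    then show "\<omega> \<in> ?V f -` S \<inter> space W" using w val by (auto simp: S_def cylinder_def space_PiM)
  next
    fix \<omega> assume w: "\<omega> \<in> ?V f -` S \<inter> space W"
    have "\<omega> x \<in> A x" if "x \<in> T" for x
    proof -
      have "x \<in> f ` {..n}" using that f(2) by simp
      then obtain j where "j \<le> n" "x = f j" by auto
      then show ?thesis using w val[of \<omega> j] that by (auto simp: S_def)
    qed
    then show "\<omega> \<in> cylinder T A" using w by (simp add: cylinder_def)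
  qed
  have sh: "?V f (levy_shift h \<omega>) = ?V g \<omega>" for \<omega>
    by (auto simp: levy_shift_def g_def)
  have Vm: "?V f \<in> measurable W ?M" for f :: "nat \<Rightarrow> real" by (rule measurable_restrict) measurable
  have pr: "prob (?V f -` S \<inter> space W) = measure (\<Pi>\<^sub>M i\<in>{..<?N}. normal_law (f (Suc i) - f i)) S"
    if "strict_mono f" "f k = 0" "k \<le> n" for f k
    unfolding grid_increments_law[OF that(1,2) le_SucI[OF that(3)] zero_less_Suc, symmetric]
    by (rule measure_distr[OF Vm S, symmetric])
  have "levy_shift h -` cylinder T A \<inter> path_space = ?V g -` S \<inter> space W"
    unfolding cyl using levy_shift_path_space by (auto simp: sh)
  then have "prob (levy_shift h -` cylinder T A \<inter> path_space) = measure (\<Pi>\<^sub>M i\<in>{..<?N}. normal_law (g (Suc i) - g i)) S"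
    using pr[OF g l(1)] by simp
  also have "\<dots> = measure (\<Pi>\<^sub>M i\<in>{..<?N}. normal_law (f (Suc i) - f i)) S" by (simp add: g_def)
  also have "\<dots> = prob (cylinder T A)" unfolding cyl using pr[OF f(1) k(2,1)] by simp
  finally show ?thesis .
qed

lemma prob_levy_shift_borel:
  assumes E: "E \<in> sets path_borel"
  shows "prob (levy_shift h -` E \<inter> path_space) = prob E"
proof -
  have sub: "cylinders \<subseteq> Pow path_space" by (auto simp: cylinders_def cylinder_def)
  have m: "levy_shift h -` E \<inter> path_space \<in> events" "E \<in> events" "E \<subseteq> path_space" if "E \<in> sigma_sets path_space cylinders" for E
    using that measurable_sets[OF levy_shift_measurable, of E] sets_path_borel_W sets.sets_into_space[of E path_borel]
    unfolding sigma_sets_cylinders[symmetric] by auto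
  have "E \<in> sigma_sets path_space cylinders" using E sigma_sets_cylinders by simp
  from Int_stable_cylinders sub this show ?thesis
  proof (induction rule: sigma_sets_induct_disjoint)
    case (basic A) then show ?case using prob_levy_shift_cylinder unfolding cylinders_def by auto
  next
    case empty then show ?case by simp
  next
    case (compl A)
    have "levy_shift h -` (path_space - A) \<inter> path_space = space W - (levy_shift h -` A \<inter> path_space)"
      using levy_shift_path_space by auto
    moreover have "path_space - A = space W - A" by simp
    ultimately show ?case using compl m[OF compl(1)] by (simp only: prob_compl)
  next
    case (union A)
    have r: "range (\<lambda>i. levy_shift h -` A i \<inter> path_space) \<subseteq> events" "range A \<subseteq> events" using m[OF subsetD[OF union(2) rangeI]] by blast+
    have "(\<lambda>i. prob (levy_shift h -` A i \<inter> path_space)) sums prob (\<Union>i. levy_shift h -` A i \<inter> path_space)"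
      using r(1) union(1) by (intro finite_measure_UNION) (auto simp: disjoint_family_on_def Int_def vimage_def)
    moreover have "(\<lambda>i. prob (A i)) sums prob (\<Union>i. A i)"
      using r(2) union(1) by (intro finite_measure_UNION)
    moreover have "levy_shift h -` (\<Union>i. A i) \<inter> path_space = (\<Union>i. levy_shift h -` A i \<inter> path_space)" by auto
    ultimately show ?case using union(3) sums_unique2 by auto
  qed
qed

lemma null_subset: "N \<in> null_sets W \<Longrightarrow> B \<subseteq> N \<Longrightarrow> B \<in> null_sets W"
proof -
  obtain P where P: "W = completion P" using two_sided unfolding two_sided_wiener_measure_def by blast
  show "N \<in> null_sets W \<Longrightarrow> B \<subseteq> N \<Longrightarrow> B \<in> null_sets W" unfolding P by (rule null_sets_completion_subset)
qed

lemma events_borel_approx: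
  assumes "A \<in> events"
  obtains S N where "S \<in> sets path_borel" "N \<in> sets path_borel" "prob N = 0" "S \<subseteq> A" "A \<subseteq> S \<union> N"
proof -
  obtain P where P: "sets P = sets path_borel" "W = completion P"
    using two_sided unfolding two_sided_wiener_measure_def by blast
  from assms[unfolded P(2)] show ?thesis
  proof (rule sets_completionE)
    fix S N N' assume *: "A = S \<union> N" "N \<subseteq> N'" "N' \<in> null_sets P" "S \<in> sets P"
    have "N' \<in> null_sets W" using *(3) unfolding P(2) by (rule null_sets_completionI)
    then have "prob N' = 0" by (simp add: null_setsD1 measure_def)
    then show ?thesis using that[of S N'] * P(1) by auto
  qed
qed

text \<open>From Borel sets to the completion: an event differs from a Borel set by a part of a
  Borel null set, and the preimage of the latter is again a null set.\<close>

lemma levy_shift_events_prob: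
  assumes A: "A \<in> events"
  shows "levy_shift h -` A \<inter> space W \<in> events" "prob (levy_shift h -` A \<inter> space W) = prob A"
proof -
  obtain S N where S: "S \<in> sets path_borel" "N \<in> sets path_borel" "prob N = 0" "S \<subseteq> A" "A \<subseteq> S \<union> N"
    using events_borel_approx[OF A] by blast
  let ?p = "\<lambda>E. levy_shift h -` E \<inter> path_space"
  have pb: "?p E \<in> events" if "E \<in> sets path_borel" for E
    using measurable_sets[OF levy_shift_measurable that] sets_path_borel_W by auto
  have "prob (?p N) = 0" using prob_levy_shift_borel[OF S(2)] S(3) by simp
  then have "?p N \<in> null_sets W" using pb[OF S(2)] by (simp add: null_sets_def emeasure_eq_measure)
  then have n: "?p A - ?p S \<in> null_sets W" using S(5) by (rule_tac null_subset) auto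
  have eq: "?p A = ?p S \<union> (?p A - ?p S)" using S(4) by auto
  show "levy_shift h -` A \<inter> space W \<in> events"
    using pb[OF S(1)] n eq by (metis null_setsD2 sets.Un space_W)
  have Nn: "N \<in> null_sets W" using S(2,3) sets_path_borel_W by (auto simp: null_sets_def emeasure_eq_measure)
  have "A - S \<in> null_sets W" using Nn S(5) by (rule_tac null_subset) auto
  have "prob (?p A) = prob (?p S)" using measure_Un_null_set[OF pb[OF S(1)] n] eq by simp
  also have "\<dots> = prob S" by (rule prob_levy_shift_borel[OF S(1)])
  also have "\<dots> = prob A" using measure_Un_null_set[OF _ \<open>A - S \<in> null_sets W\<close>, of S] S(1,4) sets_path_borel_W
    by (auto simp: Un_absorb1)
  finally show "prob (levy_shift h -` A \<inter> space W) = prob A" by simp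
qed

lemma distr_increment:
  assumes "u < v"
  shows "distr W borel (\<lambda>\<omega>. \<omega> v - \<omega> u) = normal_law (v - u)"
proof -
  have lm: "levy_shift u \<in> measurable W W"
    using levy_shift_events_prob(1) levy_shift_path_space by (intro measurableI) auto
  have "distr W W (levy_shift u) = W"
  proof (rule measure_eqI)
    fix A assume "A \<in> sets (distr W W (levy_shift u))"
    then show "emeasure (distr W W (levy_shift u)) A = emeasure W A"
      using levy_shift_events_prob[of A u] by (simp add: emeasure_distr[OF lm] emeasure_eq_measure)
  qed simp
  then have "distr W borel (\<lambda>\<omega>. \<omega> (v - u) - \<omega> 0) = distr (distr W W (levy_shift u)) borel (\<lambda>\<omega>. \<omega> (v - u) - \<omega> 0)" by simp
  also have "\<dots> = distr W borel ((\<lambda>\<omega>. \<omega> (v - u) - \<omega> 0) \<circ> levy_shift u)" by (rule distr_distr[OF _ lm]) measurable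
  also have "(\<lambda>\<omega>. \<omega> (v - u) - \<omega> 0) \<circ> levy_shift u = (\<lambda>\<omega>. \<omega> v - \<omega> u)" by (auto simp: levy_shift_def)
  finally show ?thesis using distr_increment_half[of 0 "v - u"] assms by simp
qed

text \<open>The form of \<open>increment_field\<close> with an arbitrary set of intervals, so that
  windows, pasts, futures and the complement of an interval are instances of one
  construction.\<close>

definition fld :: "(real \<times> real) set \<Rightarrow> path measure" where
  "fld R = sigma path_space
     ({(\<lambda>\<omega>. \<omega> v - \<omega> u) -` A \<inter> path_space | u v A. (u, v) \<in> R \<and> A \<in> sets borel} \<union>
      {A \<in> sets W. measure W A = 0 \<or> measure W A = 1})"

lemma space_fld [simp]: "space (fld R) = path_space"
  by (simp add: fld_def space_measure_of_conv)

lemma fld_generators: "{(\<lambda>\<omega>. \<omega> v - \<omega> u) -` A \<inter> path_space | u v A. (u, v) \<in> R \<and> A \<in> sets borel} \<union>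
      {A \<in> sets W. measure W A = 0 \<or> measure W A = 1} \<subseteq> sets W"
proof -
  have "(\<lambda>\<omega>. \<omega> v - \<omega> u) -` A \<inter> path_space \<in> sets W" if "A \<in> sets borel" for u v :: real and A :: "real set"
  proof -
    have "(\<lambda>\<omega>. \<omega> v - \<omega> u) \<in> borel_measurable W" by measurable
    from measurable_sets[OF this that] show ?thesis by simp
  qed
  then show ?thesis by blast
qed

lemma sets_fld: "sets (fld R) = sigma_sets path_space
     ({(\<lambda>\<omega>. \<omega> v - \<omega> u) -` A \<inter> path_space | u v A. (u, v) \<in> R \<and> A \<in> sets borel} \<union>
      {A \<in> sets W. measure W A = 0 \<or> measure W A = 1})"
  unfolding fld_def using order_trans[OF fld_generators[of R] sets.space_closed[of W]]
  by (intro sets_measure_of) simp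

lemma fld_events: "sets (fld R) \<subseteq> sets W"
  unfolding sets_fld using sets.sigma_sets_subset[OF fld_generators[of R]] by simp

lemma subalgebra_fld: "subalgebra W (fld R)"
  using fld_events by (simp add: subalgebra_def)

lemma fld_mono: "R \<subseteq> R' \<Longrightarrow> sets (fld R) \<subseteq> sets (fld R')"
  unfolding sets_fld by (rule sigma_sets_subseteq) blast

lemma fld_increment:
  assumes "(u, v) \<in> R \<or> (v, u) \<in> R \<or> u = v"
  shows "(\<lambda>\<omega>. \<omega> v - \<omega> u) \<in> borel_measurable (fld R)"
proof -
  have *: "(\<lambda>\<omega>. \<omega> v - \<omega> u) \<in> borel_measurable (fld R)" if "(u, v) \<in> R" for u v
  proof (rule measurableI)
    fix A :: "real set" assume "A \<in> sets borel"
    then show "(\<lambda>\<omega>. \<omega> v - \<omega> u) -` A \<inter> space (fld R) \<in> sets (fld R)"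
      using that unfolding sets_fld space_fld by (intro sigma_sets.Basic) blast
  qed simp
  from assms show ?thesis
  proof (elim disjE)
    assume "(v, u) \<in> R"
    from borel_measurable_uminus[OF *[OF this]] show ?thesis by simp
  qed (use * in auto)
qed

lemma fld_trivial: "A \<in> sets W \<Longrightarrow> measure W A = 0 \<or> measure W A = 1 \<Longrightarrow> A \<in> sets (fld R)"
  unfolding sets_fld by (intro sigma_sets.Basic) blast

section \<open>Independence of increments over non-overlapping intervals\<close>

lemma prob_path_space [simp]: "prob path_space = 1"
  using prob_space by simp

definition box :: "(real \<times> real) set \<Rightarrow> (real \<times> real \<Rightarrow> real set) \<Rightarrow> path set" where
  "box F A = {\<omega>\<in>path_space. \<forall>p\<in>F. \<omega> (snd p) - \<omega> (fst p) \<in> A p}"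

lemma box_events:
  assumes "finite F" "\<And>p. A p \<in> sets borel" shows "box F A \<in> events"
proof -
  have "(\<lambda>\<omega>. \<omega> (snd p) - \<omega> (fst p)) -` A p \<inter> path_space \<in> events" for p
  proof -
    have "(\<lambda>\<omega>. \<omega> (snd p) - \<omega> (fst p)) \<in> borel_measurable W" by measurable
    from measurable_sets[OF this assms(2)] show ?thesis by simp
  qed
  then have 1: "path_space - ((\<lambda>\<omega>. \<omega> (snd p) - \<omega> (fst p)) -` A p \<inter> path_space) \<in> events" for p
    using sets.compl_sets[of _ W] by simp
  have "box F A = space W - (\<Union>p\<in>F. path_space - ((\<lambda>\<omega>. \<omega> (snd p) - \<omega> (fst p)) -` A p \<inter> path_space))"
    by (auto simp: box_def)
  also have "\<dots> \<in> events" by (rule sets.Diff[OF sets.top sets.finite_UN]) (use assms(1) 1 in blast)+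
  finally show ?thesis .
qed

text \<open>All end points are put on one grid through 0. The intervals of \<open>F1\<close> and
  those of \<open>F2\<close> occupy disjoint sets of cells, and each increment is the sum over the
  cells of its interval.\<close>

lemma prob_box_Int:
  assumes fin: "finite F1" "finite F2" and A: "\<And>p. A1 p \<in> sets borel" "\<And>p. A2 p \<in> sets borel"
    and le: "\<And>u v. (u,v) \<in> F1 \<union> F2 \<Longrightarrow> u \<le> v"
    and sep: "\<And>u v u' v'. (u,v) \<in> F1 \<Longrightarrow> (u',v') \<in> F2 \<Longrightarrow> v \<le> u' \<or> v' \<le> u"
  shows "prob (box F1 A1 \<inter> box F2 A2) = prob (box F1 A1) * prob (box F2 A2)"
proof -
  let ?T = "{0} \<union> fst ` (F1 \<union> F2) \<union> snd ` (F1 \<union> F2)"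
  obtain f and n :: nat where f: "strict_mono f" "f ` {..n} = ?T"
    using finite_grid[of ?T] fin by auto
  have "0 \<in> f ` {..n}" unfolding f(2) by simp
  then obtain k where k: "k \<le> n" "f k = 0" by auto
  let ?X = "\<lambda>i \<omega>. \<omega> (f (Suc i)) - \<omega> (f i) :: real"
  let ?c = "\<lambda>(u, v). {j. j < n \<and> u \<le> f j \<and> f (Suc j) \<le> v}"
  have iv: "indep_vars (\<lambda>_. borel) ?X {..<n}" by (rule grid_increments_indep[OF f(1) k(2,1)])
  have inc: "(\<Sum>j\<in>?c (u,v). ?X j \<omega>) = \<omega> v - \<omega> u" if "(u, v) \<in> F1 \<union> F2" for u v \<omega>
  proof -
    have "u \<in> f ` {..n}" "v \<in> f ` {..n}" unfolding f(2) using that by force+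
    then obtain a b where ab: "a \<le> n" "u = f a" "b \<le> n" "v = f b" by auto
    have "?c (u,v) = {a..<b}" using ab f(1) by (auto simp: strict_mono_less_eq)
    moreover have "a \<le> b" using le[OF that] ab f(1) by (simp add: strict_mono_less_eq)
    ultimately show ?thesis using sum_Suc_diff'[of a b "\<lambda>i. \<omega> (f i)"] ab by simp
  qed
  define C where "C F = (\<Union>p\<in>F. ?c p)" for F
  have CI: "C F \<subseteq> {..<n}" for F by (auto simp: C_def)
  have disj: "C F1 \<inter> C F2 = {}"
  proof (rule ccontr)
    assume "C F1 \<inter> C F2 \<noteq> {}"
    then obtain j u v u' v' where "(u,v) \<in> F1" "(u',v') \<in> F2" "u \<le> f j" "f (Suc j) \<le> v" "u' \<le> f j" "f (Suc j) \<le> v'"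
      unfolding C_def by auto
    moreover have "f j < f (Suc j)" using f(1) by (simp add: strict_mono_Suc_iff)
    ultimately show False using sep[of u v u' v'] by auto
  qed
  define S where "S F A = {y\<in>space (\<Pi>\<^sub>M i\<in>C F. (borel :: real measure)). \<forall>p\<in>F. (\<Sum>j\<in>?c p. y j) \<in> A p}" for F and A :: "real \<times> real \<Rightarrow> real set"
  have S: "S F A \<in> sets (\<Pi>\<^sub>M i\<in>C F. borel)" if "finite F" "\<And>p. A p \<in> sets borel" for F A
    unfolding S_def
  proof (rule sets.sets_Collect_finite_All)
    fix p assume "p \<in> F"
    then have "(\<lambda>y. \<Sum>j\<in>?c p. y j) \<in> borel_measurable (\<Pi>\<^sub>M i\<in>C F. (borel :: real measure))"
      by (intro borel_measurable_sum measurable_component_singleton) (auto simp: C_def)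
    from measurable_sets[OF this that(2)[of p]]
    show "{y\<in>space (\<Pi>\<^sub>M i\<in>C F. (borel :: real measure)). (\<Sum>j\<in>?c p. y j) \<in> A p} \<in> sets (\<Pi>\<^sub>M i\<in>C F. borel)"
      by (simp add: vimage_def Int_def conj_commute)
  qed fact
  have E: "box F A = (\<lambda>\<omega>. \<lambda>i\<in>C F. ?X i \<omega>) -` S F A \<inter> space W" if "F \<subseteq> F1 \<union> F2" for F A
  proof -
    have "(\<Sum>j\<in>?c p. (\<lambda>i\<in>C F. ?X i \<omega>) j) = \<omega> (snd p) - \<omega> (fst p)" if "p \<in> F" for p \<omega>
    proof -
      have "(\<Sum>j\<in>?c p. (\<lambda>i\<in>C F. ?X i \<omega>) j) = (\<Sum>j\<in>?c p. ?X j \<omega>)"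
        using that by (intro sum.cong) (auto simp: C_def)
      then show ?thesis using inc[of "fst p" "snd p" \<omega>] that \<open>F \<subseteq> F1 \<union> F2\<close> by auto
    qed
    then show ?thesis unfolding box_def S_def by (auto simp: space_PiM)
  qed
  have "indep_var (\<Pi>\<^sub>M i\<in>C F1. borel) (\<lambda>\<omega>. \<lambda>i\<in>C F1. ?X i \<omega>) (\<Pi>\<^sub>M i\<in>C F2. borel) (\<lambda>\<omega>. \<lambda>i\<in>C F2. ?X i \<omega>)"
    by (rule indep_var_restrict[OF iv disj CI CI])
  from indep_varD[OF this S[of F1 A1, OF fin(1) A(1)] S[of F2 A2, OF fin(2) A(2)]]
  have "prob ((\<lambda>\<omega>. (\<lambda>i\<in>C F1. ?X i \<omega>, \<lambda>i\<in>C F2. ?X i \<omega>)) -` (S F1 A1 \<times> S F2 A2) \<inter> space W) = prob (box F1 A1) * prob (box F2 A2)"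
    by (simp only: E[of F1, OF Un_upper1] E[of F2, OF Un_upper2])
  moreover have "(\<lambda>\<omega>. (\<lambda>i\<in>C F1. ?X i \<omega>, \<lambda>i\<in>C F2. ?X i \<omega>)) -` (S F1 A1 \<times> S F2 A2) \<inter> space W = box F1 A1 \<inter> box F2 A2"
    unfolding E[of F1, OF Un_upper1] E[of F2, OF Un_upper2] by blast
  ultimately show ?thesis by simp
qed

text \<open>Each box is intersected with a trivial event, which gives a family closed under
  intersection that contains both kinds of generators of \<open>fld R\<close>.\<close>

definition boxes :: "(real \<times> real) set \<Rightarrow> path set set" where
  "boxes R = {box F A \<inter> N | F A N. finite F \<and> F \<subseteq> R \<and> (\<forall>p. A p \<in> sets borel) \<and> N \<in> events \<and> (prob N = 0 \<or> prob N = 1)}"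

lemma prob_Int_1: "A \<in> events \<Longrightarrow> N \<in> events \<Longrightarrow> prob N = 1 \<Longrightarrow> prob (A \<inter> N) = prob A"
  by (rule finite_measure_eq_AE) (auto dest!: prob_eq_1[THEN iffD1, rotated] elim!: eventually_mono)

lemma prob_Int_0: "A \<in> events \<Longrightarrow> N \<in> events \<Longrightarrow> prob N = 0 \<Longrightarrow> prob (A \<inter> N) = 0"
  using finite_measure_mono[of "A \<inter> N" N] measure_nonneg[of W "A \<inter> N"] by simp

lemma Int_stable_boxes: "Int_stable (boxes R)"
proof (rule Int_stableI)
  fix a b assume "a \<in> boxes R" "b \<in> boxes R"
  then obtain F A N F' A' N' where a: "a = box F A \<inter> N" "finite F" "F \<subseteq> R" "\<forall>p. A p \<in> sets borel" "N \<in> events" "prob N = 0 \<or> prob N = 1"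
    and b: "b = box F' A' \<inter> N'" "finite F'" "F' \<subseteq> R" "\<forall>p. A' p \<in> sets borel" "N' \<in> events" "prob N' = 0 \<or> prob N' = 1"
    unfolding boxes_def by blast
  let ?A = "\<lambda>p. (if p \<in> F then A p else UNIV) \<inter> (if p \<in> F' then A' p else UNIV)"
  have "a \<inter> b = box (F \<union> F') ?A \<inter> (N \<inter> N')" unfolding a(1) b(1) box_def by (auto split: if_splits)
  moreover have "finite (F \<union> F')" "F \<union> F' \<subseteq> R" "\<forall>p. ?A p \<in> sets borel" "N \<inter> N' \<in> events" using a b by auto
  moreover have "prob (N \<inter> N') = 0 \<or> prob (N \<inter> N') = 1"
    using a(5,6) b(5,6) prob_Int_1[of N N'] prob_Int_0[of N N'] by auto
  ultimately show "a \<inter> b \<in> boxes R" unfolding boxes_def mem_Collect_eq by (intro exI conjI)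
qed

lemma sets_fld_boxes: "sets (fld R) \<subseteq> sigma_sets path_space (boxes R)"
  unfolding sets_fld
proof (rule sigma_sets_subseteq, rule Un_least)
  have ev: "path_space \<in> events" "prob path_space = 1" using sets.top[of W] prob_space by auto
  show "{(\<lambda>\<omega>. \<omega> v - \<omega> u) -` A \<inter> path_space |u v A. (u, v) \<in> R \<and> A \<in> sets borel} \<subseteq> boxes R"
  proof
    fix E assume "E \<in> {(\<lambda>\<omega>. \<omega> v - \<omega> u) -` A \<inter> path_space |u v A. (u, v) \<in> R \<and> A \<in> sets borel}"
    then obtain u v A where E: "E = (\<lambda>\<omega>. \<omega> v - \<omega> u) -` A \<inter> path_space" "(u, v) \<in> R" "A \<in> sets borel" by blast
    have "E = box {(u, v)} (\<lambda>_. A) \<inter> path_space" unfolding E(1) box_def by auto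
    moreover have "finite {(u, v)}" "{(u, v)} \<subseteq> R" "\<forall>p :: real \<times> real. A \<in> sets borel" using E by auto
    moreover note ev
    ultimately show "E \<in> boxes R" unfolding boxes_def mem_Collect_eq by (intro exI conjI disjI2) auto
  qed
  show "{A \<in> events. prob A = 0 \<or> prob A = 1} \<subseteq> boxes R"
  proof
    fix N assume N: "N \<in> {A \<in> events. prob A = 0 \<or> prob A = 1}"
    have "N = box {} (\<lambda>_. UNIV) \<inter> N" using N sets.sets_into_space[of N W] by (auto simp: box_def)
    moreover have "finite ({} :: (real \<times> real) set)" "{} \<subseteq> R" "\<forall>p :: real \<times> real. UNIV \<in> sets (borel :: real measure)" by auto
    moreover have "N \<in> events" "prob N = 0 \<or> prob N = 1" using N by auto
    ultimately show "N \<in> boxes R" unfolding boxes_def mem_Collect_eq by (intro exI conjI)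
  qed
qed

lemma boxes_events: "boxes R \<subseteq> events"
proof
  fix E assume "E \<in> boxes R"
  then obtain F A N where "E = box F A \<inter> N" "finite F" "\<forall>p. A p \<in> sets borel" "N \<in> events" unfolding boxes_def by blast
  moreover from this have "box F A \<in> events" using box_events by blast
  ultimately show "E \<in> events" by blast
qed

definition separated :: "(real \<times> real) set \<Rightarrow> (real \<times> real) set \<Rightarrow> bool" where
  "separated R R' \<longleftrightarrow> (\<forall>(u,v)\<in>R \<union> R'. u \<le> v) \<and> (\<forall>(u,v)\<in>R. \<forall>(u',v')\<in>R'. v \<le> u' \<or> v' \<le> u)"

text \<open>On boxes the claim is \<open>prob_box_Int\<close>: a trivial event either leaves the
  probabilities unchanged or makes both sides 0. Stability under intersection extends it to the
  generated fields.\<close>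

lemma fld_indep:
  assumes sep: "separated R1 R2" and E: "E1 \<in> sets (fld R1)" "E2 \<in> sets (fld R2)"
  shows "prob (E1 \<inter> E2) = prob E1 * prob E2"
proof -
  have "indep_set (boxes R1) (boxes R2)"
  proof (rule indep_setI[OF boxes_events boxes_events])
    fix a b assume "a \<in> boxes R1" "b \<in> boxes R2"
    then obtain F A N F' A' N' where a: "a = box F A \<inter> N" "finite F" "F \<subseteq> R1" "\<forall>p. A p \<in> sets borel" "N \<in> events" "prob N = 0 \<or> prob N = 1"
      and b: "b = box F' A' \<inter> N'" "finite F'" "F' \<subseteq> R2" "\<forall>p. A' p \<in> sets borel" "N' \<in> events" "prob N' = 0 \<or> prob N' = 1"
      unfolding boxes_def by blast
    have be: "box F A \<in> events" "box F' A' \<in> events" using box_events a b by auto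
    have core: "prob (box F A \<inter> box F' A') = prob (box F A) * prob (box F' A')"
    proof (rule prob_box_Int)
      show "u \<le> v" if "(u, v) \<in> F \<union> F'" for u v using that a(3) b(3) sep unfolding separated_def by blast
      show "v \<le> u' \<or> v' \<le> u" if "(u, v) \<in> F" "(u', v') \<in> F'" for u v u' v'
        using that a(3) b(3) sep unfolding separated_def by blast
    qed (use a b in auto)
    consider "prob N = 0" | "prob N' = 0" | "prob N = 1" "prob N' = 1" using a(6) b(6) by blast
    then show "prob (a \<inter> b) = prob a * prob b"
    proof cases
      case 1
      have "prob (box F A \<inter> box F' A' \<inter> N' \<inter> N) = 0" using 1 be a b by (intro prob_Int_0) auto
      moreover have "a \<inter> b = box F A \<inter> box F' A' \<inter> N' \<inter> N" unfolding a(1) b(1) by blast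
      ultimately show ?thesis unfolding a(1) using prob_Int_0[OF be(1) a(5) 1] by simp
    next
      case 2
      have "prob (box F A \<inter> box F' A' \<inter> N \<inter> N') = 0" using 2 be a b by (intro prob_Int_0) auto
      moreover have "a \<inter> b = box F A \<inter> box F' A' \<inter> N \<inter> N'" unfolding a(1) b(1) by blast
      ultimately show ?thesis unfolding b(1) using prob_Int_0[OF be(2) b(5) 2] by simp
    next
      case 3
      have "prob (box F A \<inter> box F' A' \<inter> N \<inter> N') = prob (box F A \<inter> box F' A')"
        using 3 be a b prob_Int_1[of "box F A \<inter> box F' A' \<inter> N" N'] prob_Int_1[of "box F A \<inter> box F' A'" N] by auto
      moreover have "a \<inter> b = box F A \<inter> box F' A' \<inter> N \<inter> N'" unfolding a(1) b(1) by blast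
      ultimately show ?thesis unfolding a(1) b(1) using prob_Int_1 3 be a(5) b(5) core by simp
    qed
  qed
  then have "indep_set (sigma_sets (space W) (boxes R1)) (sigma_sets (space W) (boxes R2))"
    by (rule indep_set_sigma_sets[OF _ Int_stable_boxes Int_stable_boxes])
  from indep_setD[OF this] show ?thesis using E sets_fld_boxes by auto
qed

lemma fld_indep_integral:
  assumes sep: "separated R1 R2" and A: "A \<in> sets (fld R1)" and Z: "Z \<in> borel_measurable (fld R2)" "integrable W Z"
  shows "(\<integral>\<omega>. indicator A \<omega> * Z \<omega> \<partial>W) = prob A * (\<integral>\<omega>. Z \<omega> \<partial>W)"
proof -
  have Aev: "A \<in> events" using A fld_events by blast
  have iA: "(indicator A :: path \<Rightarrow> real) \<in> borel_measurable (fld R1)" using A by simp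
  have "indep_var borel (indicator A :: path \<Rightarrow> real) borel Z"
    unfolding indep_var_eq
  proof (intro conjI)
    show "(indicator A :: path \<Rightarrow> real) \<in> borel_measurable W" using Aev by simp
    show "Z \<in> borel_measurable W" using Z(2) by auto
    have s1: "sigma_sets (space W) {(indicator A :: path \<Rightarrow> real) -` B \<inter> space W |B. B \<in> sets borel} \<subseteq> sets (fld R1)"
      using sets.sigma_sets_subset[of "{(indicator A :: path \<Rightarrow> real) -` B \<inter> space W |B. B \<in> sets borel}" "fld R1"]
        measurable_sets[OF iA] by auto
    have s2: "sigma_sets (space W) {Z -` B \<inter> space W |B. B \<in> sets borel} \<subseteq> sets (fld R2)"
      using sets.sigma_sets_subset[of "{Z -` B \<inter> space W |B. B \<in> sets borel}" "fld R2"]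
        measurable_sets[OF Z(1)] by auto
    show "indep_set (sigma_sets (space W) {(indicator A :: path \<Rightarrow> real) -` B \<inter> space W |B. B \<in> sets borel})
       (sigma_sets (space W) {Z -` B \<inter> space W |B. B \<in> sets borel})"
      using s1 s2 fld_events fld_indep[OF sep] by (intro indep_setI) blast+
  qed
  moreover have "integrable W (indicator A :: path \<Rightarrow> real)" using Aev by (intro integrable_real_indicator) (auto simp: less_top[symmetric])
  moreover have "A \<inter> path_space = A" using sets.sets_into_space[OF Aev] by auto
  ultimately show ?thesis using indep_var_lebesgue_integral[of "indicator A" Z] Z(2) by simp
qed

section \<open>Moments and tails of increments\<close>

lemma increment_moment:
  assumes "u < v"
  shows "integrable W (\<lambda>\<omega>. (\<omega> v - \<omega> u) ^ (2 * k))"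
    and "(\<integral>\<omega>. (\<omega> v - \<omega> u) ^ (2 * k) \<partial>W) = fact (2 * k) / ((2 / (v - u)) ^ k * fact k)"
proof -
  have m: "(\<lambda>\<omega>. \<omega> v - \<omega> u) \<in> borel_measurable W" by measurable
  have hb: "has_bochner_integral lborel (\<lambda>x. normal_density 0 (sqrt (v - u)) x * x ^ (2 * k)) (fact (2 * k) / ((2 / (v - u)) ^ k * fact k))"
  proof -
    have sq: "(sqrt (v - u))\<^sup>2 = v - u" using assms by simp
    show ?thesis using normal_moment_even[where \<mu>=0 and \<sigma>="sqrt (v - u)" and k=k] assms by (simp only: sq diff_zero real_sqrt_gt_0_iff diff_gt_0_iff_gt)
  qed
  have "integrable (distr W borel (\<lambda>\<omega>. \<omega> v - \<omega> u)) (\<lambda>x. x ^ (2 * k))"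
    unfolding distr_increment[OF assms] using integrable.intros[OF hb]
    by (subst integrable_real_density) auto
  then show "integrable W (\<lambda>\<omega>. (\<omega> v - \<omega> u) ^ (2 * k))"
    using integrable_distr_eq[OF m, of "\<lambda>x. x ^ (2 * k)"] by simp
  have "(\<integral>\<omega>. (\<omega> v - \<omega> u) ^ (2 * k) \<partial>W) = (\<integral>x. x ^ (2 * k) \<partial>distr W borel (\<lambda>\<omega>. \<omega> v - \<omega> u))"
    using integral_distr[OF m, of "\<lambda>x. x ^ (2 * k)"] by simp
  also have "\<dots> = (\<integral>x. normal_density 0 (sqrt (v - u)) x * x ^ (2 * k) \<partial>lborel)"
    unfolding distr_increment[OF assms] by (subst integral_real_density) auto
  also have "\<dots> = fact (2 * k) / ((2 / (v - u)) ^ k * fact k)"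
    by (rule has_bochner_integral_integral_eq[OF hb])
  finally show "(\<integral>\<omega>. (\<omega> v - \<omega> u) ^ (2 * k) \<partial>W) = fact (2 * k) / ((2 / (v - u)) ^ k * fact k)" .
qed

lemma increment_integrable: "integrable W (\<lambda>\<omega>. \<omega> v - \<omega> u)"
proof -
  have *: "integrable W (\<lambda>\<omega>. \<omega> v - \<omega> u)" if "u < v" for u v
  proof -
    have "integrable W (\<lambda>\<omega>. (\<omega> v - \<omega> u)\<^sup>2)" using increment_moment(1)[OF that, of 1] by simp
    moreover have "(\<lambda>\<omega>. \<omega> v - \<omega> u) \<in> borel_measurable W" by measurable
    ultimately show ?thesis using square_integrable_imp_integrable by blast
  qed
  show ?thesis
  proof (cases u v rule: linorder_cases)
    case greater
    from Bochner_Integration.integrable_minus[OF *[OF this]] show ?thesis by simp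
  qed (use * in auto)
qed

text \<open>Obtained from the variance by integrating the inequality of arithmetic and geometric
  means, scaled so that both halves of the bound are of order \<open>sqrt h\<close>.\<close>

lemma increment_abs_mean:
  assumes "\<bar>v - u\<bar> \<le> h" "0 < h"
  shows "(\<integral>\<omega>. \<bar>\<omega> v - \<omega> u\<bar> \<partial>W) \<le> sqrt h"
proof -
  have *: "(\<integral>\<omega>. \<bar>\<omega> v - \<omega> u\<bar> \<partial>W) \<le> sqrt h" if uv: "u < v" "v - u \<le> h" for u v
  proof -
    have sq: "integrable W (\<lambda>\<omega>. (\<omega> v - \<omega> u)\<^sup>2)" "(\<integral>\<omega>. (\<omega> v - \<omega> u)\<^sup>2 \<partial>W) = v - u"
      using increment_moment[OF uv(1), of 1] uv by (simp_all add: fact_numeral)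
    have "(\<integral>\<omega>. \<bar>\<omega> v - \<omega> u\<bar> \<partial>W) \<le> (\<integral>\<omega>. (\<omega> v - \<omega> u)\<^sup>2 / (2 * sqrt h) + sqrt h / 2 \<partial>W)"
    proof (rule integral_mono)
      fix \<omega>
      have "0 \<le> (\<bar>\<omega> v - \<omega> u\<bar> - sqrt h)\<^sup>2" by simp
      then have "2 * \<bar>\<omega> v - \<omega> u\<bar> * sqrt h \<le> (\<omega> v - \<omega> u)\<^sup>2 + h" using assms(2) by (simp add: power2_diff)
      then show "\<bar>\<omega> v - \<omega> u\<bar> \<le> (\<omega> v - \<omega> u)\<^sup>2 / (2 * sqrt h) + sqrt h / 2"
        using assms(2) by (simp add: field_simps)
    qed (use sq increment_integrable in auto)
    also have "\<dots> = (v - u) / (2 * sqrt h) + sqrt h / 2" using sq by (simp add: prob_space)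
    also have "\<dots> \<le> h / (2 * sqrt h) + sqrt h / 2" using uv assms(2) by (intro add_mono divide_right_mono) auto
    also have "\<dots> = sqrt h" using assms(2) by (simp add: real_div_sqrt field_simps)
    finally show ?thesis .
  qed
  show ?thesis
  proof (cases u v rule: linorder_cases)
    case greater
    then show ?thesis using *[of v u] assms by (simp add: abs_minus_commute)
  qed (use * assms in auto)
qed

text \<open>The fourth moment is used because a grid has about \<open>1 / h\<close> cells of width
  \<open>h\<close>: the bound per cell has to be of smaller order than \<open>h\<close>, and the
  variance would give only order \<open>h\<close>.\<close>

lemma increment_tail:
  assumes "\<bar>v - u\<bar> \<le> h" "0 < c"
  shows "prob {\<omega>\<in>path_space. c < \<bar>\<omega> v - \<omega> u\<bar>} \<le> 3 * h\<^sup>2 / c ^ 4"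
proof -
  have *: "prob {\<omega>\<in>path_space. c < \<bar>\<omega> v - \<omega> u\<bar>} \<le> 3 * h\<^sup>2 / c ^ 4" if uv: "u < v" "v - u \<le> h" for u v
  proof -
    have q: "integrable W (\<lambda>\<omega>. (\<omega> v - \<omega> u) ^ 4)" "(\<integral>\<omega>. (\<omega> v - \<omega> u) ^ 4 \<partial>W) = 3 * (v - u)\<^sup>2"
      using increment_moment[OF uv(1), of 2] uv by (simp_all add: fact_numeral power2_eq_square field_simps)
    have m: "{\<omega>\<in>space W. c ^ 4 \<le> (\<omega> v - \<omega> u) ^ 4} \<in> events" "{\<omega>\<in>space W. c < \<bar>\<omega> v - \<omega> u\<bar>} \<in> events" by measurable
    have "prob {\<omega>\<in>path_space. c < \<bar>\<omega> v - \<omega> u\<bar>} \<le> prob {\<omega>\<in>space W. c ^ 4 \<le> (\<omega> v - \<omega> u) ^ 4}"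
    proof (rule finite_measure_mono)
      have "c ^ 4 \<le> x ^ 4" if "c < \<bar>x\<bar>" for x :: real
        using power_mono[of c "\<bar>x\<bar>" 4] that assms(2) by (simp add: power_even_abs)
      then show "{\<omega>\<in>path_space. c < \<bar>\<omega> v - \<omega> u\<bar>} \<subseteq> {\<omega>\<in>space W. c ^ 4 \<le> (\<omega> v - \<omega> u) ^ 4}" by auto
    qed (rule m)
    also have "\<dots> \<le> (\<integral>\<omega>. (\<omega> v - \<omega> u) ^ 4 \<partial>W) / c ^ 4"
      using q(1) assms(2) by (intro integral_Markov_inequality_measure[where A="{}"]) auto
    also have "\<dots> \<le> 3 * h\<^sup>2 / c ^ 4"
      unfolding q(2) using uv assms(2) by (intro divide_right_mono mult_left_mono power_mono) auto
    finally show ?thesis .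
  qed
  show ?thesis
  proof (cases u v rule: linorder_cases)
    case greater
    then show ?thesis using *[of v u] assms by (simp add: abs_minus_commute)
  next
    case equal
    then show ?thesis using assms by simp
  qed (use * assms in auto)
qed

section \<open>Continuity of the Brownian filtration\<close>

definition inside :: "real \<Rightarrow> real \<Rightarrow> (real \<times> real) set" where
  "inside p q = {(u, v). p \<le> u \<and> u \<le> v \<and> v \<le> q}"

definition outside :: "real \<Rightarrow> real \<Rightarrow> (real \<times> real) set" where
  "outside p q = {(u, v). u \<le> v \<and> (v \<le> p \<or> q \<le> u)}"

text \<open>Passing from \<open>R0\<close> to \<open>R1\<close> reveals the increments inside
  \<open>[p, q]\<close> and nothing else. Both the forward fields and the backward fields grow in
  this manner, so one argument serves for both.\<close>

definition adjacent :: "real \<Rightarrow> real \<Rightarrow> (real \<times> real) set \<Rightarrow> (real \<times> real) set \<Rightarrow> bool" where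
  "adjacent p q R0 R1 \<longleftrightarrow> p < q \<and> R0 \<subseteq> outside p q \<and> R0 \<subseteq> R1 \<and> inside p q \<subseteq> R1 \<and>
     sets (fld R1) \<subseteq> sets (fld (R0 \<union> inside p q))"

lemma separated_inside_outside: "R \<subseteq> outside p q \<Longrightarrow> separated (inside p q) R"
  unfolding separated_def inside_def outside_def by fastforce

lemma sigma_finite_fld: "sigma_finite_subalgebra W (fld R)"
  by (rule sigma_finite_subalgebra_of_subalgebra[OF subalgebra_fld])

lemma integrable_indicator_times: "A \<in> events \<Longrightarrow> integrable W Z \<Longrightarrow> integrable W (\<lambda>\<omega>. indicator A \<omega> * Z \<omega>)" for Z :: "path \<Rightarrow> real"
  using integrable_mult_indicator[of A W Z] by simp

text \<open>The increments inside \<open>[p, q]\<close> are independent of all those outside, so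
  revealing them does not change the prediction of \<open>Z\<close>. It suffices to test this on
  intersections of an event of \<open>fld R0\<close> with an event of the inside, which generate
  \<open>fld R1\<close>.\<close>

lemma cond_exp_adjacent:
  assumes ad: "adjacent p q R0 R1" and Z: "Z \<in> borel_measurable (fld (outside p q))" "integrable W Z"
  shows "AE \<omega> in W. real_cond_exp W (fld R1) Z \<omega> = real_cond_exp W (fld R0) Z \<omega>"
proof (rule sigma_finite_subalgebra.real_cond_exp_charact[OF sigma_finite_fld])
  let ?h = "real_cond_exp W (fld R0) Z"
  have R: "R0 \<subseteq> outside p q" "R0 \<subseteq> R1" using ad by (auto simp: adjacent_def)
  show h: "integrable W ?h" by (rule sigma_finite_subalgebra.real_cond_exp_int(1)[OF sigma_finite_fld Z(2)])
  have hm: "?h \<in> borel_measurable (fld R0)" by simp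
  show "?h \<in> borel_measurable (fld R1)"
    using hm measurable_mono[of borel borel "fld R0" "fld R1"] fld_mono[OF R(2)] by auto
  have ho: "?h \<in> borel_measurable (fld (outside p q))"
    using hm measurable_mono[of borel borel "fld R0" "fld (outside p q)"] fld_mono[OF R(1)] by auto
  define Pi where "Pi = {A0 \<inter> A1 | A0 A1. A0 \<in> sets (fld R0) \<and> A1 \<in> sets (fld (inside p q))}"
  have Pi_sub: "Pi \<subseteq> Pow path_space" using sets.sets_into_space[of _ "fld R0"] unfolding Pi_def by fastforce
  have stable: "Int_stable Pi"
  proof (rule Int_stableI)
    fix a b assume "a \<in> Pi" "b \<in> Pi"
    then obtain A0 A1 B0 B1 where a: "a = A0 \<inter> A1" "A0 \<in> sets (fld R0)" "A1 \<in> sets (fld (inside p q))"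
      and b: "b = B0 \<inter> B1" "B0 \<in> sets (fld R0)" "B1 \<in> sets (fld (inside p q))" unfolding Pi_def by blast
    have "a \<inter> b = (A0 \<inter> B0) \<inter> (A1 \<inter> B1)" unfolding a b by blast
    moreover have "A0 \<inter> B0 \<in> sets (fld R0)" "A1 \<inter> B1 \<in> sets (fld (inside p q))" using a b by auto
    ultimately show "a \<inter> b \<in> Pi" unfolding Pi_def by blast
  qed
  have gen: "sets (fld R1) \<subseteq> sigma_sets path_space Pi"
  proof -
    have top: "path_space \<in> sets (fld R)" for R using sets.top[of "fld R"] by simp
    have 0: "sets (fld R0) \<subseteq> Pi"
    proof
      fix A assume A: "A \<in> sets (fld R0)"
      then have "A = A \<inter> path_space" using sets.sets_into_space[OF A] by auto
      then show "A \<in> Pi" unfolding Pi_def using A top by blast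
    qed
    have 1: "sets (fld (inside p q)) \<subseteq> Pi"
    proof
      fix A assume A: "A \<in> sets (fld (inside p q))"
      then have "A = path_space \<inter> A" using sets.sets_into_space[OF A] by auto
      then show "A \<in> Pi" unfolding Pi_def using A top by blast
    qed
    have "sets (fld (R0 \<union> inside p q)) \<subseteq> sigma_sets path_space Pi"
      unfolding sets_fld[of "R0 \<union> inside p q"]
    proof (rule sigma_sets_subseteq, rule subsetI)
      fix E assume "E \<in> {(\<lambda>\<omega>. \<omega> v - \<omega> u) -` A \<inter> path_space |u v A. (u, v) \<in> R0 \<union> inside p q \<and> A \<in> sets borel} \<union>
            {A \<in> events. prob A = 0 \<or> prob A = 1}"
      then have "E \<in> sets (fld R0) \<or> E \<in> sets (fld (inside p q))"
        unfolding sets_fld by (blast intro: sigma_sets.Basic)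
      then show "E \<in> Pi" using 0 1 by blast
    qed
    then show ?thesis using ad unfolding adjacent_def by blast
  qed
  have ind: "(\<integral>\<omega>. indicator (A0 \<inter> A1) \<omega> * X \<omega> \<partial>W) = prob A1 * (\<integral>\<omega>. indicator A0 \<omega> * X \<omega> \<partial>W)"
    if "A0 \<in> sets (fld R0)" "A1 \<in> sets (fld (inside p q))" "X \<in> borel_measurable (fld (outside p q))" "integrable W X"
    for A0 A1 and X :: "path \<Rightarrow> real"
  proof -
    have A0: "A0 \<in> sets (fld (outside p q))" using that(1) fld_mono[OF R(1)] by blast
    have "(\<integral>\<omega>. indicator A1 \<omega> * (indicator A0 \<omega> * X \<omega>) \<partial>W) = prob A1 * (\<integral>\<omega>. indicator A0 \<omega> * X \<omega> \<partial>W)"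
    proof (rule fld_indep_integral[OF separated_inside_outside[OF order_refl] that(2)])
      show "(\<lambda>\<omega>. indicator A0 \<omega> * X \<omega>) \<in> borel_measurable (fld (outside p q))" using A0 that(3) by measurable
      show "integrable W (\<lambda>\<omega>. indicator A0 \<omega> * X \<omega>)" using A0 that(4) fld_events by (intro integrable_indicator_times) auto
    qed
    moreover have "(\<lambda>\<omega>. indicator (A0 \<inter> A1) \<omega> * X \<omega>) = (\<lambda>\<omega>. indicator A1 \<omega> * (indicator A0 \<omega> * X \<omega>))"
      by (rule ext) (auto split: split_indicator)
    ultimately show ?thesis by (simp only:)
  qed
  fix A assume "A \<in> sets (fld R1)"
  then have "A \<in> sigma_sets path_space Pi" using gen by blast
  from stable Pi_sub this have "(\<integral>\<omega>. indicator A \<omega> * Z \<omega> \<partial>W) = (\<integral>\<omega>. indicator A \<omega> * ?h \<omega> \<partial>W)"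
  proof (induction rule: sigma_sets_induct_disjoint)
    case (basic A)
    then obtain A0 A1 where A: "A = A0 \<inter> A1" "A0 \<in> sets (fld R0)" "A1 \<in> sets (fld (inside p q))" unfolding Pi_def by blast
    have "(\<integral>\<omega>. indicator A0 \<omega> * Z \<omega> \<partial>W) = (\<integral>\<omega>. indicator A0 \<omega> * ?h \<omega> \<partial>W)"
      using sigma_finite_subalgebra.real_cond_exp_intA[OF sigma_finite_fld Z(2) A(2)] by (simp add: set_lebesgue_integral_def)
    then show ?case unfolding A(1) using ind[OF A(2,3)] Z ho h by simp
  next
    case empty then show ?case by simp
  next
    case (compl A)
    have PiE: "Pi \<subseteq> events" using fld_events unfolding Pi_def by blast
    have "A \<in> events" using compl(1) sets.sigma_sets_subset[OF PiE] by auto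
    have *: "(\<integral>\<omega>. indicator (path_space - A) \<omega> * X \<omega> \<partial>W) = (\<integral>\<omega>. X \<omega> \<partial>W) - (\<integral>\<omega>. indicator A \<omega> * X \<omega> \<partial>W)"
      if "integrable W X" for X :: "path \<Rightarrow> real"
    proof -
      have "(\<integral>\<omega>. indicator (path_space - A) \<omega> * X \<omega> \<partial>W) = (\<integral>\<omega>. X \<omega> - indicator A \<omega> * X \<omega> \<partial>W)"
        by (intro Bochner_Integration.integral_cong) (auto split: split_indicator)
      then show ?thesis using that integrable_indicator_times[OF \<open>A \<in> events\<close> that] by simp
    qed
    have "(\<integral>\<omega>. ?h \<omega> \<partial>W) = (\<integral>\<omega>. Z \<omega> \<partial>W)" by (rule sigma_finite_subalgebra.real_cond_exp_int(2)[OF sigma_finite_fld Z(2)])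
    then show ?case using *[OF Z(2)] *[OF h] compl by simp
  next
    case (union A)
    have PiE: "Pi \<subseteq> events" using fld_events unfolding Pi_def by blast
    have Aev: "A i \<in> events" for i using union(2) sets.sigma_sets_subset[OF PiE] by auto
    have *: "(\<lambda>i. \<integral>\<omega>. indicator (A i) \<omega> * X \<omega> \<partial>W) sums (\<integral>\<omega>. indicator (\<Union>i. A i) \<omega> * X \<omega> \<partial>W)"
      if "integrable W X" for X :: "path \<Rightarrow> real"
    proof -
      have UN: "(\<Union>i. A i) \<in> events" using Aev by blast
      have "(\<lambda>n. \<Sum>i<n. \<integral>\<omega>. indicator (A i) \<omega> * X \<omega> \<partial>W) \<longlonglongrightarrow> (\<integral>\<omega>. indicator (\<Union>i. A i) \<omega> * X \<omega> \<partial>W)"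
      proof -
        have "(\<lambda>n. \<integral>\<omega>. indicator (\<Union>i<n. A i) \<omega> * X \<omega> \<partial>W) \<longlonglongrightarrow> (\<integral>\<omega>. indicator (\<Union>i. A i) \<omega> * X \<omega> \<partial>W)"
        proof (rule integral_dominated_convergence[where w="\<lambda>\<omega>. \<bar>X \<omega>\<bar>"])
          show "AE \<omega> in W. (\<lambda>n. indicator (\<Union>i<n. A i) \<omega> * X \<omega>) \<longlonglongrightarrow> indicator (\<Union>i. A i) \<omega> * X \<omega>"
            by (intro AE_I2 tendsto_mult_right LIMSEQ_indicator_UN)
        qed (use that UN Aev in \<open>auto split: split_indicator\<close>)
        moreover have "(\<integral>\<omega>. indicator (\<Union>i<n. A i) \<omega> * X \<omega> \<partial>W) = (\<Sum>i<n. \<integral>\<omega>. indicator (A i) \<omega> * X \<omega> \<partial>W)" for n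
        proof -
          have "disjoint_family_on A {..<n}" using union(1) by (auto simp: disjoint_family_on_def)
          then have "(\<lambda>\<omega>. indicator (\<Union>i<n. A i) \<omega> * X \<omega>) = (\<lambda>\<omega>. \<Sum>i<n. indicator (A i) \<omega> * X \<omega>)"
            by (simp add: indicator_UN_disjoint sum_distrib_right)
          then have "(\<integral>\<omega>. indicator (\<Union>i<n. A i) \<omega> * X \<omega> \<partial>W) = (\<integral>\<omega>. (\<Sum>i<n. indicator (A i) \<omega> * X \<omega>) \<partial>W)" by (simp only:)
          also have "\<dots> = (\<Sum>i<n. \<integral>\<omega>. indicator (A i) \<omega> * X \<omega> \<partial>W)"
            by (rule Bochner_Integration.integral_sum) (rule integrable_indicator_times[OF Aev that])
          finally show ?thesis .
        qed
        ultimately show ?thesis by simp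
      qed
      then show ?thesis by (simp add: sums_def)
    qed
    show ?case using *[OF Z(2)] *[OF h] union(3) by (simp add: sums_iff)
  qed
  then show "(\<integral>\<omega>\<in>A. Z \<omega> \<partial>W) = (\<integral>\<omega>\<in>A. ?h \<omega> \<partial>W)" by (simp add: set_lebesgue_integral_def)
qed (rule Z(2))

lemma cond_exp_inside:
  assumes R: "R \<subseteq> outside p q" and Y: "Y \<in> borel_measurable (fld (inside p q))" "integrable W Y"
  shows "AE \<omega> in W. real_cond_exp W (fld R) Y \<omega> = (\<integral>\<omega>. Y \<omega> \<partial>W)"
proof (rule sigma_finite_subalgebra.real_cond_exp_charact[OF sigma_finite_fld _ Y(2)])
  fix A assume A: "A \<in> sets (fld R)"
  have sep: "separated R (inside p q)"
    using separated_inside_outside[OF R] unfolding separated_def by (auto split: prod.splits) blast+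
  have "(\<integral>\<omega>. indicator A \<omega> * Y \<omega> \<partial>W) = prob A * (\<integral>\<omega>. Y \<omega> \<partial>W)"
    by (rule fld_indep_integral[OF sep A Y])
  then show "(\<integral>\<omega>\<in>A. Y \<omega> \<partial>W) = (\<integral>x\<in>A. (\<integral>\<omega>. Y \<omega> \<partial>W) \<partial>W)"
    using A fld_events[of R] sets.sets_into_space[of A W] by (auto simp: set_lebesgue_integral_def Int_absorb2)
qed auto

definition clamp_real :: "real \<Rightarrow> real \<Rightarrow> real \<Rightarrow> real" where
  "clamp_real p q x = max p (min q x)"

lemma clamp_real: "p \<le> q \<Longrightarrow> p \<le> clamp_real p q x \<and> clamp_real p q x \<le> q"
  by (auto simp: clamp_real_def)

text \<open>The part of \<open>\<omega> x\<close> that is accumulated inside \<open>[p, q]\<close>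
  on the way from 0 to \<open>x\<close>. Subtracting it leaves a function of the increments outside,
  because \<open>\<omega> 0 = 0\<close>.\<close>

abbreviation clamped :: "real \<Rightarrow> real \<Rightarrow> real \<Rightarrow> path \<Rightarrow> real" where
  "clamped p q x \<omega> \<equiv> \<omega> (clamp_real p q x) - \<omega> (clamp_real p q 0)"

lemma clamped_inside: "p \<le> q \<Longrightarrow> (\<lambda>\<omega>. clamped p q x \<omega>) \<in> borel_measurable (fld (inside p q))"
  using clamp_real[of p q x] clamp_real[of p q 0] by (intro fld_increment) (auto simp: inside_def)

lemma coordinate_minus_clamped_outside:
  assumes "p \<le> q" shows "(\<lambda>\<omega>. \<omega> x - clamped p q x \<omega>) \<in> borel_measurable (fld (outside p q))"
proof -
  have *: "(\<lambda>\<omega>. \<omega> x - \<omega> (clamp_real p q x)) \<in> borel_measurable (fld (outside p q))" for x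
    by (rule fld_increment) (use assms in \<open>auto simp: outside_def clamp_real_def max_def min_def\<close>)
  have "(\<lambda>\<omega>. (\<omega> x - \<omega> (clamp_real p q x)) - (\<omega> 0 - \<omega> (clamp_real p q 0))) \<in> borel_measurable (fld (outside p q))"
    by (intro borel_measurable_diff *)
  moreover have "(\<lambda>\<omega>. \<omega> x - clamped p q x \<omega>) \<in> borel_measurable (fld (outside p q)) \<longleftrightarrow>
     (\<lambda>\<omega>. (\<omega> x - \<omega> (clamp_real p q x)) - (\<omega> 0 - \<omega> (clamp_real p q 0))) \<in> borel_measurable (fld (outside p q))"
    by (rule measurable_cong) (simp add: path_0)
  ultimately show ?thesis by simp
qed

lemma bounded_integrable:
  fixes g :: "path \<Rightarrow> real"
  assumes "g \<in> borel_measurable W" "\<And>\<omega>. \<bar>g \<omega>\<bar> \<le> B" shows "integrable W g"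
  using assms by (intro integrable_const_bound[where B=B]) auto

text \<open>Removing the clamped part from every coordinate turns \<open>g\<close> into a function
  of the outside, whose conditional expectations in both fields agree. The error is at most
  \<open>L\<close> times the sum of the clamped increments. Given \<open>fld R1\<close> this sum is
  known, and given \<open>fld R0\<close> it is replaced by its mean; these are the two terms on the
  right.\<close>

lemma cond_exp_jump_le:
  assumes ad: "adjacent p q R0 R1" and T: "finite T"
    and G: "\<And>x. G x \<in> borel_measurable borel" "\<And>x y. \<bar>G x y\<bar> \<le> (1::real)" "\<And>x y z. \<bar>G x y - G x z\<bar> \<le> L * \<bar>y - z\<bar>"
    and L: "0 \<le> L"
  defines "g \<equiv> \<lambda>\<omega>. \<Prod>x\<in>T. G x (\<omega> x)"
  shows "AE \<omega> in W. \<bar>real_cond_exp W (fld R1) g \<omega> - real_cond_exp W (fld R0) g \<omega>\<bar> \<le>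
     L * (\<Sum>x\<in>T. \<bar>clamped p q x \<omega>\<bar>) + L * (card T * sqrt (q - p))"
proof -
  have pq: "p < q" "R0 \<subseteq> outside p q" "inside p q \<subseteq> R1" using ad by (auto simp: adjacent_def)
  let ?Y = "\<lambda>\<omega>. L * (\<Sum>x\<in>T. \<bar>clamped p q x \<omega>\<bar>)"
  define g' where "g' \<omega> = (\<Prod>x\<in>T. G x (\<omega> x - clamped p q x \<omega>))" for \<omega>
  have Gm: "(\<lambda>\<omega>. G x (f \<omega>)) \<in> borel_measurable N" if "f \<in> borel_measurable N" for x f and N :: "path measure"
    using measurable_compose[OF that G(1)] .
  have gm: "g \<in> borel_measurable W" unfolding g_def by (intro borel_measurable_prod Gm) measurable
  have go: "g' \<in> borel_measurable (fld (outside p q))"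
    unfolding g'_def using pq by (intro borel_measurable_prod Gm coordinate_minus_clamped_outside) auto
  have gm': "g' \<in> borel_measurable W" by (rule measurable_from_subalg[OF subalgebra_fld go])
  have b1: "\<bar>\<Prod>x\<in>T. G x (y x)\<bar> \<le> 1" for y using G(2) by (auto simp: abs_prod intro!: prod_le_1)
  have gi: "integrable W g" "integrable W g'"
    using gm gm' b1 by (auto simp: g_def g'_def intro!: bounded_integrable[where B=1])
  have Yi: "integrable W ?Y" using increment_integrable by auto
  have Ym: "?Y \<in> borel_measurable (fld (inside p q))"
    using clamped_inside[of p q] pq by (intro borel_measurable_times borel_measurable_sum borel_measurable_abs) auto
  have YR1: "?Y \<in> borel_measurable (fld R1)"
    using Ym measurable_mono[of borel borel "fld (inside p q)" "fld R1"] fld_mono[OF pq(3)] by auto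
  have le: "\<bar>g \<omega> - g' \<omega>\<bar> \<le> ?Y \<omega>" for \<omega>
  proof -
    have "norm (g \<omega> - g' \<omega>) \<le> (\<Sum>x\<in>T. norm (G x (\<omega> x) - G x (\<omega> x - clamped p q x \<omega>)))"
      unfolding g_def g'_def by (rule norm_prod_diff) (use G(2) in auto)
    also have "\<dots> \<le> (\<Sum>x\<in>T. L * \<bar>clamped p q x \<omega>\<bar>)"
    proof (rule sum_mono)
      fix x show "norm (G x (\<omega> x) - G x (\<omega> x - clamped p q x \<omega>)) \<le> L * \<bar>clamped p q x \<omega>\<bar>"
        using G(3)[of x "\<omega> x" "\<omega> x - clamped p q x \<omega>"] by simp
    qed
    finally show ?thesis by (simp add: sum_distrib_left)
  qed
  have EY: "(\<integral>\<omega>. ?Y \<omega> \<partial>W) \<le> L * (card T * sqrt (q - p))"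
  proof -
    have "(\<integral>\<omega>. (\<Sum>x\<in>T. \<bar>clamped p q x \<omega>\<bar>) \<partial>W) = (\<Sum>x\<in>T. \<integral>\<omega>. \<bar>clamped p q x \<omega>\<bar> \<partial>W)"
      using increment_integrable by (intro Bochner_Integration.integral_sum) auto
    also have "\<dots> \<le> (\<Sum>x\<in>T. sqrt (q - p))"
    proof (rule sum_mono)
      fix x show "(\<integral>\<omega>. \<bar>clamped p q x \<omega>\<bar> \<partial>W) \<le> sqrt (q - p)"
        using clamp_real[of p q x] clamp_real[of p q 0] pq by (intro increment_abs_mean) auto
    qed
    finally show ?thesis using L by (simp add: mult_left_mono)
  qed
  have diff: "AE \<omega> in W. \<bar>real_cond_exp W (fld R) g \<omega> - real_cond_exp W (fld R) g' \<omega>\<bar> \<le> real_cond_exp W (fld R) ?Y \<omega>" for R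
  proof -
    interpret s: sigma_finite_subalgebra W "fld R" by (rule sigma_finite_fld)
    have d: "integrable W (\<lambda>\<omega>. g \<omega> - g' \<omega>)" "integrable W (\<lambda>\<omega>. g' \<omega> - g \<omega>)" using gi by auto
    have 1: "AE \<omega> in W. real_cond_exp W (fld R) (\<lambda>\<omega>. g \<omega> - g' \<omega>) \<omega> \<le> real_cond_exp W (fld R) ?Y \<omega>"
      by (rule s.real_cond_exp_mono[OF _ d(1) Yi]) (use le abs_le_D1 in blast)
    have 2: "AE \<omega> in W. real_cond_exp W (fld R) (\<lambda>\<omega>. g' \<omega> - g \<omega>) \<omega> \<le> real_cond_exp W (fld R) ?Y \<omega>"
      by (rule s.real_cond_exp_mono[OF _ d(2) Yi]) (intro AE_I2, use le in \<open>smt (verit)\<close>)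
    show ?thesis
      using 1 2 s.real_cond_exp_diff[OF gi] s.real_cond_exp_diff[OF gi(2,1)] by eventually_elim linarith
  qed
  show ?thesis
    using diff[of R1] diff[of R0] cond_exp_adjacent[OF ad go gi(2)]
      sigma_finite_subalgebra.real_cond_exp_F_meas[OF sigma_finite_fld Yi YR1] cond_exp_inside[OF pq(2) Ym Yi]
    by eventually_elim (use EY in linarith)
qed

text \<open>A jump above \<open>c\<close> forces one of the clamped increments above a fixed level.
  The tail bound is of order \<open>(1 / 4) ^ n\<close> per cell, so over \<open>2 ^ n\<close> cells
  the total still tends to 0.\<close>

lemma small_jumps_product:
  assumes ad: "\<And>s t. s < t \<Longrightarrow> \<exists>p q. q - p = t - s \<and> adjacent p q (R s) (R t)" and T: "finite T"
    and G: "\<And>x. G x \<in> borel_measurable borel" "\<And>x y. \<bar>G x y\<bar> \<le> (1::real)" "\<And>x y z. \<bar>G x y - G x z\<bar> \<le> L * \<bar>y - z\<bar>"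
    and L: "0 < L" and ab: "a < b"
  shows "small_jumps (\<lambda>t. fld (R t)) a b (\<lambda>\<omega>. \<Prod>x\<in>T. G x (\<omega> x))"
  unfolding small_jumps_def
proof (intro conjI allI impI)
  let ?g = "\<lambda>\<omega>. \<Prod>x\<in>T. G x (\<omega> x)"
  have Gm: "(\<lambda>\<omega>. G x (\<omega> x)) \<in> borel_measurable W" for x
    by (rule measurable_compose[OF _ G(1)]) measurable
  have b1: "\<bar>\<Prod>x\<in>T. G x (y x)\<bar> \<le> 1" for y using G(2) by (auto simp: abs_prod intro!: prod_le_1)
  show "integrable W ?g"
    using Gm b1 by (intro bounded_integrable[where B=1] borel_measurable_prod) auto
  fix c :: real assume c: "0 < c"
  let ?E = "\<lambda>n. {\<omega>\<in>space W. \<exists>j<2^n. c < \<bar>real_cond_exp W (fld (R (grid a b n (Suc j)))) ?g \<omega> -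
      real_cond_exp W (fld (R (grid a b n j))) ?g \<omega>\<bar>}"
  define m where "m = real (card T)"
  have m: "0 \<le> m" by (simp add: m_def)
  \<comment> \<open>One half of \<open>c\<close> is reserved for the clamped increments, the other
    for their mean, which is eventually small. The summand 1 keeps the denominator positive when
    \<open>T\<close> is empty.\<close>
  define c' where "c' = c / (2 * L * (m + 1))"
  have c': "0 < c'" using c L m by (simp add: c'_def)
  let ?h = "\<lambda>n. (b - a) / 2 ^ n"
  have "(\<lambda>n. L * (m * sqrt (?h n))) \<longlonglongrightarrow> L * (m * sqrt 0)"
    by (intro tendsto_intros grid_width_tendsto_0)
  then have "eventually (\<lambda>n. L * (m * sqrt (?h n)) < c / 2) sequentially"
    using c by (intro order_tendstoD(2)) auto
  then have ev: "eventually (\<lambda>n. prob (?E n) \<le> 3 * m * (b - a)\<^sup>2 / c' ^ 4 * (1 / 2 ^ n)) sequentially"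
  proof eventually_elim
    case (elim n)
    have "\<exists>p q. q - p = ?h n \<and> adjacent p q (R (grid a b n j)) (R (grid a b n (Suc j)))" for j
      using ad[OF grid_strict_mono[OF ab lessI, of n j]] by (simp add: grid_Suc)
    then obtain p q where pq: "\<And>j. q j - p j = ?h n" "\<And>j. adjacent (p j) (q j) (R (grid a b n j)) (R (grid a b n (Suc j)))"
      by metis
    have plq: "p j \<le> q j" for j using pq(2)[of j] by (simp add: adjacent_def)
    let ?B = "\<Union>j<2^n. \<Union>x\<in>T. {\<omega>\<in>path_space. c' < \<bar>clamped (p j) (q j) x \<omega>\<bar>}"
    have Bm: "{\<omega>\<in>path_space. c' < \<bar>clamped (p j) (q j) x \<omega>\<bar>} \<in> events" for j x
    proof -
      have "{\<omega>\<in>space W. c' < \<bar>clamped (p j) (q j) x \<omega>\<bar>} \<in> events" by measurable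
      then show ?thesis by simp
    qed
    have "AE \<omega> in W. \<forall>j\<in>{..<2^n}. \<bar>real_cond_exp W (fld (R (grid a b n (Suc j)))) ?g \<omega> - real_cond_exp W (fld (R (grid a b n j))) ?g \<omega>\<bar> \<le>
     L * (\<Sum>x\<in>T. \<bar>clamped (p j) (q j) x \<omega>\<bar>) + L * (card T * sqrt (q j - p j))"
      using cond_exp_jump_le[OF pq(2) T G less_imp_le[OF L]] by (intro AE_finite_allI) auto
    then have "AE \<omega> in W. \<omega> \<in> ?E n \<longrightarrow> \<omega> \<in> ?B"
      using AE_space
    proof eventually_elim
      case w: (elim \<omega>)
      show ?case
      proof (rule impI, rule ccontr)
        assume E: "\<omega> \<in> ?E n" and "\<omega> \<notin> ?B"
        then have small: "\<bar>clamped (p j) (q j) x \<omega>\<bar> \<le> c'" if "j < 2^n" "x \<in> T" for j x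
          using that w(2) by (auto simp: not_less)
        obtain j where j: "j < 2^n" "c < \<bar>real_cond_exp W (fld (R (grid a b n (Suc j)))) ?g \<omega> - real_cond_exp W (fld (R (grid a b n j))) ?g \<omega>\<bar>"
          using E by blast
        have "(\<Sum>x\<in>T. \<bar>clamped (p j) (q j) x \<omega>\<bar>) \<le> (\<Sum>x\<in>T. c')" using small[OF j(1)] by (intro sum_mono)
        also have "\<dots> = m * c'" by (simp add: m_def)
        also have "\<dots> \<le> (m + 1) * c'" using c' by (simp add: mult_right_mono)
        finally have "L * (\<Sum>x\<in>T. \<bar>clamped (p j) (q j) x \<omega>\<bar>) \<le> L * ((m + 1) * c')" using L by (simp add: mult_left_mono)
        also have "\<dots> = (c' * (2 * L * (m + 1))) / 2" by (simp add: algebra_simps)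
        also have "\<dots> = c / 2"
        proof -
          have "2 * L * (m + 1) \<noteq> 0" using L m by simp
          then have "c' * (2 * L * (m + 1)) = c" by (metis c'_def nonzero_eq_divide_eq)
          then show ?thesis by simp
        qed
        finally have "L * (\<Sum>x\<in>T. \<bar>clamped (p j) (q j) x \<omega>\<bar>) \<le> c / 2" .
        moreover have "L * (card T * sqrt (q j - p j)) < c / 2" using elim pq(1)[of j] by (simp add: m_def)
        moreover note bspec[OF w(1) lessThan_iff[THEN iffD2, OF j(1)]]
        ultimately show False using j(2) by linarith
      qed
    qed
    then have "prob (?E n) \<le> prob ?B" using Bm T by (intro finite_measure_mono_AE) auto
    also have "\<dots> \<le> (\<Sum>j<2^n. prob (\<Union>x\<in>T. {\<omega>\<in>path_space. c' < \<bar>clamped (p j) (q j) x \<omega>\<bar>}))"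
      using Bm T by (intro finite_measure_subadditive_finite) auto
    also have "\<dots> \<le> (\<Sum>j<(2::nat)^n. m * (3 * (?h n)\<^sup>2 / c' ^ 4))"
    proof (rule sum_mono)
      fix j
      have "prob (\<Union>x\<in>T. {\<omega>\<in>path_space. c' < \<bar>clamped (p j) (q j) x \<omega>\<bar>}) \<le> (\<Sum>x\<in>T. prob {\<omega>\<in>path_space. c' < \<bar>clamped (p j) (q j) x \<omega>\<bar>})"
        using Bm T by (intro finite_measure_subadditive_finite) auto
      also have "\<dots> \<le> (\<Sum>x\<in>T. 3 * (?h n)\<^sup>2 / c' ^ 4)"
      proof (rule sum_mono)
        fix x show "prob {\<omega>\<in>path_space. c' < \<bar>clamped (p j) (q j) x \<omega>\<bar>} \<le> 3 * (?h n)\<^sup>2 / c' ^ 4"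
          using clamp_real[OF plq, of j x] clamp_real[OF plq, of j 0] pq(1)[of j] c' by (intro increment_tail) auto
      qed
      finally show "prob (\<Union>x\<in>T. {\<omega>\<in>path_space. c' < \<bar>clamped (p j) (q j) x \<omega>\<bar>}) \<le> m * (3 * (?h n)\<^sup>2 / c' ^ 4)"
        by (simp add: m_def)
    qed
    also have "\<dots> = 3 * m * (b - a)\<^sup>2 / c' ^ 4 * (1 / 2 ^ n)"
    proof -
      have "x * (m * (3 * (D / x)\<^sup>2 / y)) = 3 * m * D\<^sup>2 / y * (1 / x)" if "0 < x" for x y D :: real
        using that by (cases "y = 0") (simp_all add: power2_eq_square mult_ac)
      then show ?thesis by simp
    qed
    finally show ?case .
  qed
  have "(\<lambda>n. 3 * m * (b - a)\<^sup>2 / c' ^ 4 * (1 / 2 ^ n)) \<longlonglongrightarrow> 3 * m * (b - a)\<^sup>2 / c' ^ 4 * 0"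
    by (intro tendsto_mult_left LIMSEQ_divide_realpow_zero) auto
  then show "(\<lambda>n. prob (?E n)) \<longlonglongrightarrow> 0"
    by (intro tendsto_sandwich[OF _ ev tendsto_const]) auto
qed

section \<open>Approximation by random variables with small jumps\<close>

definition approximable :: "(real \<Rightarrow> path measure) \<Rightarrow> real \<Rightarrow> real \<Rightarrow> (path \<Rightarrow> real) \<Rightarrow> bool" where
  "approximable F a b V \<longleftrightarrow> integrable W V \<and> (\<forall>e>0. \<exists>g. small_jumps F a b g \<and> (\<integral>\<omega>. \<bar>V \<omega> - g \<omega>\<bar> \<partial>W) \<le> e)"

lemma small_jumps_add:
  assumes F: "\<And>t. subalgebra W (F t)" and f: "small_jumps F a b f" and g: "small_jumps F a b g"
  shows "small_jumps F a b (\<lambda>\<omega>. f \<omega> + g \<omega>)"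
  unfolding small_jumps_def
proof (intro conjI allI impI)
  have i: "integrable W f" "integrable W g" using f g by (auto simp: small_jumps_def)
  then show "integrable W (\<lambda>\<omega>. f \<omega> + g \<omega>)" by simp
  fix c :: real assume c: "0 < c"
  let ?J = "\<lambda>g c n. {\<omega>\<in>space W. \<exists>j<2^n. c < \<bar>real_cond_exp W (F (grid a b n (Suc j))) g \<omega> - real_cond_exp W (F (grid a b n j)) g \<omega>\<bar>}"
  have Jm: "?J g c n \<in> events" for g c n by measurable
  have le: "prob (?J (\<lambda>\<omega>. f \<omega> + g \<omega>) c n) \<le> prob (?J f (c / 2) n) + prob (?J g (c / 2) n)" for n
  proof -
    have "AE \<omega> in W. \<forall>j. real_cond_exp W (F (grid a b n j)) (\<lambda>\<omega>. f \<omega> + g \<omega>) \<omega> =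
        real_cond_exp W (F (grid a b n j)) f \<omega> + real_cond_exp W (F (grid a b n j)) g \<omega>"
      by (intro AE_all_countable[THEN iffD2] allI
           sigma_finite_subalgebra.real_cond_exp_add[OF sigma_finite_subalgebra_of_subalgebra[OF F] i])
    then have "AE \<omega> in W. \<omega> \<in> ?J (\<lambda>\<omega>. f \<omega> + g \<omega>) c n \<longrightarrow> \<omega> \<in> ?J f (c / 2) n \<union> ?J g (c / 2) n"
    proof eventually_elim
      case (elim \<omega>)
      show ?case
      proof
        assume "\<omega> \<in> ?J (\<lambda>\<omega>. f \<omega> + g \<omega>) c n"
        then obtain j where j: "j < 2^n" "\<omega> \<in> space W" "c < \<bar>real_cond_exp W (F (grid a b n (Suc j))) (\<lambda>\<omega>. f \<omega> + g \<omega>) \<omega> - real_cond_exp W (F (grid a b n j)) (\<lambda>\<omega>. f \<omega> + g \<omega>) \<omega>\<bar>" by blast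
        then have "c / 2 < \<bar>real_cond_exp W (F (grid a b n (Suc j))) f \<omega> - real_cond_exp W (F (grid a b n j)) f \<omega>\<bar> \<or>
          c / 2 < \<bar>real_cond_exp W (F (grid a b n (Suc j))) g \<omega> - real_cond_exp W (F (grid a b n j)) g \<omega>\<bar>"
          unfolding elim[rule_format] by linarith
        then show "\<omega> \<in> ?J f (c / 2) n \<union> ?J g (c / 2) n" using j by blast
      qed
    qed
    then have "prob (?J (\<lambda>\<omega>. f \<omega> + g \<omega>) c n) \<le> prob (?J f (c / 2) n \<union> ?J g (c / 2) n)"
      by (rule finite_measure_mono_AE) (rule sets.Un[OF Jm Jm])
    also have "\<dots> \<le> prob (?J f (c / 2) n) + prob (?J g (c / 2) n)" by (rule measure_Un_le[OF Jm Jm])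
    finally show ?thesis .
  qed
  have "c / 2 > 0" using c by simp
  then have "(\<lambda>n. prob (?J f (c / 2) n)) \<longlonglongrightarrow> 0" "(\<lambda>n. prob (?J g (c / 2) n)) \<longlonglongrightarrow> 0"
    using f g unfolding small_jumps_def by blast+
  from tendsto_add[OF this] have "(\<lambda>n. prob (?J f (c / 2) n) + prob (?J g (c / 2) n)) \<longlonglongrightarrow> 0" by simp
  then show "(\<lambda>n. prob (?J (\<lambda>\<omega>. f \<omega> + g \<omega>) c n)) \<longlonglongrightarrow> 0"
    by (rule tendsto_sandwich[OF _ _ tendsto_const, rotated 2]) (use le in auto)
qed

lemma small_jumps_cmult:
  assumes F: "\<And>t. subalgebra W (F t)" and f: "small_jumps F a b f" and k: "k \<noteq> 0"
  shows "small_jumps F a b (\<lambda>\<omega>. k * f \<omega>)"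
  unfolding small_jumps_def
proof (intro conjI allI impI)
  have i: "integrable W f" using f by (auto simp: small_jumps_def)
  then show "integrable W (\<lambda>\<omega>. k * f \<omega>)" by simp
  fix c :: real assume c: "0 < c"
  let ?J = "\<lambda>g c n. {\<omega>\<in>space W. \<exists>j<2^n. c < \<bar>real_cond_exp W (F (grid a b n (Suc j))) g \<omega> - real_cond_exp W (F (grid a b n j)) g \<omega>\<bar>}"
  have Jm: "?J g c n \<in> events" for g c n by measurable
  have eq: "prob (?J (\<lambda>\<omega>. k * f \<omega>) c n) = prob (?J f (c / \<bar>k\<bar>) n)" for n
  proof (rule finite_measure_eq_AE[OF _ Jm Jm])
    have "AE \<omega> in W. \<forall>j. real_cond_exp W (F (grid a b n j)) (\<lambda>\<omega>. k * f \<omega>) \<omega> = k * real_cond_exp W (F (grid a b n j)) f \<omega>"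
      by (intro AE_all_countable[THEN iffD2] allI
           sigma_finite_subalgebra.real_cond_exp_cmult[OF sigma_finite_subalgebra_of_subalgebra[OF F] i])
    then show "AE \<omega> in W. (\<omega> \<in> ?J (\<lambda>\<omega>. k * f \<omega>) c n) = (\<omega> \<in> ?J f (c / \<bar>k\<bar>) n)"
    proof eventually_elim
      case (elim \<omega>)
      have "c < \<bar>k * x - k * y\<bar> \<longleftrightarrow> c / \<bar>k\<bar> < \<bar>x - y\<bar>" for x y
        using k unfolding right_diff_distrib[symmetric] abs_mult by (simp add: divide_less_eq mult.commute)
      then show ?case unfolding mem_Collect_eq elim[rule_format] by simp
    qed
  qed
  have "c / \<bar>k\<bar> > 0" using c k by simp
  then have "(\<lambda>n. prob (?J f (c / \<bar>k\<bar>) n)) \<longlonglongrightarrow> 0" using f unfolding small_jumps_def by blast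
  then show "(\<lambda>n. prob (?J (\<lambda>\<omega>. k * f \<omega>) c n)) \<longlonglongrightarrow> 0" by (simp only: eq)
qed

lemma approximable_add:
  assumes F: "\<And>t. subalgebra W (F t)" and f: "approximable F a b f" and g: "approximable F a b g"
  shows "approximable F a b (\<lambda>\<omega>. f \<omega> + g \<omega>)"
  unfolding approximable_def
proof (intro conjI allI impI)
  have i: "integrable W f" "integrable W g" using f g by (auto simp: approximable_def)
  then show "integrable W (\<lambda>\<omega>. f \<omega> + g \<omega>)" by simp
  fix e :: real assume "0 < e"
  then have e: "0 < e / 2" by simp
  obtain f' where f': "small_jumps F a b f'" "(\<integral>\<omega>. \<bar>f \<omega> - f' \<omega>\<bar> \<partial>W) \<le> e / 2" using f e unfolding approximable_def by blast
  obtain g' where g': "small_jumps F a b g'" "(\<integral>\<omega>. \<bar>g \<omega> - g' \<omega>\<bar> \<partial>W) \<le> e / 2" using g e unfolding approximable_def by blast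
  have i': "integrable W f'" "integrable W g'" using f' g' by (auto simp: small_jumps_def)
  have "(\<integral>\<omega>. \<bar>(f \<omega> + g \<omega>) - (f' \<omega> + g' \<omega>)\<bar> \<partial>W) \<le> (\<integral>\<omega>. \<bar>f \<omega> - f' \<omega>\<bar> + \<bar>g \<omega> - g' \<omega>\<bar> \<partial>W)"
    using i i' by (intro integral_mono) auto
  also have "\<dots> = (\<integral>\<omega>. \<bar>f \<omega> - f' \<omega>\<bar> \<partial>W) + (\<integral>\<omega>. \<bar>g \<omega> - g' \<omega>\<bar> \<partial>W)"
    using i i' by (intro Bochner_Integration.integral_add) auto
  finally have "(\<integral>\<omega>. \<bar>(f \<omega> + g \<omega>) - (f' \<omega> + g' \<omega>)\<bar> \<partial>W) \<le> e" using f' g' by simp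
  then show "\<exists>h. small_jumps F a b h \<and> (\<integral>\<omega>. \<bar>(f \<omega> + g \<omega>) - h \<omega>\<bar> \<partial>W) \<le> e"
    using small_jumps_add[OF F f'(1) g'(1)] by blast
qed

lemma approximable_limit:
  assumes V: "integrable W V" and s: "\<And>i. approximable F a b (s i)" and lim: "(\<lambda>i::nat. \<integral>\<omega>. \<bar>V \<omega> - s i \<omega>\<bar> \<partial>W) \<longlonglongrightarrow> 0"
  shows "approximable F a b V"
  unfolding approximable_def
proof (intro conjI allI impI V)
  fix e :: real assume "0 < e"
  then have e: "0 < e / 2" by simp
  obtain i where i: "(\<integral>\<omega>. \<bar>V \<omega> - s i \<omega>\<bar> \<partial>W) < e / 2"
    using order_tendstoD(2)[OF lim e] unfolding eventually_sequentially by blast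
  obtain g where g: "small_jumps F a b g" "(\<integral>\<omega>. \<bar>s i \<omega> - g \<omega>\<bar> \<partial>W) \<le> e / 2"
    using s[of i] e unfolding approximable_def by blast
  have int: "integrable W (s i)" "integrable W g" using s g by (auto simp: approximable_def small_jumps_def)
  have "(\<integral>\<omega>. \<bar>V \<omega> - g \<omega>\<bar> \<partial>W) \<le> (\<integral>\<omega>. \<bar>V \<omega> - s i \<omega>\<bar> + \<bar>s i \<omega> - g \<omega>\<bar> \<partial>W)"
    using V int by (intro integral_mono) auto
  also have "\<dots> = (\<integral>\<omega>. \<bar>V \<omega> - s i \<omega>\<bar> \<partial>W) + (\<integral>\<omega>. \<bar>s i \<omega> - g \<omega>\<bar> \<partial>W)"
    using V int by (intro Bochner_Integration.integral_add) auto
  finally show "\<exists>g. small_jumps F a b g \<and> (\<integral>\<omega>. \<bar>V \<omega> - g \<omega>\<bar> \<partial>W) \<le> e" using g i by (intro exI[of _ g]) auto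
qed

lemma approximable_dominated:
  assumes V: "integrable W V" and s: "\<And>i::nat. approximable F a b (s i)"
    and lim: "\<And>\<omega>. \<omega> \<in> space W \<Longrightarrow> (\<lambda>i. s i \<omega>) \<longlonglongrightarrow> V \<omega>" and bound: "\<And>i \<omega>. \<omega> \<in> space W \<Longrightarrow> \<bar>s i \<omega>\<bar> \<le> B \<omega>" and B: "integrable W B"
  shows "approximable F a b V"
proof (rule approximable_limit[OF V s])
  have si: "integrable W (s i)" for i using s by (simp add: approximable_def)
  have "(\<lambda>i. \<integral>\<omega>. \<bar>V \<omega> - s i \<omega>\<bar> \<partial>W) \<longlonglongrightarrow> (\<integral>\<omega>. 0 \<partial>W)"
  proof (rule integral_dominated_convergence[where w="\<lambda>\<omega>. \<bar>V \<omega>\<bar> + B \<omega>"])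
    show "AE \<omega> in W. (\<lambda>i. \<bar>V \<omega> - s i \<omega>\<bar>) \<longlonglongrightarrow> 0"
    proof (rule AE_I2)
      fix \<omega> assume "\<omega> \<in> space W"
      then have "(\<lambda>i. \<bar>V \<omega> - s i \<omega>\<bar>) \<longlonglongrightarrow> \<bar>V \<omega> - V \<omega>\<bar>" by (intro tendsto_intros lim)
      then show "(\<lambda>i. \<bar>V \<omega> - s i \<omega>\<bar>) \<longlonglongrightarrow> 0" by simp
    qed
    show "AE \<omega> in W. norm \<bar>V \<omega> - s i \<omega>\<bar> \<le> \<bar>V \<omega>\<bar> + B \<omega>" for i
    proof (rule AE_I2)
      fix \<omega> assume "\<omega> \<in> space W"
      then show "norm \<bar>V \<omega> - s i \<omega>\<bar> \<le> \<bar>V \<omega>\<bar> + B \<omega>" using bound[of \<omega> i] by simp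
    qed
  qed (use V B si in auto)
  then show "(\<lambda>i. \<integral>\<omega>. \<bar>V \<omega> - s i \<omega>\<bar> \<partial>W) \<longlonglongrightarrow> 0" by simp
qed

lemma small_jumps_approximable: "small_jumps F a b g \<Longrightarrow> approximable F a b g"
  unfolding approximable_def by (auto simp: small_jumps_def intro!: exI[of _ g])

lemma approximable_cmult:
  assumes F: "\<And>t. subalgebra W (F t)" and f: "approximable F a b f" and k: "k \<noteq> 0"
  shows "approximable F a b (\<lambda>\<omega>. k * f \<omega>)"
  unfolding approximable_def
proof (intro conjI allI impI)
  have i: "integrable W f" using f by (auto simp: approximable_def)
  then show "integrable W (\<lambda>\<omega>. k * f \<omega>)" by simp
  fix e :: real assume "0 < e"
  then have e: "0 < e / \<bar>k\<bar>" using k by simp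
  obtain f' where f': "small_jumps F a b f'" "(\<integral>\<omega>. \<bar>f \<omega> - f' \<omega>\<bar> \<partial>W) \<le> e / \<bar>k\<bar>" using f e unfolding approximable_def by blast
  have "(\<integral>\<omega>. \<bar>k * f \<omega> - k * f' \<omega>\<bar> \<partial>W) = (\<integral>\<omega>. \<bar>k\<bar> * \<bar>f \<omega> - f' \<omega>\<bar> \<partial>W)"
    by (simp add: right_diff_distrib[symmetric] abs_mult)
  also have "\<dots> = \<bar>k\<bar> * (\<integral>\<omega>. \<bar>f \<omega> - f' \<omega>\<bar> \<partial>W)" by simp
  also have "\<dots> \<le> \<bar>k\<bar> * (e / \<bar>k\<bar>)" using f'(2) by (intro mult_left_mono) auto
  also have "\<dots> = e" using k by simp
  finally show "\<exists>h. small_jumps F a b h \<and> (\<integral>\<omega>. \<bar>k * f \<omega> - h \<omega>\<bar> \<partial>W) \<le> e"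
    using small_jumps_cmult[OF F f'(1) k] by blast
qed

text \<open>Indicators of closed sets are pointwise limits of Lipschitz functions, the kind of
  factor that \<open>small_jumps_product\<close> can treat; and these cylinders still form an
  intersection-stable generator of the Borel field.\<close>

definition closed_cylinders :: "path set set" where
  "closed_cylinders = {cylinder T A | T A. finite T \<and> (\<forall>x. closed (A x))}"

lemma Int_stable_closed_cylinders: "Int_stable closed_cylinders"
proof (rule Int_stableI)
  fix a b assume "a \<in> closed_cylinders" "b \<in> closed_cylinders"
  then obtain S A T B where a: "a = cylinder S A" "finite S" "\<forall>x. closed (A x)"
    and b: "b = cylinder T B" "finite T" "\<forall>x. closed (B x)" unfolding closed_cylinders_def by blast
  have "a \<inter> b = cylinder (S \<union> T) (\<lambda>x. (if x \<in> S then A x else UNIV) \<inter> (if x \<in> T then B x else UNIV))"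
    unfolding a b cylinder_def by (auto split: if_splits)
  moreover have "finite (S \<union> T)" "\<forall>x. closed ((if x \<in> S then A x else UNIV) \<inter> (if x \<in> T then B x else UNIV))"
    using a b by auto
  ultimately show "a \<inter> b \<in> closed_cylinders" unfolding closed_cylinders_def mem_Collect_eq by (intro exI conjI)
qed

lemma closed_cylinders_sub: "closed_cylinders \<subseteq> Pow path_space" "closed_cylinders \<subseteq> sets path_borel"
proof -
  show "closed_cylinders \<subseteq> Pow path_space" by (auto simp: closed_cylinders_def cylinder_def)
  have "closed_cylinders \<subseteq> cylinders"
  proof
    fix a assume "a \<in> closed_cylinders"
    then obtain T A where a: "a = cylinder T A" "finite T" "\<forall>x. closed (A x)" unfolding closed_cylinders_def by blast
    then have "\<forall>x. A x \<in> sets borel" by (auto intro: borel_closed)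
    with a show "a \<in> cylinders" unfolding cylinders_def by blast
  qed
  then show "closed_cylinders \<subseteq> sets path_borel" unfolding sigma_sets_cylinders by (auto intro: sigma_sets.Basic)
qed

lemma sets_path_borel_closed_cylinders: "sets path_borel \<subseteq> sigma_sets path_space closed_cylinders"
proof -
  have "sets path_borel \<subseteq> sets (sigma path_space closed_cylinders)"
  proof (rule path_measurableI)
    fix t
    show "(\<lambda>\<omega>. \<omega> t) \<in> borel_measurable (sigma path_space closed_cylinders)"
    proof (rule borel_measurableI)
      fix B :: "real set" assume "open B"
      then have "finite {t}" "\<forall>x::real. closed (- B)" by auto
      then have "cylinder {t} (\<lambda>_. - B) \<in> closed_cylinders"
        unfolding closed_cylinders_def mem_Collect_eq by (intro exI conjI) auto
      then have "path_space - cylinder {t} (\<lambda>_. - B) \<in> sigma_sets path_space closed_cylinders"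
        by (intro sigma_sets.Compl sigma_sets.Basic)
      moreover have "(\<lambda>\<omega>. \<omega> t) -` B \<inter> path_space = path_space - cylinder {t} (\<lambda>_. - B)" by (auto simp: cylinder_def)
      ultimately show "(\<lambda>\<omega>. \<omega> t) -` B \<inter> space (sigma path_space closed_cylinders) \<in> sets (sigma path_space closed_cylinders)"
        using closed_cylinders_sub(1) by (simp add: space_measure_of_conv)
    qed
  qed (simp add: space_measure_of_conv)
  then show ?thesis using closed_cylinders_sub(1) by simp
qed

text \<open>The distance to the empty set is 0 by convention, so without the case distinction the
  bump of the empty set would be 1 and would not converge to its indicator.\<close>

definition bump :: "real set \<Rightarrow> nat \<Rightarrow> real \<Rightarrow> real" where
  "bump A k y = (if A = {} then 0 else max 0 (1 - real k * infdist y A))"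

lemma bump_bounds: "0 \<le> bump A k y" "bump A k y \<le> 1"
  by (auto simp: bump_def infdist_nonneg)

text \<open>The constant \<open>real k + 1\<close> is positive for \<open>k = 0\<close> too, as
  \<open>small_jumps_product\<close> demands.\<close>

lemma bump_lipschitz: "\<bar>bump A k y - bump A k z\<bar> \<le> (real k + 1) * \<bar>y - z\<bar>"
proof (cases "A = {}")
  case False
  have "\<bar>max 0 (1 - real k * infdist y A) - max 0 (1 - real k * infdist z A)\<bar> \<le> \<bar>real k * infdist y A - real k * infdist z A\<bar>"
    by linarith
  also have "\<dots> = real k * \<bar>infdist y A - infdist z A\<bar>" by (simp add: right_diff_distrib[symmetric] abs_mult)
  also have "\<dots> \<le> real k * \<bar>y - z\<bar>"
    using infdist_triangle_abs[of y A z] by (intro mult_left_mono) (auto simp: dist_real_def)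
  also have "\<dots> \<le> (real k + 1) * \<bar>y - z\<bar>" by (intro mult_right_mono) auto
  finally show ?thesis using False by (simp add: bump_def)
qed (simp add: bump_def)

lemma bump_measurable: "bump A k \<in> borel_measurable borel"
proof (cases "A = {}")
  case True
  then show ?thesis by (simp add: bump_def[abs_def])
next
  case False
  have "continuous_on UNIV (\<lambda>y. max 0 (1 - real k * infdist y A))" by (intro continuous_intros)
  then have "(\<lambda>y. max 0 (1 - real k * infdist y A)) \<in> borel_measurable borel" by (rule borel_measurable_continuous_onI)
  with False show ?thesis by (simp add: bump_def[abs_def])
qed

lemma bump_tendsto:
  assumes "closed A" shows "(\<lambda>k. bump A k y) \<longlonglongrightarrow> indicator A y"
proof (cases "A = {}")
  case False
  show ?thesis
  proof (cases "y \<in> A")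
    case True
    then show ?thesis using False by (simp add: bump_def)
  next
    case out: False
    then have d: "0 < infdist y A" using in_closed_iff_infdist_zero[OF assms False, of y] infdist_nonneg[of y A] by auto
    have "eventually (\<lambda>k. bump A k y = 0) sequentially"
    proof -
      obtain N where N: "inverse (infdist y A) \<le> real N" using real_arch_simple by blast
      have "bump A k y = 0" if "N \<le> k" for k
      proof -
        have "inverse (infdist y A) \<le> real k" using N that by linarith
        then have "1 \<le> real k * infdist y A" using d by (simp add: field_simps)
        then show ?thesis by (simp add: bump_def)
      qed
      then show ?thesis unfolding eventually_sequentially by blast
    qed
    then show ?thesis using out by (simp add: tendsto_eventually)
  qed
qed (simp add: bump_def)

text \<open>A density argument: products of bumps approximate closed cylinders, complements and
  disjoint unions lead to all Borel sets, null sets to the completion, and linear combinations with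
  dominated limits to all integrable variables. \<open>approximable\<close> is stable under each of
  these operations.\<close>

theorem continuous_filtration_fld:
  assumes ad: "\<And>s t. s < t \<Longrightarrow> \<exists>p q. q - p = t - s \<and> adjacent p q (R s) (R t)"
  shows "continuous_filtration (\<lambda>t. fld (R t))"
proof -
  let ?F = "\<lambda>t. fld (R t)"
  have F: "subalgebra W (?F t)" for t by (rule subalgebra_fld)
  have main: "approximable ?F a b V" if V: "integrable W V" and ab: "a < b" for V a b
  proof -
    have indI: "integrable W (indicator A :: path \<Rightarrow> real)" if "A \<in> events" for A
      using that by (intro integrable_real_indicator) (auto simp: less_top[symmetric])
    have cyl: "approximable ?F a b (indicator (cylinder T A))" if T: "finite T" and A: "\<forall>x. closed (A x)" for T A
    proof (rule approximable_dominated)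
      have "cylinder T A \<in> closed_cylinders" unfolding closed_cylinders_def using T A by blast
      then have "cylinder T A \<in> events" using closed_cylinders_sub(2) sets_path_borel_W by blast
      then show "integrable W (indicator (cylinder T A) :: path \<Rightarrow> real)" by (rule indI)
      show "approximable ?F a b (\<lambda>\<omega>. \<Prod>x\<in>T. bump (A x) k (\<omega> x))" for k
      proof (rule small_jumps_approximable, rule small_jumps_product[OF ad T])
        show "\<bar>bump (A x) k y\<bar> \<le> 1" for x y using bump_bounds[of "A x" k y] by simp
        show "\<bar>bump (A x) k y - bump (A x) k z\<bar> \<le> (real k + 1) * \<bar>y - z\<bar>" for x y z by (rule bump_lipschitz)
      qed (use ab bump_measurable in auto)
      show "(\<lambda>k. \<Prod>x\<in>T. bump (A x) k (\<omega> x)) \<longlonglongrightarrow> indicator (cylinder T A) \<omega>" if "\<omega> \<in> space W" for \<omega>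
      proof -
        have "(\<lambda>k. \<Prod>x\<in>T. bump (A x) k (\<omega> x)) \<longlonglongrightarrow> (\<Prod>x\<in>T. indicator (A x) (\<omega> x))"
          using A by (intro tendsto_prod bump_tendsto) auto
        moreover have "(\<Prod>x\<in>T. indicator (A x) (\<omega> x) :: real) = indicator (cylinder T A) \<omega>"
        proof (cases "\<forall>x\<in>T. \<omega> x \<in> A x")
          case True then show ?thesis using that by (simp add: cylinder_def)
        next
          case False
          then obtain x where "x \<in> T" "\<omega> x \<notin> A x" by blast
          then have "\<exists>x\<in>T. indicator (A x) (\<omega> x) = (0::real)" by (intro bexI[of _ x]) simp_all
          then have "(\<Prod>x\<in>T. indicator (A x) (\<omega> x) :: real) = 0" by (rule prod_zero[OF T])
          then show ?thesis using False by (simp add: cylinder_def)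
        qed
        ultimately show ?thesis by simp
      qed
      show "\<bar>\<Prod>x\<in>T. bump (A x) k (\<omega> x)\<bar> \<le> 1" for k \<omega>
        unfolding abs_prod by (intro prod_le_1) (simp add: bump_bounds)
      show "integrable W (\<lambda>_. 1 :: real)" by simp
    qed
    have one: "approximable ?F a b (\<lambda>_. 1)"
    proof (rule small_jumps_approximable)
      show "small_jumps ?F a b (\<lambda>_. 1)"
        using small_jumps_product[OF ad, of "{}" "\<lambda>_ _. 1" 1] ab by simp
    qed
    \<comment> \<open>\<open>approximable_cmult\<close> excludes the factor 0, so the zero variable
      is obtained as a difference of ones.\<close>
    have zero: "approximable ?F a b (\<lambda>_. 0)"
      using approximable_add[OF F one approximable_cmult[OF F one, of "-1"]] by simp
    have sub: "A \<in> events" if "A \<in> sigma_sets path_space closed_cylinders" for A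
      using that sets.sigma_sets_subset[OF subset_trans[OF closed_cylinders_sub(2) sets_path_borel_W]] by auto
    have bor: "approximable ?F a b (indicator A)" if "A \<in> sets path_borel" for A
    proof -
      have "A \<in> sigma_sets path_space closed_cylinders" using that sets_path_borel_closed_cylinders by blast
      from Int_stable_closed_cylinders closed_cylinders_sub(1) this show ?thesis
      proof (induction rule: sigma_sets_induct_disjoint)
        case (basic A)
        then show ?case using cyl unfolding closed_cylinders_def by blast
      next
        case empty
        then show ?case using zero by simp
      next
        case (compl A)
        have *: "approximable ?F a b (\<lambda>\<omega>. 1 + -1 * indicator A \<omega>)"
          by (intro approximable_add[OF F one] approximable_cmult[OF F compl(2)]) simp
        \<comment> \<open>The indicator of the complement and one minus the indicator agree on
          \<open>path_space\<close> only; a constant sequence in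
          \<open>approximable_dominated\<close> bridges the difference outside.\<close>
        show ?case
        proof (rule approximable_dominated)
          show "approximable ?F a b (\<lambda>\<omega>. 1 + -1 * indicator A \<omega>)" for i :: nat by (rule *)
          show "integrable W (indicator (path_space - A) :: path \<Rightarrow> real)"
            using sub[OF compl(1)] sets.compl_sets[of A W] by (intro indI) simp
          show "(\<lambda>i. 1 + -1 * indicator A \<omega> :: real) \<longlonglongrightarrow> indicator (path_space - A) \<omega>" if "\<omega> \<in> space W" for \<omega>
            using that by (cases "\<omega> \<in> A") simp_all
          show "\<bar>1 + -1 * indicator A \<omega>\<bar> \<le> (1::real)" for \<omega> by (cases "\<omega> \<in> A") simp_all
        qed simp
      next
        case (union A)
        have Aev: "A i \<in> events" for i using union(2) sub by blast
        have fin: "approximable ?F a b (indicator (\<Union>i<n. A i))" for n :: nat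
        proof (induction n)
          case 0 then show ?case using zero by simp
        next
          case (Suc n)
          have "(indicator (\<Union>i<Suc n. A i) :: path \<Rightarrow> real) = (\<lambda>\<omega>. indicator (\<Union>i<n. A i) \<omega> + indicator (A n) \<omega>)"
          proof
            fix \<omega>
            have "A n \<inter> A i = {}" if "i < n" for i
              using union(1) that by (auto simp: disjoint_family_on_def)
            then have dis: "A n \<inter> (\<Union>i<n. A i) = {}" by blast
            have un: "(\<Union>i<Suc n. A i) = A n \<union> (\<Union>i<n. A i)" by (simp add: lessThan_Suc)
            show "(indicator (\<Union>i<Suc n. A i) \<omega> :: real) = indicator (\<Union>i<n. A i) \<omega> + indicator (A n) \<omega>"
              unfolding un indicator_add[OF dis, symmetric] by (simp only: add.commute)
          qed
          then show ?case using approximable_add[OF F Suc union(3)[of n]] by (simp only:)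
        qed
        show ?case
        proof (rule approximable_dominated[OF _ fin])
          show "integrable W (indicator (\<Union>i. A i) :: path \<Rightarrow> real)" using Aev by (intro indI sets.countable_UN') auto
          show "(\<lambda>n. indicator (\<Union>i<n. A i) \<omega> :: real) \<longlonglongrightarrow> indicator (\<Union>i. A i) \<omega>" for \<omega>
            by (rule LIMSEQ_indicator_UN)
          show "\<bar>indicator (\<Union>i<n. A i) \<omega>\<bar> \<le> (1::real)" for n \<omega> by (simp add: indicator_def)
        qed simp
      qed
    qed
    have ev: "approximable ?F a b (indicator A)" if A: "A \<in> events" for A
    proof -
      obtain S N where S: "S \<in> sets path_borel" "N \<in> sets path_borel" "prob N = 0" "S \<subseteq> A" "A \<subseteq> S \<union> N"
        using events_borel_approx[OF A] by blast
      have Nn: "N \<in> null_sets W" using S(2,3) sets_path_borel_W by (auto simp: null_sets_def emeasure_eq_measure)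
      have "AE \<omega> in W. \<bar>indicator A \<omega> - indicator S \<omega> :: real\<bar> = 0"
        using AE_not_in[OF Nn] by eventually_elim (use S in \<open>auto split: split_indicator\<close>)
      then have "(\<integral>\<omega>. \<bar>indicator A \<omega> - indicator S \<omega> :: real\<bar> \<partial>W) = 0"
        using A S(1) sets_path_borel_W integral_cong_AE[of "\<lambda>\<omega>. \<bar>indicator A \<omega> - indicator S \<omega> :: real\<bar>" W "\<lambda>_. 0"] by auto
      then show ?thesis
        by (intro approximable_limit[OF indI[OF A], of _ _ _ "\<lambda>_. indicator S"] bor S) simp
    qed
    show ?thesis
      using V
    proof (induction rule: integrable_induct)
      case (base A c)
      show ?case
      proof (cases "c = 0")
        case True then show ?thesis using zero by simp
      next
        case False
        then show ?thesis using approximable_cmult[OF F ev[OF base(1)] False] by (simp add: mult.commute)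
      qed
    next
      case (add f g)
      then show ?case by (intro approximable_add[OF F])
    next
      case (lim f s)
      show ?case
      proof (rule approximable_dominated)
        show "integrable W f" by (rule lim(4))
        show "approximable ?F a b (s i)" for i by (rule lim(5))
        show "(\<lambda>i. s i \<omega>) \<longlonglongrightarrow> f \<omega>" if "\<omega> \<in> space W" for \<omega> using lim(2) that by blast
        show "\<bar>s i \<omega>\<bar> \<le> 2 * \<bar>f \<omega>\<bar>" if "\<omega> \<in> space W" for i \<omega> using lim(3)[OF that, of i] by simp
        show "integrable W (\<lambda>\<omega>. 2 * \<bar>f \<omega>\<bar>)" using lim(4) by simp
      qed
    qed
  qed
  show ?thesis
    unfolding continuous_filtration_def
  proof (intro allI impI)
    fix V :: "path \<Rightarrow> real" and a b e :: real assume "integrable W V \<and> a < b \<and> 0 < e"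
    then have h: "integrable W V" "a < b" "0 < e" by auto
    from main[OF h(1,2)] h(3) show "\<exists>g. small_jumps ?F a b g \<and> (\<integral>\<omega>. \<bar>V \<omega> - g \<omega>\<bar> \<partial>W) \<le> e"
      unfolding approximable_def by blast
  qed
qed

section \<open>Local random sets in the Brownian filtration\<close>

definition before :: "real \<Rightarrow> (real \<times> real) set" where
  "before t = {(u, v). u \<le> v \<and> v \<le> t}"

definition after :: "real \<Rightarrow> (real \<times> real) set" where
  "after t = {(u, v). t \<le> u \<and> u \<le> v}"

lemma fld_subsetI:
  assumes "\<And>u v. (u, v) \<in> R \<Longrightarrow> (\<lambda>\<omega>. \<omega> v - \<omega> u) \<in> borel_measurable (fld R')"
  shows "sets (fld R) \<subseteq> sets (fld R')"
proof -
  have "(\<lambda>\<omega>. \<omega> v - \<omega> u) -` A \<inter> path_space \<in> sets (fld R')" if "(u, v) \<in> R" "A \<in> sets borel" for u v A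
    using measurable_sets[OF assms[OF that(1)] that(2)] by simp
  moreover have "N \<in> sets (fld R')" if "N \<in> events" "prob N = 0 \<or> prob N = 1" for N
    using that by (rule fld_trivial)
  ultimately have "{(\<lambda>\<omega>. \<omega> v - \<omega> u) -` A \<inter> path_space | u v A. (u, v) \<in> R \<and> A \<in> sets borel} \<union>
      {A \<in> events. prob A = 0 \<or> prob A = 1} \<subseteq> sets (fld R')" by blast
  from sets.sigma_sets_subset[OF this] show ?thesis unfolding sets_fld[of R] by simp
qed

lemma adjacent_before: "s < t \<Longrightarrow> adjacent s t (before s) (before t)"
proof -
  assume st: "s < t"
  have "sets (fld (before t)) \<subseteq> sets (fld (before s \<union> inside s t))"
  proof (rule fld_subsetI)
    let ?F = "fld (before s \<union> inside s t)"
    fix u v assume uv: "(u, v) \<in> before t"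
    have 1: "(\<lambda>\<omega>. \<omega> (max s v) - \<omega> (max s u)) \<in> borel_measurable ?F"
      by (rule fld_increment) (use uv st in \<open>auto simp: before_def inside_def\<close>)
    have 2: "(\<lambda>\<omega>. \<omega> (min s v) - \<omega> (min s u)) \<in> borel_measurable ?F"
      by (rule fld_increment) (use uv st in \<open>auto simp: before_def inside_def\<close>)
    \<comment> \<open>The increment is cut at \<open>s\<close>: the clipped end points give its part
      after \<open>s\<close> and its part before \<open>s\<close>.\<close>
    have "(\<lambda>\<omega>::path. \<omega> v - \<omega> u) = (\<lambda>\<omega>. (\<omega> (max s v) - \<omega> (max s u)) + (\<omega> (min s v) - \<omega> (min s u)))"
      by (auto simp: max_def min_def)
    with borel_measurable_add[OF 1 2] show "(\<lambda>\<omega>. \<omega> v - \<omega> u) \<in> borel_measurable ?F" by simp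
  qed
  then show ?thesis using st by (auto simp: adjacent_def before_def inside_def outside_def)
qed

lemma adjacent_after: "s < t \<Longrightarrow> adjacent s t (after t) (after s)"
proof -
  assume st: "s < t"
  have "sets (fld (after s)) \<subseteq> sets (fld (after t \<union> inside s t))"
  proof (rule fld_subsetI)
    let ?F = "fld (after t \<union> inside s t)"
    fix u v assume uv: "(u, v) \<in> after s"
    have 1: "(\<lambda>\<omega>. \<omega> (max t v) - \<omega> (max t u)) \<in> borel_measurable ?F"
      by (rule fld_increment) (use uv st in \<open>auto simp: after_def inside_def\<close>)
    have 2: "(\<lambda>\<omega>. \<omega> (min t v) - \<omega> (min t u)) \<in> borel_measurable ?F"
      by (rule fld_increment) (use uv st in \<open>auto simp: after_def inside_def\<close>)
    have "(\<lambda>\<omega>::path. \<omega> v - \<omega> u) = (\<lambda>\<omega>. (\<omega> (max t v) - \<omega> (max t u)) + (\<omega> (min t v) - \<omega> (min t u)))"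
      by (auto simp: max_def min_def)
    with borel_measurable_add[OF 1 2] show "(\<lambda>\<omega>. \<omega> v - \<omega> u) \<in> borel_measurable ?F" by simp
  qed
  then show ?thesis using st by (auto simp: adjacent_def after_def inside_def outside_def)
qed

lemma continuous_before: "continuous_filtration (\<lambda>t. fld (before t))"
proof (rule continuous_filtration_fld)
  fix s t :: real assume "s < t"
  then show "\<exists>p q. q - p = t - s \<and> adjacent p q (before s) (before t)"
    by (intro exI[of _ s] exI[of _ t] conjI adjacent_before) simp_all
qed

lemma continuous_after: "continuous_filtration (\<lambda>t. fld (after (- t)))"
proof (rule continuous_filtration_fld)
  fix s t :: real assume "s < t"
  then show "\<exists>p q. q - p = t - s \<and> adjacent p q (after (- s)) (after (- t))"
    by (intro exI[of _ "-t"] exI[of _ "-s"] conjI adjacent_after) simp_all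
qed

lemma before_after_indep:
  "A \<in> sets (fld (before t)) \<Longrightarrow> B \<in> sets (fld (after t)) \<Longrightarrow> prob (A \<inter> B) = prob A * prob B"
proof (rule fld_indep)
  show "separated (before t) (after t)" unfolding separated_def before_def after_def by fastforce
qed

section \<open>Windows, almost sure modifications and the coffin state\<close>

definition window :: "ereal \<Rightarrow> ereal \<Rightarrow> (real \<times> real) set" where
  "window s t = {(u, v). s \<le> ereal u \<and> u \<le> v \<and> ereal v \<le> t}"

lemma increment_field_fld: "increment_field W s t = fld (window s t)"
  unfolding increment_field_def fld_def window_def by simp

lemma window_subset: "window (ereal s) (ereal t) \<subseteq> before t" "window (ereal s) (ereal t) \<subseteq> after s"
  by (auto simp: window_def before_def after_def)

lemma subalgebra_fld_mono: "R \<subseteq> R' \<Longrightarrow> subalgebra (fld R') (fld R)"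
  using fld_mono[of R R'] by (simp add: subalgebra_def)

text \<open>\<open>fld R\<close> contains all events of probability 0, and by completeness of
  \<open>W\<close> every subset of a null set is such an event; so changing a member on a null set
  gives a member.\<close>

lemma fld_AE_eq:
  assumes A: "A \<in> sets (fld R)" and B: "B \<subseteq> path_space" and ae: "AE \<omega> in W. \<omega> \<in> A \<longleftrightarrow> \<omega> \<in> B"
  shows "B \<in> sets (fld R)"
proof -
  obtain N where N: "N \<in> null_sets W" "{\<omega>\<in>space W. \<not> (\<omega> \<in> A \<longleftrightarrow> \<omega> \<in> B)} \<subseteq> N"
    using ae by (elim AE_E) (auto simp: null_sets_def)
  have Ap: "A \<subseteq> path_space" using sets.sets_into_space[OF A] by simp
  have triv: "D \<in> sets (fld R)" if "D \<subseteq> N" for D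
  proof -
    have "D \<in> null_sets W" by (rule null_subset[OF N(1) that])
    then show ?thesis by (intro fld_trivial) (auto simp: null_sets_def measure_def)
  qed
  have "B = (A \<union> (B - A)) - (A - B)" by blast
  moreover have "A - B \<subseteq> N" "B - A \<subseteq> N" using N(2) Ap B by auto
  ultimately show ?thesis using triv A by (metis sets.Diff sets.Un)
qed

lemma AE_levy_shift:
  assumes "AE \<omega> in W. Q \<omega>" shows "AE \<omega> in W. Q (levy_shift h \<omega>)"
proof -
  obtain N where N: "N \<in> null_sets W" "{\<omega>\<in>space W. \<not> Q \<omega>} \<subseteq> N"
    using assms by (elim AE_E) (auto simp: null_sets_def)
  have ev: "N \<in> events" and "prob N = 0" using N(1) by (auto simp: null_sets_def measure_def)
  then have "levy_shift h -` N \<inter> space W \<in> null_sets W"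
    using levy_shift_events_prob[OF ev, of h] by (simp add: null_sets_def emeasure_eq_measure)
  moreover have "{\<omega>\<in>space W. \<not> Q (levy_shift h \<omega>)} \<subseteq> levy_shift h -` N \<inter> space W"
    using N(2) levy_shift_path_space[of _ h] by auto
  ultimately show ?thesis by (rule AE_I')
qed

lemma sets_coffin: "A \<in> sets borel \<Longrightarrow> Some ` A \<in> sets coffin_borel" "{None} \<in> sets coffin_borel"
  by (auto simp: coffin_borel_def)

lemma the_measurable:
  assumes S: "S \<in> measurable N coffin_borel"
  shows "(\<lambda>\<omega>. the (S \<omega>)) \<in> borel_measurable N"
proof (rule measurableI)
  fix A :: "real set" assume A: "A \<in> sets borel"
  have "S -` (Some ` A) \<inter> space N \<in> sets N" by (rule measurable_sets[OF S sets_coffin(1)[OF A]])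
  moreover have "S -` {None} \<inter> space N \<in> sets N" by (rule measurable_sets[OF S sets_coffin(2)])
  \<comment> \<open>\<open>the None\<close> is an unspecified but fixed real, so the coffin part
    belongs to the preimage either entirely or not at all.\<close>
  moreover have "(\<lambda>\<omega>. the (S \<omega>)) -` A \<inter> space N =
      (S -` (Some ` A) \<inter> space N) \<union> (if the None \<in> A then S -` {None} \<inter> space N else {})"
  proof (rule set_eqI)
    fix \<omega> show "\<omega> \<in> (\<lambda>\<omega>. the (S \<omega>)) -` A \<inter> space N \<longleftrightarrow>
      \<omega> \<in> (S -` (Some ` A) \<inter> space N) \<union> (if the None \<in> A then S -` {None} \<inter> space N else {})"
      by (cases "S \<omega>") auto
  qed
  ultimately show "(\<lambda>\<omega>. the (S \<omega>)) -` A \<inter> space N \<in> sets N" by simp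
qed simp

text \<open>Since \<open>X\<close> falls into the window, membership in \<open>M\<close> can be read
  off an enumeration of \<open>M\<close> inside the window, which is measurable for the same field.
  Coffin entries are excluded explicitly, because \<open>the None\<close> might happen to equal the
  value of \<open>X\<close>.\<close>

lemma mem_random_set:
  assumes X: "X \<in> measurable (fld R) coffin_borel" and S: "\<And>i::nat. S i \<in> measurable (fld R) coffin_borel"
    and Xin: "AE \<omega> in W. X \<omega> \<in> Some ` {s<..<t}"
    and M: "AE \<omega> in W. M \<omega> \<inter> {x. ereal s < ereal x \<and> ereal x < ereal t} = noncoffin_range (\<lambda>i. S i \<omega>)"
  shows "{\<omega>\<in>path_space. the (X \<omega>) \<in> M \<omega>} \<in> sets (fld R)"
proof (rule fld_AE_eq)
  have m: "(\<lambda>\<omega>. the (X \<omega>)) \<in> borel_measurable (fld R)" "(\<lambda>\<omega>. the (S i \<omega>)) \<in> borel_measurable (fld R)" for i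
    using the_measurable[OF X] the_measurable[OF S] .
  have e1: "{\<omega>\<in>space (fld R). the (X \<omega>) = the (S i \<omega>)} \<in> sets (fld R)" for i
    using m(1) m(2)[of i] by measurable
  have e2: "space (fld R) - (S i -` {None} \<inter> space (fld R)) \<in> sets (fld R)" for i
    by (rule sets.compl_sets[OF measurable_sets[OF S sets_coffin(2)]])
  show "(\<Union>i. {\<omega>\<in>space (fld R). the (X \<omega>) = the (S i \<omega>)} \<inter> (space (fld R) - (S i -` {None} \<inter> space (fld R)))) \<in> sets (fld R)"
    using e1 e2 by (intro sets.countable_nat_UN) blast
  show "AE \<omega> in W. (\<omega> \<in> (\<Union>i. {\<omega>\<in>space (fld R). the (X \<omega>) = the (S i \<omega>)} \<inter> (space (fld R) - (S i -` {None} \<inter> space (fld R))))) =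
      (\<omega> \<in> {\<omega>\<in>path_space. the (X \<omega>) \<in> M \<omega>})"
    using Xin M AE_space
  proof eventually_elim
    case (elim \<omega>)
    obtain x where x: "X \<omega> = Some x" "s < x" "x < t" using elim(1) by auto
    have "x \<in> M \<omega> \<longleftrightarrow> x \<in> M \<omega> \<inter> {x. ereal s < ereal x \<and> ereal x < ereal t}" using x by simp
    also have "\<dots> \<longleftrightarrow> (\<exists>i. S i \<omega> = Some x)" unfolding elim(2) by (simp add: noncoffin_range_def)
    also have "\<dots> \<longleftrightarrow> (\<exists>i. S i \<omega> \<noteq> None \<and> x = the (S i \<omega>))" by force
    finally show ?case using elim(3) x(1) by auto
  qed
qed blast

text \<open>Countably many random variables have only countably many atoms altogether, so some time
  \<open>v0\<close> is almost surely avoided, and stationarity moves \<open>v0\<close> to any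
  \<open>v\<close>. In particular leaders are irrational.\<close>

lemma AE_not_mem:
  assumes "random_countable_set W M" "stationary_random_set W M"
  shows "AE \<omega> in W. v \<notin> M \<omega>"
proof -
  obtain S where S: "\<And>i. S i \<in> measurable W coffin_borel" and M: "AE \<omega> in W. M \<omega> = noncoffin_range (\<lambda>i. S i \<omega>)"
    using assms(1) unfolding random_countable_set_def measurable_enumeration_def by blast
  let ?D = "\<lambda>i. distr W borel (\<lambda>\<omega>. the (S i \<omega>))"
  have m: "(\<lambda>\<omega>. the (S i \<omega>)) \<in> borel_measurable W" for i by (rule the_measurable[OF S])
  have "countable {x. measure (?D i) {x} \<noteq> 0}" for i
    by (rule finite_measure.countable_support) (rule finite_measure_distr[OF m])
  then have "countable (\<Union>i. {x. measure (?D i) {x} \<noteq> 0})" by simp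
  then have "(\<Union>i. {x. measure (?D i) {x} \<noteq> 0}) \<noteq> UNIV" using uncountable_UNIV_real by auto
  then obtain v0 where v0: "\<And>i. measure (?D i) {v0} = 0" by blast
  have "AE \<omega> in W. the (S i \<omega>) \<noteq> v0" for i
  proof -
    have "(\<lambda>\<omega>. the (S i \<omega>)) -` {v0} \<inter> space W \<in> null_sets W"
      using v0[of i] measurable_sets[OF m, of "{v0}" i] by (simp add: measure_distr[OF m] null_sets_def emeasure_eq_measure)
    then show ?thesis by (rule AE_I') auto
  qed
  then have "AE \<omega> in W. \<forall>i. the (S i \<omega>) \<noteq> v0" by (simp add: AE_all_countable)
  with M have "AE \<omega> in W. v0 \<notin> M \<omega>"
  proof eventually_elim
    case (elim \<omega>)
    show ?case
    proof
      assume "v0 \<in> M \<omega>"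
      then obtain i where "S i \<omega> = Some v0" unfolding elim(1) noncoffin_range_def by blast
      with elim(2)[rule_format, of i] show False by simp
    qed
  qed
  from AE_levy_shift[OF this, of "v - v0"] have "AE \<omega> in W. v0 \<notin> M (levy_shift (v - v0) \<omega>)" .
  moreover have "AE \<omega> in W. M \<omega> = (+) (v - v0) ` M (levy_shift (v - v0) \<omega>)"
    using assms(2) unfolding stationary_random_set_def by blast
  ultimately show ?thesis by eventually_elim auto
qed

text \<open>Off a null set, a path is determined by \<^term>\<open>X\<close> together with the increments before and after
  arbitrarily small rational cells around \<^term>\<open>X\<close>; so these generate the whole \<open>\<sigma>\<close>-field and the
  event \<^term>\<open>C\<close> is independent of itself.\<close>

lemma zero_one_law:
  assumes X: "X \<in> borel_measurable W" and X01: "AE \<omega> in W. 0 < X \<omega> \<and> X \<omega> < 1 \<and> X \<omega> \<notin> \<rat>"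
    and C: "C \<in> events"
    and split: "\<And>a b A B. a \<in> \<rat> \<Longrightarrow> b \<in> \<rat> \<Longrightarrow> 0 < a \<Longrightarrow> a < b \<Longrightarrow> b < 1 \<Longrightarrow>
        A \<in> sets (fld (before a)) \<Longrightarrow> B \<in> sets (fld (after b)) \<Longrightarrow>
        prob (C \<inter> (A \<inter> B \<inter> {\<omega>\<in>path_space. a < X \<omega> \<and> X \<omega> < b})) = prob C * prob (A \<inter> B \<inter> {\<omega>\<in>path_space. a < X \<omega> \<and> X \<omega> < b})"
  shows "prob C = 0 \<or> prob C = 1"
proof -
  let ?J = "\<lambda>a b. {\<omega>\<in>path_space. a < X \<omega> \<and> X \<omega> < b}"
  \<comment> \<open>A past event, a future event and the localization of \<open>X\<close> between
    them. The null sets are included because \<open>X\<close> determines the path together with its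
    surroundings only almost surely.\<close>
  define G where "G = {A \<inter> B \<inter> ?J a b | A B a b. a \<in> \<rat> \<and> b \<in> \<rat> \<and> 0 < a \<and> a < b \<and> b < 1 \<and>
      A \<in> sets (fld (before a)) \<and> B \<in> sets (fld (after b))} \<union> null_sets W"
  define F where "F = sigma path_space G"
  have J: "?J a b \<in> events" for a b
  proof -
    have "{\<omega>\<in>space W. a < X \<omega> \<and> X \<omega> < b} \<in> events" using X by measurable
    then show ?thesis by simp
  qed
  have Gev: "G \<subseteq> events"
  proof -
    have "A \<inter> B \<inter> ?J a b \<in> events" if "A \<in> sets (fld (before a))" "B \<in> sets (fld (after b))" for A B a b
      using that fld_events J by (intro sets.Int) blast+
    then show ?thesis unfolding G_def by auto
  qed
  have GP: "G \<subseteq> Pow path_space" using Gev sets.space_closed[of W] by auto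
  have setsF: "sets F = sigma_sets path_space G" and spaceF: "space F = path_space"
    using GP by (simp_all add: F_def)
  have nullG: "N \<in> sets F" if "N \<in> null_sets W" for N using that unfolding setsF G_def by (intro sigma_sets.Basic) simp
  have prodG: "A \<inter> B \<inter> ?J a b \<in> sets F" if "a \<in> \<rat>" "b \<in> \<rat>" "0 < a" "a < b" "b < 1" "A \<in> sets (fld (before a))" "B \<in> sets (fld (after b))" for A B a b
    unfolding setsF G_def using that by (intro sigma_sets.Basic) blast
  have stable: "Int_stable G"
  proof (rule Int_stableI)
    fix p q assume p: "p \<in> G" and q: "q \<in> G"
    show "p \<inter> q \<in> G"
    proof (cases "p \<in> null_sets W \<or> q \<in> null_sets W")
      case True
      then have "p \<inter> q \<in> null_sets W" by (auto intro: null_subset)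
      then show ?thesis by (simp add: G_def)
    next
      case False
      obtain A B a b where 1: "p = A \<inter> B \<inter> ?J a b" "a \<in> \<rat>" "b \<in> \<rat>" "0 < a" "a < b" "b < 1" "A \<in> sets (fld (before a))" "B \<in> sets (fld (after b))"
        using p False unfolding G_def by blast
      obtain A' B' a' b' where 2: "q = A' \<inter> B' \<inter> ?J a' b'" "a' \<in> \<rat>" "b' \<in> \<rat>" "0 < a'" "a' < b'" "b' < 1" "A' \<in> sets (fld (before a'))" "B' \<in> sets (fld (after b'))"
        using q False unfolding G_def by blast
      let ?a = "max a a'" and ?b = "min b b'"
      have "before a \<subseteq> before ?a" "before a' \<subseteq> before ?a" "after b \<subseteq> after ?b" "after b' \<subseteq> after ?b"
        by (auto simp: before_def after_def)
      then have AB: "A \<inter> A' \<in> sets (fld (before ?a))" "B \<inter> B' \<in> sets (fld (after ?b))"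
        using 1(7,8) 2(7,8) fld_mono by (blast intro: sets.Int)+
      have eq: "p \<inter> q = (A \<inter> A') \<inter> (B \<inter> B') \<inter> ?J ?a ?b" unfolding 1(1) 2(1) by auto
      show ?thesis
      proof (cases "?a < ?b")
        case True
        have "?a \<in> \<rat>" "?b \<in> \<rat>" "0 < ?a" "?b < 1" using 1(2-6) 2(2-6) by (auto simp: max_def min_def)
        with True AB show ?thesis unfolding eq G_def by blast
      next
        case False
        then have "?J ?a ?b = {}" by auto
        then have "p \<inter> q = {}" unfolding eq by blast
        then show ?thesis by (simp add: G_def)
      qed
    qed
  qed
  have indep: "D \<in> events \<and> prob (C \<inter> D) = prob C * prob D" if "D \<in> sets F" for D
  proof -
    from that have "D \<in> sigma_sets path_space G" unfolding setsF .
    from stable GP this show ?thesis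
    proof (induction rule: sigma_sets_induct_disjoint)
      case (basic D)
      then have ev: "D \<in> events" using Gev by blast
      show ?case
      proof (cases "D \<in> null_sets W")
        case True
        then have "prob D = 0" by (simp add: null_sets_def measure_def)
        then show ?thesis using prob_Int_0[OF C ev] ev by simp
      next
        case False
        with basic obtain A B a b where "D = A \<inter> B \<inter> ?J a b" "a \<in> \<rat>" "b \<in> \<rat>" "0 < a" "a < b" "b < 1" "A \<in> sets (fld (before a))" "B \<in> sets (fld (after b))"
          unfolding G_def by blast
        then show ?thesis using split ev by blast
      qed
    next
      case empty
      show ?case by simp
    next
      case (compl D)
      then have D: "D \<in> events" "prob (C \<inter> D) = prob C * prob D" by auto
      have "C \<inter> (path_space - D) = C - C \<inter> D" using sets.sets_into_space[OF C] by auto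
      then have "prob (C \<inter> (path_space - D)) = prob C - prob (C \<inter> D)" using finite_measure_Diff[of C "C \<inter> D"] C D by auto
      moreover have "prob (path_space - D) = 1 - prob D" using prob_compl[OF D(1)] by simp
      moreover have "path_space - D \<in> events" using sets.compl_sets[OF D(1)] by simp
      ultimately show ?case using D(2) by (simp add: right_diff_distrib)
    next
      case (union D)
      then have D: "D i \<in> events" "prob (C \<inter> D i) = prob C * prob (D i)" for i by auto
      have 1: "(\<lambda>i. prob (D i)) sums prob (\<Union>i. D i)" using D union(1) by (intro finite_measure_UNION) auto
      have 2: "(\<lambda>i. prob (C \<inter> D i)) sums prob (\<Union>i. C \<inter> D i)"
      proof (rule finite_measure_UNION)
        show "disjoint_family (\<lambda>i. C \<inter> D i)" using union(1) unfolding disjoint_family_on_def by blast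
        show "range (\<lambda>i. C \<inter> D i) \<subseteq> events" using C D by blast
      qed
      have "(\<lambda>i. prob (C \<inter> D i)) sums (prob C * prob (\<Union>i. D i))" unfolding D(2) by (rule sums_mult[OF 1])
      with 2 have "prob (\<Union>i. C \<inter> D i) = prob C * prob (\<Union>i. D i)" by (rule sums_unique2)
      moreover have "(\<Union>i. C \<inter> D i) = C \<inter> (\<Union>i. D i)" by blast
      moreover have "(\<Union>i. D i) \<in> events" using D by blast
      ultimately show ?case by simp
    qed
  qed
  obtain N where N: "N \<in> null_sets W" "{\<omega>\<in>space W. \<not> (0 < X \<omega> \<and> X \<omega> < 1 \<and> X \<omega> \<notin> \<rat>)} \<subseteq> N"
    using X01 by (elim AE_E) (auto simp: null_sets_def)
  have coord: "(\<lambda>\<omega>. \<omega> t) \<in> borel_measurable F" for t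
  proof -
    \<comment> \<open>The parts of \<open>\<omega> t\<close> accumulated before \<open>a\<close> and
      after \<open>b\<close>; their sum misses only the increment inside the cell. Cells that touch
      0 or 1 are dropped in \<open>?h\<close>, as \<open>split\<close> requires \<open>0 < a\<close>
      and \<open>b < 1\<close>; on fine grids \<open>X\<close> does not lie in them.\<close>
    let ?y1 = "\<lambda>a \<omega>. \<omega> (min t a) - \<omega> (min 0 a) :: real" and ?y2 = "\<lambda>b \<omega>. \<omega> (max t b) - \<omega> (max 0 b) :: real"
    let ?h = "\<lambda>a b \<omega>. if 0 < a \<and> b < 1 then indicator (?J a b) \<omega> * (?y1 a \<omega> + ?y2 b \<omega>) else (0::real)"
    have hm: "?h a b \<in> borel_measurable F" if ab: "a \<in> \<rat>" "b \<in> \<rat>" "a < b" for a b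
    proof (cases "0 < a \<and> b < 1")
      case True
      have full: "path_space \<in> sets (fld R)" for R using sets.top[of "fld R"] by simp
      have localm: "(\<lambda>\<omega>. indicator (?J a b) \<omega> * f \<omega>) \<in> borel_measurable F"
        if f: "\<And>E. E \<in> sets borel \<Longrightarrow> f -` E \<inter> path_space \<inter> ?J a b \<in> sets F" for f :: "path \<Rightarrow> real"
      proof (rule measurableI)
        fix E :: "real set" assume E: "E \<in> sets borel"
        have JF: "?J a b \<in> sets F" using prodG[OF ab(1,2) _ ab(3) _ full full] True by (simp add: Int_absorb1 subset_eq)
        have "(\<lambda>\<omega>. indicator (?J a b) \<omega> * f \<omega>) -` E \<inter> space F =
            (f -` E \<inter> path_space \<inter> ?J a b) \<union> (if 0 \<in> E then space F - ?J a b else {})"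
          unfolding spaceF
        proof (rule set_eqI)
          fix \<omega>
          show "\<omega> \<in> (\<lambda>\<omega>. indicator (?J a b) \<omega> * f \<omega>) -` E \<inter> path_space \<longleftrightarrow>
            \<omega> \<in> (f -` E \<inter> path_space \<inter> ?J a b) \<union> (if 0 \<in> E then path_space - ?J a b else {})"
            by (cases "\<omega> \<in> ?J a b"; cases "0 \<in> E") auto
        qed
        also have "\<dots> \<in> sets F" using f[OF E] sets.compl_sets[OF JF] by auto
        finally show "(\<lambda>\<omega>. indicator (?J a b) \<omega> * f \<omega>) -` E \<inter> space F \<in> sets F" .
      qed simp
      have b1: "?y1 a \<in> borel_measurable (fld (before a))" by (rule fld_increment) (auto simp: before_def)
      have b2: "?y2 b \<in> borel_measurable (fld (after b))" by (rule fld_increment) (auto simp: after_def)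
      have 1: "(\<lambda>\<omega>. indicator (?J a b) \<omega> * ?y1 a \<omega>) \<in> borel_measurable F"
      proof (rule localm)
        fix E :: "real set" assume E: "E \<in> sets borel"
        have "?y1 a -` E \<inter> path_space \<in> sets (fld (before a))" using measurable_sets[OF b1 E] by simp
        from prodG[OF ab(1,2) _ ab(3) _ this full] True
        show "?y1 a -` E \<inter> path_space \<inter> ?J a b \<in> sets F" by (simp add: Int_assoc)
      qed
      have 2: "(\<lambda>\<omega>. indicator (?J a b) \<omega> * ?y2 b \<omega>) \<in> borel_measurable F"
      proof (rule localm)
        fix E :: "real set" assume E: "E \<in> sets borel"
        have *: "?y2 b -` E \<inter> path_space \<in> sets (fld (after b))" using measurable_sets[OF b2 E] by simp
        have "path_space \<inter> (?y2 b -` E \<inter> path_space) = ?y2 b -` E \<inter> path_space" by blast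
        with prodG[OF ab(1,2) _ ab(3) _ full *] True
        show "?y2 b -` E \<inter> path_space \<inter> ?J a b \<in> sets F" by simp
      qed
      have "?h a b = (\<lambda>\<omega>. indicator (?J a b) \<omega> * ?y1 a \<omega> + indicator (?J a b) \<omega> * ?y2 b \<omega>)"
        by (simp only: True simp_thms if_True distrib_left)
      with borel_measurable_add[OF 1 2] show ?thesis by (simp only:)
    next
      case False
      then show ?thesis by (simp only: if_False) (rule borel_measurable_const)
    qed
    let ?g = "\<lambda>n \<omega>. \<Sum>j<2^n. ?h (grid 0 1 n j) (grid 0 1 n (Suc j)) \<omega>"
    have gm: "?g n \<in> borel_measurable F" for n
      by (intro borel_measurable_sum hm grid_Rats grid_strict_mono) simp_all
    have lim: "(\<lambda>n. ?g n \<omega>) \<longlonglongrightarrow> \<omega> t" if w: "\<omega> \<in> path_space" "0 < X \<omega>" "X \<omega> < 1" "X \<omega> \<notin> \<rat>" for \<omega>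
    proof -
      have "\<exists>j<2^n. grid 0 1 n j < X \<omega> \<and> X \<omega> < grid 0 1 n (Suc j)" for n
        using grid_cell[of 0 1 "X \<omega>" n] w by auto
      then obtain j where j: "\<And>n. j n < 2^n" "\<And>n. grid 0 1 n (j n) < X \<omega>" "\<And>n. X \<omega> < grid 0 1 n (Suc (j n))" by metis
      define a where "a n = grid 0 1 n (j n)" for n
      define b where "b n = grid 0 1 n (Suc (j n))" for n
      have ab: "a n < X \<omega>" "X \<omega> < b n" "b n = a n + (1 - 0) / 2 ^ n" for n using j by (simp_all add: a_def b_def grid_Suc)
      have la: "a \<longlonglongrightarrow> X \<omega>"
      proof (rule tendsto_sandwich[OF _ _ _ tendsto_const])
        show "(\<lambda>n. X \<omega> - (1 - 0) / 2 ^ n) \<longlonglongrightarrow> X \<omega>" using tendsto_diff[OF tendsto_const grid_width_tendsto_0[of 1 0], of "X \<omega>"] by simp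
        show "\<forall>\<^sub>F n in sequentially. X \<omega> - (1 - 0) / 2 ^ n \<le> a n" using ab(2,3) by (intro always_eventually allI) (smt (verit))
        show "\<forall>\<^sub>F n in sequentially. a n \<le> X \<omega>" using ab(1) by (intro always_eventually allI less_imp_le)
      qed
      have lb: "b \<longlonglongrightarrow> X \<omega>" using tendsto_add[OF la grid_width_tendsto_0[of 1 0]] by (simp add: ab(3)[abs_def])
      have cont: "isCont \<omega> x" for x using w(1) by (auto simp: path_space_def continuous_on_eq_continuous_at)
      \<comment> \<open>The cell shrinks to the single time \<open>X\<close>, across which a
        continuous path has no increment.\<close>
      have "(\<lambda>n. ?y1 (a n) \<omega> + ?y2 (b n) \<omega>) \<longlonglongrightarrow> ?y1 (X \<omega>) \<omega> + ?y2 (X \<omega>) \<omega>"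
        by (intro tendsto_intros isCont_tendsto_compose[OF cont] la lb)
      moreover have "?y1 (X \<omega>) \<omega> + ?y2 (X \<omega>) \<omega> = \<omega> t"
        using w(1,2) by (auto simp: path_space_def max_def min_def)
      ultimately have "(\<lambda>n. ?y1 (a n) \<omega> + ?y2 (b n) \<omega>) \<longlonglongrightarrow> \<omega> t" by simp
      moreover have "\<forall>\<^sub>F n in sequentially. ?y1 (a n) \<omega> + ?y2 (b n) \<omega> = ?g n \<omega>"
        using order_tendstoD(1)[OF la w(2)] order_tendstoD(2)[OF lb w(3)]
      proof eventually_elim
        case (elim n)
        have zero: "?h (grid 0 1 n i) (grid 0 1 n (Suc i)) \<omega> = 0" if "i \<noteq> j n" for i
        proof -
          have "\<not> (grid 0 1 n i < X \<omega> \<and> X \<omega> < grid 0 1 n (Suc i))"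
          proof (cases "i < j n")
            case True
            then show ?thesis using grid_mono[of 0 1 "Suc i" "j n" n] j(2)[of n] by linarith
          next
            case False
            then show ?thesis using that grid_mono[of 0 1 "Suc (j n)" i n] j(3)[of n] by linarith
          qed
          then show ?thesis by simp
        qed
        have "?g n \<omega> = ?h (grid 0 1 n (j n)) (grid 0 1 n (Suc (j n))) \<omega>"
          using j(1)[of n] by (subst sum.remove[of _ "j n"]) (simp_all add: zero)
        also have "\<dots> = ?y1 (a n) \<omega> + ?y2 (b n) \<omega>" using elim w(1) ab(1,2)[of n] by (simp add: a_def b_def)
        finally show ?case by simp
      qed
      ultimately show ?thesis by (rule Lim_transform_eventually)
    qed
    have NF: "D \<in> sets F" if "D \<subseteq> N" for D by (rule nullG[OF null_subset[OF N(1) that]])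
    have fm: "(\<lambda>\<omega>. indicator (path_space - N) \<omega> * \<omega> t) \<in> borel_measurable F"
    proof (rule borel_measurable_LIMSEQ_real)
      have "path_space - N \<in> sets F" using sets.compl_sets[OF NF[OF subset_refl]] spaceF by simp
      then show "(\<lambda>\<omega>. indicator (path_space - N) \<omega> * ?g n \<omega>) \<in> borel_measurable F" for n
        by (intro borel_measurable_times borel_measurable_indicator gm)
      fix \<omega> assume "\<omega> \<in> space F"
      then have w: "\<omega> \<in> path_space" by (simp add: spaceF)
      show "(\<lambda>n. indicator (path_space - N) \<omega> * ?g n \<omega>) \<longlonglongrightarrow> indicator (path_space - N) \<omega> * \<omega> t"
      proof (cases "\<omega> \<in> N")
        case False
        then have "0 < X \<omega> \<and> X \<omega> < 1 \<and> X \<omega> \<notin> \<rat>" using N(2) w by auto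
        then have "(\<lambda>n. ?g n \<omega>) \<longlonglongrightarrow> \<omega> t" using w by (intro lim) auto
        then show ?thesis by (rule tendsto_mult_left)
      qed simp
    qed
    show ?thesis
    proof (rule measurableI)
      fix E :: "real set" assume E: "E \<in> sets borel"
      have "(\<lambda>\<omega>. \<omega> t) -` E \<inter> space F = (((\<lambda>\<omega>. indicator (path_space - N) \<omega> * \<omega> t) -` E \<inter> space F) - N) \<union> ((\<lambda>\<omega>. \<omega> t) -` E \<inter> space F \<inter> N)"
        unfolding spaceF
      proof (rule set_eqI)
        fix \<omega>
        show "\<omega> \<in> (\<lambda>\<omega>. \<omega> t) -` E \<inter> path_space \<longleftrightarrow>
          \<omega> \<in> (((\<lambda>\<omega>. indicator (path_space - N) \<omega> * \<omega> t) -` E \<inter> path_space) - N) \<union> ((\<lambda>\<omega>. \<omega> t) -` E \<inter> path_space \<inter> N)"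
          by (cases "\<omega> \<in> N") auto
      qed
      also have "\<dots> \<in> sets F"
        by (rule sets.Un[OF sets.Diff[OF measurable_sets[OF fm E] NF[OF subset_refl]] NF[OF Int_lower2]])
      finally show "(\<lambda>\<omega>. \<omega> t) -` E \<inter> space F \<in> sets F" .
    qed simp
  qed
  have bor: "sets path_borel \<subseteq> sets F" by (rule path_measurableI[OF spaceF coord])
  \<comment> \<open>A Borel set inside \<open>C\<close> of the same probability belongs to
    \<open>F\<close>, so \<open>C\<close> is independent of it and thereby of itself.\<close>
  obtain S N' where S: "S \<in> sets path_borel" "N' \<in> sets path_borel" "prob N' = 0" "S \<subseteq> C" "C \<subseteq> S \<union> N'"
    using events_borel_approx[OF C] by blast
  have N'n: "N' \<in> null_sets W" using S(2,3) sets_path_borel_W by (auto simp: null_sets_def emeasure_eq_measure)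
  have "prob C = prob S"
    by (rule finite_measure_eq_AE[OF _ C]) (use AE_not_in[OF N'n] S sets_path_borel_W in \<open>auto elim!: eventually_mono\<close>)
  moreover have "C \<inter> S = S" using S(4) by blast
  moreover have "prob (C \<inter> S) = prob C * prob S" using indep bor S(1) by blast
  ultimately have "prob C = prob C * prob C" by simp
  then show ?thesis by simp
qed

text \<open>Locality places each leader in the field of its own window, hence in the past of the
  right end and in the future of the left end; locality of \<open>M'\<close> does the same for the
  colour. Irrationality of the leaders comes from inclusion, as no fixed time lies in
  \<open>M\<close>.\<close>

lemma honest_index_wiener:
  assumes M: "random_countable_set W M" "stationary_random_set W M" and h: "honest_indexation W M \<tau>"
    and M': "stationary_random_set W M'" "local_random_set W M'"
  shows "honest_index W (\<lambda>t. fld (before t)) (\<lambda>t. fld (after t)) levy_shift (\<lambda>s t \<omega>. the (\<tau> s t \<omega>)) M'"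
proof -
  have inM: "AE \<omega> in W. \<tau> s t \<omega> \<in> Some ` M \<omega>" if "s < t" for s t
    using h that unfolding honest_indexation_def by blast
  have into: "AE \<omega> in W. \<tau> s t \<omega> \<in> Some ` {s<..<t}" if "s < t" for s t
    using h that unfolding honest_indexation_def by blast
  have meas: "\<tau> s t \<in> measurable (fld (window (ereal s) (ereal t))) coffin_borel" if "s < t" for s t
    using h that unfolding honest_indexation_def increment_field_fld by blast
  have stat: "AE \<omega> in W. \<tau> (s + h) (t + h) \<omega> = map_option ((+) h) (\<tau> s t (levy_shift h \<omega>))" if "s < t" for s t h
    using h that unfolding honest_indexation_def by blast
  have nest: "AE \<omega> in W. \<tau> s t \<omega> \<in> Some ` {u<..<v} \<longrightarrow> \<tau> s t \<omega> = \<tau> u v \<omega>" if "s \<le> u" "u < v" "v \<le> t" for s t u v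
    using h that unfolding honest_indexation_def by blast
  have the: "(\<lambda>\<omega>. the (\<tau> s t \<omega>)) \<in> borel_measurable (fld (window (ereal s) (ereal t)))" if "s < t" for s t
    by (rule the_measurable[OF meas[OF that]])
  have mem: "{\<omega>\<in>path_space. the (\<tau> s t \<omega>) \<in> M' \<omega>} \<in> sets (fld (window (ereal s) (ereal t)))" if st: "s < t" for s t
  proof -
    from st have "ereal s < ereal t" by simp
    then obtain S where S: "measurable_enumeration W (increment_field W (ereal s) (ereal t)) (\<lambda>\<omega>. M' \<omega> \<inter> {x. ereal s < ereal x \<and> ereal x < ereal t}) S"
      using M'(2) unfolding local_random_set_def by blast
    then have S1: "S i \<in> measurable (fld (window (ereal s) (ereal t))) coffin_borel" for i
      unfolding measurable_enumeration_def increment_field_fld by blast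
    from S have S2: "AE \<omega> in W. M' \<omega> \<inter> {x. ereal s < ereal x \<and> ereal x < ereal t} = noncoffin_range (\<lambda>i. S i \<omega>)"
      unfolding measurable_enumeration_def by blast
    show ?thesis by (rule mem_random_set[OF meas[OF st] S1 into[OF st] S2])
  qed
  show ?thesis
  proof (intro honest_index.intro honest_index_axioms.intro)
    show "prob_space W" by (rule prob_space_axioms)
    show "subalgebra W (fld (before t))" "subalgebra W (fld (after t))" for t by (rule subalgebra_fld)+
    show "sets (fld (before s)) \<subseteq> sets (fld (before t))" "sets (fld (after t)) \<subseteq> sets (fld (after s))" if "s \<le> t" for s t
      using that by (intro fld_mono; auto simp: before_def after_def)+
    show "prob (A \<inter> B) = prob A * prob B" if "A \<in> sets (fld (before t))" "B \<in> sets (fld (after t))" for t A B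
      using that by (rule before_after_indep)
    show "continuous_filtration (\<lambda>t. fld (before t))" by (rule continuous_before)
    show "continuous_filtration (\<lambda>t. fld (after (- t)))" by (rule continuous_after)
    show "levy_shift h -` A \<inter> space W \<in> events" "prob (levy_shift h -` A \<inter> space W) = prob A" if "A \<in> events" for A h
      by (rule levy_shift_events_prob[OF that])+
    show "levy_shift h \<omega> \<in> space W" if "\<omega> \<in> space W" for \<omega> h using that levy_shift_path_space by simp
    show "(\<lambda>\<omega>. the (\<tau> s t \<omega>)) \<in> borel_measurable (fld (before t))" "(\<lambda>\<omega>. the (\<tau> s t \<omega>)) \<in> borel_measurable (fld (after s))"
      if "s < t" for s t
      by (rule measurable_from_subalg[OF subalgebra_fld_mono[OF window_subset(1)] the[OF that]])
        (rule measurable_from_subalg[OF subalgebra_fld_mono[OF window_subset(2)] the[OF that]])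
    show "{\<omega>\<in>space W. the (\<tau> s t \<omega>) \<in> M' \<omega>} \<in> sets (fld (before t))" "{\<omega>\<in>space W. the (\<tau> s t \<omega>) \<in> M' \<omega>} \<in> sets (fld (after s))"
      if "s < t" for s t
      using mem[OF that] fld_mono[OF window_subset(1)[of s t]] fld_mono[OF window_subset(2)[of s t]] unfolding space_W by blast+
    have irrat: "AE \<omega> in W. \<forall>q\<in>\<rat>. q \<notin> M \<omega>"
      by (rule AE_ball_countable'[OF AE_not_mem[OF M] countable_rat])
    show "AE \<omega> in W. \<forall>s\<in>\<rat>. \<forall>t\<in>\<rat>. s < t \<longrightarrow> s < the (\<tau> s t \<omega>) \<and> the (\<tau> s t \<omega>) < t \<and> the (\<tau> s t \<omega>) \<notin> \<rat>"
    proof (intro AE_ball_countable' countable_rat AE_impI)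
      fix s t :: real assume st: "s < t"
      show "AE \<omega> in W. s < the (\<tau> s t \<omega>) \<and> the (\<tau> s t \<omega>) < t \<and> the (\<tau> s t \<omega>) \<notin> \<rat>"
        using inM[OF st] into[OF st] irrat by eventually_elim auto
    qed
    show "AE \<omega> in W. \<forall>s\<in>\<rat>. \<forall>t\<in>\<rat>. \<forall>u\<in>\<rat>. \<forall>v\<in>\<rat>. s \<le> u \<longrightarrow> u < v \<longrightarrow> v \<le> t \<longrightarrow>
        u < the (\<tau> s t \<omega>) \<longrightarrow> the (\<tau> s t \<omega>) < v \<longrightarrow> the (\<tau> u v \<omega>) = the (\<tau> s t \<omega>)"
    proof (intro AE_ball_countable' countable_rat AE_impI)
      fix s t u v :: real assume o: "s \<le> u" "u < v" "v \<le> t"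
      have st: "s < t" using o by linarith
      show "AE \<omega> in W. u < the (\<tau> s t \<omega>) \<longrightarrow> the (\<tau> s t \<omega>) < v \<longrightarrow> the (\<tau> u v \<omega>) = the (\<tau> s t \<omega>)"
        using into[OF st] nest[OF o] by eventually_elim auto
    qed
    show "AE \<omega> in W. \<forall>s\<in>\<rat>. \<forall>t\<in>\<rat>. s < t \<longrightarrow> the (\<tau> (s + h) (t + h) \<omega>) = h + the (\<tau> s t (levy_shift h \<omega>)) \<and>
        (the (\<tau> (s + h) (t + h) \<omega>) \<in> M' \<omega> \<longleftrightarrow> the (\<tau> s t (levy_shift h \<omega>)) \<in> M' (levy_shift h \<omega>))" for h
    proof (intro AE_ball_countable' countable_rat AE_impI)
      fix s t :: real assume st: "s < t"
      have "AE \<omega> in W. M' \<omega> = (+) h ` M' (levy_shift h \<omega>)" using M'(1) unfolding stationary_random_set_def by blast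
      with stat[OF st, of h] AE_levy_shift[OF into[OF st], of h]
      show "AE \<omega> in W. the (\<tau> (s + h) (t + h) \<omega>) = h + the (\<tau> s t (levy_shift h \<omega>)) \<and>
        (the (\<tau> (s + h) (t + h) \<omega>) \<in> M' \<omega> \<longleftrightarrow> the (\<tau> s t (levy_shift h \<omega>)) \<in> M' (levy_shift h \<omega>))"
      proof eventually_elim
        case (elim \<omega>)
        obtain x where x: "\<tau> s t (levy_shift h \<omega>) = Some x" using elim(2) by auto
        show ?case unfolding elim(1,3) x by auto
      qed
    qed
  qed
qed

lemma honest_zero_one:
  assumes M: "random_countable_set W M" "stationary_random_set W M" and h: "honest_indexation W M \<tau>"
    and M': "stationary_random_set W M'" "local_random_set W M'"
  shows "(AE \<omega> in W. M \<omega> \<subseteq> M' \<omega>) \<or> (AE \<omega> in W. M \<omega> \<inter> M' \<omega> = {})"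
proof -
  interpret h: honest_index W "\<lambda>t. fld (before t)" "\<lambda>t. fld (after t)" levy_shift "\<lambda>s t \<omega>. the (\<tau> s t \<omega>)" M'
    by (rule honest_index_wiener[OF assms])
  let ?C = "\<lambda>s t. {\<omega>\<in>path_space. the (\<tau> s t \<omega>) \<in> M' \<omega>}"
  have Cev: "?C s t \<in> events" if "s \<in> \<rat>" "t \<in> \<rat>" "s < t" for s t
    using h.K_past[OF that] fld_events unfolding space_W by blast
  have C: "prob (?C s t) = h.colour_prob" if "s \<in> \<rat>" "t \<in> \<rat>" "s < t" for s t
    using h.prob_colour[OF that] unfolding space_W .
  have ex: "AE \<omega> in W. Some ` M \<omega> = {\<tau> s t \<omega> | s t. s \<in> \<rat> \<and> t \<in> \<rat> \<and> s < t}"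
    using h unfolding honest_indexation_def by blast
  have mem: "AE \<omega> in W. \<forall>x\<in>M \<omega>. \<exists>s\<in>\<rat>. \<exists>t\<in>\<rat>. s < t \<and> x = the (\<tau> s t \<omega>)"
    using ex
  proof eventually_elim
    case (elim \<omega>)
    show ?case
    proof
      fix x assume "x \<in> M \<omega>"
      then have "Some x \<in> {\<tau> s t \<omega> | s t. s \<in> \<rat> \<and> t \<in> \<rat> \<and> s < t}" unfolding elim[symmetric] by simp
      then obtain s t where "Some x = \<tau> s t \<omega>" "s \<in> \<rat>" "t \<in> \<rat>" "s < t" by blast
      then show "\<exists>s\<in>\<rat>. \<exists>t\<in>\<rat>. s < t \<and> x = the (\<tau> s t \<omega>)"
        by (intro bexI[of _ s] bexI[of _ t] conjI) (auto dest: sym)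
    qed
  qed
  have "prob (?C 0 1) = 0 \<or> prob (?C 0 1) = 1"
  proof (rule zero_one_law)
    show "(\<lambda>\<omega>. the (\<tau> 0 1 \<omega>)) \<in> borel_measurable W"
      by (rule measurable_from_subalg[OF subalgebra_fld h.\<tau>_past]) simp_all
    show "AE \<omega> in W. 0 < the (\<tau> 0 1 \<omega>) \<and> the (\<tau> 0 1 \<omega>) < 1 \<and> the (\<tau> 0 1 \<omega>) \<notin> \<rat>"
      using h.AE_inside by eventually_elim auto
    show "?C 0 1 \<in> events" by (rule Cev) auto
    fix a b A B assume ab: "a \<in> \<rat>" "b \<in> \<rat>" "0 < a" "a < b" "b < 1" and AB: "A \<in> sets (fld (before a))" "B \<in> sets (fld (after b))"
    have eq: "?C 0 1 \<inter> (A \<inter> B \<inter> {\<omega>\<in>path_space. a < the (\<tau> 0 1 \<omega>) \<and> the (\<tau> 0 1 \<omega>) < b}) =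
        A \<inter> B \<inter> {\<omega>\<in>space W. the (\<tau> 0 1 \<omega>) \<in> M' \<omega> \<and> a < the (\<tau> 0 1 \<omega>) \<and> the (\<tau> 0 1 \<omega>) < b}" by auto
    show "prob (?C 0 1 \<inter> (A \<inter> B \<inter> {\<omega>\<in>path_space. a < the (\<tau> 0 1 \<omega>) \<and> the (\<tau> 0 1 \<omega>) < b})) =
        prob (?C 0 1) * prob (A \<inter> B \<inter> {\<omega>\<in>path_space. a < the (\<tau> 0 1 \<omega>) \<and> the (\<tau> 0 1 \<omega>) < b})"
      unfolding eq C[OF Rats_0 Rats_1 zero_less_one]
      using h.colour_indep_past_fut[OF Rats_0 ab(1,2) Rats_1 ab(3,4,5) AB] unfolding space_W .
  qed
  then have p: "h.colour_prob = 0 \<or> h.colour_prob = 1" unfolding C[OF Rats_0 Rats_1 zero_less_one] .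
  then show ?thesis
  proof
    assume p: "h.colour_prob = 1"
    have "AE \<omega> in W. \<forall>s\<in>\<rat>. \<forall>t\<in>\<rat>. s < t \<longrightarrow> the (\<tau> s t \<omega>) \<in> M' \<omega>"
    proof (intro AE_ball_countable' countable_rat AE_impI)
      fix s t :: real assume st: "s \<in> \<rat>" "t \<in> \<rat>" "s < t"
      have "AE \<omega> in W. \<omega> \<in> ?C s t" using C[OF st] p Cev[OF st] by (subst prob_eq_1[symmetric]) simp_all
      then show "AE \<omega> in W. the (\<tau> s t \<omega>) \<in> M' \<omega>" by eventually_elim simp
    qed
    with mem have "AE \<omega> in W. M \<omega> \<subseteq> M' \<omega>"
    proof eventually_elim
      case (elim \<omega>)
      show ?case
      proof
        fix x assume "x \<in> M \<omega>"
        with elim(1) obtain s t where "s \<in> \<rat>" "t \<in> \<rat>" "s < t" "x = the (\<tau> s t \<omega>)" by blast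
        with elim(2) show "x \<in> M' \<omega>" by simp
      qed
    qed
    then show ?thesis ..
  next
    assume p: "h.colour_prob = 0"
    have "AE \<omega> in W. \<forall>s\<in>\<rat>. \<forall>t\<in>\<rat>. s < t \<longrightarrow> the (\<tau> s t \<omega>) \<notin> M' \<omega>"
    proof (intro AE_ball_countable' countable_rat AE_impI)
      fix s t :: real assume st: "s \<in> \<rat>" "t \<in> \<rat>" "s < t"
      have "?C s t \<in> null_sets W" using C[OF st] p Cev[OF st] by (simp add: null_sets_def emeasure_eq_measure)
      from AE_not_in[OF this] show "AE \<omega> in W. the (\<tau> s t \<omega>) \<notin> M' \<omega>" using AE_space by eventually_elim simp
    qed
    with mem have "AE \<omega> in W. M \<omega> \<inter> M' \<omega> = {}"
    proof eventually_elim
      case (elim \<omega>)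
      have "x \<notin> M' \<omega>" if "x \<in> M \<omega>" for x
      proof -
        from that elim(1) obtain s t where "s \<in> \<rat>" "t \<in> \<rat>" "s < t" "x = the (\<tau> s t \<omega>)" by blast
        with elim(2) show ?thesis by simp
      qed
      then show ?case by blast
    qed
    then show ?thesis ..
  qed
qed

end

theorem corollary6p4:
  fixes W :: "path measure"
    and M :: "path \<Rightarrow> real set"
    and \<tau> :: "real \<Rightarrow> real \<Rightarrow> path \<Rightarrow> real option"
  assumes "two_sided_wiener_measure W"
    and "dense_stationary_local_random_countable_set W M"
    and "honest_indexation W M \<tau>"
  shows "minimal_random_set W M"
proof -
  interpret wiener W using assms(1) by unfold_locales
  have "measure W {\<omega> \<in> space W. M' \<omega> \<subset> M \<omega>} = 0"
    if M': "dense_stationary_local_random_countable_set W M'" for M'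
  proof -
    have "(AE \<omega> in W. M \<omega> \<subseteq> M' \<omega>) \<or> (AE \<omega> in W. M \<omega> \<inter> M' \<omega> = {})"
      using assms(2,3) M' unfolding dense_stationary_local_random_countable_set_def
      by (intro honest_zero_one) auto
    moreover have "AE \<omega> in W. closure (M' \<omega>) = UNIV"
      using M' unfolding dense_stationary_local_random_countable_set_def dense_random_set_def by blast
    then have "AE \<omega> in W. M' \<omega> \<noteq> {}" by eventually_elim auto
    ultimately have "AE \<omega> in W. \<not> M' \<omega> \<subset> M \<omega>"
    proof (elim disjE)
      assume "AE \<omega> in W. M \<omega> \<inter> M' \<omega> = {}" "AE \<omega> in W. M' \<omega> \<noteq> {}"
      then show ?thesis by eventually_elim auto
    next
      assume "AE \<omega> in W. M \<omega> \<subseteq> M' \<omega>"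
      then show ?thesis by eventually_elim auto
    qed
    then obtain N where N: "N \<in> null_sets W" "{\<omega>\<in>space W. \<not> \<not> M' \<omega> \<subset> M \<omega>} \<subseteq> N"
      by (elim AE_E) (auto simp: null_sets_def)
    \<comment> \<open>Completeness of \<open>W\<close> makes this set an event, so its measure is a
      genuine probability 0.\<close>
    then have "{\<omega>\<in>space W. M' \<omega> \<subset> M \<omega>} \<in> null_sets W" by (intro null_subset[OF N(1)]) simp
    then show ?thesis by (simp add: null_sets_def measure_def)
  qed
  then show ?thesis using assms(2) unfolding minimal_random_set_def by fastforce
qed

end
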